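(* Let $\Omega\subset\mathbb{R}^N$ ($N>1$) be a bounded domain with $C^2$ boundary, and let $r,p,q,s,\alpha,\gamma$ satisfy $(H_0)$. Let $f,g:\overline{\Omega}\times\mathbb{R}\to\mathbb{R}$ be continuous and let $\mathcal{A}:\overline{\Omega}\times(0,\infty)\to\mathbb{R}$ be continuous. Suppose $(\underline{u},\overline{u})$ is a sub-supersolution pair for problem $(P)$ with $\underline{u}>0$ a.e. in $\Omega$, that $f(x,t)\ge 0$ and $g(x,t)\ge 0$ for all $(x,t)\in\overline{\Omega}\times[0,|\overline{u}|_{L^\infty}]$, and that $\mathcal{A}(x,t)>0$ for all $(x,t)\in\overline{\Omega}\times\big[|\underline{u}|_{L^{r(x)}},|\overline{u}|_{L^{r(x)}}\big]$. Then $(P)$ has a positive weak solution $u$ with $\underline{u}\le u\le\overline{u}$ a.e. in $\Omega$.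
   Context: For a measurable $m:\Omega\to\mathbb{R}$ with $m\in L^\infty(\Omega)$, write $m^+=\operatorname{ess\,sup}_\Omega m$, $m^-=\operatorname{ess\,inf}_\Omega m$; $L^\infty_+(\Omega)=\{m\in L^\infty(\Omega): m^-\ge 1\}$. For $m\in L^\infty_+(\Omega)$, $L^{m(x)}(\Omega)$ is the variable exponent Lebesgue space of measurable $u$ with $\int_\Omega|u|^{m(x)}dx<\infty$, with Luxemburg norm $|u|_{L^{m(x)}}=\inf\{\lambda>0:\int_\Omega|u/\lambda|^{m(x)}dx\le1\}$. $W^{1,p(x)}(\Omega)=\{u\in L^{p(x)}(\Omega):\partial_{x_j}u\in L^{p(x)}(\Omega), j=1,\dots,N\}$ with norm $|u|_{L^{p(x)}}+\sum_j|\partial_{x_j}u|_{L^{p(x)}}$, and $W^{1,p(x)}_0(\Omega)$ is the closure of $C_0^\infty(\Omega)$ in it. $\Delta_{p(x)}u=\operatorname{div}(|\nabla u|^{p(x)-2}\nabla u)$. Hypothesis $(H_0)$: $p\in C^1(\overline{\Omega})$, $r,q,s\in L^\infty_+(\Omega)$, $\alpha,\gamma\in L^\infty(\Omega)$, $1<p^-\le p^+<N$, and $\alpha(x),\gamma(x)\ge0$ a.e. in $\Omega$. Problem $(P)$: $-\mathcal{A}(x,|u|_{L^{r(x)}})\Delta_{p(x)}u=f(x,u)|u|_{L^{q(x)}}^{\alpha(x)}+g(x,u)|u|_{L^{s(x)}}^{\gamma(x)}$ in $\Omega$, $u=0$ on $\partial\Omega$. A weak solution of $(P)$ is $u\in W_0^{1,p(x)}(\Omega)\cap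 L^\infty(\Omega)$ such that for all $\varphi\in W_0^{1,p(x)}(\Omega)$: $\int_\Omega|\nabla u|^{p(x)-2}\nabla u\cdot\nabla\varphi=\int_\Omega\Big(\frac{f(x,u)|u|_{L^{q(x)}}^{\alpha(x)}+g(x,u)|u|_{L^{s(x)}}^{\gamma(x)}}{\mathcal{A}(x,|u|_{L^{r(x)}})}\Big)\varphi$. For measurable $u,v$, $[u,v]=\{w \text{ measurable}: u\le w\le v \text{ a.e.}\}$. A pair $(\underline{u},\overline{u})$ is a sub-supersolution pair for $(P)$ if $\underline{u}\in W_0^{1,p(x)}(\Omega)\cap L^\infty(\Omega)$, $\overline{u}\in W^{1,p(x)}(\Omega)\cap L^\infty(\Omega)$, $\underline{u}\le\overline{u}$ a.e., $\underline{u}=0\le\overline{u}$ on $\partial\Omega$, and for every $w\in[\underline{u},\overline{u}]$ and every $\varphi\in W_0^{1,p(x)}(\Omega)$ with $\varphi\ge0$: $\int_\Omega|\nabla\underline{u}|^{p(x)-2}\nabla\underline{u}\cdot\nabla\varphi\le\int_\Omega\frac{f(x,\underline{u})|\underline{u}|_{L^{q(x)}}^{\alpha(x)}+g(x,\underline{u})|\underline{u}|_{L^{s(x)}}^{\gamma(x)}}{\mathcal{A}(x,|w|_{L^{r(x)}})}\varphi$ and $\int_\Omega|\nabla\overline{u}|^{p(x)-2}\nabla\overline{u}\cdot\nabla\varphi\ge\int_\Omega\frac{f(x,\overline{u})|\overline{u}|_{L^{q(x)}}^{\alpha(x)}+g(x,\overline{u})|\overline{u}|_{L^{s(x)}}^{\gamma(x)}}{\mathcal{A}(x,|w|_{L^{r(x)}})}\varphi$.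 *)

theory Defs
  imports "HOL-Analysis.Analysis"
begin

definition ess_sup :: "'a::euclidean_space set \<Rightarrow> ('a \<Rightarrow> real) \<Rightarrow> real" where
  "ess_sup \<Omega> m = Inf {c. AE x in lebesgue_on \<Omega>. m x \<le> c}"

definition ess_inf :: "'a::euclidean_space set \<Rightarrow> ('a \<Rightarrow> real) \<Rightarrow> real" where
  "ess_inf \<Omega> m = Sup {c. AE x in lebesgue_on \<Omega>. c \<le> m x}"

definition Linf :: "'a::euclidean_space set \<Rightarrow> ('a \<Rightarrow> real) set" where
  "Linf \<Omega> = {m. m \<in> borel_measurable (lebesgue_on \<Omega>) \<and>
                 (\<exists>C. AE x in lebesgue_on \<Omega>. \<bar>m x\<bar> \<le> C)}"

definition Linf_norm :: "'a::euclidean_space set \<Rightarrow> ('a \<Rightarrow> real) \<Rightarrow> real" where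
  "Linf_norm \<Omega> u = ess_sup \<Omega> (\<lambda>x. \<bar>u x\<bar>)"

definition Linf_plus :: "'a::euclidean_space set \<Rightarrow> ('a \<Rightarrow> real) set" where
  "Linf_plus \<Omega> = {m \<in> Linf \<Omega>. ess_inf \<Omega> m \<ge> 1}"

definition modular :: "'a::euclidean_space set \<Rightarrow> ('a \<Rightarrow> real) \<Rightarrow> ('a \<Rightarrow> real) \<Rightarrow> ennreal" where
  "modular \<Omega> m u = (\<integral>\<^sup>+ x. ennreal (\<bar>u x\<bar> powr m x) \<partial>lebesgue_on \<Omega>)"

definition Lvar :: "'a::euclidean_space set \<Rightarrow> ('a \<Rightarrow> real) \<Rightarrow> ('a \<Rightarrow> real) set" where
  "Lvar \<Omega> m = {u. u \<in> borel_measurable (lebesgue_on \<Omega>) \<and> modular \<Omega> m u < \<infinity>}"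

definition lux_norm :: "'a::euclidean_space set \<Rightarrow> ('a \<Rightarrow> real) \<Rightarrow> ('a \<Rightarrow> real) \<Rightarrow> real" where
  "lux_norm \<Omega> m u = Inf {c. c > 0 \<and> modular \<Omega> m (\<lambda>x. u x / c) \<le> 1}"

definition smooth_on :: "'a::euclidean_space set \<Rightarrow> ('a \<Rightarrow> real) \<Rightarrow> bool" where
  "smooth_on U f \<longleftrightarrow> (\<exists>S. f \<in> S \<and> (\<forall>g\<in>S. (\<forall>x\<in>U. g differentiable (at x)) \<and>
       (\<forall>b\<in>Basis. (\<lambda>x. frechet_derivative g (at x) b) \<in> S)))"

definition partial :: "('a::euclidean_space \<Rightarrow> real) \<Rightarrow> 'a \<Rightarrow> 'a \<Rightarrow> real" where
  "partial f b x = frechet_derivative f (at x) b"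

definition test_fun :: "'a::euclidean_space set \<Rightarrow> ('a \<Rightarrow> real) set" where
  "test_fun \<Omega> = {\<phi>. smooth_on UNIV \<phi> \<and>
      (\<exists>K. compact K \<and> K \<subseteq> \<Omega> \<and> (\<forall>x. x \<notin> K \<longrightarrow> \<phi> x = 0))}"

definition has_weak_gradient :: "'a::euclidean_space set \<Rightarrow> ('a \<Rightarrow> real) \<Rightarrow> ('a \<Rightarrow> 'a) \<Rightarrow> bool" where
  "has_weak_gradient \<Omega> u G \<longleftrightarrow>
     (\<forall>K. compact K \<and> K \<subseteq> \<Omega> \<longrightarrow> integrable (lebesgue_on K) u \<and>
                 (\<forall>b\<in>Basis. integrable (lebesgue_on K) (\<lambda>x. G x \<bullet> b))) \<and>
     (\<forall>\<phi>\<in>test_fun \<Omega>. \<forall>b\<in>Basis.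
        integral\<^sup>L (lebesgue_on \<Omega>) (\<lambda>x. u x * partial \<phi> b x) =
        - integral\<^sup>L (lebesgue_on \<Omega>) (\<lambda>x. (G x \<bullet> b) * \<phi> x))"

definition weak_grad :: "'a::euclidean_space set \<Rightarrow> ('a \<Rightarrow> real) \<Rightarrow> 'a \<Rightarrow> 'a" where
  "weak_grad \<Omega> u = (SOME G. has_weak_gradient \<Omega> u G)"

definition W1 :: "'a::euclidean_space set \<Rightarrow> ('a \<Rightarrow> real) \<Rightarrow> ('a \<Rightarrow> real) set" where
  "W1 \<Omega> p = {u. u \<in> Lvar \<Omega> p \<and> (\<exists>G. has_weak_gradient \<Omega> u G \<and>
                   (\<forall>b\<in>Basis. (\<lambda>x. G x \<bullet> b) \<in> Lvar \<Omega> p))}"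

definition W1_norm :: "'a::euclidean_space set \<Rightarrow> ('a \<Rightarrow> real) \<Rightarrow> ('a \<Rightarrow> real) \<Rightarrow> real" where
  "W1_norm \<Omega> p u = lux_norm \<Omega> p u + (\<Sum>b\<in>Basis. lux_norm \<Omega> p (\<lambda>x. weak_grad \<Omega> u x \<bullet> b))"

definition W10 :: "'a::euclidean_space set \<Rightarrow> ('a \<Rightarrow> real) \<Rightarrow> ('a \<Rightarrow> real) set" where
  "W10 \<Omega> p = {u \<in> W1 \<Omega> p. \<exists>\<phi>. (\<forall>n. \<phi> n \<in> test_fun \<Omega>) \<and>
                 (\<lambda>n. W1_norm \<Omega> p (\<lambda>x. \<phi> n x - u x)) \<longlonglongrightarrow> 0}"

definition C1_on_closure :: "'a::euclidean_space set \<Rightarrow> ('a \<Rightarrow> real) \<Rightarrow> bool" where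
  "C1_on_closure \<Omega> p \<longleftrightarrow> continuous_on (closure \<Omega>) p \<and>
     (\<exists>D :: 'a \<Rightarrow> ('a \<Rightarrow>\<^sub>L real). (\<forall>x\<in>\<Omega>. (p has_derivative blinfun_apply (D x)) (at x)) \<and>
          continuous_on (closure \<Omega>) D)"

definition C2_on :: "'a::euclidean_space set \<Rightarrow> ('a \<Rightarrow> real) \<Rightarrow> bool" where
  "C2_on U \<psi> \<longleftrightarrow> (\<exists>(D :: 'a \<Rightarrow> ('a \<Rightarrow>\<^sub>L real)) (D2 :: 'a \<Rightarrow> ('a \<Rightarrow>\<^sub>L ('a \<Rightarrow>\<^sub>L real))).
      (\<forall>x\<in>U. (\<psi> has_derivative blinfun_apply (D x)) (at x)) \<and>
      (\<forall>x\<in>U. (D has_derivative blinfun_apply (D2 x)) (at x)) \<and>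
      continuous_on U D2)"

definition C2_boundary :: "'a::euclidean_space set \<Rightarrow> bool" where
  "C2_boundary \<Omega> \<longleftrightarrow> (\<forall>x0\<in>frontier \<Omega>. \<exists>U \<psi>. open U \<and> x0 \<in> U \<and> C2_on U \<psi> \<and>
      (\<forall>x\<in>U. frechet_derivative \<psi> (at x) \<noteq> (\<lambda>_. 0)) \<and>
      \<Omega> \<inter> U = {x\<in>U. \<psi> x < 0})"

definition pLap_form :: "'a::euclidean_space set \<Rightarrow> ('a \<Rightarrow> real) \<Rightarrow> ('a \<Rightarrow> real) \<Rightarrow> ('a \<Rightarrow> real) \<Rightarrow> real" where
  "pLap_form \<Omega> p u \<phi> = integral\<^sup>L (lebesgue_on \<Omega>)
     (\<lambda>x. norm (weak_grad \<Omega> u x) powr (p x - 2) * (weak_grad \<Omega> u x \<bullet> weak_grad \<Omega> \<phi> x))"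

definition rhs :: "'a::euclidean_space set \<Rightarrow> ('a \<Rightarrow> real) \<Rightarrow> ('a \<Rightarrow> real) \<Rightarrow> ('a \<Rightarrow> real) \<Rightarrow>
     ('a \<Rightarrow> real) \<Rightarrow> ('a \<Rightarrow> real) \<Rightarrow> ('a \<Rightarrow> real \<Rightarrow> real) \<Rightarrow> ('a \<Rightarrow> real \<Rightarrow> real) \<Rightarrow>
     ('a \<Rightarrow> real \<Rightarrow> real) \<Rightarrow> ('a \<Rightarrow> real) \<Rightarrow> ('a \<Rightarrow> real) \<Rightarrow> ('a \<Rightarrow> real) \<Rightarrow> real" where
  "rhs \<Omega> r q s \<alpha> \<gamma> f g A v w \<phi> = integral\<^sup>L (lebesgue_on \<Omega>)
     (\<lambda>x. ((f x (v x) * lux_norm \<Omega> q v powr \<alpha> x + g x (v x) * lux_norm \<Omega> s v powr \<gamma> x)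
           / A x (lux_norm \<Omega> r w)) * \<phi> x)"

definition weak_solution where
  "weak_solution \<Omega> p r q s \<alpha> \<gamma> f g A u \<longleftrightarrow>
     u \<in> W10 \<Omega> p \<and> u \<in> Linf \<Omega> \<and>
     (\<forall>\<phi>\<in>W10 \<Omega> p. pLap_form \<Omega> p u \<phi> = rhs \<Omega> r q s \<alpha> \<gamma> f g A u u \<phi>)"

definition order_interval :: "'a::euclidean_space set \<Rightarrow> ('a \<Rightarrow> real) \<Rightarrow> ('a \<Rightarrow> real) \<Rightarrow> ('a \<Rightarrow> real) set" where
  "order_interval \<Omega> u v = {w. w \<in> borel_measurable (lebesgue_on \<Omega>) \<and>
       (AE x in lebesgue_on \<Omega>. u x \<le> w x \<and> w x \<le> v x)}"

text \<open>"0 <= overline u on the boundary" is read as: the negative part of overline u lies in W_0.\<close>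
definition sub_super_pair where
  "sub_super_pair \<Omega> p r q s \<alpha> \<gamma> f g A ul uu \<longleftrightarrow>
     ul \<in> W10 \<Omega> p \<and> ul \<in> Linf \<Omega> \<and> uu \<in> W1 \<Omega> p \<and> uu \<in> Linf \<Omega> \<and>
     (AE x in lebesgue_on \<Omega>. ul x \<le> uu x) \<and>
     (\<lambda>x. max (- uu x) 0) \<in> W10 \<Omega> p \<and>
     (\<forall>w\<in>order_interval \<Omega> ul uu. \<forall>\<phi>\<in>W10 \<Omega> p. (AE x in lebesgue_on \<Omega>. \<phi> x \<ge> 0) \<longrightarrow>
        pLap_form \<Omega> p ul \<phi> \<le> rhs \<Omega> r q s \<alpha> \<gamma> f g A ul w \<phi> \<and>
        pLap_form \<Omega> p uu \<phi> \<ge> rhs \<Omega> r q s \<alpha> \<gamma> f g A uu w \<phi>)"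

definition H0 :: "'a::euclidean_space set \<Rightarrow> ('a \<Rightarrow> real) \<Rightarrow> ('a \<Rightarrow> real) \<Rightarrow> ('a \<Rightarrow> real) \<Rightarrow> ('a \<Rightarrow> real) \<Rightarrow> ('a \<Rightarrow> real) \<Rightarrow> ('a \<Rightarrow> real) \<Rightarrow> bool" where
  "H0 \<Omega> p r q s \<alpha> \<gamma> \<longleftrightarrow> C1_on_closure \<Omega> p \<and>
     r \<in> Linf_plus \<Omega> \<and> q \<in> Linf_plus \<Omega> \<and> s \<in> Linf_plus \<Omega> \<and>
     \<alpha> \<in> Linf \<Omega> \<and> \<gamma> \<in> Linf \<Omega> \<and>
     1 < ess_inf \<Omega> p \<and> ess_inf \<Omega> p \<le> ess_sup \<Omega> p \<and> ess_sup \<Omega> p < real DIM('a) \<and>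
     (AE x in lebesgue_on \<Omega>. \<alpha> x \<ge> 0 \<and> \<gamma> x \<ge> 0)"

end

theory Submission
  imports Defs "HOL-Library.Diagonal_Subsequence"
begin

text \<open>
  Truncate the unknown to \<open>[ul, uu]\<close> inside the right-hand side and add the penalty
  \<open>|u|\<^bsup>p(x)-2\<^esup> u - |T u|\<^bsup>p(x)-2\<^esup> T u\<close>, where \<open>T\<close> is the truncation. With \<open>w\<close> frozen in the nonlocal
  terms and in \<open>T w\<close>, the equation is the Euler--Lagrange equation of a uniformly convex functional on
  \<open>W\<^sub>0\<close>, so it has a unique solution \<open>S w\<close>. Its energy is bounded independently of \<open>w\<close> and
  \<open>S\<close> is continuous and compact in \<open>L\<^sup>1\<close>, by uniform convexity and Rellich's theorem; Schauder's
  argument gives approximate fixed points, and these converge to a fixed point \<open>v\<close>. Testing with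
  \<open>\<rho>(ul - v)\<close> and \<open>\<rho>(v - uu)\<close>, where \<open>\<rho>\<close> is a smooth function that vanishes on
  \<open>(-\<infinity>, 0]\<close> and increases on \<open>[0, \<infinity>)\<close>, the penalty forces \<open>ul \<le> v \<le> uu\<close>: there \<open>T v\<close> is
  \<open>ul\<close> resp. \<open>uu\<close>, and the Luxemburg norms are monotone. Hence \<open>T v = v\<close> and the penalty vanishes.
\<close>

subsection \<open>Smooth functions\<close>

text \<open>The obstacle is that \<open>A\<close> is positive only on a range of norms and
  \<open>f\<close>, \<open>g\<close> are nonnegative only on a range of values. Truncation puts all
  arguments into these ranges, so all right-hand sides share one sup bound. The penalty adds
  |u|^p(x)/p(x) to the energy, which makes it coercive without a Poincare inequality. One pointwise
  inequality, bounding |a - b|^q by the midpoint convexity defect of |.|^q, gives both existence and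
  stability of minimisers.

  The Sobolev space is a set \<open>V\<close> of pairs (function, gradient), closed under modular
  convergence, because \<open>weak_grad\<close> is a choice fixed only almost everywhere. The
  delicate point is to show that \<rho>(v - uu) lies in this space, as \<open>uu\<close> need not
  vanish on the boundary. For v replaced by a test function only the values of \<open>uu\<close>
  near its support count; there \<open>uu\<close> is cut off and mollified, and the regularity of
  \<open>p\<close> keeps mollifications bounded in the modular. A smooth \<rho> composed with a test
  function is again a test function, so the chain rule holds before passing to the limit.\<close>

definition exp_recip :: "nat \<Rightarrow> real \<Rightarrow> real" where
  "exp_recip j t = (if t > 0 then exp (- 1 / t) / t ^ j else 0)"

lemma exp_recip_nonpos [simp]: "t \<le> 0 \<Longrightarrow> exp_recip j t = 0"
  by (simp add: exp_recip_def)

lemma exp_recip_pos: "t > 0 \<Longrightarrow> exp_recip j t > 0"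
  by (simp add: exp_recip_def)

lemma exp_recip_nonneg: "exp_recip j t \<ge> 0"
  by (simp add: exp_recip_def)

lemma exp_recip_le_one: "exp_recip 0 t \<le> 1"
  by (simp add: exp_recip_def)

text \<open>The substitution y = 1/t turns the right-hand limit into the decay of y^j / exp y at
  infinity.\<close>

lemma exp_recip_tendsto_0: "(exp_recip j \<longlongrightarrow> 0) (at 0)"
proof -
  have "((\<lambda>y::real. y ^ j / exp y) \<longlongrightarrow> 0) at_top"
    by (rule tendsto_power_div_exp_0)
  then have "((\<lambda>t::real. (inverse t) ^ j / exp (inverse t)) \<longlongrightarrow> 0) (at_right 0)"
    by (rule filterlim_compose) (rule filterlim_inverse_at_top_right)
  moreover have "\<forall>\<^sub>F t in at_right 0. (inverse t) ^ j / exp (inverse t) = exp_recip j t"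
    unfolding eventually_at_right_field
    by (intro exI[of _ 1]) (auto simp: exp_recip_def exp_minus field_simps)
  ultimately have r: "(exp_recip j \<longlongrightarrow> 0) (at_right 0)"
    by (rule Lim_transform_eventually)
  have "(exp_recip j \<longlongrightarrow> 0) (at_left 0)"
  proof (rule Lim_transform_eventually)
    show "((\<lambda>_. 0) \<longlongrightarrow> 0) (at_left (0::real))" by simp
    show "\<forall>\<^sub>F t in at_left 0. 0 = exp_recip j t"
      unfolding eventually_at_left_field by (intro exI[of _ "-1"]) auto
  qed
  with r show ?thesis by (simp add: filterlim_split_at)
qed

text \<open>The index \<open>j\<close> exists for the sake of this formula: the span of the family
  is closed under differentiation.\<close>

lemma exp_recip_has_derivative:
  "(exp_recip j has_real_derivative exp_recip (j + 2) t - real j * exp_recip (j + 1) t) (at t)"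
proof (cases t "0::real" rule: linorder_cases)
  case greater
  have "((\<lambda>t. exp (- 1 / t) / t ^ j) has_real_derivative
          exp_recip (j + 2) t - real j * exp_recip (j + 1) t) (at t)"
  proof (cases j)
    case 0 then show ?thesis using greater
      by (auto intro!: derivative_eq_intros simp: exp_recip_def power2_eq_square)
  next
    case (Suc k)
    have "((\<lambda>t. exp (- 1 / t) / t ^ j) has_real_derivative
        (exp (- 1 / t) * (1 / t\<^sup>2) * t ^ j - exp (- 1 / t) * (real j * t ^ (j - 1))) / (t ^ j * t ^ j)) (at t)"
      using greater by (auto intro!: derivative_eq_intros simp: power2_eq_square)
    also have "(exp (- 1 / t) * (1 / t\<^sup>2) * t ^ j - exp (- 1 / t) * (real j * t ^ (j - 1))) / (t ^ j * t ^ j)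
       = exp_recip (j + 2) t - real j * exp_recip (j + 1) t"
      using greater Suc by (simp add: exp_recip_def power2_eq_square field_simps)
    finally show ?thesis .
  qed
  then show ?thesis
    by (rule has_field_derivative_transform_within[where d = t])
       (use greater in \<open>auto simp: exp_recip_def dist_real_def\<close>)
next
  case less
  have "((\<lambda>t. 0) has_real_derivative 0) (at t)" by simp
  then have "(exp_recip j has_real_derivative 0) (at t)"
    by (rule has_field_derivative_transform_within_open[where S = "{..<0}"]) (use less in auto)
  then show ?thesis using less by simp
next
  case equal
  \<comment> \<open>At the origin the difference quotient of member j is member j + 1, which tends
    to 0.\<close>
  have "((\<lambda>h. (exp_recip j (0 + h) - exp_recip j 0) / h) \<longlongrightarrow> 0) (at 0)"
  proof (rule Lim_transform_eventually)
    show "(exp_recip (Suc j) \<longlongrightarrow> 0) (at 0)" by (rule exp_recip_tendsto_0)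
    show "\<forall>\<^sub>F x in at 0. exp_recip (Suc j) x = (exp_recip j (0 + x) - exp_recip j 0) / x"
      by (auto simp: eventually_at exp_recip_def intro!: exI[of _ 1])
  qed
  then show ?thesis using equal by (simp add: DERIV_def)
qed

text \<open>\<open>smooth_on\<close> asks for one set of differentiable functions that is stable
  under partial derivatives. This generated set is such a witness for all needed operations at once,
  so sums, products and compositions need no witness of their own.\<close>

inductive_set smooth_gen :: "('a::euclidean_space \<Rightarrow> real) set" where
  base: "smooth_on UNIV f \<Longrightarrow> f \<in> smooth_gen"
| const: "(\<lambda>_. c) \<in> smooth_gen"
| coord: "(\<lambda>x. x \<bullet> b) \<in> smooth_gen"
| add: "f \<in> smooth_gen \<Longrightarrow> g \<in> smooth_gen \<Longrightarrow> (\<lambda>x. f x + g x) \<in> smooth_gen"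
| mult: "f \<in> smooth_gen \<Longrightarrow> g \<in> smooth_gen \<Longrightarrow> (\<lambda>x. f x * g x) \<in> smooth_gen"
| comp: "f \<in> smooth_gen \<Longrightarrow> (\<lambda>x. exp_recip j (f x)) \<in> smooth_gen"

lemma smooth_imp_differentiable: "smooth_on UNIV f \<Longrightarrow> f differentiable (at x)"
  unfolding smooth_on_def by blast

lemma smooth_partial: "smooth_on UNIV f \<Longrightarrow> b \<in> Basis \<Longrightarrow> smooth_on UNIV (\<lambda>x. frechet_derivative f (at x) b)"
  unfolding smooth_on_def by blast

lemma frechet_derivative_eqI:
  "(f has_derivative f') (at x) \<Longrightarrow> frechet_derivative f (at x) = f'"
  using frechet_derivative_at by metis

lemma has_derivative_frechet:
  "f differentiable (at x) \<Longrightarrow> (f has_derivative frechet_derivative f (at x)) (at x)"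
  by (simp add: frechet_derivative_works)

lemma smooth_gen_closed:
  assumes "f \<in> smooth_gen"
  shows "(\<forall>x. f differentiable (at x)) \<and>
    (\<forall>b\<in>Basis. (\<lambda>x. frechet_derivative f (at x) b) \<in> smooth_gen)"
  using assms
proof induction
  case (base f)
  then show ?case by (auto intro: smooth_imp_differentiable smooth_gen.base smooth_partial)
next
  case (const c)
  show ?case using smooth_gen.const[of 0] by (auto simp: frechet_derivative_eqI[OF has_derivative_const])
next
  case (coord b)
  have *: "((\<lambda>x. x \<bullet> b) has_derivative (\<lambda>h. h \<bullet> b)) (at x)" for x
    by (auto intro!: derivative_eq_intros)
  then show ?case
    by (auto simp: frechet_derivative_eqI[OF *] intro: smooth_gen.const differentiableI)
next
  case (add f g)
  have *: "((\<lambda>x. f x + g x) has_derivative (\<lambda>h. frechet_derivative f (at x) h + frechet_derivative g (at x) h)) (at x)" for x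
    using add by (intro derivative_intros has_derivative_frechet) auto
  then show ?case using add.IH
    by (auto simp: frechet_derivative_eqI[OF *] intro: smooth_gen.add differentiableI)
next
  case (mult f g)
  have *: "((\<lambda>x. f x * g x) has_derivative
     (\<lambda>h. f x * frechet_derivative g (at x) h + frechet_derivative f (at x) h * g x)) (at x)" for x
    using mult by (intro derivative_intros has_derivative_frechet) auto
  show ?case
    unfolding frechet_derivative_eqI[OF *]
  proof (intro conjI allI ballI)
    show "(\<lambda>x. f x * g x) differentiable (at x)" for x using * by (rule differentiableI)
    fix b :: 'a assume b: "b \<in> Basis"
    show "(\<lambda>x. f x * frechet_derivative g (at x) b + frechet_derivative f (at x) b * g x) \<in> smooth_gen"
      using mult b by (intro smooth_gen.add smooth_gen.mult) auto
  qed
next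
  case (comp f j)
  have *: "((\<lambda>x. exp_recip j (f x)) has_derivative
     (\<lambda>h. frechet_derivative f (at x) h * (exp_recip (j + 2) (f x) + (- real j) * exp_recip (j + 1) (f x)))) (at x)" for x
  proof -
    have "f differentiable at x" using comp by auto
    from has_derivative_compose[OF has_derivative_frechet[OF this]
        exp_recip_has_derivative[THEN has_field_derivative_imp_has_derivative], of j]
    show ?thesis by (simp add: mult.commute)
  qed
  show ?case
    unfolding frechet_derivative_eqI[OF *]
  proof (intro conjI allI ballI)
    show "(\<lambda>x. exp_recip j (f x)) differentiable (at x)" for x using * by (rule differentiableI)
    fix b :: 'a assume b: "b \<in> Basis"
    show "(\<lambda>x. frechet_derivative f (at x) b *
       (exp_recip (j + 2) (f x) + (- real j) * exp_recip (j + 1) (f x))) \<in> smooth_gen"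
      using comp b by (intro smooth_gen.add smooth_gen.mult smooth_gen.const smooth_gen.comp) auto
  qed
qed

lemma smooth_gen_iff: "f \<in> smooth_gen \<longleftrightarrow> smooth_on UNIV f"
proof
  assume "f \<in> smooth_gen"
  then show "smooth_on UNIV f"
    unfolding smooth_on_def using smooth_gen_closed by (intro exI[of _ smooth_gen]) blast
qed (rule smooth_gen.base)

lemma smooth_const: "smooth_on UNIV (\<lambda>_. c)"
  and smooth_coord: "smooth_on UNIV (\<lambda>x. x \<bullet> b)"
  and smooth_add: "smooth_on UNIV f \<Longrightarrow> smooth_on UNIV g \<Longrightarrow> smooth_on UNIV (\<lambda>x. f x + g x)"
  and smooth_mult: "smooth_on UNIV f \<Longrightarrow> smooth_on UNIV g \<Longrightarrow> smooth_on UNIV (\<lambda>x. f x * g x)"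
  and smooth_exp_recip: "smooth_on UNIV f \<Longrightarrow> smooth_on UNIV (\<lambda>x. exp_recip j (f x))"
  by (fact smooth_gen.intros(2-)[unfolded smooth_gen_iff])+

lemma smooth_cmult: "smooth_on UNIV f \<Longrightarrow> smooth_on UNIV (\<lambda>x. c * f x)"
  by (intro smooth_mult smooth_const)

lemma smooth_diff: "smooth_on UNIV f \<Longrightarrow> smooth_on UNIV g \<Longrightarrow> smooth_on UNIV (\<lambda>x. f x - g x)"
  using smooth_add[OF _ smooth_cmult[of g "-1"], of f] by simp

lemma smooth_sum: "(\<And>i. i \<in> I \<Longrightarrow> smooth_on UNIV (f i)) \<Longrightarrow> smooth_on UNIV (\<lambda>x. \<Sum>i\<in>I. f i x)"
  by (induction I rule: infinite_finite_induct) (auto intro: smooth_const smooth_add)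

lemma smooth_norm_sq: "smooth_on UNIV (\<lambda>x. x \<bullet> x)"
proof -
  have "smooth_on UNIV (\<lambda>x. \<Sum>b\<in>Basis. (x \<bullet> b) * (x \<bullet> b))"
    by (intro smooth_sum smooth_mult smooth_coord)
  then show ?thesis by (simp add: euclidean_inner[symmetric])
qed

lemma smooth_affine:
  fixes f :: "'a::euclidean_space \<Rightarrow> real"
  assumes "smooth_on UNIV f"
  shows "smooth_on UNIV (\<lambda>y. f (x0 + c *\<^sub>R y))"
proof -
  \<comment> \<open>Each partial derivative brings out a factor c, so the witness set must contain
    scalar multiples.\<close>
  define S where "S = {\<lambda>y. a * f (x0 + c *\<^sub>R y) | a f. smooth_on UNIV f}"
  show ?thesis unfolding smooth_on_def
  proof (intro exI[of _ S] conjI ballI)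
    show "(\<lambda>y. f (x0 + c *\<^sub>R y)) \<in> S" using assms unfolding S_def
      by (auto intro!: exI[of _ 1])
    fix g assume "g \<in> S"
    then obtain a f where g: "g = (\<lambda>y. a * f (x0 + c *\<^sub>R y))" and f: "smooth_on UNIV f"
      unfolding S_def by auto
    have *: "(g has_derivative (\<lambda>h. a * frechet_derivative f (at (x0 + c *\<^sub>R y)) (c *\<^sub>R h))) (at y)" for y
      unfolding g
      by (intro has_derivative_mult_right
          has_derivative_compose[where f = "\<lambda>y. x0 + c *\<^sub>R y" and g = f])
         (auto intro!: derivative_eq_intros has_derivative_frechet[OF smooth_imp_differentiable[OF f]])
    have lin: "linear (frechet_derivative f (at z))" for z
      using linear_frechet_derivative[OF smooth_imp_differentiable[OF f]] .
    { fix x show "g differentiable (at x)" using * by (rule differentiableI) }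
    fix b :: 'a assume b: "b \<in> Basis"
    have "(\<lambda>x. frechet_derivative g (at x) b) = (\<lambda>y. (a * c) * frechet_derivative f (at (x0 + c *\<^sub>R y)) b)"
      unfolding frechet_derivative_eqI[OF *] using lin by (simp add: linear_cmul mult.assoc)
    then show "(\<lambda>x. frechet_derivative g (at x) b) \<in> S"
      unfolding S_def using smooth_partial[OF f b] by auto
  qed
qed

definition grad :: "('a::euclidean_space \<Rightarrow> real) \<Rightarrow> 'a \<Rightarrow> 'a" where
  "grad f x = (\<Sum>b\<in>Basis. partial f b x *\<^sub>R b)"

lemma grad_inner_Basis [simp]: "b \<in> Basis \<Longrightarrow> grad f x \<bullet> b = partial f b x"
  by (simp add: grad_def inner_sum_left inner_Basis if_distrib cong: if_cong)

lemma has_derivative_grad: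
  assumes "f differentiable (at x)"
  shows "(f has_derivative (\<lambda>h. grad f x \<bullet> h)) (at x)"
proof -
  have lin: "linear (frechet_derivative f (at x))" using assms by (rule linear_frechet_derivative)
  have "frechet_derivative f (at x) h = grad f x \<bullet> h" for h
  proof -
    have "frechet_derivative f (at x) h = frechet_derivative f (at x) (\<Sum>b\<in>Basis. (h \<bullet> b) *\<^sub>R b)"
      by (simp add: euclidean_representation)
    also have "\<dots> = (\<Sum>b\<in>Basis. (h \<bullet> b) * frechet_derivative f (at x) b)"
      by (simp add: linear_sum[OF lin] linear_cmul[OF lin])
    also have "\<dots> = grad f x \<bullet> h"
      unfolding grad_def partial_def inner_sum_left
      by (simp add: inner_commute[of _ h] mult.commute)
    finally show ?thesis .
  qed
  then have "frechet_derivative f (at x) = (\<lambda>h. grad f x \<bullet> h)" by auto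
  then show ?thesis using has_derivative_frechet[OF assms] by simp
qed

lemma grad_eqI:
  assumes "(f has_derivative (\<lambda>h. v \<bullet> h)) (at x)"
  shows "grad f x = v"
  by (rule euclidean_eqI) (simp add: partial_def frechet_derivative_eqI[OF assms])

lemma grad_add: "f differentiable (at x) \<Longrightarrow> g differentiable (at x) \<Longrightarrow>
    grad (\<lambda>x. f x + g x) x = grad f x + grad g x"
  using has_derivative_add[OF has_derivative_grad has_derivative_grad, of f x g]
  by (intro grad_eqI) (simp add: inner_add_left)

lemma grad_cmult: "f differentiable (at x) \<Longrightarrow> grad (\<lambda>x. c * f x) x = c *\<^sub>R grad f x"
  using has_derivative_mult_right[OF has_derivative_grad, of f x c]
  by (intro grad_eqI) simp

lemma grad_mult: "f differentiable (at x) \<Longrightarrow> g differentiable (at x) \<Longrightarrow>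
    grad (\<lambda>x. f x * g x) x = f x *\<^sub>R grad g x + g x *\<^sub>R grad f x"
  using has_derivative_mult[OF has_derivative_grad has_derivative_grad, of f x g]
  by (intro grad_eqI) (simp add: inner_add_left mult.commute)

lemma grad_affine: "f differentiable (at (x0 + c *\<^sub>R y)) \<Longrightarrow>
    grad (\<lambda>y. f (x0 + c *\<^sub>R y)) y = c *\<^sub>R grad f (x0 + c *\<^sub>R y)"
proof (rule grad_eqI)
  assume d: "f differentiable (at (x0 + c *\<^sub>R y))"
  have "((\<lambda>y. x0 + c *\<^sub>R y) has_derivative (\<lambda>h. c *\<^sub>R h)) (at y)"
    by (auto intro!: derivative_eq_intros)
  from has_derivative_compose[OF this has_derivative_grad[OF d]]
  show "((\<lambda>y. f (x0 + c *\<^sub>R y)) has_derivative (\<lambda>h. (c *\<^sub>R grad f (x0 + c *\<^sub>R y)) \<bullet> h)) (at y)"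
    by simp
qed

lemma grad_comp_real:
  assumes "f differentiable (at x)" "(G has_real_derivative G') (at (f x))"
  shows "grad (\<lambda>x. G (f x)) x = G' *\<^sub>R grad f x"
  using has_derivative_compose[OF has_derivative_grad[OF assms(1)]
      assms(2)[THEN has_field_derivative_imp_has_derivative]]
  by (intro grad_eqI) simp

lemma smooth_continuous: "smooth_on UNIV f \<Longrightarrow> continuous_on UNIV f"
  by (simp add: continuous_on_eq_continuous_at smooth_imp_differentiable differentiable_imp_continuous_within)

lemma smooth_grad_continuous: "smooth_on UNIV f \<Longrightarrow> continuous_on UNIV (grad f)"
  unfolding grad_def partial_def
  by (intro continuous_intros smooth_continuous smooth_partial)

text \<open>The function \<rho> of the overview, a smooth substitute for the positive part: zero for
  t \<le> 0, asymptotic to t - 1 at infinity, with slope in [0, 1].\<close>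

definition ramp :: "real \<Rightarrow> real" where "ramp t = t * exp_recip 0 t"
definition ramp' :: "real \<Rightarrow> real" where "ramp' t = exp_recip 0 t + t * exp_recip 2 t"

lemma ramp_has_derivative: "(ramp has_real_derivative ramp' t) (at t)"
proof -
  have "((\<lambda>t. t * exp_recip 0 t) has_real_derivative ramp' t) (at t)"
    using exp_recip_has_derivative[of 0 t]
    by (auto intro!: derivative_eq_intros simp: ramp'_def numeral_2_eq_2)
  then show ?thesis by (simp add: ramp_def[abs_def])
qed

lemma ramp_nonpos [simp]: "t \<le> 0 \<Longrightarrow> ramp t = 0" "t \<le> 0 \<Longrightarrow> ramp' t = 0"
  by (simp_all add: ramp_def ramp'_def)

lemma ramp_pos: "t > 0 \<Longrightarrow> ramp t > 0"
  by (simp add: ramp_def exp_recip_pos)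

lemma ramp_nonneg: "ramp t \<ge> 0"
  by (cases "t \<le> 0") (auto intro: less_imp_le[OF ramp_pos])

text \<open>With s = 1/t the upper bound is exp (-s) * (1 + s) \<le> 1.\<close>

lemma ramp'_bounds: "0 \<le> ramp' t" "ramp' t \<le> 1"
proof -
  show "0 \<le> ramp' t"
    by (cases "t \<le> 0") (auto simp: ramp'_def exp_recip_nonneg)
  show "ramp' t \<le> 1"
  proof (cases "t \<le> 0")
    case False
    then have "ramp' t = exp (- (1 / t)) * (1 + 1 / t)"
      by (simp add: ramp'_def exp_recip_def power2_eq_square field_simps)
    also have "\<dots> \<le> exp (- (1 / t)) * exp (1 / t)"
      by (intro mult_left_mono exp_ge_add_one_self) auto
    finally show ?thesis by (simp add: exp_minus)
  qed simp
qed

lemma continuous_ramp: "continuous_on UNIV ramp" "continuous_on UNIV ramp'"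
proof -
  show "continuous_on UNIV ramp"
    using DERIV_isCont[OF ramp_has_derivative] by (simp add: continuous_on_eq_continuous_at)
  have "continuous_on UNIV (exp_recip j)" for j
    using DERIV_isCont[OF exp_recip_has_derivative] by (simp add: continuous_on_eq_continuous_at)
  then show "continuous_on UNIV ramp'"
    unfolding ramp'_def[abs_def] by (intro continuous_intros) auto
qed

lemma ramp_lipschitz: "\<bar>ramp s - ramp t\<bar> \<le> \<bar>s - t\<bar>"
proof -
  have "norm (ramp s - ramp t) \<le> 1 * norm (s - t)"
    by (rule field_differentiable_bound[OF convex_UNIV, where f' = ramp'])
       (auto simp: ramp_has_derivative ramp'_bounds)
  then show ?thesis by simp
qed

lemma ramp_le: "ramp t \<le> \<bar>t\<bar>" using ramp_lipschitz[of t 0] by simp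

lemma smooth_ramp: "smooth_on UNIV f \<Longrightarrow> smooth_on UNIV (\<lambda>x. ramp (f x))"
  unfolding ramp_def by (intro smooth_mult smooth_exp_recip)

subsection \<open>Test functions\<close>

lemma integrable_continuous_compact_support:
  fixes f :: "'a::euclidean_space \<Rightarrow> 'b::{banach, second_countable_topology}"
  assumes "compact K" "continuous_on UNIV f" "\<And>x. x \<notin> K \<Longrightarrow> f x = 0"
  shows "integrable lborel f"
proof -
  have "integrable lborel (\<lambda>x. indicator K x *\<^sub>R f x)"
    by (rule borel_integrable_compact) (use assms in \<open>auto intro: continuous_on_subset\<close>)
  moreover have "(\<lambda>x. indicator K x *\<^sub>R f x) = f"
    using assms(3) by (auto simp: indicator_def fun_eq_iff)
  ultimately show ?thesis by simp
qed

lemma bounded_continuous_compact_support: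
  fixes f :: "'a::euclidean_space \<Rightarrow> 'b::real_normed_vector"
  assumes "compact K" "continuous_on UNIV f" "\<And>x. x \<notin> K \<Longrightarrow> f x = 0"
  obtains B where "B > 0" "\<And>x. norm (f x) \<le> B"
proof -
  have "compact (f ` K)"
    using assms by (intro compact_continuous_image) (auto intro: continuous_on_subset)
  then obtain B where B: "B > 0" "\<And>x. x \<in> K \<Longrightarrow> norm (f x) \<le> B"
    using compact_imp_bounded bounded_pos by (metis imageI)
  then have "norm (f x) \<le> B" for x by (cases "x \<in> K") (auto simp: assms(3))
  with B that show ?thesis by blast
qed

lemma lborel_shift:
  fixes f :: "'a::euclidean_space \<Rightarrow> 'b::{banach, second_countable_topology}" and c :: 'a
  shows integrable_lborel_shift: "integrable lborel f \<Longrightarrow> integrable lborel (\<lambda>x. f (c + x))"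
    and integral_lborel_shift: "f \<in> borel_measurable borel \<Longrightarrow> (\<integral>x. f (c + x) \<partial>lborel) = (\<integral>x. f x \<partial>lborel)"
proof -
  show "integrable lborel (\<lambda>x. f (c + x))" if "integrable lborel f"
    using integrable_distr[of "(+) c" lborel borel f] that by (simp add: lborel_distr_plus)
  show "(\<integral>x. f (c + x) \<partial>lborel) = (\<integral>x. f x \<partial>lborel)" if "f \<in> borel_measurable borel"
    using integral_distr[of "(+) c" lborel borel f] that by (simp add: lborel_distr_plus)
qed

lemma lborel_reflect:
  fixes f :: "'a::euclidean_space \<Rightarrow> 'b::{banach, second_countable_topology}" and c :: 'a
  assumes "f \<in> borel_measurable borel"
  shows integral_lborel_reflect: "(\<integral>x. f (c - x) \<partial>lborel) = (\<integral>x. f x \<partial>lborel)"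
    and integrable_lborel_reflect: "integrable lborel (\<lambda>x. f (c - x)) \<longleftrightarrow> integrable lborel f"
proof -
  \<comment> \<open>Reflection is the affine map with factor -1, whose Jacobian has absolute value
    1.\<close>
  have eq: "distr lborel borel (\<lambda>x::'a. c - x) = lborel"
    by (subst (2) lborel_affine[of "-1" c]) (auto simp: density_1)
  show "(\<integral>x. f (c - x) \<partial>lborel) = (\<integral>x. f x \<partial>lborel)"
    using integral_distr[of "\<lambda>x. c - x" lborel borel f] assms by (simp add: eq)
  show "integrable lborel (\<lambda>x. f (c - x)) \<longleftrightarrow> integrable lborel f"
    using integrable_distr_eq[of "\<lambda>x. c - x" lborel borel f] assms by (simp add: eq)
qed

lemma test_funE:
  assumes "\<phi> \<in> test_fun \<Omega>"
  obtains K where "smooth_on UNIV \<phi>" "compact K" "K \<subseteq> \<Omega>" "\<And>x. x \<notin> K \<Longrightarrow> \<phi> x = 0"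
    "\<And>x. x \<notin> K \<Longrightarrow> grad \<phi> x = 0"
proof -
  obtain K where K: "smooth_on UNIV \<phi>" "compact K" "K \<subseteq> \<Omega>" "\<And>x. x \<notin> K \<Longrightarrow> \<phi> x = 0"
    using assms unfolding test_fun_def by blast
  have "grad \<phi> x = 0" if "x \<notin> K" for x
  proof (rule grad_eqI)
    have "(\<phi> has_derivative (\<lambda>_. 0)) (at x)"
      using K that by (intro has_derivative_transform_within_open[OF has_derivative_const[of 0], of "- K"])
         (auto simp: compact_imp_closed open_Compl)
    moreover have "(\<bullet>) (0::'a) = (\<lambda>_. 0)" by auto
    ultimately show "(\<phi> has_derivative (\<bullet>) 0) (at x)" by simp
  qed
  with K that show ?thesis by blast
qed

lemma test_funI:
  "smooth_on UNIV \<phi> \<Longrightarrow> compact K \<Longrightarrow> K \<subseteq> \<Omega> \<Longrightarrow> (\<And>x. x \<notin> K \<Longrightarrow> \<phi> x = 0) \<Longrightarrow> \<phi> \<in> test_fun \<Omega>"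
  unfolding test_fun_def by blast

lemma test_fun_smooth: "\<phi> \<in> test_fun \<Omega> \<Longrightarrow> smooth_on UNIV \<phi>"
  by (simp add: test_fun_def)

lemma test_fun_differentiable: "\<phi> \<in> test_fun \<Omega> \<Longrightarrow> \<phi> differentiable (at x)"
  by (auto intro: smooth_imp_differentiable test_fun_smooth)

lemma test_fun_outside: "\<phi> \<in> test_fun \<Omega> \<Longrightarrow> x \<notin> \<Omega> \<Longrightarrow> \<phi> x = 0 \<and> grad \<phi> x = 0"
  by (meson subsetD test_funE)

lemma test_fun_add: "\<phi> \<in> test_fun \<Omega> \<Longrightarrow> \<psi> \<in> test_fun \<Omega> \<Longrightarrow> (\<lambda>x. \<phi> x + \<psi> x) \<in> test_fun \<Omega>"
proof -
  assume "\<phi> \<in> test_fun \<Omega>" "\<psi> \<in> test_fun \<Omega>"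
  then obtain K L where "smooth_on UNIV \<phi>" "compact K" "K \<subseteq> \<Omega>" "\<And>x. x \<notin> K \<Longrightarrow> \<phi> x = 0"
     "smooth_on UNIV \<psi>" "compact L" "L \<subseteq> \<Omega>" "\<And>x. x \<notin> L \<Longrightarrow> \<psi> x = 0"
    using test_funE by metis
  then show ?thesis by (intro test_funI[of _ "K \<union> L"] smooth_add) (auto intro: compact_Un)
qed

lemma test_fun_smooth_mult: "\<phi> \<in> test_fun \<Omega> \<Longrightarrow> smooth_on UNIV \<psi> \<Longrightarrow> (\<lambda>x. \<psi> x * \<phi> x) \<in> test_fun \<Omega>"
proof -
  assume "\<phi> \<in> test_fun \<Omega>" "smooth_on UNIV \<psi>"
  then obtain K where "smooth_on UNIV \<phi>" "compact K" "K \<subseteq> \<Omega>" "\<And>x. x \<notin> K \<Longrightarrow> \<phi> x = 0"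
    using test_funE by metis
  then show ?thesis using \<open>smooth_on UNIV \<psi>\<close> by (intro test_funI[of _ "K"] smooth_mult) auto
qed

lemma test_fun_cmult: "\<phi> \<in> test_fun \<Omega> \<Longrightarrow> (\<lambda>x. c * \<phi> x) \<in> test_fun \<Omega>"
  by (intro test_fun_smooth_mult smooth_const)

lemma test_fun_zero: "(\<lambda>x. 0) \<in> test_fun \<Omega>"
  by (rule test_funI[of _ "{}"]) (auto intro: smooth_const)

lemma test_fun_partial: "\<phi> \<in> test_fun \<Omega> \<Longrightarrow> b \<in> Basis \<Longrightarrow> partial \<phi> b \<in> test_fun \<Omega>"
proof -
  assume *: "\<phi> \<in> test_fun \<Omega>" "b \<in> Basis"
  then obtain K where K: "compact K" "K \<subseteq> \<Omega>" "\<And>x. x \<notin> K \<Longrightarrow> grad \<phi> x = 0"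
    using test_funE by metis
  have "partial \<phi> b x = 0" if "x \<notin> K" for x
    using K(3)[OF that] * by (metis grad_inner_Basis inner_zero_left)
  then show ?thesis
    using smooth_partial[OF test_fun_smooth[OF *(1)] *(2)]
    by (intro test_funI[OF _ K(1,2)]) (auto simp: partial_def[abs_def])
qed

lemma test_fun_ramp: "\<phi> \<in> test_fun \<Omega> \<Longrightarrow> (\<lambda>x. ramp (\<phi> x)) \<in> test_fun \<Omega>"
proof -
  assume "\<phi> \<in> test_fun \<Omega>"
  then obtain K where "smooth_on UNIV \<phi>" "compact K" "K \<subseteq> \<Omega>" "\<And>x. x \<notin> K \<Longrightarrow> \<phi> x = 0"
    using test_funE by metis
  then show ?thesis by (intro test_funI[of _ "K"] smooth_ramp) auto
qed

lemma test_fun_continuous: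
  assumes "\<phi> \<in> test_fun \<Omega>"
  shows "continuous_on UNIV \<phi>" "continuous_on UNIV (grad \<phi>)"
  using assms by (auto intro: smooth_continuous smooth_grad_continuous test_fun_smooth)

lemma test_fun_measurable [measurable_dest]:
  assumes "\<phi> \<in> test_fun \<Omega>"
  shows "\<phi> \<in> borel_measurable borel" "grad \<phi> \<in> borel_measurable borel"
  using test_fun_continuous[OF assms] by (auto intro: borel_measurable_continuous_onI)

lemma test_fun_integrable:
  assumes "\<phi> \<in> test_fun \<Omega>"
  shows "integrable lborel \<phi>" "integrable lborel (grad \<phi>)"
proof -
  obtain K where K: "compact K" "\<And>x. x \<notin> K \<Longrightarrow> \<phi> x = 0" "\<And>x. x \<notin> K \<Longrightarrow> grad \<phi> x = 0"
    using test_funE[OF assms] by metis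
  show "integrable lborel \<phi>" "integrable lborel (grad \<phi>)"
    using K test_fun_continuous[OF assms] integrable_continuous_compact_support by metis+
qed

lemma test_fun_bounded:
  assumes "\<phi> \<in> test_fun \<Omega>"
  obtains B where "B > 0" "\<And>x. \<bar>\<phi> x\<bar> \<le> B" "\<And>x. norm (grad \<phi> x) \<le> B"
proof -
  obtain K where K: "compact K" "\<And>x. x \<notin> K \<Longrightarrow> \<phi> x = 0" "\<And>x. x \<notin> K \<Longrightarrow> grad \<phi> x = 0"
    using test_funE[OF assms] by metis
  obtain B1 where B1: "B1 > 0" "\<And>x. norm (\<phi> x) \<le> B1"
    using bounded_continuous_compact_support[OF K(1) test_fun_continuous(1)[OF assms] K(2)] by metis
  obtain B2 where B2: "B2 > 0" "\<And>x. norm (grad \<phi> x) \<le> B2"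
    using bounded_continuous_compact_support[OF K(1) test_fun_continuous(2)[OF assms] K(3)] by metis
  show ?thesis
    by (rule that[of "max B1 B2"]) (use B1 B2 in \<open>auto simp: max.coboundedI1 max.coboundedI2\<close>)
qed

lemma test_fun_lipschitz:
  assumes "\<phi> \<in> test_fun \<Omega>" "\<And>x. norm (grad \<phi> x) \<le> B"
  shows "\<bar>\<phi> x - \<phi> y\<bar> \<le> B * norm (x - y)"
proof -
  have "norm (\<phi> x - \<phi> y) \<le> B * norm (x - y)"
  proof (rule differentiable_bound[OF convex_UNIV])
    show "(\<phi> has_derivative (\<bullet>) (grad \<phi> x)) (at x within UNIV)" for x
      using has_derivative_grad[OF test_fun_differentiable[OF assms(1)]] by simp
    show "onorm ((\<bullet>) (grad \<phi> x)) \<le> B" for x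
    proof (rule onorm_le)
      fix y show "norm (grad \<phi> x \<bullet> y) \<le> B * norm y"
        using Cauchy_Schwarz_ineq2[of "grad \<phi> x" y] mult_right_mono[OF assms(2)[of x], of "norm y"] by simp
    qed
  qed auto
  then show ?thesis by simp
qed

text \<open>The quotients are supported in one compact set and bounded by the Lipschitz constant
  times |h|, so dominated convergence applies. The first limit yields integration by parts, the
  second the translation estimate in \<open>L\<^sup>1\<close>.\<close>

lemma test_fun_difference_quotient:
  fixes \<phi> :: "'a::euclidean_space \<Rightarrow> real" and h :: 'a
  assumes \<phi>: "\<phi> \<in> test_fun \<Omega>"
  defines "q \<equiv> \<lambda>n x. real (Suc n) * (\<phi> ((1 / real (Suc n)) *\<^sub>R h + x) - \<phi> x)"
  shows "(\<lambda>n. \<integral>x. q n x \<partial>lborel) \<longlonglongrightarrow> (\<integral>x. grad \<phi> x \<bullet> h \<partial>lborel)"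
    and "(\<lambda>n. \<integral>x. \<bar>q n x\<bar> \<partial>lborel) \<longlonglongrightarrow> (\<integral>x. \<bar>grad \<phi> x \<bullet> h\<bar> \<partial>lborel)"
proof -
  obtain K where K: "compact K" "\<And>x. x \<notin> K \<Longrightarrow> \<phi> x = 0"
    using test_funE[OF \<phi>] by metis
  obtain B where B: "B > 0" "\<And>x. norm (grad \<phi> x) \<le> B"
    using test_fun_bounded[OF \<phi>] by metis
  \<comment> \<open>All points that some shift by a vector of length at most |h| moves into the
    support.\<close>
  define K' where "K' = (\<lambda>(k, y). k - y) ` (K \<times> cball 0 (norm h))"
  have K': "compact K'" unfolding K'_def
    by (intro compact_continuous_image compact_Times K compact_cball) (auto intro!: continuous_intros simp: split_def)
  have in_K': "x \<in> K'" if "y + x \<in> K" "norm y \<le> norm h" for x y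
  proof -
    have "x = (y + x) - y" by simp
    then show ?thesis unfolding K'_def using that
      by (intro image_eqI[of _ _ "(y + x, y)"]) auto
  qed
  have bound: "\<bar>q n x\<bar> \<le> indicator K' x * (B * norm h)" for n x
  proof (cases "x \<in> K'")
    case True
    have "\<bar>\<phi> ((1 / real (Suc n)) *\<^sub>R h + x) - \<phi> x\<bar> \<le> B * norm ((1 / real (Suc n)) *\<^sub>R h)"
      using test_fun_lipschitz[OF \<phi> B(2), of "(1 / real (Suc n)) *\<^sub>R h + x" x] by simp
    also have "\<dots> = B * norm h / real (Suc n)" by simp
    finally have "\<bar>q n x\<bar> \<le> real (Suc n) * (B * norm h / real (Suc n))"
      unfolding q_def abs_mult by (intro mult_mono) auto
    then show ?thesis using True by simp
  next
    case False
    have "norm ((1 / real (Suc n)) *\<^sub>R h) \<le> norm h"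
      by (simp add: divide_le_eq mult_left_mono algebra_simps)
    then have "(1 / real (Suc n)) *\<^sub>R h + x \<notin> K" using in_K' False by blast
    moreover have "x \<notin> K" using in_K'[of 0 x] False by auto
    ultimately show ?thesis using K(2) by (simp add: q_def False)
  qed
  have int: "integrable lborel (\<lambda>x. indicator K' x * (B * norm h))"
    using borel_integrable_compact[OF K' continuous_on_const, of "B * norm h"] by simp
  have lim: "(\<lambda>n. q n x) \<longlonglongrightarrow> grad \<phi> x \<bullet> h" for x
  proof -
    have "((\<lambda>t::real. x + t *\<^sub>R h) has_derivative (\<lambda>t. t *\<^sub>R h)) (at 0)"
      by (auto intro!: derivative_eq_intros)
    from has_derivative_compose[OF this, of \<phi> "(\<bullet>) (grad \<phi> x)"] has_derivative_grad[OF test_fun_differentiable[OF \<phi>], of x]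
    have "((\<lambda>t. \<phi> (x + t *\<^sub>R h)) has_derivative (\<lambda>t. t * (grad \<phi> x \<bullet> h))) (at 0)" by simp
    then have "((\<lambda>t. \<phi> (x + t *\<^sub>R h)) has_real_derivative (grad \<phi> x \<bullet> h)) (at 0)"
      unfolding has_field_derivative_def by (simp add: mult.commute[of _ "grad \<phi> x \<bullet> h"])
    then have *: "((\<lambda>t. (\<phi> (x + t *\<^sub>R h) - \<phi> x) / t) \<longlongrightarrow> grad \<phi> x \<bullet> h) (at 0)"
      by (simp add: DERIV_def)
    have "filterlim (\<lambda>n. 1 / real (Suc n)) (at 0) sequentially"
      unfolding filterlim_at using LIMSEQ_inverse_real_of_nat by (auto simp: inverse_eq_divide)
    from filterlim_compose[OF * this]
    show ?thesis by (simp add: q_def add.commute mult.commute)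
  qed
  have meas [measurable]: "q n \<in> borel_measurable borel" for n
    unfolding q_def using test_fun_measurable[OF \<phi>] by measurable
  have meas' [measurable]: "grad \<phi> \<in> borel_measurable borel" using test_fun_measurable[OF \<phi>] by simp
  show "(\<lambda>n. \<integral>x. q n x \<partial>lborel) \<longlonglongrightarrow> (\<integral>x. grad \<phi> x \<bullet> h \<partial>lborel)"
    by (rule integral_dominated_convergence[OF _ _ int]) (use bound lim in auto)
  show "(\<lambda>n. \<integral>x. \<bar>q n x\<bar> \<partial>lborel) \<longlonglongrightarrow> (\<integral>x. \<bar>grad \<phi> x \<bullet> h\<bar> \<partial>lborel)"
    by (rule integral_dominated_convergence[OF _ _ int]) (use bound tendsto_rabs[OF lim] in auto)
qed

text \<open>Every difference quotient integrates to 0 by translation invariance.\<close>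

lemma integral_grad_test_fun:
  fixes \<phi> :: "'a::euclidean_space \<Rightarrow> real"
  assumes \<phi>: "\<phi> \<in> test_fun \<Omega>"
  shows "(\<integral>x. grad \<phi> x \<bullet> h \<partial>lborel) = 0"
proof -
  have "(\<integral>x. real (Suc n) * (\<phi> ((1 / real (Suc n)) *\<^sub>R h + x) - \<phi> x) \<partial>lborel) = 0" for n
    using test_fun_integrable(1)[OF \<phi>] test_fun_measurable(1)[OF \<phi>]
    by (simp add: Bochner_Integration.integral_diff integrable_lborel_shift integral_lborel_shift)
  with test_fun_difference_quotient(1)[OF \<phi>, of h]
  have "(\<lambda>n. 0) \<longlonglongrightarrow> (\<integral>x. grad \<phi> x \<bullet> h \<partial>lborel)" by simp
  then show ?thesis using LIMSEQ_unique tendsto_const by blast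
qed

text \<open>The translation distance D is subadditive in the shift, so D(h) is at most n D(h/n), and
  n D(h/n) converges to the integral of the directional derivative. This avoids integrating along
  segments.\<close>

lemma test_fun_shift_L1:
  fixes \<phi> :: "'a::euclidean_space \<Rightarrow> real"
  assumes \<phi>: "\<phi> \<in> test_fun \<Omega>"
  shows "(\<integral>x. \<bar>\<phi> (h + x) - \<phi> x\<bar> \<partial>lborel) \<le> norm h * (\<integral>x. norm (grad \<phi> x) \<partial>lborel)"
proof -
  note int = test_fun_integrable[OF \<phi>] and [measurable] = test_fun_measurable[OF \<phi>]
  define D where "D = (\<lambda>h. \<integral>x. \<bar>\<phi> (h + x) - \<phi> x\<bar> \<partial>lborel)"
  have D_int: "integrable lborel (\<lambda>x. \<bar>\<phi> (h + x) - \<phi> x\<bar>)" for h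
    using int by (intro integrable_abs Bochner_Integration.integrable_diff integrable_lborel_shift)
  have D_add: "D (g + h) \<le> D g + D h" for g h
  proof -
    have D_int': "integrable lborel (\<lambda>x. \<bar>\<phi> (g + (h + x)) - \<phi> (h + x)\<bar>)"
      using integrable_lborel_shift[OF D_int[of g], of h] .
    have "D (g + h) \<le> (\<integral>x. \<bar>\<phi> (g + (h + x)) - \<phi> (h + x)\<bar> + \<bar>\<phi> (h + x) - \<phi> x\<bar> \<partial>lborel)"
      unfolding D_def
      using D_int[of "g + h"] D_int[of h] D_int'
      by (intro integral_mono Bochner_Integration.integrable_add) (auto simp: add.assoc)
    also have "\<dots> = (\<integral>x. \<bar>\<phi> (g + (h + x)) - \<phi> (h + x)\<bar> \<partial>lborel) + D h"
      unfolding D_def using D_int[of h] D_int' by (intro Bochner_Integration.integral_add) auto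
    also have "(\<integral>x. \<bar>\<phi> (g + (h + x)) - \<phi> (h + x)\<bar> \<partial>lborel) = D g"
      unfolding D_def by (rule integral_lborel_shift[of "\<lambda>x. \<bar>\<phi> (g + x) - \<phi> x\<bar>"]) measurable
    finally show ?thesis .
  qed
  have "D (real n *\<^sub>R g) \<le> real n * D g" for n g
  proof (induction n)
    case 0 then show ?case by (simp add: D_def)
  next
    case (Suc n)
    have "D (real (Suc n) *\<^sub>R g) = D (g + real n *\<^sub>R g)" by (simp add: algebra_simps)
    then show ?case using D_add[of g "real n *\<^sub>R g"] Suc by (simp add: algebra_simps)
  qed
  from this[of "Suc n" "(1 / real (Suc n)) *\<^sub>R h" for n]
  have "D h \<le> real (Suc n) * D ((1 / real (Suc n)) *\<^sub>R h)" for n by simp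
  also have "real (Suc n) * D ((1 / real (Suc n)) *\<^sub>R h)
      = (\<integral>x. \<bar>real (Suc n) * (\<phi> ((1 / real (Suc n)) *\<^sub>R h + x) - \<phi> x)\<bar> \<partial>lborel)" for n
    unfolding D_def abs_mult by simp
  finally have "D h \<le> (\<integral>x. \<bar>grad \<phi> x \<bullet> h\<bar> \<partial>lborel)"
    using test_fun_difference_quotient(2)[OF \<phi>, of h] by (intro LIMSEQ_le_const) auto
  also have "\<dots> \<le> (\<integral>x. norm h * norm (grad \<phi> x) \<partial>lborel)"
    using int by (intro integral_mono integrable_abs integrable_inner_left integrable_mult_right integrable_norm)
       (auto simp: mult.commute[of "norm h"] Cauchy_Schwarz_ineq2)
  finally show ?thesis by (simp add: D_def)
qed

subsection \<open>Mollification\<close>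

definition bump :: "'a::euclidean_space \<Rightarrow> real" where
  "bump x = exp_recip 0 (1 - x \<bullet> x)"

lemma bump_smooth: "smooth_on UNIV bump"
  unfolding bump_def[abs_def] by (intro smooth_exp_recip smooth_diff smooth_const smooth_norm_sq)

lemma bump_pos: "norm x < 1 \<Longrightarrow> bump x > 0"
  unfolding bump_def by (intro exp_recip_pos) (simp add: dot_square_norm abs_square_less_1)

lemma bump_outside: "norm x \<ge> 1 \<Longrightarrow> bump x = 0"
  unfolding bump_def by (intro exp_recip_nonpos) (simp add: dot_square_norm one_le_power)

lemma bump_bounds: "0 \<le> bump x" "bump x \<le> 1"
  by (simp_all add: bump_def exp_recip_nonneg exp_recip_le_one)

lemma bump_test_fun: "bump \<in> test_fun UNIV"
  by (rule test_funI[of _ "cball 0 1"]) (auto intro: bump_smooth bump_outside)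

text \<open>A vanishing integral would make the open unit ball a null set.\<close>

lemma bump_integral_pos: "integral\<^sup>L lborel (bump :: 'a::euclidean_space \<Rightarrow> real) > 0"
proof -
  have int: "integrable lborel (bump :: 'a \<Rightarrow> real)"
    by (rule test_fun_integrable[OF bump_test_fun])
  have "integral\<^sup>L lborel (bump :: 'a \<Rightarrow> real) \<noteq> 0"
  proof
    assume "integral\<^sup>L lborel (bump :: 'a \<Rightarrow> real) = 0"
    then have "AE x::'a in lborel. bump x = 0"
      using int bump_bounds by (subst (asm) integral_nonneg_eq_0_iff_AE) auto
    then have "AE x in lborel. x \<notin> ball (0::'a) 1"
      by eventually_elim (use bump_pos in force)
    then have "ball (0::'a) 1 \<in> null_sets lborel"
      by (subst (asm) AE_iff_null_sets[symmetric]) auto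
    then have "negligible (ball (0::'a) 1)"
      using negligible_iff_null_sets null_sets_completionI by blast
    then show False using open_not_negligible[of "ball (0::'a) 1"] by auto
  qed
  moreover have "integral\<^sup>L lborel (bump :: 'a \<Rightarrow> real) \<ge> 0" by (intro integral_nonneg_AE) (auto simp: bump_bounds)
  ultimately show ?thesis by linarith
qed

text \<open>The factor normalises the integral to 1. The leading \<open>0 +\<close> is the affine
  shape that \<open>smooth_affine\<close> and \<open>lborel_affine\<close> expect.\<close>

definition moll :: "nat \<Rightarrow> 'a::euclidean_space \<Rightarrow> real" where
  "moll n x = real (Suc n) ^ DIM('a) / integral\<^sup>L lborel (bump :: 'a \<Rightarrow> real) * bump (0 + real (Suc n) *\<^sub>R x)"

lemma moll_nonneg: "moll n x \<ge> 0"
  unfolding moll_def using less_imp_le[OF bump_integral_pos]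
  by (intro mult_nonneg_nonneg divide_nonneg_nonneg bump_bounds) auto

lemma moll_outside:
  assumes "norm x \<ge> 1 / real (Suc n)"
  shows "moll n x = 0"
proof -
  have "real (Suc n) * norm x \<ge> 1" using assms by (simp add: field_simps)
  then show ?thesis unfolding moll_def by (simp add: bump_outside)
qed

lemma moll_test_fun: "moll n \<in> test_fun UNIV"
proof (rule test_funI[of _ "cball 0 (1 / real (Suc n))"])
  show "smooth_on UNIV (moll n)"
    unfolding moll_def[abs_def] by (intro smooth_cmult smooth_affine bump_smooth)
  show "moll n x = 0" if "x \<notin> cball 0 (1 / real (Suc n))" for x
    using that by (intro moll_outside) (simp del: of_nat_Suc)
qed auto

lemma moll_integral: "integral\<^sup>L lborel (moll n :: 'a::euclidean_space \<Rightarrow> real) = 1"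
proof -
  have "integral\<^sup>L lborel (bump :: 'a \<Rightarrow> real) = (\<integral>x. real (Suc n) ^ DIM('a) * bump (0 + real (Suc n) *\<^sub>R (x::'a)) \<partial>lborel)"
  proof -
    have [measurable]: "(bump :: 'a \<Rightarrow> real) \<in> borel_measurable borel"
      using test_fun_measurable[OF bump_test_fun] by simp
    have "integral\<^sup>L lborel (bump :: 'a \<Rightarrow> real) = integral\<^sup>L
       (density (distr lborel borel (\<lambda>x. 0 + real (Suc n) *\<^sub>R x)) (\<lambda>_. ennreal (\<bar>real (Suc n)\<bar> ^ DIM('a)))) (bump :: 'a \<Rightarrow> real)"
      by (subst lborel_affine[of "real (Suc n)" 0]) auto
    also have "\<dots> = (\<integral>x. real (Suc n) ^ DIM('a) * bump x \<partial>distr lborel borel (\<lambda>x::'a. 0 + real (Suc n) *\<^sub>R x))"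
      by (subst integral_density) auto
    also have "\<dots> = (\<integral>x. real (Suc n) ^ DIM('a) * bump (0 + real (Suc n) *\<^sub>R (x::'a)) \<partial>lborel)"
      by (subst integral_distr) auto
    finally show ?thesis .
  qed
  moreover have "integral\<^sup>L lborel (moll n :: 'a \<Rightarrow> real) =
     (\<integral>x. real (Suc n) ^ DIM('a) * bump (0 + real (Suc n) *\<^sub>R (x::'a)) \<partial>lborel) / integral\<^sup>L lborel (bump :: 'a \<Rightarrow> real)"
    unfolding moll_def[abs_def] times_divide_eq_left by (rule integral_divide_zero)
  ultimately show ?thesis
    using bump_integral_pos[where 'a='a] by (metis divide_self_if less_irrefl)
qed

definition conv :: "('a::euclidean_space \<Rightarrow> real) \<Rightarrow> ('a \<Rightarrow> real) \<Rightarrow> 'a \<Rightarrow> real" where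
  "conv \<eta> v x = (\<integral>y. \<eta> (x - y) * v y \<partial>lborel)"

lemma conv_integrable:
  assumes "\<eta> \<in> test_fun UNIV" "integrable lborel v"
  shows "integrable lborel (\<lambda>y. \<eta> (x - y) * v y)"
proof -
  obtain B where B: "\<And>x. \<bar>\<eta> x\<bar> \<le> B" using test_fun_bounded[OF assms(1)] by metis
  note [measurable] = test_fun_measurable[OF assms(1)]
  have [measurable]: "v \<in> borel_measurable borel" using assms(2) by auto
  show ?thesis
  proof (rule Bochner_Integration.integrable_bound)
    show "integrable lborel (\<lambda>y. B * v y)" using assms(2) by simp
    have "\<bar>\<eta> (x - y) * v y\<bar> \<le> \<bar>B * v y\<bar>" for y
      unfolding abs_mult using order_trans[OF B abs_ge_self] by (intro mult_right_mono) auto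
    then show "AE y in lborel. norm (\<eta> (x - y) * v y) \<le> norm (B * v y)" by simp
  qed measurable
qed

text \<open>The partial derivatives of a test function are Lipschitz, so the Taylor remainder is
  uniformly quadratic and no limit has to be taken under the integral.\<close>

lemma test_fun_taylor:
  assumes "\<eta> \<in> test_fun UNIV"
  obtains C where "C \<ge> 0" "\<And>z h. \<bar>\<eta> (z + h) - \<eta> z - grad \<eta> z \<bullet> h\<bar> \<le> C * (norm h)\<^sup>2"
proof -
  have "\<exists>B. \<forall>x y. \<bar>partial \<eta> b x - partial \<eta> b y\<bar> \<le> B * norm (x - y)" if "b \<in> Basis" for b
    using test_fun_bounded[OF test_fun_partial[OF assms that]]
      test_fun_lipschitz[OF test_fun_partial[OF assms that]] by metis
  then obtain B where B: "\<And>b x y. b \<in> Basis \<Longrightarrow> \<bar>partial \<eta> b x - partial \<eta> b y\<bar> \<le> B b * norm (x - y)"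
    by metis
  define C where "C = (\<Sum>b\<in>Basis. \<bar>B b\<bar>)"
  have lip: "norm (grad \<eta> x - grad \<eta> y) \<le> C * norm (x - y)" for x y
  proof -
    have "norm (grad \<eta> x - grad \<eta> y) \<le> (\<Sum>b\<in>Basis. \<bar>(grad \<eta> x - grad \<eta> y) \<bullet> b\<bar>)"
      by (rule norm_le_l1)
    also have "\<dots> \<le> (\<Sum>b\<in>Basis. \<bar>B b\<bar> * norm (x - y))"
    proof (rule sum_mono)
      fix b :: 'a assume b: "b \<in> Basis"
      have "\<bar>(grad \<eta> x - grad \<eta> y) \<bullet> b\<bar> \<le> B b * norm (x - y)"
        using B[OF b, of x y] b by (simp add: inner_diff_left)
      also have "\<dots> \<le> \<bar>B b\<bar> * norm (x - y)" by (intro mult_right_mono) auto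
      finally show "\<bar>(grad \<eta> x - grad \<eta> y) \<bullet> b\<bar> \<le> \<bar>B b\<bar> * norm (x - y)" .
    qed
    finally show ?thesis by (simp add: C_def sum_distrib_right)
  qed
  have C: "C \<ge> 0" unfolding C_def by (intro sum_nonneg) auto
  have "\<bar>\<eta> (z + h) - \<eta> z - grad \<eta> z \<bullet> h\<bar> \<le> C * (norm h)\<^sup>2" for z h
  proof -
    \<comment> \<open>After subtraction of the linear part at z, the gradient on the ball of radius
      |h| is at most C |h|, so the mean value inequality gives a quadratic bound.\<close>
    have "norm ((\<lambda>w. \<eta> w - grad \<eta> z \<bullet> w) (z + h) - (\<lambda>w. \<eta> w - grad \<eta> z \<bullet> w) z) \<le> (C * norm h) * norm (z + h - z)"
    proof (rule differentiable_bound[OF convex_cball])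
      fix w assume w: "w \<in> cball z (norm h)"
      show "((\<lambda>w. \<eta> w - grad \<eta> z \<bullet> w) has_derivative (\<lambda>u. grad \<eta> w \<bullet> u - grad \<eta> z \<bullet> u)) (at w within cball z (norm h))"
        by (intro has_derivative_diff has_derivative_at_withinI[OF has_derivative_grad] test_fun_differentiable[OF assms])
           (auto intro!: derivative_eq_intros)
      have le: "norm (grad \<eta> w - grad \<eta> z) \<le> C * norm h"
        using lip[of w z] w C mult_left_mono[of "norm (w - z)" "norm h" C]
        by (simp add: dist_norm norm_minus_commute)
      show "onorm (\<lambda>u. grad \<eta> w \<bullet> u - grad \<eta> z \<bullet> u) \<le> C * norm h"
      proof (rule onorm_le)
        fix y
        have "norm (grad \<eta> w \<bullet> y - grad \<eta> z \<bullet> y) \<le> norm (grad \<eta> w - grad \<eta> z) * norm y"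
          using Cauchy_Schwarz_ineq2[of "grad \<eta> w - grad \<eta> z" y] by (simp add: inner_diff_left)
        also have "\<dots> \<le> C * norm h * norm y" using le by (intro mult_right_mono) auto
        finally show "norm (grad \<eta> w \<bullet> y - grad \<eta> z \<bullet> y) \<le> C * norm h * norm y" .
      qed
    qed (auto simp: dist_norm)
    then show ?thesis by (simp add: inner_add_right power2_eq_square algebra_simps)
  qed
  with C that show ?thesis by blast
qed

lemma conv_has_derivative:
  assumes \<eta>: "\<eta> \<in> test_fun UNIV" and v: "integrable lborel v"
  shows "(conv \<eta> v has_derivative (\<lambda>h. \<Sum>b\<in>Basis. (h \<bullet> b) * conv (partial \<eta> b) v x)) (at x)"
proof -
  obtain C where C: "C \<ge> 0" "\<And>z h. \<bar>\<eta> (z + h) - \<eta> z - grad \<eta> z \<bullet> h\<bar> \<le> C * (norm h)\<^sup>2"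
    using test_fun_taylor[OF \<eta>] by metis
  define D where "D = (\<lambda>h. \<Sum>b\<in>Basis. (h \<bullet> b) * conv (partial \<eta> b) v x)"
  define I where "I = (\<integral>y. \<bar>v y\<bar> \<partial>lborel)"
  note int = conv_integrable[OF \<eta> v] conv_integrable[OF test_fun_partial[OF \<eta>] v]
  have D: "D h = (\<integral>y. (grad \<eta> (x - y) \<bullet> h) * v y \<partial>lborel)"
    and Di: "integrable lborel (\<lambda>y. (grad \<eta> (x - y) \<bullet> h) * v y)" for h
  proof -
    have eq: "(grad \<eta> (x - y) \<bullet> h) * v y = (\<Sum>b\<in>Basis. (h \<bullet> b) * (partial \<eta> b (x - y) * v y))" for y
      unfolding euclidean_inner[of "grad \<eta> (x - y)" h] sum_distrib_right
      by (intro sum.cong) (auto simp: mult_ac)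
    show "integrable lborel (\<lambda>y. (grad \<eta> (x - y) \<bullet> h) * v y)"
      unfolding eq by (intro Bochner_Integration.integrable_sum integrable_mult_right int(2))
    show "D h = (\<integral>y. (grad \<eta> (x - y) \<bullet> h) * v y \<partial>lborel)"
      unfolding eq D_def conv_def
      by (subst Bochner_Integration.integral_sum)
         (auto intro!: integrable_mult_right int(2))
  qed
  have est: "norm (conv \<eta> v (x + h) - conv \<eta> v x - D h) \<le> C * (norm h)\<^sup>2 * I" for h
  proof -
    have "conv \<eta> v (x + h) - conv \<eta> v x - D h =
        (\<integral>y. (\<eta> (x + h - y) * v y - \<eta> (x - y) * v y) - (grad \<eta> (x - y) \<bullet> h) * v y \<partial>lborel)"
      unfolding conv_def D using int(1) Di by (simp add: Bochner_Integration.integral_diff)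
    also have "norm \<dots> \<le> (\<integral>y. C * (norm h)\<^sup>2 * \<bar>v y\<bar> \<partial>lborel)"
    proof (rule order_trans[OF Bochner_Integration.integral_norm_bound integral_mono])
      show "integrable lborel (\<lambda>y. norm (\<eta> (x + h - y) * v y - \<eta> (x - y) * v y - (grad \<eta> (x - y) \<bullet> h) * v y))"
        using int(1) Di by (intro integrable_norm Bochner_Integration.integrable_diff)
      show "integrable lborel (\<lambda>y. C * (norm h)\<^sup>2 * \<bar>v y\<bar>)" using v by simp
      fix y
      have "norm (\<eta> (x + h - y) * v y - \<eta> (x - y) * v y - (grad \<eta> (x - y) \<bullet> h) * v y)
         = \<bar>\<eta> ((x - y) + h) - \<eta> (x - y) - grad \<eta> (x - y) \<bullet> h\<bar> * \<bar>v y\<bar>"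
        by (simp add: abs_mult[symmetric] algebra_simps)
      also have "\<dots> \<le> C * (norm h)\<^sup>2 * \<bar>v y\<bar>" by (intro mult_right_mono C(2)) auto
      finally show "norm (\<eta> (x + h - y) * v y - \<eta> (x - y) * v y - (grad \<eta> (x - y) \<bullet> h) * v y) \<le> C * (norm h)\<^sup>2 * \<bar>v y\<bar>" .
    qed
    finally show ?thesis by (simp add: I_def)
  qed
  have "(conv \<eta> v has_derivative D) (at x)"
    unfolding has_derivative_at
  proof
    show "bounded_linear D" unfolding D_def
      by (intro bounded_linear_sum bounded_linear_mult_const bounded_linear_inner_left)
    show "(\<lambda>h. norm (conv \<eta> v (x + h) - conv \<eta> v x - D h) / norm h) \<midarrow>0\<rightarrow> 0"
    proof (rule tendsto_sandwich)
      show "\<forall>\<^sub>F h in at 0. 0 \<le> norm (conv \<eta> v (x + h) - conv \<eta> v x - D h) / norm h" by simp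
      show "\<forall>\<^sub>F h in at 0. norm (conv \<eta> v (x + h) - conv \<eta> v x - D h) / norm h \<le> C * norm h * I"
        unfolding eventually_at
        by (intro exI[of _ 1])
           (use est in \<open>auto simp: divide_le_eq power2_eq_square algebra_simps\<close>)
      have "((\<lambda>h::'a. C * norm h * I) \<longlongrightarrow> C * norm (0::'a) * I) (at 0)"
        by (intro tendsto_intros)
      then show "((\<lambda>h::'a. C * norm h * I) \<longlongrightarrow> 0) (at 0)" by simp
    qed simp
  qed
  then show ?thesis by (simp add: D_def)
qed

lemma partial_conv:
  assumes "\<eta> \<in> test_fun UNIV" "integrable lborel v" "b \<in> Basis"
  shows "partial (conv \<eta> v) b x = conv (partial \<eta> b) v x"
  unfolding partial_def[of "conv \<eta> v"] frechet_derivative_eqI[OF conv_has_derivative[OF assms(1,2)]]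
proof -
  have "(\<Sum>c\<in>Basis. (b \<bullet> c) * conv (partial \<eta> c) v x) = (\<Sum>c\<in>Basis. if c = b then conv (partial \<eta> b) v x else 0)"
    using assms(3) by (intro sum.cong) (auto simp: inner_Basis)
  then show "(\<Sum>c\<in>Basis. (b \<bullet> c) * conv (partial \<eta> c) v x) = conv (partial \<eta> b) v x"
    using assms(3) by simp
qed

lemma conv_smooth:
  assumes "\<eta> \<in> test_fun UNIV" "integrable lborel v"
  shows "smooth_on UNIV (conv \<eta> v)"
  unfolding smooth_on_def
\<comment> \<open>Derivatives fall on the kernel, and partial derivatives of test functions are test
  functions; hence all convolutions of the fixed \<open>v\<close> form a witness set.\<close>
proof (intro exI[of _ "{conv \<eta> v | \<eta>. \<eta> \<in> test_fun UNIV}"] conjI ballI)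
  show "conv \<eta> v \<in> {conv \<eta> v |\<eta>. \<eta> \<in> test_fun UNIV}" using assms by blast
  fix g assume "g \<in> {conv \<eta> v |\<eta>. \<eta> \<in> test_fun UNIV}"
  then obtain \<eta> where g: "g = conv \<eta> v" "\<eta> \<in> test_fun UNIV" by blast
  { fix x show "g differentiable (at x)"
      using conv_has_derivative[OF g(2) assms(2)] g(1) differentiableI by blast }
  fix b :: 'a assume b: "b \<in> Basis"
  have "(\<lambda>x. frechet_derivative g (at x) b) = conv (partial \<eta> b) v"
    using partial_conv[OF g(2) assms(2) b] g(1) by (auto simp: partial_def)
  then show "(\<lambda>x. frechet_derivative g (at x) b) \<in> {conv \<eta> v |\<eta>. \<eta> \<in> test_fun UNIV}"
    using test_fun_partial[OF g(2) b] by blast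
qed

lemma conv_moll_support:
  assumes "\<And>y. y \<notin> K \<Longrightarrow> v y = 0" "x \<notin> (\<Union>y\<in>K. cball y (1 / real (Suc n)))"
  shows "conv (moll n) v x = 0"
proof -
  have "moll n (x - y) * v y = 0" for y
  proof (cases "y \<in> K")
    case True
    then have "1 / real (Suc n) \<le> norm (x - y)"
      using assms(2) by (auto simp: dist_norm norm_minus_commute simp del: of_nat_Suc)
    then show ?thesis by (simp add: moll_outside del: of_nat_Suc)
  qed (use assms in simp)
  then show ?thesis unfolding conv_def by (simp only: integral_zero)
qed

lemma compact_UN_cball: 
  fixes K :: "'a::euclidean_space set"
  assumes "compact K" shows "compact (\<Union>y\<in>K. cball y e)"
proof -
  have "(\<Union>y\<in>K. cball y e) = (\<Union>x\<in>K. \<Union>y\<in>cball 0 e. {x + y})"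
  proof (intro equalityI subsetI)
    fix z assume "z \<in> (\<Union>y\<in>K. cball y e)"
    then obtain y where "y \<in> K" "norm (z - y) \<le> e" by (auto simp: dist_norm norm_minus_commute)
    then show "z \<in> (\<Union>x\<in>K. \<Union>y\<in>cball 0 e. {x + y})"
      by (intro UN_I[of y] UN_I[of "z - y"]) auto
  qed (force simp: dist_norm)
  then show ?thesis using compact_sums'[OF assms compact_cball[of 0 e]] by simp
qed

lemma conv_moll_test_fun:
  assumes "integrable lborel v" "compact K" "\<And>y. y \<notin> K \<Longrightarrow> v y = 0"
    "(\<Union>y\<in>K. cball y (1 / real (Suc n))) \<subseteq> \<Omega>"
  shows "conv (moll n) v \<in> test_fun \<Omega>"
  by (rule test_funI[OF conv_smooth[OF moll_test_fun assms(1)] compact_UN_cball[OF assms(2)] assms(4)])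
     (rule conv_moll_support[OF assms(3)])

lemma compact_margin:
  fixes K :: "'a::euclidean_space set"
  assumes "compact K" "open \<Omega>" "K \<subseteq> \<Omega>"
  obtains d where "d > 0" "(\<Union>y\<in>K. cball y d) \<subseteq> \<Omega>"
proof -
  obtain e where e: "e > 0" "(\<Union>x\<in>K. ball x e) \<subseteq> \<Omega>"
    using compact_subset_open_imp_ball_epsilon_subset[OF assms] by blast
  have "(\<Union>y\<in>K. cball y (e/2)) \<subseteq> (\<Union>x\<in>K. ball x e)" using e by force
  with e that[of "e/2"] show ?thesis by auto
qed

text \<open>Mollifying the indicator of the closed \<delta>-neighbourhood of K at scale \<delta>
  leaves the value 1 on K and spreads the support by at most 2\<delta>, which is less than the
  distance d kept from the complement.\<close>

lemma test_fun_cutoff: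
  fixes K :: "'a::euclidean_space set"
  assumes "compact K" "open \<Omega>" "K \<subseteq> \<Omega>"
  obtains \<zeta> where "\<zeta> \<in> test_fun \<Omega>" "\<And>x. \<zeta> x \<ge> 0" "\<And>x. x \<in> K \<Longrightarrow> \<zeta> x = 1"
proof -
  obtain d where d: "d > 0" "(\<Union>y\<in>K. cball y d) \<subseteq> \<Omega>" using compact_margin[OF assms] by blast
  obtain n where n: "1 / real (Suc n) < d / 2"
    using nat_approx_posE[of "d/2"] d by auto
  define \<delta> where "\<delta> = 1 / real (Suc n)"
  define L where "L = (\<Union>y\<in>K. cball y \<delta>)"
  have L: "compact L" unfolding L_def by (rule compact_UN_cball[OF assms(1)])
  have int: "integrable lborel (indicator L :: 'a \<Rightarrow> real)"
    using borel_integrable_compact[OF L continuous_on_const, of "1::real"] by simp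
  have sub: "(\<Union>y\<in>L. cball y (1 / real (Suc n))) \<subseteq> \<Omega>"
  proof
    fix z assume "z \<in> (\<Union>y\<in>L. cball y (1 / real (Suc n)))"
    then obtain x y where "x \<in> K" "dist x y \<le> \<delta>" "dist y z \<le> \<delta>" by (auto simp: L_def \<delta>_def)
    then have "dist x z \<le> d" using dist_triangle[of x z y] n unfolding \<delta>_def by linarith
    then have "z \<in> (\<Union>y\<in>K. cball y d)" using \<open>x \<in> K\<close> by auto
    then show "z \<in> \<Omega>" using d(2) by blast
  qed
  show ?thesis
  proof (rule that[of "conv (moll n) (indicator L)"])
    show "conv (moll n) (indicator L) \<in> test_fun \<Omega>"
      by (rule conv_moll_test_fun[OF int L _ sub]) auto
    show "conv (moll n) (indicator L) x \<ge> 0" for x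
      unfolding conv_def by (intro integral_nonneg_AE) (auto simp: moll_nonneg)
    fix x assume x: "x \<in> K"
    have "moll n (x - y) * indicator L y = moll n (x - y)" for y
    proof (cases "y \<in> L")
      case False
      then have "1 / real (Suc n) \<le> norm (x - y)" using x by (auto simp: L_def \<delta>_def dist_norm simp del: of_nat_Suc)
      then show ?thesis by (simp add: moll_outside del: of_nat_Suc)
    qed simp
    then have "conv (moll n) (indicator L) x = (\<integral>y. moll n (x - y) \<partial>lborel)"
      unfolding conv_def by presburger
    then show "conv (moll n) (indicator L) x = 1"
      using integral_lborel_reflect[OF test_fun_measurable(1)[OF moll_test_fun], of n x] moll_integral[of n, where 'a='a]
      by simp
  qed
qed

text \<open>A is squeezed between a closed T and an open U with both differences of measure below
  e/2. A Urysohn function that is 1 on T and 0 off U can differ from the indicator only on these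
  differences.\<close>

lemma L1_approx_indicator:
  fixes A :: "'a::euclidean_space set"
  assumes A: "A \<in> sets borel" "A \<subseteq> ball 0 m" and e: "e > 0"
  obtains f :: "'a \<Rightarrow> real" where "continuous_on UNIV f" "\<And>x. x \<notin> cball 0 m \<Longrightarrow> f x = 0"
    "(\<integral>x. \<bar>f x - indicator A x\<bar> \<partial>lborel) < e"
proof -
  have AL: "A \<in> sets lebesgue" using A(1) by simp
  obtain T where T: "closed T" "T \<subseteq> A" "A - T \<in> lmeasurable" "emeasure lebesgue (A - T) < ennreal (e/2)"
    using sets_lebesgue_inner_closed[OF AL, of "e/2"] e by auto
  obtain U where U: "open U" "A \<subseteq> U" "U - A \<in> lmeasurable" "emeasure lebesgue (U - A) < ennreal (e/2)"
    using sets_lebesgue_outer_open[OF AL, of "e/2"] e by auto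
  \<comment> \<open>Intersecting with the ball gives the Urysohn function bounded support.\<close>
  define V where "V = U \<inter> ball 0 m"
  have V: "open V" "A \<subseteq> V" "V \<subseteq> U" using U A unfolding V_def by auto
  have "closed (- V)" "T \<inter> - V = {}" using V T by auto
  then obtain f :: "'a \<Rightarrow> real" where f: "continuous_on UNIV f" "\<And>x. f x \<in> closed_segment 1 0"
     "\<And>x. x \<in> T \<Longrightarrow> f x = 1" "\<And>x. x \<in> - V \<Longrightarrow> f x = 0"
    using Urysohn[OF T(1), of "- V" 1 0] by metis
  have f01: "0 \<le> f x" "f x \<le> 1" for x using f(2)[of x] by (auto simp: closed_segment_eq_real_ivl)
  have supp: "f x = 0" if "x \<notin> cball 0 m" for x using f(4)[of x] that unfolding V_def by auto
  have [measurable]: "f \<in> borel_measurable borel" using f(1) by (rule borel_measurable_continuous_onI)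
  have [measurable]: "A \<in> sets borel" "T \<in> sets borel" "U \<in> sets borel" using A T U by auto
  have "(\<integral>\<^sup>+x. ennreal \<bar>f x - indicator A x\<bar> \<partial>lborel) \<le> (\<integral>\<^sup>+x. indicator (A - T) x + indicator (U - A) x \<partial>lborel)"
  proof (rule nn_integral_mono)
    fix x
    have "\<bar>f x - indicator A x\<bar> \<le> 1" using f01[of x] by (auto simp: indicator_def)
    moreover have "f x = indicator A x" if "x \<notin> A - T" "x \<notin> U - A"
      using that f(3,4)[of x] V T by (cases "x \<in> A") auto
    ultimately show "ennreal \<bar>f x - indicator A x\<bar> \<le> indicator (A - T) x + indicator (U - A) x"
      by (cases "x \<in> A - T"; cases "x \<in> U - A") auto
  qed
  also have "\<dots> = emeasure lborel (A - T) + emeasure lborel (U - A)"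
    by (subst nn_integral_add) auto
  also have "\<dots> < ennreal (e/2) + ennreal (e/2)"
    using T(4) U(4) by (intro add_strict_mono) auto
  also have "\<dots> = ennreal e" using e by (simp flip: ennreal_plus)
  finally have lt: "(\<integral>\<^sup>+x. ennreal \<bar>f x - indicator A x\<bar> \<partial>lborel) < ennreal e" .
  have "(\<integral>x. \<bar>f x - indicator A x\<bar> \<partial>lborel) = enn2real (\<integral>\<^sup>+x. ennreal \<bar>f x - indicator A x\<bar> \<partial>lborel)"
    by (rule integral_eq_nn_integral) auto
  also have "\<dots> < e" using lt e by (cases "\<integral>\<^sup>+x. ennreal \<bar>f x - indicator A x\<bar> \<partial>lborel") (auto simp: ennreal_less_iff)
  finally show ?thesis using that f(1) supp by blast
qed

definition L1_shift_continuous :: "('a::euclidean_space \<Rightarrow> real) \<Rightarrow> bool" where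
  "L1_shift_continuous F \<longleftrightarrow> (\<forall>e>0. \<exists>d>0. \<forall>z. norm z < d \<longrightarrow> (\<integral>x. \<bar>F (z + x) - F x\<bar> \<partial>lborel) < e)"

text \<open>The e/3 argument: a translation is an isometry of \<open>L\<^sup>1\<close>, so the
  approximation error enters twice.\<close>

lemma L1_shift_continuous_approx:
  assumes F: "integrable lborel F"
    and ap: "\<And>e. e > 0 \<Longrightarrow> \<exists>G. integrable lborel G \<and> L1_shift_continuous G \<and> (\<integral>x. \<bar>G x - F x\<bar> \<partial>lborel) < e"
  shows "L1_shift_continuous F"
  unfolding L1_shift_continuous_def
proof (intro allI impI)
  fix e :: real assume "e > 0"
  then obtain G where G: "integrable lborel G" "L1_shift_continuous G" "(\<integral>x. \<bar>G x - F x\<bar> \<partial>lborel) < e / 3"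
    using ap[of "e/3"] by auto
  obtain d where d: "d > 0" "\<And>z. norm z < d \<Longrightarrow> (\<integral>x. \<bar>G (z + x) - G x\<bar> \<partial>lborel) < e / 3"
    using G(2)[unfolded L1_shift_continuous_def, rule_format, of "e/3"] \<open>e > 0\<close> by auto
  have "(\<integral>x. \<bar>F (z + x) - F x\<bar> \<partial>lborel) < e" if z: "norm z < d" for z
  proof -
    note int = F G(1) integrable_lborel_shift[OF F, of z] integrable_lborel_shift[OF G(1), of z]
    have [measurable]: "F \<in> borel_measurable borel" "G \<in> borel_measurable borel"
      using int(1,2) by auto
    have "(\<integral>x. \<bar>F (z + x) - F x\<bar> \<partial>lborel) \<le>
       (\<integral>x. (\<bar>G (z + x) - F (z + x)\<bar> + \<bar>G (z + x) - G x\<bar>) + \<bar>G x - F x\<bar> \<partial>lborel)"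
      using int by (intro integral_mono) auto
    also have "\<dots> = (\<integral>x. \<bar>G (z + x) - F (z + x)\<bar> \<partial>lborel) + (\<integral>x. \<bar>G (z + x) - G x\<bar> \<partial>lborel) + (\<integral>x. \<bar>G x - F x\<bar> \<partial>lborel)"
      using int by (simp add: Bochner_Integration.integral_add)
    also have "(\<integral>x. \<bar>G (z + x) - F (z + x)\<bar> \<partial>lborel) = (\<integral>x. \<bar>G x - F x\<bar> \<partial>lborel)"
      by (rule integral_lborel_shift[of "\<lambda>x. \<bar>G x - F x\<bar>"]) measurable
    finally show ?thesis using G(3) d(2)[OF z] by linarith
  qed
  with d(1) show "\<exists>d>0. \<forall>z. norm z < d \<longrightarrow> (\<integral>x. \<bar>F (z + x) - F x\<bar> \<partial>lborel) < e" by blast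
qed

lemma L1_shift_continuous_compact_support:
  fixes f :: "'a::euclidean_space \<Rightarrow> real"
  assumes f: "continuous_on UNIV f" "\<And>x. x \<notin> cball 0 m \<Longrightarrow> f x = 0"
  shows "L1_shift_continuous f"
  unfolding L1_shift_continuous_def
proof (intro allI impI)
  fix e :: real assume e: "e > 0"
  \<comment> \<open>For |z| < 1 the difference vanishes off the ball of radius m + 1, and both
    arguments stay in radius m + 2. The bound e / (V + 1) integrates to less than e, and its divisor
    is positive.\<close>
  define V where "V = measure lborel (cball (0::'a) (m + 1))"
  have V: "V \<ge> 0" by (simp add: V_def)
  have "uniformly_continuous_on (cball 0 (m + 2)) f"
    using f(1) by (intro compact_uniformly_continuous continuous_on_subset[OF f(1)]) auto
  moreover have e': "e / (V + 1) > 0" using e V by auto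
  ultimately obtain d where d: "d > 0" "\<And>x y. x \<in> cball 0 (m + 2) \<Longrightarrow> y \<in> cball 0 (m + 2) \<Longrightarrow> dist y x < d \<Longrightarrow> dist (f y) (f x) < e / (V + 1)"
    unfolding uniformly_continuous_on_def by metis
  have "(\<integral>x. \<bar>f (z + x) - f x\<bar> \<partial>lborel) < e" if z: "norm z < min d 1" for z
  proof -
    have le: "\<bar>f (z + x) - f x\<bar> \<le> indicator (cball 0 (m + 1)) x * (e / (V + 1))" for x
    proof (cases "x \<in> cball 0 (m + 1)")
      case True
      then have "x \<in> cball 0 (m + 2)" "z + x \<in> cball 0 (m + 2)"
        using z norm_triangle_ineq[of z x] by auto
      then have "dist (f (z + x)) (f x) < e / (V + 1)"
        using z by (intro d(2)) (auto simp: dist_norm)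
      then show ?thesis using True by (simp add: dist_real_def)
    next
      case False
      have "norm x \<le> norm (z + x) + norm z" using norm_triangle_ineq4[of "z + x" z] by simp
      then have "z + x \<notin> cball 0 m" "x \<notin> cball 0 m" using False z by auto
      then show ?thesis using f(2) e V by simp
    qed
    have intf: "integrable lborel f"
      by (rule integrable_continuous_compact_support[OF compact_cball f])
    have "(\<integral>x. \<bar>f (z + x) - f x\<bar> \<partial>lborel) \<le> (\<integral>x. indicator (cball (0::'a) (m + 1)) x * (e / (V + 1)) \<partial>lborel)"
      using le intf integrable_lborel_shift[OF intf, of z] emeasure_lborel_cball_finite[of "0::'a" "m + 1"]
      by (intro integral_mono integrable_mult_left integrable_real_indicator) auto
    also have "\<dots> = V * (e / (V + 1))" unfolding V_def by simp
    also have "\<dots> < e" using e V by (simp add: field_simps)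
    finally show ?thesis .
  qed
  with d(1) show "\<exists>d>0. \<forall>z. norm z < d \<longrightarrow> (\<integral>x. \<bar>f (z + x) - f x\<bar> \<partial>lborel) < e"
    by (intro exI[of _ "min d 1"]) auto
qed

lemma integrable_imp_L1_shift_continuous:
  fixes F :: "'a::euclidean_space \<Rightarrow> real"
  assumes "integrable lborel F"
  shows "L1_shift_continuous F"
  using assms
proof (induction rule: integrable_induct)
  case (base A c)
  \<comment> \<open>Bounded sets come first, because \<open>L1_approx_indicator\<close> approximates
    inside a ball.\<close>
  have bounded: "L1_shift_continuous (\<lambda>x. indicator B x * c)" if B: "B \<in> sets borel" "B \<subseteq> ball 0 m" for B :: "'a set" and m
  proof (rule L1_shift_continuous_approx)
    have fin: "emeasure lborel B < \<infinity>"
      using emeasure_mono[OF B(2), of lborel] emeasure_lborel_ball_finite[of 0 m] by (auto intro: le_less_trans)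
    then show int: "integrable lborel (\<lambda>x. indicator B x * c)"
      using B by (intro integrable_mult_left integrable_real_indicator) auto
    fix e :: real assume e: "e > 0"
    have "e / (\<bar>c\<bar> + 1) > 0" using e by (simp add: divide_pos_pos add_nonneg_pos)
    then obtain f where f: "continuous_on UNIV f" "\<And>x. x \<notin> cball 0 m \<Longrightarrow> f x = 0"
        "(\<integral>x. \<bar>f x - indicator B x\<bar> \<partial>lborel) < e / (\<bar>c\<bar> + 1)"
      using L1_approx_indicator[OF B] by metis
    have fc: "continuous_on UNIV (\<lambda>x. f x * c)" "\<And>x. x \<notin> cball 0 m \<Longrightarrow> f x * c = 0"
      using f by (auto intro!: continuous_intros)
    have "(\<integral>x. \<bar>f x * c - indicator B x * c\<bar> \<partial>lborel) = (\<integral>x. \<bar>f x - indicator B x\<bar> * \<bar>c\<bar> \<partial>lborel)"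
      by (simp add: left_diff_distrib[symmetric] abs_mult)
    also have "\<dots> = (\<integral>x. \<bar>f x - indicator B x\<bar> \<partial>lborel) * \<bar>c\<bar>" by (rule integral_mult_left_zero)
    also have "\<dots> \<le> e / (\<bar>c\<bar> + 1) * \<bar>c\<bar>" using f(3) by (intro mult_right_mono) auto
    also have "\<dots> < e" using e by (simp add: field_simps add_pos_nonneg)
    finally show "\<exists>G. integrable lborel G \<and> L1_shift_continuous G \<and> (\<integral>x. \<bar>G x - indicator B x * c\<bar> \<partial>lborel) < e"
      using L1_shift_continuous_compact_support[OF fc]
        integrable_continuous_compact_support[OF compact_cball fc] by blast
  qed
  have intA: "integrable lborel (\<lambda>x. indicator A x * c)"
    using base by (intro integrable_mult_left integrable_real_indicator) auto
  have [measurable]: "A \<in> sets borel" using base by simp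
  have "L1_shift_continuous (\<lambda>x. indicator A x * c)"
  proof (rule L1_shift_continuous_approx[OF intA])
    fix e :: real assume e: "e > 0"
    \<comment> \<open>A set of finite measure is exhausted by its intersections with balls, in
      \<open>L\<^sup>1\<close> by dominated convergence.\<close>
    define G where "G = (\<lambda>m x. indicator (A \<inter> ball 0 (real m)) x * c)"
    have Gi: "integrable lborel (G m)" for m
      unfolding G_def by (rule Bochner_Integration.integrable_bound[OF intA]) (auto simp: indicator_def)
    have "(\<lambda>m. \<integral>x. \<bar>G m x - indicator A x * c\<bar> \<partial>lborel) \<longlonglongrightarrow> (\<integral>x. 0 \<partial>(lborel :: 'a measure))"
    proof (rule integral_dominated_convergence[where w = "\<lambda>x. \<bar>indicator A x * c\<bar>"])
      show "integrable lborel (\<lambda>x. \<bar>indicator A x * c\<bar>)" using intA by (rule integrable_abs)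
      have "(\<lambda>m. \<bar>G m x - indicator A x * c\<bar>) \<longlonglongrightarrow> 0" for x
      proof (rule tendsto_eventually)
        obtain k where "norm x < real k" using reals_Archimedean2 by blast
        then show "\<forall>\<^sub>F m in sequentially. \<bar>G m x - indicator A x * c\<bar> = 0"
          by (intro eventually_sequentiallyI[of k]) (auto simp: G_def indicator_def)
      qed
      then show "AE x in lborel. (\<lambda>m. \<bar>G m x - indicator A x * c\<bar>) \<longlonglongrightarrow> 0" by simp
    qed (auto simp: G_def indicator_def)
    then have "(\<lambda>m. \<integral>x. \<bar>G m x - indicator A x * c\<bar> \<partial>lborel) \<longlonglongrightarrow> 0" by simp
    from order_tendstoD(2)[OF this e] obtain m where "(\<integral>x. \<bar>G m x - indicator A x * c\<bar> \<partial>lborel) < e"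
      by (auto simp: eventually_sequentially)
    moreover have "L1_shift_continuous (G m)" unfolding G_def by (rule bounded[of _ "real m"]) auto
    ultimately show "\<exists>G. integrable lborel G \<and> L1_shift_continuous G \<and> (\<integral>x. \<bar>G x - indicator A x * c\<bar> \<partial>lborel) < e"
      using Gi by blast
  qed
  then show ?case by simp
next
  case (add f g)
  show ?case unfolding L1_shift_continuous_def
  proof (intro allI impI)
    fix e :: real assume e: "e > 0"
    obtain d1 where d1: "d1 > 0" "\<And>z. norm z < d1 \<Longrightarrow> (\<integral>x. \<bar>f (z + x) - f x\<bar> \<partial>lborel) < e / 2"
      using add(3)[unfolded L1_shift_continuous_def, rule_format, of "e/2"] e by auto
    obtain d2 where d2: "d2 > 0" "\<And>z. norm z < d2 \<Longrightarrow> (\<integral>x. \<bar>g (z + x) - g x\<bar> \<partial>lborel) < e / 2"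
      using add(4)[unfolded L1_shift_continuous_def, rule_format, of "e/2"] e by auto
    have "(\<integral>x. \<bar>(f (z + x) + g (z + x)) - (f x + g x)\<bar> \<partial>lborel) < e" if z: "norm z < min d1 d2" for z
    proof -
      note int = add(1,2) integrable_lborel_shift[OF add(1), of z] integrable_lborel_shift[OF add(2), of z]
      have "(\<integral>x. \<bar>(f (z + x) + g (z + x)) - (f x + g x)\<bar> \<partial>lborel) \<le>
        (\<integral>x. \<bar>f (z + x) - f x\<bar> + \<bar>g (z + x) - g x\<bar> \<partial>lborel)"
        using int by (intro integral_mono) auto
      also have "\<dots> = (\<integral>x. \<bar>f (z + x) - f x\<bar> \<partial>lborel) + (\<integral>x. \<bar>g (z + x) - g x\<bar> \<partial>lborel)"
        using int by (intro Bochner_Integration.integral_add) auto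
      also have "\<dots> < e" using d1(2)[of z] d2(2)[of z] z by auto
      finally show ?thesis .
    qed
    with d1(1) d2(1) show "\<exists>d>0. \<forall>z. norm z < d \<longrightarrow> (\<integral>x. \<bar>(f (z + x) + g (z + x)) - (f x + g x)\<bar> \<partial>lborel) < e"
      by (intro exI[of _ "min d1 d2"]) auto
  qed
next
  case (lim f s)
  show ?case
  proof (rule L1_shift_continuous_approx[OF lim.hyps(4)])
    fix e :: real assume e: "e > 0"
    have [measurable]: "\<And>i. s i \<in> borel_measurable borel" "f \<in> borel_measurable borel"
      using lim.hyps(1,4) by auto
    have "(\<lambda>i. \<integral>x. \<bar>s i x - f x\<bar> \<partial>lborel) \<longlonglongrightarrow> (\<integral>x. 0 \<partial>(lborel :: 'a measure))"
    proof (rule integral_dominated_convergence[where w = "\<lambda>x. 3 * \<bar>f x\<bar>"])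
      show "AE x in lborel. (\<lambda>i. \<bar>s i x - f x\<bar>) \<longlonglongrightarrow> 0"
      proof (rule AE_I2)
        fix x :: 'a
        have "(\<lambda>i. s i x - f x) \<longlonglongrightarrow> f x - f x" using lim.hyps(2)[of x] by (intro tendsto_intros) auto
        then show "(\<lambda>i. \<bar>s i x - f x\<bar>) \<longlonglongrightarrow> 0" by (simp add: tendsto_rabs_zero)
      qed
      have "norm \<bar>s i x - f x\<bar> \<le> 3 * \<bar>f x\<bar>" for i x
        using lim.hyps(3)[of x i] by simp
      then show "AE x in lborel. norm \<bar>s i x - f x\<bar> \<le> 3 * \<bar>f x\<bar>" for i by simp
      show "integrable lborel (\<lambda>x. 3 * \<bar>f x\<bar>)" using lim.hyps(4) by simp
    qed auto
    then have "(\<lambda>i. \<integral>x. \<bar>s i x - f x\<bar> \<partial>lborel) \<longlonglongrightarrow> 0" by simp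
    from order_tendstoD(2)[OF this e] obtain i where "(\<integral>x. \<bar>s i x - f x\<bar> \<partial>lborel) < e"
      by (auto simp: eventually_sequentially)
    then show "\<exists>G. integrable lborel G \<and> L1_shift_continuous G \<and> (\<integral>x. \<bar>G x - f x\<bar> \<partial>lborel) < e"
      using lim by blast
  qed
qed

text \<open>A mollification is an average of translates by less than 1/(n+1) with weights of total
  mass 1. Tonelli's theorem therefore bounds its \<open>L\<^sup>1\<close> error by the largest
  translation error at that scale.\<close>

lemma conv_moll_L1_bound:
  fixes F :: "'a::euclidean_space \<Rightarrow> real"
  assumes F: "integrable lborel F" and e: "e \<ge> 0"
    and le: "\<And>z. norm z < 1 / real (Suc n) \<Longrightarrow> (\<integral>x. \<bar>F (z + x) - F x\<bar> \<partial>lborel) \<le> e"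
  shows "(\<integral>\<^sup>+x. ennreal \<bar>conv (moll n) F x - F x\<bar> \<partial>lborel) \<le> ennreal e"
proof -
  have [measurable]: "F \<in> borel_measurable borel" using F by auto
  have [measurable]: "moll n \<in> borel_measurable borel" by (rule test_fun_measurable(1)[OF moll_test_fun])
  have mi: "integrable lborel (moll n :: 'a \<Rightarrow> real)" by (rule test_fun_integrable(1)[OF moll_test_fun])
  have ptw: "ennreal \<bar>conv (moll n) F x - F x\<bar> \<le> (\<integral>\<^sup>+z. ennreal (moll n z) * ennreal \<bar>F ((- z) + x) - F x\<bar> \<partial>lborel)" for x
  proof -
    have i1: "integrable lborel (\<lambda>y. moll n (x - y) * F y)" by (rule conv_integrable[OF moll_test_fun F])
    have i2: "integrable lborel (\<lambda>y. moll n (x - y) * F x)"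
      using integrable_lborel_reflect[of "moll n" x] mi by (intro integrable_mult_left) simp
    have "conv (moll n) F x - F x = (\<integral>y. moll n (x - y) * F y \<partial>lborel) - (\<integral>y. moll n (x - y) * F x \<partial>lborel)"
      unfolding conv_def
      using integral_lborel_reflect[OF test_fun_measurable(1)[OF moll_test_fun], of n x] moll_integral[of n, where 'a='a]
      by simp
    also have "\<dots> = (\<integral>y. moll n (x - y) * (F y - F x) \<partial>lborel)"
      using i1 i2 by (simp add: Bochner_Integration.integral_diff[symmetric] algebra_simps)
    also have "\<dots> = (\<integral>z. moll n z * (F (x - z) - F x) \<partial>lborel)"
      using integral_lborel_reflect[of "\<lambda>y. moll n (x - y) * (F y - F x)" x] by simp
    finally have eq: "conv (moll n) F x - F x = (\<integral>z. moll n z * (F (x - z) - F x) \<partial>lborel)" .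
    \<comment> \<open>If the integrand is not integrable, its Bochner integral is 0 and the bound is
      trivial.\<close>
    have "ennreal \<bar>conv (moll n) F x - F x\<bar> \<le> (\<integral>\<^sup>+z. ennreal \<bar>moll n z * (F (x - z) - F x)\<bar> \<partial>lborel)"
      unfolding eq using integral_norm_bound_ennreal[of lborel "\<lambda>z. moll n z * (F (x - z) - F x)"]
      by (cases "integrable lborel (\<lambda>z. moll n z * (F (x - z) - F x))") (auto simp: not_integrable_integral_eq)
    then show ?thesis by (simp add: abs_mult moll_nonneg ennreal_mult)
  qed
  have "(\<integral>\<^sup>+x. ennreal \<bar>conv (moll n) F x - F x\<bar> \<partial>lborel) \<le>
     (\<integral>\<^sup>+x. (\<integral>\<^sup>+z. ennreal (moll n z) * ennreal \<bar>F ((- z) + x) - F x\<bar> \<partial>lborel) \<partial>lborel)"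
    by (intro nn_integral_mono ptw)
  also have "\<dots> = (\<integral>\<^sup>+z. (\<integral>\<^sup>+x. ennreal (moll n z) * ennreal \<bar>F ((- z) + x) - F x\<bar> \<partial>lborel) \<partial>lborel)"
    by (rule lborel_pair.Fubini') measurable
  also have "\<dots> = (\<integral>\<^sup>+z. ennreal (moll n z) * (\<integral>\<^sup>+x. ennreal \<bar>F ((- z) + x) - F x\<bar> \<partial>lborel) \<partial>lborel)"
    by (intro nn_integral_cong nn_integral_cmult) measurable
  also have "\<dots> \<le> (\<integral>\<^sup>+z. ennreal (moll n (z::'a)) * ennreal e \<partial>lborel)"
  proof (rule nn_integral_mono)
    fix z :: 'a
    show "ennreal (moll n z) * (\<integral>\<^sup>+x. ennreal \<bar>F ((- z) + x) - F x\<bar> \<partial>lborel) \<le> ennreal (moll n z) * ennreal e"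
    proof (cases "norm z < 1 / real (Suc n)")
      case True
      have "(\<integral>\<^sup>+x. ennreal \<bar>F ((- z) + x) - F x\<bar> \<partial>lborel) = ennreal (\<integral>x. \<bar>F ((- z) + x) - F x\<bar> \<partial>lborel)"
        using F integrable_lborel_shift[OF F, of "- z"] by (intro nn_integral_eq_integral) auto
      also have "\<dots> \<le> ennreal e" using le[of "- z"] True by (intro ennreal_leI) auto
      finally show ?thesis by (rule mult_left_mono) simp
    qed (simp add: moll_outside del: of_nat_Suc)
  qed
  also have "\<dots> = (\<integral>\<^sup>+z. ennreal (moll n (z::'a)) \<partial>lborel) * ennreal e"
    by (rule nn_integral_multc) measurable
  also have "(\<integral>\<^sup>+z. ennreal (moll n (z::'a)) \<partial>lborel) = 1"
    using mi moll_nonneg moll_integral[of n, where 'a='a] by (subst nn_integral_eq_integral) auto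
  finally show ?thesis by simp
qed

lemma conv_moll_tendsto_L1:
  assumes F: "integrable lborel F"
  shows "(\<lambda>n. \<integral>\<^sup>+x. ennreal \<bar>conv (moll n) F x - F x\<bar> \<partial>lborel) \<longlonglongrightarrow> 0"
proof (rule tendsto_zero_ennreal)
  fix e :: real assume e: "e > 0"
  obtain d where d: "d > 0" "\<And>z. norm z < d \<Longrightarrow> (\<integral>x. \<bar>F (z + x) - F x\<bar> \<partial>lborel) < e / 2"
    using integrable_imp_L1_shift_continuous[OF F, unfolded L1_shift_continuous_def, rule_format, of "e/2"] e
    by auto
  obtain N where N: "1 / real (Suc N) < d" using nat_approx_posE[OF d(1)] by auto
  show "\<forall>\<^sub>F n in sequentially. (\<integral>\<^sup>+x. ennreal \<bar>conv (moll n) F x - F x\<bar> \<partial>lborel) < ennreal e"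
  proof (rule eventually_sequentiallyI[of N])
    fix n assume "n \<ge> N"
    then have "1 / real (Suc n) \<le> 1 / real (Suc N)" by (simp add: frac_le)
    then have "(\<integral>\<^sup>+x. ennreal \<bar>conv (moll n) F x - F x\<bar> \<partial>lborel) \<le> ennreal (e / 2)"
      using N e d(2) by (intro conv_moll_L1_bound[OF F]) (auto intro!: less_imp_le)
    also have "\<dots> < ennreal e" using e by (simp add: ennreal_less_iff)
    finally show "(\<integral>\<^sup>+x. ennreal \<bar>conv (moll n) F x - F x\<bar> \<partial>lborel) < ennreal e" .
  qed
qed

subsection \<open>Compactness in \<open>L\<^sup>1\<close>\<close>

text \<open>The rate depends on the function only through the \<open>L\<^sup>1\<close> norm of its
  gradient, so it is uniform over a set with bounded gradients.\<close>

lemma test_fun_conv_moll_L1: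
  fixes \<phi> :: "'a::euclidean_space \<Rightarrow> real"
  assumes \<phi>: "\<phi> \<in> test_fun \<Omega>" and C: "(\<integral>x. norm (grad \<phi> x) \<partial>lborel) \<le> C"
  shows "(\<integral>\<^sup>+x. ennreal \<bar>conv (moll n) \<phi> x - \<phi> x\<bar> \<partial>lborel) \<le> ennreal (C / real (Suc n))"
proof (rule conv_moll_L1_bound)
  have "0 \<le> (\<integral>x. norm (grad \<phi> x) \<partial>lborel)" by simp
  then have C0: "C \<ge> 0" using C by linarith
  then show "0 \<le> C / real (Suc n)" by simp
  show "integrable lborel \<phi>" by (rule test_fun_integrable[OF \<phi>])
  fix z :: 'a assume z: "norm z < 1 / real (Suc n)"
  have "(\<integral>x. \<bar>\<phi> (z + x) - \<phi> x\<bar> \<partial>lborel) \<le> norm z * (\<integral>x. norm (grad \<phi> x) \<partial>lborel)"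
    by (rule test_fun_shift_L1[OF \<phi>])
  also have "\<dots> \<le> (1 / real (Suc n)) * C" using z C C0 by (intro mult_mono) auto
  finally show "(\<integral>x. \<bar>\<phi> (z + x) - \<phi> x\<bar> \<partial>lborel) \<le> C / real (Suc n)" by simp
qed

text \<open>Mollified functions from a set bounded in \<open>L\<^sup>1\<close> are equi-Lipschitz, so convergence on a
  countable dense set is convergence everywhere.\<close>

lemma conv_bounds:
  fixes \<eta> :: "'a::euclidean_space \<Rightarrow> real"
  assumes \<eta>: "\<eta> \<in> test_fun UNIV"
  obtains B where "B > 0"
    "\<And>v C x. integrable lborel v \<Longrightarrow> (\<integral>y. \<bar>v y\<bar> \<partial>lborel) \<le> C \<Longrightarrow> \<bar>conv \<eta> v x\<bar> \<le> B * C"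
    "\<And>v C x y. integrable lborel v \<Longrightarrow> (\<integral>y. \<bar>v y\<bar> \<partial>lborel) \<le> C \<Longrightarrow>
        \<bar>conv \<eta> v x - conv \<eta> v y\<bar> \<le> B * C * norm (x - y)"
proof -
  obtain B where B: "B > 0" "\<And>x. \<bar>\<eta> x\<bar> \<le> B" "\<And>x. norm (grad \<eta> x) \<le> B"
    using test_fun_bounded[OF \<eta>] by metis
  show ?thesis
  proof (rule that[OF B(1)])
    fix v :: "'a \<Rightarrow> real" and C x y
    assume v: "integrable lborel v" and C: "(\<integral>y. \<bar>v y\<bar> \<partial>lborel) \<le> C"
    note i = conv_integrable[OF \<eta> v]
    have "\<bar>conv \<eta> v x\<bar> \<le> (\<integral>y. \<bar>\<eta> (x - y) * v y\<bar> \<partial>lborel)"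
      unfolding conv_def by (rule integral_abs_bound)
    also have "\<dots> \<le> (\<integral>y. B * \<bar>v y\<bar> \<partial>lborel)"
      using v B(2) by (intro integral_mono integrable_abs[OF i]) (auto simp: abs_mult intro!: mult_right_mono)
    also have "\<dots> \<le> B * C" using C B(1) by simp
    finally show "\<bar>conv \<eta> v x\<bar> \<le> B * C" .
    have "\<bar>conv \<eta> v x - conv \<eta> v y\<bar> = \<bar>\<integral>w. \<eta> (x - w) * v w - \<eta> (y - w) * v w \<partial>lborel\<bar>"
      unfolding conv_def using i[of x] i[of y] by (simp add: Bochner_Integration.integral_diff)
    also have "\<dots> \<le> (\<integral>w. \<bar>\<eta> (x - w) * v w - \<eta> (y - w) * v w\<bar> \<partial>lborel)" by (rule integral_abs_bound)
    also have "\<dots> \<le> (\<integral>w. (B * norm (x - y)) * \<bar>v w\<bar> \<partial>lborel)"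
    proof (rule integral_mono)
      show "integrable lborel (\<lambda>w. \<bar>\<eta> (x - w) * v w - \<eta> (y - w) * v w\<bar>)" using i[of x] i[of y] by auto
      show "integrable lborel (\<lambda>w. (B * norm (x - y)) * \<bar>v w\<bar>)" using v by simp
      fix w
      have "\<bar>\<eta> (x - w) * v w - \<eta> (y - w) * v w\<bar> = \<bar>\<eta> (x - w) - \<eta> (y - w)\<bar> * \<bar>v w\<bar>"
        by (simp add: abs_mult[symmetric] left_diff_distrib)
      also have "\<dots> \<le> (B * norm (x - y)) * \<bar>v w\<bar>"
        using test_fun_lipschitz[OF \<eta> B(3), of "x - w" "y - w"] by (intro mult_right_mono) auto
      finally show "\<bar>\<eta> (x - w) * v w - \<eta> (y - w) * v w\<bar> \<le> (B * norm (x - y)) * \<bar>v w\<bar>" .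
    qed
    also have "\<dots> \<le> (B * norm (x - y)) * C" using C B(1) by (simp add: mult_left_mono)
    finally show "\<bar>conv \<eta> v x - conv \<eta> v y\<bar> \<le> B * C * norm (x - y)" by (simp add: mult_ac)
  qed
qed

lemma diagonal_subsequence:
  fixes X :: "nat \<Rightarrow> nat \<Rightarrow> real"
  assumes "\<And>i k. \<bar>X i k\<bar> \<le> B i"
  obtains r :: "nat \<Rightarrow> nat" where "strict_mono r" "\<And>i. convergent (\<lambda>k. X i (r k))"
proof -
  interpret subseqs "\<lambda>i s. convergent (\<lambda>k. X i (s k))"
  proof
    fix i and s :: "nat \<Rightarrow> nat"
    have "bounded (range (\<lambda>k. X i (s k)))"
      using assms[of i] by (auto simp: bounded_iff intro!: exI[of _ "B i"])
    from bounded_imp_convergent_subsequence[OF this]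
    show "\<exists>r'. strict_mono r' \<and> convergent (\<lambda>k. X i ((s \<circ> r') k))"
      by (auto simp: convergent_def o_def)
  qed
  have "convergent (\<lambda>k. X i (diagseq k))" for i
  proof -
    \<comment> \<open>Only from index i + 1 on is the diagonal sequence a subsequence of the
      refinement made for row i.\<close>
    have "convergent (\<lambda>k. X i ((diagseq \<circ> (+) (Suc i)) k))"
    proof (rule diagseq_holds)
      fix x and s r :: "nat \<Rightarrow> nat" assume r: "strict_mono r" and "convergent (\<lambda>k. X x (s k))"
      then show "convergent (\<lambda>k. X x ((s \<circ> r) k))"
        using convergent_subseq_convergent[of "\<lambda>k. X x (s k)" r] by (simp add: o_def)
    qed
    then have "convergent (\<lambda>k. X i (diagseq (k + Suc i)))" by (simp add: o_def add.commute)
    then show ?thesis by (rule convergent_ignore_initial_segment[THEN iffD1])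
  qed
  then show ?thesis using that subseq_diagseq by blast
qed

text \<open>For each fixed scale the mollified functions converge everywhere along one common
  subsequence, and in \<open>L\<^sup>1\<close> by domination on a ball. Their distance to the
  original functions is at most C/(n+1) for all k, so the Cauchy property carries over.\<close>

lemma rellich:
  fixes \<phi> :: "nat \<Rightarrow> 'a::euclidean_space \<Rightarrow> real"
  assumes \<phi>: "\<And>k. \<phi> k \<in> test_fun \<Omega>" and bdd: "bounded \<Omega>"
    and C1: "\<And>k. (\<integral>x. \<bar>\<phi> k x\<bar> \<partial>lborel) \<le> C" and C2: "\<And>k. (\<integral>x. norm (grad (\<phi> k) x) \<partial>lborel) \<le> C"
  obtains r :: "nat \<Rightarrow> nat" where "strict_mono r"
    "\<And>e. e > 0 \<Longrightarrow> \<exists>N. \<forall>k\<ge>N. \<forall>l\<ge>N. (\<integral>x. \<bar>\<phi> (r k) x - \<phi> (r l) x\<bar> \<partial>lborel) < e"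
proof -
  define u where "u = (\<lambda>n k. conv (moll n) (\<phi> k))"
  note phi_int = test_fun_integrable(1)[OF \<phi>]
  have "\<exists>B>0. \<forall>k x. \<bar>u n k x\<bar> \<le> B \<and> (\<forall>y. \<bar>u n k x - u n k y\<bar> \<le> B * norm (x - y))" for n
  proof -
    obtain B where B: "B > 0"
      "\<And>v C x. integrable lborel v \<Longrightarrow> (\<integral>y. \<bar>v y\<bar> \<partial>lborel) \<le> C \<Longrightarrow> \<bar>conv (moll n) v (x::'a)\<bar> \<le> B * C"
      "\<And>v C x y. integrable lborel v \<Longrightarrow> (\<integral>y. \<bar>v y\<bar> \<partial>lborel) \<le> C \<Longrightarrow>
        \<bar>conv (moll n) v x - conv (moll n) v (y::'a)\<bar> \<le> B * C * norm (x - y)"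
      using conv_bounds[OF moll_test_fun] by metis
    have "\<bar>u n k x\<bar> \<le> B * C + 1" for k x using B(2)[OF phi_int C1] unfolding u_def by (simp add: add_increasing2)
    moreover have "\<bar>u n k x - u n k y\<bar> \<le> (B * C + 1) * norm (x - y)" for k x y
      using B(3)[OF phi_int C1, of k x y] unfolding u_def by (simp add: algebra_simps add_increasing)
    moreover have "0 \<le> (\<integral>x. \<bar>\<phi> 0 x\<bar> \<partial>lborel)" by simp
    then have "C \<ge> 0" using C1[of 0] by linarith
    then have "B * C + 1 > 0" using B(1) by (simp add: add_nonneg_pos)
    ultimately show ?thesis by blast
  qed
  then obtain B where B: "\<And>n. B n > 0" "\<And>n k x. \<bar>u n k x\<bar> \<le> B n"
     "\<And>n k x y. \<bar>u n k x - u n k y\<bar> \<le> B n * norm (x - y)" by metis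
  obtain Q :: "'a set" where Q: "countable Q" "\<And>U. open U \<Longrightarrow> U \<noteq> {} \<Longrightarrow> \<exists>q\<in>Q. q \<in> U"
    using countable_dense_exists by metis
  have "Q \<noteq> {}" using Q(2)[of UNIV] by auto
  define q where "q = from_nat_into Q"
  \<comment> \<open>One index codes a scale n and a point of the countable dense set, so a single
    diagonal subsequence serves all scales.\<close>
  define X where "X = (\<lambda>i k. case prod_decode i of (n, j) \<Rightarrow> u n k (q j))"
  obtain r :: "nat \<Rightarrow> nat" where r: "strict_mono r" "\<And>i. convergent (\<lambda>k. X i (r k))"
    by (rule diagonal_subsequence[of X "\<lambda>i. B (fst (prod_decode i))"])
       (auto simp: X_def split_beta B(2))
  have convQ: "convergent (\<lambda>k. u n (r k) y)" if y: "y \<in> Q" for n y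
  proof -
    obtain j where "q j = y" using from_nat_into_surj[OF Q(1) y] unfolding q_def by blast
    then show ?thesis using r(2)[of "prod_encode (n, j)"] by (simp add: X_def)
  qed
  have conv: "convergent (\<lambda>k. u n (r k) x)" for n x
  proof (rule Cauchy_convergent, rule metric_CauchyI)
    fix e :: real assume e: "e > 0"
    define d where "d = e / (3 * B n)"
    have d: "d > 0" using e B(1)[of n] unfolding d_def by simp
    obtain y where y: "y \<in> Q" "norm (x - y) < d" using Q(2)[of "ball x d"] d by (auto simp: dist_norm)
    have near: "\<bar>u n k x - u n k y\<bar> < e / 3" for k
    proof -
      have "\<bar>u n k x - u n k y\<bar> \<le> B n * norm (x - y)" by (rule B)
      also have "\<dots> < B n * d" using y(2) B(1)[of n] by simp
      finally show ?thesis using B(1)[of n] by (simp add: d_def)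
    qed
    obtain N where N: "\<And>k l. k \<ge> N \<Longrightarrow> l \<ge> N \<Longrightarrow> dist (u n (r k) y) (u n (r l) y) < e / 3"
      using metric_CauchyD[OF convergent_Cauchy[OF convQ[OF y(1), of n]], of "e/3"] e by auto
    have "dist (u n (r k) x) (u n (r l) x) < e" if "k \<ge> N" "l \<ge> N" for k l
      using near[of "r k"] near[of "r l"] N[OF that] unfolding dist_real_def by linarith
    then show "\<exists>M. \<forall>m\<ge>M. \<forall>k\<ge>M. dist (u n (r m) x) (u n (r k) x) < e" by blast
  qed
  obtain R where R: "\<Omega> \<subseteq> cball 0 R" using bdd by (force simp: bounded_iff subset_iff)
  \<comment> \<open>The mollification radius is at most 1, so the supports stay within R +
    1.\<close>
  define I :: "'a \<Rightarrow> real" where "I = indicator (cball 0 (R + 1))"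
  have I_int: "integrable lborel I" unfolding I_def
    using emeasure_lborel_cball_finite[of "0::'a" "R + 1"] by (intro integrable_real_indicator) auto
  have supp: "\<bar>u n k x\<bar> \<le> B n * I x" for n k x
  proof (cases "x \<in> cball 0 (R + 1)")
    case False
    have "x \<notin> (\<Union>y\<in>\<Omega>. cball y (1 / real (Suc n)))"
    proof
      assume "x \<in> (\<Union>y\<in>\<Omega>. cball y (1 / real (Suc n)))"
      then obtain y where "y \<in> \<Omega>" "dist y x \<le> 1 / real (Suc n)" by auto
      moreover have "1 / real (Suc n) \<le> 1" by simp
      ultimately have "norm y \<le> R" "norm (x - y) \<le> 1"
        using R by (force, metis dist_commute dist_norm order_trans)
      then show False using False norm_triangle_ineq[of "x - y" y] by simp
    qed
    then have "u n k x = 0" unfolding u_def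
      using test_fun_outside[OF \<phi>] by (intro conv_moll_support[of \<Omega>]) auto
    then show ?thesis using False by (simp add: I_def)
  qed (simp add: I_def B)
  define L where "L = (\<lambda>n x. lim (\<lambda>k. u n (r k) x))"
  have lim: "(\<lambda>k. u n (r k) x) \<longlonglongrightarrow> L n x" for n x using conv[of n x] unfolding L_def by (rule convergent_LIMSEQ_iff[THEN iffD1])
  have um [measurable]: "u n k \<in> borel_measurable borel" for n k unfolding u_def
    by (intro borel_measurable_continuous_onI smooth_continuous conv_smooth[OF moll_test_fun phi_int])
  have Lm [measurable]: "L n \<in> borel_measurable borel" for n
    by (rule borel_measurable_LIMSEQ_real[OF lim]) auto
  have L_le: "\<bar>L n x\<bar> \<le> B n * I x" for n x
    by (rule LIMSEQ_le_const2[OF tendsto_rabs[OF lim]]) (use supp in auto)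
  have dom: "integrable lborel w" if "w \<in> borel_measurable borel" "\<And>x. \<bar>w x\<bar> \<le> B n * I x" for w n
  proof (rule Bochner_Integration.integrable_bound)
    show "integrable lborel (\<lambda>x. B n * I x)" using I_int by simp
    show "AE x in lborel. norm (w x) \<le> norm (B n * I x)"
      using order_trans[OF that(2) abs_ge_self] by simp
  qed (use that in simp)
  have u_int: "integrable lborel (u n k)" for n k using dom[OF um supp] .
  have L_int: "integrable lborel (L n)" for n using dom[OF Lm L_le] .
  have dct: "(\<lambda>k. \<integral>x. \<bar>u n (r k) x - L n x\<bar> \<partial>lborel) \<longlonglongrightarrow> 0" for n
  proof -
    have "(\<lambda>k. \<integral>x. \<bar>u n (r k) x - L n x\<bar> \<partial>lborel) \<longlonglongrightarrow> (\<integral>x. 0 \<partial>(lborel :: 'a measure))"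
    proof (rule integral_dominated_convergence[where w = "\<lambda>x. 2 * B n * I x"])
      have "(\<lambda>k. \<bar>u n (r k) x - L n x\<bar>) \<longlonglongrightarrow> 0" for x
        using lim[of n x] by (intro tendsto_rabs_zero) (simp add: LIM_zero)
      then show "AE x in lborel. (\<lambda>k. \<bar>u n (r k) x - L n x\<bar>) \<longlonglongrightarrow> 0" by simp
      have "norm \<bar>u n (r k) x - L n x\<bar> \<le> 2 * B n * I x" for k x
        using supp[of n "r k" x] L_le[of n x] by simp
      then show "AE x in lborel. norm \<bar>u n (r k) x - L n x\<bar> \<le> 2 * B n * I x" for k by simp
    qed (use I_int in auto)
    then show ?thesis by simp
  qed
  have close: "(\<integral>x. \<bar>u n k x - \<phi> k x\<bar> \<partial>lborel) \<le> C / real (Suc n)" for n k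
  proof -
    have C0: "0 \<le> C / real (Suc n)"
      using order_trans[OF integral_nonneg_AE C1[of 0]] by auto
    have "ennreal (\<integral>x. \<bar>u n k x - \<phi> k x\<bar> \<partial>lborel) = (\<integral>\<^sup>+x. ennreal \<bar>u n k x - \<phi> k x\<bar> \<partial>lborel)"
      using u_int phi_int by (intro nn_integral_eq_integral[symmetric]) auto
    also have "\<dots> \<le> ennreal (C / real (Suc n))" unfolding u_def by (rule test_fun_conv_moll_L1[OF \<phi> C2])
    finally show ?thesis using C0 by (simp add: ennreal_le_iff)
  qed
  have "\<exists>N. \<forall>k\<ge>N. \<forall>l\<ge>N. (\<integral>x. \<bar>\<phi> (r k) x - \<phi> (r l) x\<bar> \<partial>lborel) < e" if e: "e > 0" for e
  proof -
    have "(\<lambda>n. C / real (Suc n)) \<longlonglongrightarrow> 0" using tendsto_mult_right_zero[OF LIMSEQ_inverse_real_of_nat, of C] by (simp add: divide_inverse)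
    \<comment> \<open>Four errors of size e/4: two from the mollification at scale n, two from the
      convergence of the mollified functions to \<open>L n\<close>.\<close>
    from order_tendstoD(2)[OF this, of "e / 4"] e obtain n where n: "C / real (Suc n) < e / 4"
      by (auto simp: eventually_sequentially)
    obtain N where N: "\<And>k. k \<ge> N \<Longrightarrow> (\<integral>x. \<bar>u n (r k) x - L n x\<bar> \<partial>lborel) < e / 4"
      using order_tendstoD(2)[OF dct, of "e/4"] e by (auto simp: eventually_sequentially)
    have "(\<integral>x. \<bar>\<phi> (r k) x - \<phi> (r l) x\<bar> \<partial>lborel) < e" if "k \<ge> N" "l \<ge> N" for k l
    proof -
      have "(\<integral>x. \<bar>\<phi> (r k) x - \<phi> (r l) x\<bar> \<partial>lborel) \<le>
        (\<integral>x. (\<bar>u n (r k) x - \<phi> (r k) x\<bar> + \<bar>u n (r k) x - L n x\<bar>) +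
              (\<bar>u n (r l) x - L n x\<bar> + \<bar>u n (r l) x - \<phi> (r l) x\<bar>) \<partial>lborel)"
        using phi_int u_int L_int by (intro integral_mono) auto
      also have "\<dots> = (\<integral>x. \<bar>u n (r k) x - \<phi> (r k) x\<bar> \<partial>lborel) + (\<integral>x. \<bar>u n (r k) x - L n x\<bar> \<partial>lborel)
         + ((\<integral>x. \<bar>u n (r l) x - L n x\<bar> \<partial>lborel) + (\<integral>x. \<bar>u n (r l) x - \<phi> (r l) x\<bar> \<partial>lborel))"
        using phi_int u_int L_int by (simp add: Bochner_Integration.integral_add)
      also have "\<dots> < e" using close[of n "r k"] close[of n "r l"] N[of k] N[of l] n that by linarith
      finally show ?thesis .
    qed
    then show ?thesis by blast
  qed
  with r(1) that show ?thesis by blast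
qed

section \<open>Functions that vanish outside a set, and the fundamental lemma of the calculus of
  variations\<close>

lemma integral_lebesgue_on_zero_outside:
  fixes f :: "'a::euclidean_space \<Rightarrow> 'b::{banach, second_countable_topology}"
  assumes "S \<in> sets lebesgue" "\<And>x. x \<notin> S \<Longrightarrow> f x = 0"
  shows "integral\<^sup>L (lebesgue_on S) f = integral\<^sup>L lebesgue f"
    and "integrable (lebesgue_on S) f \<longleftrightarrow> integrable lebesgue f"
proof -
  have eq: "(\<lambda>x. indicator S x *\<^sub>R f x) = f" using assms(2) by (auto simp: indicator_def fun_eq_iff)
  show "integral\<^sup>L (lebesgue_on S) f = integral\<^sup>L lebesgue f"
    using assms(1) by (simp add: integral_restrict_space eq)
  show "integrable (lebesgue_on S) f \<longleftrightarrow> integrable lebesgue f"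
    using assms(1) by (simp add: integrable_restrict_space eq)
qed

lemma borel_measurable_lebesgue_on:
  "f \<in> borel_measurable borel \<Longrightarrow> f \<in> borel_measurable (lebesgue_on S)"
  by (auto intro!: measurable_restrict_space1 measurable_completion)

text \<open>For a cutoff \<zeta>, the mollification of \<zeta> g at x is the integral of g against
  the test function y \<mapsto> moll (x - y) \<zeta>(y), hence 0. Mollifications converge to \<zeta>
  g in \<open>L\<^sup>1\<close>, so \<zeta> g vanishes almost everywhere.\<close>

lemma fundamental_lemma:
  fixes g :: "'a::euclidean_space \<Rightarrow> real"
  assumes \<Omega>: "open \<Omega>"
    and loc: "\<And>K. compact K \<Longrightarrow> K \<subseteq> \<Omega> \<Longrightarrow> integrable (lebesgue_on K) g"
    and zero: "\<And>\<phi>. \<phi> \<in> test_fun \<Omega> \<Longrightarrow> integral\<^sup>L (lebesgue_on \<Omega>) (\<lambda>x. g x * \<phi> x) = 0"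
  shows "AE x in lebesgue_on \<Omega>. g x = 0"
proof -
  have \<Omega>s: "\<Omega> \<in> sets lebesgue" using \<Omega> by simp
  have step: "AE x in lebesgue. \<zeta> x * g x = 0" if \<zeta>: "\<zeta> \<in> test_fun \<Omega>" for \<zeta>
  proof -
    obtain K where K: "compact K" "K \<subseteq> \<Omega>" "\<And>x. x \<notin> K \<Longrightarrow> \<zeta> x = 0" using test_funE[OF \<zeta>] by metis
    obtain B where B: "B > 0" "\<And>x. \<bar>\<zeta> x\<bar> \<le> B" using test_fun_bounded[OF \<zeta>] by metis
    have Ks: "K \<in> sets lebesgue" using K(1) by (simp add: compact_imp_closed)
    have "integrable (lebesgue_on K) (\<lambda>x. \<zeta> x * g x)"
    proof (rule Bochner_Integration.integrable_bound)
      show "integrable (lebesgue_on K) (\<lambda>x. B * g x)" using loc[OF K(1,2)] by simp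
      have "g \<in> borel_measurable (lebesgue_on K)" using loc[OF K(1,2)] by auto
      then show "(\<lambda>x. \<zeta> x * g x) \<in> borel_measurable (lebesgue_on K)"
        using test_fun_measurable(1)[OF \<zeta>] borel_measurable_lebesgue_on by (intro borel_measurable_times) auto
      have "\<bar>\<zeta> x * g x\<bar> \<le> \<bar>B * g x\<bar>" for x
        using order_trans[OF B(2)[of x] abs_ge_self] unfolding abs_mult by (intro mult_right_mono) auto
      then show "AE x in lebesgue_on K. norm (\<zeta> x * g x) \<le> norm (B * g x)" by simp
    qed
    then have int: "integrable lebesgue (\<lambda>x. \<zeta> x * g x)"
      using integral_lebesgue_on_zero_outside(2)[OF Ks, of "\<lambda>x. \<zeta> x * g x"] K(3) by simp
    then have "(\<lambda>x. \<zeta> x * g x) \<in> borel_measurable lebesgue" by auto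
    \<comment> \<open>\<open>conv\<close> integrates over \<open>lborel\<close>, whereas g is only
      Lebesgue measurable; a Borel version takes its place.\<close>
    from completion_ex_borel_measurable_real[OF this]
    obtain F where F: "F \<in> borel_measurable lborel" "AE x in lborel. \<zeta> x * g x = F x" by blast
    have F': "AE x in lebesgue. \<zeta> x * g x = F x" using F(2) by (rule AE_completion)
    have F_leb: "F \<in> borel_measurable lebesgue" using F(1) by (rule measurable_completion)
    have "integrable lebesgue F"
      using int F' F_leb integrable_cong_AE[of "\<lambda>x. \<zeta> x * g x" lebesgue F] by auto
    then have F_int: "integrable lborel F" using F(1) by (simp add: integrable_completion)
    have zero_conv: "conv (moll n) F x = 0" for n x
    proof -
      define \<psi> where "\<psi> = (\<lambda>y. moll n (x + (- 1) *\<^sub>R y) * \<zeta> y)"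
      have \<psi>: "\<psi> \<in> test_fun \<Omega>" unfolding \<psi>_def
        by (intro test_fun_smooth_mult \<zeta> smooth_affine test_fun_smooth[OF moll_test_fun])
      have [measurable]: "moll n \<in> borel_measurable borel" by (rule test_fun_measurable(1)[OF moll_test_fun])
      have [measurable]: "F \<in> borel_measurable borel" using F(1) by simp
      have mm: "(\<lambda>y. moll n (x - y)) \<in> borel_measurable lebesgue" by (intro measurable_completion) measurable
      have "conv (moll n) F x = (\<integral>y. moll n (x - y) * F y \<partial>lebesgue)"
        unfolding conv_def by (intro integral_completion[symmetric]) measurable
      also have "\<dots> = (\<integral>y. moll n (x - y) * (\<zeta> y * g y) \<partial>lebesgue)"
        using F' by (intro integral_cong_AE borel_measurable_times mm F_leb
            \<open>(\<lambda>x. \<zeta> x * g x) \<in> borel_measurable lebesgue\<close>) (auto elim!: eventually_mono)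
      also have "\<dots> = (\<integral>y. g y * \<psi> y \<partial>lebesgue)" by (simp add: \<psi>_def mult_ac)
      also have "\<dots> = integral\<^sup>L (lebesgue_on \<Omega>) (\<lambda>y. g y * \<psi> y)"
        using test_fun_outside[OF \<psi>] by (intro integral_lebesgue_on_zero_outside(1)[OF \<Omega>s, symmetric]) auto
      also have "\<dots> = 0" by (rule zero[OF \<psi>])
      finally show ?thesis .
    qed
    have "(\<integral>\<^sup>+x. ennreal \<bar>F x\<bar> \<partial>lborel) = 0"
      using conv_moll_tendsto_L1[OF F_int] by (simp add: zero_conv LIMSEQ_const_iff)
    then have "AE x in lborel. F x = 0"
      using F(1) by (subst (asm) nn_integral_0_iff_AE) auto
    then have "AE x in lebesgue. F x = 0" by (rule AE_completion)
    with F' show ?thesis by eventually_elim simp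
  qed
  \<comment> \<open>Countably many cutoffs, each 1 on a member of a compact exhaustion, cover all of
    \<Omega> up to one null set.\<close>
  obtain K :: "nat \<Rightarrow> 'a set" where K: "\<And>n. compact (K n)" "\<And>n. K n \<subseteq> \<Omega>" "(\<Union>n. K n) = \<Omega>"
    using open_Union_compact_subsets[OF \<Omega>] by (metis UNIV_I image_eqI order_refl)
  have "\<exists>\<zeta>\<in>test_fun \<Omega>. \<forall>x\<in>K n. \<zeta> x = 1" for n using test_fun_cutoff[OF K(1) \<Omega> K(2)] by metis
  then obtain \<zeta> where \<zeta>: "\<And>n. \<zeta> n \<in> test_fun \<Omega>" "\<And>n x. x \<in> K n \<Longrightarrow> \<zeta> n x = 1" by metis
  have "AE x in lebesgue. \<forall>n. \<zeta> n x * g x = 0" using step[OF \<zeta>(1)] by (subst AE_all_countable) blast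
  then have "AE x in lebesgue. x \<in> \<Omega> \<longrightarrow> g x = 0"
  proof eventually_elim
    case (elim x)
    show ?case
    proof
      assume "x \<in> \<Omega>"
      then obtain n where "x \<in> K n" using K(3) by blast
      then show "g x = 0" using \<zeta>(2) elim by (metis mult_1)
    qed
  qed
  then show ?thesis using \<Omega>s by (simp add: AE_restrict_space_iff)
qed

subsection \<open>Uniform convexity of powers\<close>

lemma powr_gt_tangent:
  fixes t q :: real
  assumes q: "q > 1" and t: "t \<ge> 0" "t \<noteq> 1"
  shows "t powr q > 1 + q * (t - 1)"
proof -
  \<comment> \<open>The difference to the tangent at 1 has its strict minimum there: the derivative
    changes sign at 1.\<close>
  define f where "f = (\<lambda>t::real. t powr q - q * t)"
  have d: "(f has_real_derivative q * (s powr (q - 1) - 1)) (at s)" if "s > 0" for s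
    unfolding f_def using that by (auto intro!: derivative_eq_intros simp: algebra_simps)
  have cont: "continuous_on {0..} f" unfolding f_def
    using q by (intro continuous_intros continuous_on_powr') auto
  have "f t > f 1"
  proof (cases "t > 1")
    case True
    show ?thesis
    proof (rule DERIV_pos_imp_increasing_open[OF True])
      fix s assume "1 < s" "s < t"
      then show "\<exists>y. DERIV f s :> y \<and> y > 0"
        using d[of s] q powr_less_mono2[of "q - 1" 1 s] by (intro exI[of _ "q * (s powr (q - 1) - 1)"]) auto
    qed (use cont in \<open>auto intro: continuous_on_subset\<close>)
  next
    case False
    then have "t < 1" using t by simp
    then show ?thesis
    proof (rule DERIV_neg_imp_decreasing_open)
      fix s assume "t < s" "s < 1"
      then show "\<exists>y. DERIV f s :> y \<and> y < 0"
        using d[of s] q t powr_less_mono2[of "q - 1" s 1]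
        by (intro exI[of _ "q * (s powr (q - 1) - 1)"]) (auto simp: mult_pos_neg)
    qed (use cont t in \<open>auto intro: continuous_on_subset\<close>)
  qed
  then show ?thesis by (simp add: f_def algebra_simps)
qed

text \<open>Dividing by the midpoint makes the two arguments average to 1, so the linear terms of
  the tangent bounds cancel.\<close>

lemma powr_midpoint_less:
  fixes s t q :: real
  assumes q: "q > 1" and st: "s \<ge> 0" "t \<ge> 0" "s \<noteq> t"
  shows "2 * ((s + t) / 2) powr q < s powr q + t powr q"
proof -
  define m where "m = (s + t) / 2"
  have m: "m > 0" using st unfolding m_def by (cases "s = 0") auto
  have "s / m \<noteq> 1" "t / m \<noteq> 1" using st m unfolding m_def by (auto simp: divide_eq_eq)
  then have "(s / m) powr q > 1 + q * (s / m - 1)" "(t / m) powr q > 1 + q * (t / m - 1)"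
    using st m by (auto intro!: powr_gt_tangent q)
  moreover have "q * (s / m - 1) + q * (t / m - 1) = q * ((s + t) / m - 2)"
    by (simp add: algebra_simps add_divide_distrib)
  moreover have "(s + t) / m = 2" using m unfolding m_def by (simp add: divide_eq_eq)
  ultimately have "(s / m) powr q + (t / m) powr q > 2" by simp
  then have "m powr q * ((s / m) powr q + (t / m) powr q) > m powr q * 2"
    using m by simp
  then show ?thesis using m st unfolding m_def[symmetric] by (simp add: powr_divide algebra_simps)
qed

text \<open>Twice the defect in the midpoint convexity of |.|^q.\<close>

definition gap :: "real \<Rightarrow> 'b::euclidean_space \<Rightarrow> 'b \<Rightarrow> real" where
  "gap q a b = norm a powr q + norm b powr q - 2 * norm ((1/2) *\<^sub>R (a + b)) powr q"

lemma gap_nonneg: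
  assumes "q > 1" shows "gap q a b \<ge> 0"
proof -
  have "norm ((1/2) *\<^sub>R (a + b)) \<le> (norm a + norm b) / 2" using norm_triangle_ineq[of a b] by simp
  then have "norm ((1/2) *\<^sub>R (a + b)) powr q \<le> ((norm a + norm b) / 2) powr q"
    using assms by (intro powr_mono2) auto
  moreover have "2 * ((norm a + norm b) / 2) powr q \<le> norm a powr q + norm b powr q"
    using powr_midpoint_less[OF assms, of "norm a" "norm b"] by (cases "norm a = norm b") auto
  ultimately show ?thesis unfolding gap_def by linarith
qed

text \<open>For equal norms the parallelogram law shortens the midpoint strictly; for different
  norms the scalar power is strictly convex.\<close>

lemma gap_pos:
  assumes q: "q > 1" and ab: "a \<noteq> b" shows "gap q a b > 0"
proof (cases "norm a = norm b")
  case True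
  have "norm ((1/2) *\<^sub>R (a + b)) < norm a"
  proof (rule power2_less_imp_less)
    have "norm (a + b)^2 + norm (a - b)^2 = 2 * norm a^2 + 2 * norm b^2"
      by (simp add: power2_norm_eq_inner inner_simps inner_commute)
    moreover have "norm (a - b)^2 > 0" using ab by simp
    ultimately have "norm (a + b)^2 < 4 * norm a^2" using True by (simp only:)
    then show "(norm ((1/2) *\<^sub>R (a + b)))\<^sup>2 < (norm a)\<^sup>2" by (simp add: power_mult_distrib power_divide)
  qed simp
  then have "norm ((1/2) *\<^sub>R (a + b)) powr q < norm a powr q" using q by (intro powr_less_mono2) auto
  then show ?thesis using True by (simp add: gap_def)
next
  case False
  have "norm ((1/2) *\<^sub>R (a + b)) \<le> (norm a + norm b) / 2" using norm_triangle_ineq[of a b] by simp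
  then have "norm ((1/2) *\<^sub>R (a + b)) powr q \<le> ((norm a + norm b) / 2) powr q"
    using q by (intro powr_mono2) auto
  moreover have "2 * ((norm a + norm b) / 2) powr q < norm a powr q + norm b powr q"
    using powr_midpoint_less[OF q _ _ False] by simp
  ultimately show ?thesis unfolding gap_def by linarith
qed

lemma gap_scaleR: "s \<ge> 0 \<Longrightarrow> gap q (s *\<^sub>R a) (s *\<^sub>R b) = s powr q * gap q a b"
proof -
  assume "s \<ge> 0"
  then have 1: "norm (s *\<^sub>R c) powr q = s powr q * norm c powr q" for c :: 'a
    by (simp add: powr_mult)
  have 2: "(1/2) *\<^sub>R (s *\<^sub>R a + s *\<^sub>R b) = s *\<^sub>R ((1/2) *\<^sub>R (a + b))" by (simp add: algebra_simps)
  show ?thesis unfolding gap_def 2 1 by (simp add: algebra_simps)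
qed

text \<open>Uniform convexity, uniformly in the exponent: by homogeneity it suffices to bound the gap
  below on a compact set of triples \<open>(q, a, b)\<close>, where it is continuous and positive.\<close>

lemma gap_controls_distance:
  assumes pm: "pm > 1" and e: "e > 0"
  obtains C where "C > 0" "\<And>q a b::'b::euclidean_space. q \<in> {pm..pp} \<Longrightarrow>
     norm (a - b) powr q \<le> e * (norm a powr q + norm b powr q) + C * gap q a b"
proof -
  \<comment> \<open>The cap at 1 gives \<eta>^q \<le> \<eta> \<le> e for every exponent q >
    1.\<close>
  define \<eta> where "\<eta> = min 1 e"
  have \<eta>: "\<eta> > 0" "\<eta> \<le> 1" "\<eta> \<le> e" using e unfolding \<eta>_def by auto
  define S :: "(real \<times> 'b \<times> 'b) set" where
    "S = ({pm..pp} \<times> cball 0 1 \<times> cball 0 1) \<inter> {z. norm (fst (snd z) - snd (snd z)) \<ge> \<eta>}"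
  have S: "compact S" unfolding S_def
    by (intro compact_Int_closed compact_Times compact_Icc compact_cball closed_Collect_le continuous_intros)
  have cont: "continuous_on S (\<lambda>z. gap (fst z) (fst (snd z)) (snd (snd z)))"
    unfolding gap_def using pm
    by (intro continuous_intros continuous_on_powr') (auto simp: S_def)
  have pos: "gap (fst z) (fst (snd z)) (snd (snd z)) > 0" if "z \<in> S" for z
    using that pm \<eta> by (intro gap_pos) (auto simp: S_def)
  \<comment> \<open>The minimum over the compact set of normalised pairs at distance at least
    \<eta>; the set may be empty, and then any positive constant will do.\<close>
  obtain c where c: "c > 0" "\<And>z. z \<in> S \<Longrightarrow> c \<le> gap (fst z) (fst (snd z)) (snd (snd z))"
  proof (cases "S = {}")
    case False
    then obtain z0 where "z0 \<in> S" "\<And>z. z \<in> S \<Longrightarrow> gap (fst z0) (fst (snd z0)) (snd (snd z0)) \<le> gap (fst z) (fst (snd z)) (snd (snd z))"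
      using continuous_attains_inf[OF S _ cont] by blast
    then show ?thesis using that[of "gap (fst z0) (fst (snd z0)) (snd (snd z0))"] pos by blast
  qed (use that[of 1] in auto)
  \<comment> \<open>In the rescaled case |a - b| \<le> 2m and m^q \<le> gap / c, where m is the
    larger norm; 2^q is at most 2^pp.\<close>
  define C where "C = 2 powr pp / c"
  have C: "C > 0" using c unfolding C_def by simp
  have "norm (a - b) powr q \<le> e * (norm a powr q + norm b powr q) + C * gap q a b"
    if q: "q \<in> {pm..pp}" for q and a b :: 'b
  proof -
    define m where "m = max (norm a) (norm b)"
    have q1: "q > 1" using q pm by auto
    have g0: "gap q a b \<ge> 0" by (rule gap_nonneg[OF q1])
    have mq: "m powr q \<le> norm a powr q + norm b powr q" unfolding m_def by (auto simp: max_def)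
    show ?thesis
    \<comment> \<open>If the distance is small compared with m, the first term suffices; otherwise
      dividing by m > 0 lands in the compact set \<open>S\<close>.\<close>
    proof (cases "norm (a - b) < \<eta> * m \<or> m = 0")
      case True
      have "norm (a - b) \<le> \<eta> * m"
        using True unfolding m_def by (auto simp: max_def split: if_splits)
      then have "norm (a - b) powr q \<le> (\<eta> * m) powr q" using q1 by (intro powr_mono2) auto
      also have "\<dots> = \<eta> powr q * m powr q" using \<eta> by (simp add: powr_mult m_def)
      also have "\<dots> \<le> e * m powr q"
      proof (intro mult_right_mono)
        have "\<eta> powr q \<le> \<eta> powr 1" using \<eta> q1 by (intro powr_mono') auto
        then show "\<eta> powr q \<le> e" using \<eta> by simp
      qed simp
      also have "\<dots> \<le> e * (norm a powr q + norm b powr q)" using mq e by (intro mult_left_mono) auto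
      finally show ?thesis using g0 C by (simp add: add_increasing2)
    next
      case False
      then have m: "m > 0" by (metis m_def max.coboundedI1 norm_ge_zero order_le_less)
      define a' b' where "a' = (1/m) *\<^sub>R a" and "b' = (1/m) *\<^sub>R b"
      have ab: "a = m *\<^sub>R a'" "b = m *\<^sub>R b'" using m by (auto simp: a'_def b'_def)
      have "norm a' \<le> 1" "norm b' \<le> 1" using m by (auto simp: a'_def b'_def divide_le_eq m_def)
      moreover have "\<eta> \<le> norm (a' - b')"
      proof -
        have "norm (a - b) = m * norm (a' - b')"
          using m unfolding ab by (simp add: scaleR_diff_right[symmetric])
        then show ?thesis using False m by (simp add: not_less mult.commute)
      qed
      ultimately have "(q, a', b') \<in> S" using q by (auto simp: S_def)
      then have "c \<le> gap q a' b'" using c(2) by fastforce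
      then have "m powr q * c \<le> gap q a b" unfolding ab using m by (simp add: gap_scaleR mult_left_mono)
      then have *: "m powr q \<le> gap q a b / c" using c(1) by (simp add: pos_le_divide_eq)
      have "norm (a - b) \<le> 2 * m" using norm_triangle_ineq4[of a b] unfolding m_def by linarith
      then have "norm (a - b) powr q \<le> (2 * m) powr q" using q1 by (intro powr_mono2) auto
      also have "\<dots> = 2 powr q * m powr q" using m by (simp add: powr_mult)
      also have "\<dots> \<le> 2 powr pp * (gap q a b / c)" using q * by (intro mult_mono) auto
      finally have "norm (a - b) powr q \<le> C * gap q a b" by (simp add: C_def)
      then show ?thesis using e by (simp add: add_increasing)
    qed
  qed
  with C that show ?thesis by blast
qed

lemma abs_powr_tendsto_0: "s > 0 \<Longrightarrow> ((\<lambda>h::real. \<bar>h\<bar> powr s) \<longlongrightarrow> 0) (at 0)"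
  using tendsto_powr'[of "\<lambda>h::real. \<bar>h\<bar>" 0 "at 0" "\<lambda>_. s" s] tendsto_rabs_zero[OF tendsto_ident_at[of 0 UNIV]]
  by simp

lemma powr_diff_bound:
  fixes x y q :: real
  assumes q: "q > 1" and xy: "0 \<le> x" "x \<le> z" "0 \<le> y" "y \<le> z"
  shows "\<bar>x powr q - y powr q\<bar> \<le> q * z powr (q - 1) * \<bar>x - y\<bar>"
proof -
  have *: "y powr q - x powr q \<le> q * z powr (q - 1) * (y - x)" if "0 \<le> x" "x < y" "y \<le> z" for x y
  proof -
    have "continuous_on {x..y} (\<lambda>s. s powr q)"
      using that q by (intro continuous_on_powr' continuous_intros) auto
    moreover have d: "((\<lambda>s. s powr q) has_real_derivative q * s powr (q - 1)) (at s)" if "x < s" for s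
      using that \<open>0 \<le> x\<close> by (auto intro!: derivative_eq_intros)
    then have "(\<lambda>s. s powr q) differentiable (at s)" if "x < s" "s < y" for s
      using that real_differentiable_def by blast
    ultimately obtain l s where s: "x < s" "s < y" "((\<lambda>s. s powr q) has_real_derivative l) (at s)"
        "y powr q - x powr q = (y - x) * l"
      using MVT[OF \<open>x < y\<close>] by blast
    then have "y powr q - x powr q = (y - x) * (q * s powr (q - 1))" using DERIV_unique[OF s(3) d] by simp
    note s = s(1,2) this
    have "s powr (q - 1) \<le> z powr (q - 1)" using s that q by (intro powr_mono2) auto
    then show ?thesis using s(3) that q by (simp add: mult.commute mult_left_mono)
  qed
  show ?thesis
  proof (cases x y rule: linorder_cases)
    case less
    then have "y powr q - x powr q \<le> q * z powr (q - 1) * (y - x)" "x powr q \<le> y powr q"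
      using * xy q by (auto intro!: powr_mono2)
    then show ?thesis using less by simp
  next
    case greater
    then have "x powr q - y powr q \<le> q * z powr (q - 1) * (x - y)" "y powr q \<le> x powr q"
      using * xy q by (auto intro!: powr_mono2)
    then show ?thesis using greater by simp
  qed simp
qed

text \<open>The gradient of |a|^q / q. At a = 0 it is 0 for every q, since \<open>powr\<close> with
  base 0 is 0.\<close>

definition flux :: "real \<Rightarrow> 'b::euclidean_space \<Rightarrow> 'b" where
  "flux q a = norm a powr (q - 2) *\<^sub>R a"

lemma norm_flux: "norm (flux q a) = norm a powr (q - 1)"
  by (cases "a = 0") (auto simp: flux_def powr_diff power2_eq_square)

text \<open>Cauchy-Schwarz reduces the claim to the monotonicity of t^(q-1) on the norms.\<close>

lemma flux_monotone:
  assumes "q > 1" shows "(flux q a - flux q b) \<bullet> (a - b) \<ge> 0"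
proof -
  have aa: "flux q c \<bullet> c = norm c powr (q - 1) * norm c" for c :: 'a
    by (cases "c = 0") (auto simp: flux_def powr_diff power2_eq_square dot_square_norm)
  have ab: "flux q c \<bullet> d \<le> norm c powr (q - 1) * norm d" for c d :: 'a
    using norm_cauchy_schwarz[of "flux q c" d] by (simp add: norm_flux)
  have "(norm a powr (q - 1) - norm b powr (q - 1)) * (norm a - norm b) \<ge> 0"
  proof (cases "norm a \<le> norm b")
    case True then show ?thesis using assms by (intro mult_nonpos_nonpos) (auto intro: powr_mono2)
  next
    case False then show ?thesis using assms by (intro mult_nonneg_nonneg) (auto intro: powr_mono2)
  qed
  then show ?thesis using aa[of a] aa[of b] ab[of a b] ab[of b a]
    by (simp add: inner_diff_left inner_diff_right algebra_simps)
qed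

lemma flux_real: "flux q (t::real) = sgn t * \<bar>t\<bar> powr (q - 1)"
  by (cases "t = 0") (auto simp: flux_def powr_diff power2_eq_square sgn_if)

lemma flux_real_less:
  fixes s t :: real assumes q: "q > 1" and st: "s < t" shows "flux q s < flux q t"
proof (cases "s \<ge> 0")
  case True
  then show ?thesis using st q by (cases "s = 0") (auto simp: flux_real intro!: powr_less_mono2)
next
  case False
  then have s: "flux q s < 0" by (simp add: flux_real)
  show ?thesis
  proof (cases "t \<ge> 0")
    case True then have "flux q t \<ge> 0" by (simp add: flux_real sgn_if)
    then show ?thesis using s by linarith
  next
    case False
    then have "\<bar>t\<bar> powr (q - 1) < \<bar>s\<bar> powr (q - 1)" using st q by (intro powr_less_mono2) auto
    then show ?thesis using False st by (simp add: flux_real)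
  qed
qed

text \<open>For a \<noteq> 0 the q-th power of the norm is the power q/2 of a positive quadratic
  polynomial in the step. For a = 0 the quotient is of order |h|^(q-1), which tends to 0 because q >
  1.\<close>

lemma norm_powr_quotient_tendsto:
  fixes a b :: "'b::euclidean_space"
  assumes q: "q > 1"
  shows "(\<lambda>n. (norm (a + (1 / real (Suc n)) *\<^sub>R b) powr q - norm a powr q) / q * real (Suc n)) \<longlonglongrightarrow> flux q a \<bullet> b"
proof -
  have "((\<lambda>t::real. norm (a + t *\<^sub>R b) powr q / q) has_real_derivative flux q a \<bullet> b) (at 0)"
  proof (cases "a = 0")
    case True
    have "((\<lambda>h::real. \<bar>h\<bar> powr (q - 1) * (norm b powr q / q)) \<longlongrightarrow> 0) (at 0)"
      using q by (intro tendsto_mult_left_zero abs_powr_tendsto_0) auto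
    then have "((\<lambda>h::real. norm ((norm (a + (0 + h) *\<^sub>R b) powr q / q - norm (a + 0 *\<^sub>R b) powr q / q) / h)) \<longlongrightarrow> 0) (at 0)"
    proof (rule Lim_transform_eventually)
      show "\<forall>\<^sub>F h in at (0::real). \<bar>h\<bar> powr (q - 1) * (norm b powr q / q) =
          norm ((norm (a + (0 + h) *\<^sub>R b) powr q / q - norm (a + 0 *\<^sub>R b) powr q / q) / h)"
        using q True by (auto simp: eventually_at powr_mult powr_diff abs_mult intro!: exI[of _ 1])
    qed
    from tendsto_norm_zero_cancel[OF this]
    have "((\<lambda>t::real. norm (a + t *\<^sub>R b) powr q / q) has_real_derivative 0) (at 0)"
      unfolding DERIV_def .
    moreover have "flux q a \<bullet> b = 0" using True by (simp add: flux_def)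
    ultimately show ?thesis by (simp only:)
  next
    case False
    have eq: "norm (a + t *\<^sub>R b) powr q = (a \<bullet> a + 2 * t * (a \<bullet> b) + t * t * (b \<bullet> b)) powr (q / 2)" for t
    proof -
      have sq: "c powr q = (c\<^sup>2) powr (q / 2)" if "c \<ge> 0" for c :: real
      proof -
        have "(c\<^sup>2) powr (q / 2) = (c powr 2) powr (q / 2)" using that by simp
        also have "\<dots> = c powr q" by (simp only: powr_powr) simp
        finally show ?thesis by simp
      qed
      have "norm (a + t *\<^sub>R b) powr q = ((norm (a + t *\<^sub>R b))\<^sup>2) powr (q / 2)"
        by (rule sq) simp
      also have "(norm (a + t *\<^sub>R b))\<^sup>2 = a \<bullet> a + 2 * t * (a \<bullet> b) + t * t * (b \<bullet> b)"
        unfolding power2_norm_eq_inner by (simp add: inner_simps inner_commute[of b a] algebra_simps)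
      finally show ?thesis .
    qed
    have aa: "a \<bullet> a > 0" using False by simp
    have "((\<lambda>t. (a \<bullet> a + 2 * t * (a \<bullet> b) + t * t * (b \<bullet> b)) powr (q / 2) / q) has_real_derivative
        (q / 2 * (a \<bullet> a) powr (q / 2 - 1) * (2 * (a \<bullet> b))) / q) (at 0)"
      using aa by (auto intro!: derivative_eq_intros)
    moreover have "(a \<bullet> a) powr (q / 2 - 1) = norm a powr (q - 2)"
    proof -
      have "(a \<bullet> a) powr (q / 2 - 1) = (norm a powr 2) powr (q / 2 - 1)" using False by (simp add: dot_square_norm)
      also have "\<dots> = norm a powr (2 * (q / 2 - 1))" by (rule powr_powr)
      also have "2 * (q / 2 - 1) = q - 2" by simp
      finally show ?thesis .
    qed
    ultimately show ?thesis using q unfolding eq by (simp add: flux_def)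
  qed
  then have *: "((\<lambda>t. (norm (a + t *\<^sub>R b) powr q / q - norm a powr q / q) / t) \<longlongrightarrow> flux q a \<bullet> b) (at 0)"
    by (simp add: DERIV_def)
  have "filterlim (\<lambda>n. 1 / real (Suc n)) (at 0) sequentially"
    unfolding filterlim_at using LIMSEQ_inverse_real_of_nat by (auto simp: inverse_eq_divide)
  from filterlim_compose[OF * this] show ?thesis by (simp add: diff_divide_distrib)
qed

subsection \<open>Variable exponent modulars\<close>

locale variable_exponent = finite_measure M for M :: "'x measure" +
  fixes p :: "'x \<Rightarrow> real" and pm pp :: real
  assumes p_measurable [measurable]: "p \<in> borel_measurable M"
    and pm: "1 < pm" and p_ge: "\<And>x. x \<in> space M \<Longrightarrow> pm \<le> p x" and p_le: "\<And>x. x \<in> space M \<Longrightarrow> p x \<le> pp"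
begin

text \<open>The modular is taken for vector-valued functions, so functions and gradients share one
  theory. Limits are formulated with it instead of the Luxemburg norm, since it is a plain
  integral.\<close>

definition mdl :: "('x \<Rightarrow> 'b::euclidean_space) \<Rightarrow> ennreal" where
  "mdl f = (\<integral>\<^sup>+x. ennreal (norm (f x) powr p x) \<partial>M)"

definition Lp :: "('x \<Rightarrow> 'b::euclidean_space) set" where
  "Lp = {f \<in> borel_measurable M. mdl f < \<infinity>}"

lemma p_gt_1: "x \<in> space M \<Longrightarrow> p x > 1" using pm p_ge by force

lemma p_mem: "x \<in> space M \<Longrightarrow> p x \<in> {pm..pp}" using p_ge p_le by auto

lemma Lp_measurable [measurable_dest]: "f \<in> Lp \<Longrightarrow> f \<in> borel_measurable M"
  by (simp add: Lp_def)

lemma powr_add_le: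
  fixes a b :: "'b::euclidean_space"
  assumes "x \<in> space M"
  shows "norm (a + b) powr p x \<le> 2 powr pp * (norm a powr p x + norm b powr p x)"
proof -
  define m where "m = max (norm a) (norm b)"
  have p0: "p x > 0" "p x \<le> pp" using p_gt_1[OF assms] p_le[OF assms] by auto
  have "norm (a + b) \<le> 2 * m" using norm_triangle_ineq[of a b] unfolding m_def by linarith
  then have "norm (a + b) powr p x \<le> (2 * m) powr p x" using p0 by (intro powr_mono2) auto
  also have "\<dots> = 2 powr p x * m powr p x" by (simp add: powr_mult m_def)
  also have "\<dots> \<le> 2 powr pp * (norm a powr p x + norm b powr p x)"
    using p0 by (intro mult_mono) (auto simp: m_def max_def)
  finally show ?thesis .
qed

text \<open>The modular is not a norm; this inequality with a fixed factor replaces the triangle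
  inequality in limits.\<close>

lemma mdl_add_le:
  assumes [measurable]: "f \<in> borel_measurable M" "g \<in> borel_measurable M"
  shows "mdl (\<lambda>x. f x + g x) \<le> ennreal (2 powr pp) * (mdl f + mdl g)"
proof -
  have "mdl (\<lambda>x. f x + g x) \<le> (\<integral>\<^sup>+x. ennreal (2 powr pp) * (ennreal (norm (f x) powr p x) + ennreal (norm (g x) powr p x)) \<partial>M)"
    unfolding mdl_def
    by (intro nn_integral_mono) (auto simp flip: ennreal_plus ennreal_mult intro!: ennreal_leI powr_add_le)
  also have "\<dots> = ennreal (2 powr pp) * (mdl f + mdl g)"
    unfolding mdl_def by (simp add: nn_integral_cmult nn_integral_add)
  finally show ?thesis .
qed

lemma mdl_cmult_le:
  assumes [measurable]: "f \<in> borel_measurable M"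
  shows "mdl (\<lambda>x. c *\<^sub>R f x) \<le> ennreal (max 1 \<bar>c\<bar> powr pp) * mdl f"
proof -
  have "norm (c *\<^sub>R f x) powr p x \<le> max 1 \<bar>c\<bar> powr pp * norm (f x) powr p x" if "x \<in> space M" for x
  proof -
    have "\<bar>c\<bar> powr p x \<le> max 1 \<bar>c\<bar> powr p x" using p_gt_1[OF that] by (intro powr_mono2) auto
    also have "\<dots> \<le> max 1 \<bar>c\<bar> powr pp" using p_le[OF that] by (intro powr_mono) auto
    finally show ?thesis by (simp add: powr_mult mult_right_mono)
  qed
  then have "mdl (\<lambda>x. c *\<^sub>R f x) \<le> (\<integral>\<^sup>+x. ennreal (max 1 \<bar>c\<bar> powr pp) * ennreal (norm (f x) powr p x) \<partial>M)"
    unfolding mdl_def by (intro nn_integral_mono) (auto simp flip: ennreal_mult intro!: ennreal_leI)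
  also have "\<dots> = ennreal (max 1 \<bar>c\<bar> powr pp) * mdl f" unfolding mdl_def by (simp add: nn_integral_cmult)
  finally show ?thesis .
qed

lemma mdl_mono_AE:
  assumes "AE x in M. norm (f x) \<le> norm (g x)"
  shows "mdl f \<le> mdl g"
  unfolding mdl_def
proof (rule nn_integral_mono_AE)
  show "AE x in M. ennreal (norm (f x) powr p x) \<le> ennreal (norm (g x) powr p x)"
    using assms AE_space
  proof eventually_elim
    case (elim x) then show ?case using p_gt_1[of x] by (intro ennreal_leI powr_mono2) auto
  qed
qed

lemma mdl_cong_AE: "AE x in M. f x = g x \<Longrightarrow> mdl f = mdl g"
  by (intro antisym mdl_mono_AE) (auto elim: eventually_mono)

lemma Lp_zero: "(\<lambda>x. 0) \<in> Lp" by (simp add: Lp_def mdl_def)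

lemma Lp_add: "f \<in> Lp \<Longrightarrow> g \<in> Lp \<Longrightarrow> (\<lambda>x. f x + g x) \<in> Lp"
  using mdl_add_le[of f g] by (auto simp: Lp_def ennreal_mult_less_top intro: le_less_trans)

lemma Lp_cmult: "f \<in> Lp \<Longrightarrow> (\<lambda>x. c *\<^sub>R f x) \<in> Lp"
  using mdl_cmult_le[of f c] by (auto simp: Lp_def ennreal_mult_less_top intro: le_less_trans)

lemma Lp_diff: "f \<in> Lp \<Longrightarrow> g \<in> Lp \<Longrightarrow> (\<lambda>x. f x - g x) \<in> Lp"
  using Lp_add[OF _ Lp_cmult[of g "-1"], of f] by simp

lemma Lp_bound:
  assumes "f \<in> Lp" "g \<in> borel_measurable M" "AE x in M. norm (g x) \<le> norm (f x)"
  shows "g \<in> Lp"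
  using assms mdl_mono_AE[OF assms(3)] by (auto simp: Lp_def intro: le_less_trans)

lemma Lp_bounded:
  assumes [measurable]: "f \<in> borel_measurable M" and "AE x in M. norm (f x) \<le> C"
  shows "f \<in> Lp"
proof -
  have "AE x in M. norm (f x) powr p x \<le> max 1 C powr pp"
    using assms(2) AE_space
  proof eventually_elim
    case (elim x)
    have "norm (f x) powr p x \<le> max 1 C powr p x" using elim p_gt_1[of x] by (intro powr_mono2) auto
    also have "\<dots> \<le> max 1 C powr pp" using elim p_le[of x] by (intro powr_mono) auto
    finally show ?case .
  qed
  then have "mdl f \<le> (\<integral>\<^sup>+x. ennreal (max 1 C powr pp) \<partial>M)"
    unfolding mdl_def by (intro nn_integral_mono_AE) (auto elim!: eventually_mono intro: ennreal_leI)
  also have "\<dots> < \<infinity>" using finite_emeasure_space by (simp add: ennreal_mult_eq_top_iff less_top[symmetric])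
  finally show ?thesis using assms(1) by (simp add: Lp_def)
qed

lemma integrable_powr: "f \<in> Lp \<Longrightarrow> integrable M (\<lambda>x. norm (f x) powr p x)"
  unfolding Lp_def mdl_def by (intro integrableI_nonneg) auto

lemma mdl_eq_integral: "f \<in> Lp \<Longrightarrow> mdl f = ennreal (\<integral>x. norm (f x) powr p x \<partial>M)"
  unfolding mdl_def by (intro nn_integral_eq_integral integrable_powr) auto

text \<open>For t > d the factor t^(1 - p x) is at most d^(1 - pp). On a finite measure space this
  bounds the \<open>L\<^sup>1\<close> norm by the modular up to an additive error that is as small
  as desired.\<close>

lemma le_powr_split:
  fixes t d :: real
  assumes "x \<in> space M" "t \<ge> 0" "0 < d" "d \<le> 1"
  shows "t \<le> d + d powr (1 - pp) * t powr p x"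
proof (cases "t \<le> d")
  case True then show ?thesis by (simp add: add_increasing2)
next
  case False
  have p: "p x > 1" "p x \<le> pp" using p_gt_1 p_le assms by auto
  have "t = t powr (1 - p x) * t powr p x" using False assms by (simp flip: powr_add)
  also have "\<dots> \<le> d powr (1 - pp) * t powr p x"
  proof (intro mult_right_mono)
    have "t powr (1 - p x) \<le> d powr (1 - p x)" using False assms p by (intro powr_mono2') auto
    also have "\<dots> \<le> d powr (1 - pp)" using assms p by (intro powr_mono') auto
    finally show "t powr (1 - p x) \<le> d powr (1 - pp)" .
  qed simp
  finally show ?thesis using assms by simp
qed

lemma Lp_integrable: "f \<in> Lp \<Longrightarrow> integrable M f"
proof (rule Bochner_Integration.integrable_bound)
  assume f: "f \<in> Lp"
  show "integrable M (\<lambda>x. 1 + norm (f x) powr p x)" using integrable_powr[OF f] by simp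
  show "f \<in> borel_measurable M" using f by measurable
  show "AE x in M. norm (f x) \<le> norm (1 + norm (f x) powr p x)"
  proof (rule AE_I2)
    fix x assume "x \<in> space M"
    from le_powr_split[OF this, of "norm (f x)" 1] show "norm (f x) \<le> norm (1 + norm (f x) powr p x)" by simp
  qed
qed

lemma integral_norm_le_mdl:
  assumes f: "f \<in> Lp" and d: "0 < d" "d \<le> 1"
  shows "(\<integral>x. norm (f x) \<partial>M) \<le> d * measure M (space M) + d powr (1 - pp) * enn2real (mdl f)"
proof -
  have "(\<integral>x. norm (f x) \<partial>M) \<le> (\<integral>x. d + d powr (1 - pp) * norm (f x) powr p x \<partial>M)"
    using Lp_integrable[OF f] integrable_powr[OF f] le_powr_split[OF _ _ d]
    by (intro integral_mono) auto
  also have "\<dots> = d * measure M (space M) + d powr (1 - pp) * (\<integral>x. norm (f x) powr p x \<partial>M)"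
    using integrable_powr[OF f] by (simp add: mult.commute)
  finally show ?thesis by (simp add: mdl_eq_integral[OF f])
qed

lemma mdl_small_imp_L1_small:
  assumes e: "e > 0"
  obtains d where "d > 0" "\<And>f :: 'x \<Rightarrow> 'b::euclidean_space. f \<in> Lp \<Longrightarrow> mdl f < ennreal d \<Longrightarrow> (\<integral>x. norm (f x) \<partial>M) < e"
proof -
  define m where "m = measure M (space M) + 1"
  have m: "m > 0" "measure M (space M) \<le> m" by (auto simp: m_def add_nonneg_pos)
  \<comment> \<open>First the split level c makes the additive error at most e/2; then d makes the
    remaining term c^(1 - pp) * d equal to e/2.\<close>
  define c where "c = min 1 (e / (2 * m))"
  have c: "0 < c" "c \<le> 1" using e m unfolding c_def by auto
  have "c * measure M (space M) \<le> e / (2 * m) * m"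
    using m e unfolding c_def by (intro mult_mono) auto
  then have c2: "c * measure M (space M) \<le> e / 2" using m by simp
  define d where "d = e / (2 * c powr (1 - pp))"
  have d: "d > 0" using e c by (simp add: d_def)
  have "(\<integral>x. norm (f x) \<partial>M) < e" if f: "f \<in> Lp" "mdl f < ennreal d" for f :: "'x \<Rightarrow> 'b"
  proof -
    have "enn2real (mdl f) < d" using f(2) d mdl_eq_integral[OF f(1)] by (simp add: ennreal_less_iff)
    then have "c powr (1 - pp) * enn2real (mdl f) < c powr (1 - pp) * d" using c by simp
    also have "\<dots> = e / 2" using c by (simp add: d_def)
    finally show ?thesis using integral_norm_le_mdl[OF f(1) c] c2 by linarith
  qed
  with d that show ?thesis by blast
qed

lemma mdl_tendsto_imp_L1:
  fixes f :: "nat \<Rightarrow> 'x \<Rightarrow> 'b::euclidean_space"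
  assumes f: "\<And>n. f n \<in> Lp" and lim: "(\<lambda>n. mdl (f n)) \<longlonglongrightarrow> 0"
  shows "(\<lambda>n. \<integral>x. norm (f n x) \<partial>M) \<longlonglongrightarrow> 0"
proof (rule LIMSEQ_I)
  fix e :: real assume "e > 0"
  from mdl_small_imp_L1_small[OF this] obtain d where d: "d > 0"
    "\<And>f :: 'x \<Rightarrow> 'b. f \<in> Lp \<Longrightarrow> mdl f < ennreal d \<Longrightarrow> (\<integral>x. norm (f x) \<partial>M) < e" by metis
  obtain N where "\<And>n. n \<ge> N \<Longrightarrow> mdl (f n) < ennreal d"
    using order_tendstoD(2)[OF lim, of "ennreal d"] d(1) by (auto simp: eventually_sequentially)
  then show "\<exists>N. \<forall>n\<ge>N. norm ((\<integral>x. norm (f n x) \<partial>M) - 0) < e" using d(2)[OF f] by auto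
qed

lemma mdl_tendsto_AE_subseq:
  assumes f: "\<And>n. f n \<in> Lp" "g \<in> Lp" and lim: "(\<lambda>n. mdl (\<lambda>x. f n x - g x)) \<longlonglongrightarrow> 0"
  obtains r :: "nat \<Rightarrow> nat" where "strict_mono r" "AE x in M. (\<lambda>n. f (r n) x) \<longlonglongrightarrow> g x"
proof -
  have d: "(\<lambda>x. f n x - g x) \<in> Lp" for n by (intro Lp_diff f)
  from tendsto_L1_AE_subseq[OF Lp_integrable[OF d] mdl_tendsto_imp_L1[OF d lim]]
  obtain r :: "nat \<Rightarrow> nat" where r: "strict_mono r" "AE x in M. (\<lambda>n. f (r n) x - g x) \<longlonglongrightarrow> 0" by blast
  from r(2) have "AE x in M. (\<lambda>n. f (r n) x) \<longlonglongrightarrow> g x"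
    by eventually_elim (simp add: LIM_zero_cancel)
  with r(1) that show ?thesis by blast
qed

lemma mdl_Fatou:
  assumes [measurable]: "\<And>n. f n \<in> borel_measurable M" "g \<in> borel_measurable M"
    and lim: "AE x in M. (\<lambda>n. f n x) \<longlonglongrightarrow> g x" and le: "\<forall>\<^sub>F n in sequentially. mdl (f n) \<le> C"
  shows "mdl g \<le> C"
proof -
  have "mdl g = (\<integral>\<^sup>+x. liminf (\<lambda>n. ennreal (norm (f n x) powr p x)) \<partial>M)"
    unfolding mdl_def
  proof (rule nn_integral_cong_AE)
    show "AE x in M. ennreal (norm (g x) powr p x) = liminf (\<lambda>n. ennreal (norm (f n x) powr p x))"
      using lim AE_space
    proof eventually_elim
      case (elim x)
      have "(\<lambda>n. norm (f n x) powr p x) \<longlonglongrightarrow> norm (g x) powr p x"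
        using elim p_gt_1[of x] by (intro tendsto_powr' tendsto_norm tendsto_const) auto
      then have "(\<lambda>n. ennreal (norm (f n x) powr p x)) \<longlonglongrightarrow> ennreal (norm (g x) powr p x)" by (rule tendsto_ennrealI)
      then show ?case by (rule lim_imp_Liminf[OF sequentially_bot, symmetric])
    qed
  qed
  also have "\<dots> \<le> liminf (\<lambda>n. mdl (f n))" unfolding mdl_def by (rule nn_integral_liminf) measurable
  also have "\<dots> \<le> C"
  proof -
    have "liminf (\<lambda>n. mdl (f n)) \<le> liminf (\<lambda>n. C)" using le by (intro Liminf_mono)
    then show ?thesis by (simp add: Liminf_const)
  qed
  finally show ?thesis .
qed

text \<open>The argument of Riesz and Fischer: a subsequence converges almost everywhere by the
  \<open>L\<^sup>1\<close> theory, and Fatou's lemma carries the Cauchy bound over to the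
  limit.\<close>

lemma mdl_complete:
  fixes f :: "nat \<Rightarrow> 'x \<Rightarrow> 'b::euclidean_space"
  assumes f: "\<And>n. f n \<in> Lp"
    and cauchy: "\<And>e. e > 0 \<Longrightarrow> \<exists>N. \<forall>m\<ge>N. \<forall>n\<ge>N. mdl (\<lambda>x. f m x - f n x) < ennreal e"
  obtains g where "g \<in> Lp" "(\<lambda>n. mdl (\<lambda>x. f n x - g x)) \<longlonglongrightarrow> 0"
proof -
  note [measurable] = Lp_measurable[OF f]
  have d: "(\<lambda>x. f m x - f n x) \<in> Lp" for m n by (intro Lp_diff f)
  have "\<exists>N. \<forall>i\<ge>N. \<forall>j\<ge>N. (\<integral>x. norm (f i x - f j x) \<partial>M) < e" if "e > 0" for e
  proof -
    from mdl_small_imp_L1_small[OF that] obtain \<delta> where \<delta>: "\<delta> > 0"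
      "\<And>f :: 'x \<Rightarrow> 'b. f \<in> Lp \<Longrightarrow> mdl f < ennreal \<delta> \<Longrightarrow> (\<integral>x. norm (f x) \<partial>M) < e" by metis
    then show ?thesis using cauchy[OF \<delta>(1)] d by meson
  qed
  then obtain r :: "nat \<Rightarrow> nat" where r: "strict_mono r" "AE x in M. Cauchy (\<lambda>i. f (r i) x)"
    using cauchy_L1_AE_cauchy_subseq[of M f] Lp_integrable[OF f] by metis
  define g where "g = (\<lambda>x. lim (\<lambda>i. f (r i) x))"
  have [measurable]: "g \<in> borel_measurable M" unfolding g_def by measurable
  have lim: "AE x in M. (\<lambda>i. f (r i) x) \<longlonglongrightarrow> g x"
    using r(2) by eventually_elim (simp add: g_def Cauchy_convergent_iff convergent_LIMSEQ_iff)
  have close: "\<exists>N. \<forall>n\<ge>N. mdl (\<lambda>x. f n x - g x) \<le> ennreal e" if e: "e > 0" for e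
  proof -
    obtain N where N: "\<And>m n. m \<ge> N \<Longrightarrow> n \<ge> N \<Longrightarrow> mdl (\<lambda>x. f m x - f n x) < ennreal e"
      using cauchy[OF e] by blast
    have "mdl (\<lambda>x. f n x - g x) \<le> ennreal e" if n: "n \<ge> N" for n
    proof (rule mdl_Fatou[of "\<lambda>i x. f n x - f (r i) x"])
      show "AE x in M. (\<lambda>i. f n x - f (r i) x) \<longlonglongrightarrow> f n x - g x"
        using lim by eventually_elim (intro tendsto_intros)
      show "\<forall>\<^sub>F i in sequentially. mdl (\<lambda>x. f n x - f (r i) x) \<le> ennreal e"
        using N[OF n] seq_suble[OF r(1)] by (intro eventually_sequentiallyI[of N]) (meson less_imp_le order_trans)
    qed measurable
    then show ?thesis by blast
  qed
  obtain N where "mdl (\<lambda>x. f N x - g x) \<le> ennreal 1" using close[of 1] by auto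
  then have "(\<lambda>x. f N x - g x) \<in> Lp" by (auto simp: Lp_def intro: le_less_trans)
  from Lp_diff[OF f[of N] this] have g: "g \<in> Lp" by simp
  have "(\<lambda>n. mdl (\<lambda>x. f n x - g x)) \<longlonglongrightarrow> 0"
  proof (rule tendsto_zero_ennreal)
    fix e :: real assume e: "e > 0"
    from close[of "e/2"] e obtain N where "\<And>n. n \<ge> N \<Longrightarrow> mdl (\<lambda>x. f n x - g x) \<le> ennreal (e/2)" by auto
    moreover have "ennreal (e/2) < ennreal e" using e by (simp add: ennreal_less_iff)
    ultimately show "\<forall>\<^sub>F n in sequentially. mdl (\<lambda>x. f n x - g x) < ennreal e"
      by (intro eventually_sequentiallyI[of N]) (meson le_less_trans)
  qed
  with g that show ?thesis by blast
qed

lemma mdl_dominated: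
  assumes [measurable]: "\<And>n. f n \<in> borel_measurable M" "g \<in> borel_measurable M"
    and w: "w \<in> Lp" and bound: "\<And>n. AE x in M. norm (f n x) \<le> norm (w x)"
    and lim: "AE x in M. (\<lambda>n. f n x) \<longlonglongrightarrow> g x"
  shows "(\<lambda>n. mdl (\<lambda>x. f n x - g x)) \<longlonglongrightarrow> 0"
proof -
  note [measurable] = Lp_measurable[OF w]
  have "AE x in M. \<forall>n. norm (f n x) \<le> norm (w x)" using bound by (subst AE_all_countable) blast
  with lim have gw: "AE x in M. norm (g x) \<le> norm (w x)"
  proof eventually_elim
    case (elim x)
    then show ?case by (intro LIMSEQ_le_const2[OF tendsto_norm]) auto
  qed
  have "(\<lambda>n. mdl (\<lambda>x. f n x - g x)) \<longlonglongrightarrow> (\<integral>\<^sup>+x. 0 \<partial>M)"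
    unfolding mdl_def
  proof (rule nn_integral_dominated_convergence[where w = "\<lambda>x. ennreal (norm (2 *\<^sub>R w x) powr p x)"])
    show "AE x in M. ennreal (norm (f n x - g x) powr p x) \<le> ennreal (norm (2 *\<^sub>R w x) powr p x)" for n
      using bound[of n] gw AE_space
    proof eventually_elim
      case (elim x)
      have "norm (f n x - g x) \<le> norm (2 *\<^sub>R w x)" using elim norm_triangle_ineq4[of "f n x" "g x"] by simp
      then show ?case using p_gt_1[of x] elim by (intro ennreal_leI powr_mono2) auto
    qed
    show "(\<integral>\<^sup>+x. ennreal (norm (2 *\<^sub>R w x) powr p x) \<partial>M) < \<infinity>"
      using Lp_cmult[OF w, of 2] by (simp add: Lp_def mdl_def)
    show "AE x in M. (\<lambda>n. ennreal (norm (f n x - g x) powr p x)) \<longlonglongrightarrow> 0"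
      using lim AE_space
    proof eventually_elim
      case (elim x)
      have "(\<lambda>n. norm (f n x - g x)) \<longlonglongrightarrow> 0" using elim by (simp add: tendsto_norm_zero LIM_zero)
      then have "(\<lambda>n. norm (f n x - g x) powr p x) \<longlonglongrightarrow> 0 powr p x"
        using p_gt_1[of x] elim by (intro tendsto_powr' tendsto_const) auto
      then show ?case using tendsto_ennrealI by fastforce
    qed
  qed measurable
  then show ?thesis by simp
qed

lemma flux_measurable [measurable]:
  assumes [measurable]: "f \<in> borel_measurable M"
  shows "(\<lambda>x. flux (p x) (f x)) \<in> borel_measurable M"
  unfolding flux_def by measurable

text \<open>A crude form of Young's inequality: both norms are replaced by the larger one.\<close>

lemma flux_inner_bound:
  assumes "x \<in> space M"
  shows "\<bar>flux (p x) a \<bullet> b\<bar> \<le> norm a powr p x + norm b powr p x"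
proof -
  define m where "m = max (norm a) (norm b)"
  have "\<bar>flux (p x) a \<bullet> b\<bar> \<le> norm a powr (p x - 1) * norm b"
    using Cauchy_Schwarz_ineq2[of "flux (p x) a" b] by (simp add: norm_flux)
  also have "\<dots> \<le> m powr (p x - 1) * m"
    using p_gt_1[OF assms] by (intro mult_mono powr_mono2) (auto simp: m_def)
  also have "\<dots> = m powr p x"
    by (cases "m = 0") (auto simp: powr_diff m_def max_def)
  also have "\<dots> \<le> norm a powr p x + norm b powr p x" by (auto simp: m_def max_def)
  finally show ?thesis .
qed

lemma flux_inner_integrable:
  assumes f: "f \<in> Lp" and g: "g \<in> Lp"
  shows "integrable M (\<lambda>x. flux (p x) (f x) \<bullet> g x)"
proof (rule Bochner_Integration.integrable_bound)
  note [measurable] = Lp_measurable[OF f] Lp_measurable[OF g]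
  show "integrable M (\<lambda>x. norm (f x) powr p x + norm (g x) powr p x)"
    using integrable_powr[OF f] integrable_powr[OF g] by simp
  show "(\<lambda>x. flux (p x) (f x) \<bullet> g x) \<in> borel_measurable M" by measurable
  show "AE x in M. norm (flux (p x) (f x) \<bullet> g x) \<le> norm (norm (f x) powr p x + norm (g x) powr p x)"
    using flux_inner_bound by (intro AE_I2) auto
qed

end

subsection \<open>Energy minimisers\<close>

text \<open>Minimisation is carried out over any linear set of pairs closed under modular
  convergence; the second component plays the part of the gradient without reference to
  differentiation.\<close>

locale energy_space = variable_exponent M p pm pp for M :: "'x measure" and p pm pp +
  fixes V :: "(('x \<Rightarrow> real) \<times> ('x \<Rightarrow> 'b::euclidean_space)) set"
  assumes V_Lp: "(u, G) \<in> V \<Longrightarrow> u \<in> Lp" "(u, G) \<in> V \<Longrightarrow> G \<in> Lp"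
    and V_zero: "(\<lambda>_. 0, \<lambda>_. 0) \<in> V"
    and V_add: "(u, G) \<in> V \<Longrightarrow> (v, K) \<in> V \<Longrightarrow> (\<lambda>x. u x + v x, \<lambda>x. G x + K x) \<in> V"
    and V_cmult: "(u, G) \<in> V \<Longrightarrow> (\<lambda>x. c * u x, \<lambda>x. c *\<^sub>R G x) \<in> V"
    and V_closed: "(\<And>n. (us n, Gs n) \<in> V) \<Longrightarrow> u \<in> Lp \<Longrightarrow> G \<in> Lp \<Longrightarrow>
       (\<lambda>n. mdl (\<lambda>x. us n x - u x)) \<longlonglongrightarrow> 0 \<Longrightarrow> (\<lambda>n. mdl (\<lambda>x. Gs n x - G x)) \<longlonglongrightarrow> 0 \<Longrightarrow> (u, G) \<in> V"
begin

text \<open>The bound \<open>H\<close> is a parameter, so that later constants depend on it and not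
  on the particular right-hand side.\<close>

definition adm :: "real \<Rightarrow> ('x \<Rightarrow> real) \<Rightarrow> bool" where
  "adm H h \<longleftrightarrow> h \<in> borel_measurable M \<and> (AE x in M. \<bar>h x\<bar> \<le> H)"

definition dens :: "('x \<Rightarrow> real) \<Rightarrow> ('x \<Rightarrow> 'b) \<Rightarrow> 'x \<Rightarrow> real" where
  "dens u G x = (norm (u x) powr p x + norm (G x) powr p x) / p x"

definition energy :: "('x \<Rightarrow> real) \<Rightarrow> ('x \<Rightarrow> real) \<Rightarrow> ('x \<Rightarrow> 'b) \<Rightarrow> real" where
  "energy h u G = (\<integral>x. dens u G x \<partial>M) - (\<integral>x. h x * u x \<partial>M)"

definition total :: "('x \<Rightarrow> real) \<Rightarrow> ('x \<Rightarrow> 'b) \<Rightarrow> real" where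
  "total u G = (\<integral>x. norm (u x) powr p x + norm (G x) powr p x \<partial>M)"

definition gap_int :: "('x \<Rightarrow> real) \<Rightarrow> ('x \<Rightarrow> 'b) \<Rightarrow> ('x \<Rightarrow> real) \<Rightarrow> ('x \<Rightarrow> 'b) \<Rightarrow> real" where
  "gap_int u G v K = (\<integral>x. (gap (p x) (u x) (v x) + gap (p x) (G x) (K x)) / p x \<partial>M)"

abbreviation mid where "mid u v \<equiv> (\<lambda>x. (1/2) *\<^sub>R (u x + v x))"

lemma V_mid: "(u, G) \<in> V \<Longrightarrow> (v, K) \<in> V \<Longrightarrow> (mid u v, mid G K) \<in> V"
  using V_cmult[OF V_add, of u G v K "1/2"] by simp

lemma V_diff: "(u, G) \<in> V \<Longrightarrow> (v, K) \<in> V \<Longrightarrow> (\<lambda>x. u x - v x, \<lambda>x. G x - K x) \<in> V"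
  using V_add[OF _ V_cmult[of v K "-1"], of u G] by simp

lemma adm_integrable:
  assumes h: "adm H h" and u: "u \<in> Lp"
  shows "integrable M (\<lambda>x. h x * u x)"
proof (rule Bochner_Integration.integrable_bound)
  show "integrable M (\<lambda>x. H * u x)" using Lp_integrable[OF u] by simp
  show "(\<lambda>x. h x * u x) \<in> borel_measurable M" using h[unfolded adm_def] Lp_measurable[OF u] by (intro borel_measurable_times) auto
  show "AE x in M. norm (h x * u x) \<le> norm (H * u x)"
    using h unfolding adm_def by (auto simp: abs_mult elim!: eventually_mono intro!: mult_right_mono)
qed

lemma adm_integrable_self: "adm H h \<Longrightarrow> integrable M h"
  unfolding adm_def by (intro integrable_const_bound[of h H]) auto

lemma dens_integrable: "u \<in> Lp \<Longrightarrow> G \<in> Lp \<Longrightarrow> integrable M (dens u G)"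
proof (rule Bochner_Integration.integrable_bound)
  assume *: "u \<in> Lp" "G \<in> Lp"
  note [measurable] = Lp_measurable[OF *(1)] Lp_measurable[OF *(2)]
  show "integrable M (\<lambda>x. norm (u x) powr p x + norm (G x) powr p x)"
    by (intro Bochner_Integration.integrable_add integrable_powr *)
  show "dens u G \<in> borel_measurable M" unfolding dens_def by measurable
  show "AE x in M. norm (dens u G x) \<le> norm (norm (u x) powr p x + norm (G x) powr p x)"
  proof (rule AE_I2)
    fix x assume "x \<in> space M"
    from p_gt_1[OF this] show "norm (dens u G x) \<le> norm (norm (u x) powr p x + norm (G x) powr p x)"
      using mult_left_mono[of 1 "p x" "norm (u x) powr p x + norm (G x) powr p x"]
      by (simp add: dens_def divide_le_eq)
  qed
qed

lemma dens_nonneg: "x \<in> space M \<Longrightarrow> dens u G x \<ge> 0"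
  unfolding dens_def using p_gt_1[of x] by (intro divide_nonneg_nonneg add_nonneg_nonneg) auto

lemma total_integrable: "u \<in> Lp \<Longrightarrow> G \<in> Lp \<Longrightarrow> integrable M (\<lambda>x. norm (u x) powr p x + norm (G x) powr p x)"
  by (intro Bochner_Integration.integrable_add integrable_powr)

lemma total_nonneg: "total u G \<ge> 0"
  unfolding total_def by (intro integral_nonneg_AE) auto

lemma mdl_le_total:
  assumes "u \<in> Lp" "G \<in> Lp"
  shows "mdl u \<le> ennreal (total u G)" "mdl G \<le> ennreal (total u G)"
proof -
  note i = total_integrable[OF assms] integrable_powr[OF assms(1)] integrable_powr[OF assms(2)]
  show "mdl u \<le> ennreal (total u G)"
    unfolding total_def mdl_eq_integral[OF assms(1)] by (intro ennreal_leI integral_mono i) auto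
  show "mdl G \<le> ennreal (total u G)"
    unfolding total_def mdl_eq_integral[OF assms(2)] by (intro ennreal_leI integral_mono i) auto
qed

lemma gap_integrable:
  assumes "u \<in> Lp" "v \<in> Lp"
  shows "integrable M (\<lambda>x. gap (p x) (u x) (v x))"
  unfolding gap_def using assms Lp_cmult[OF Lp_add[OF assms], of "1/2"]
  by (intro Bochner_Integration.integrable_diff Bochner_Integration.integrable_add integrable_mult_right integrable_powr)

lemma gap_div_integrable:
  assumes "u \<in> Lp" "v \<in> Lp" "G \<in> Lp" "K \<in> Lp"
  shows "integrable M (\<lambda>x. (gap (p x) (u x) (v x) + gap (p x) (G x) (K x)) / p x)"
proof (rule Bochner_Integration.integrable_bound)
  show i: "integrable M (\<lambda>x. gap (p x) (u x) (v x) + gap (p x) (G x) (K x))"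
    by (intro Bochner_Integration.integrable_add gap_integrable assms)
  then have "(\<lambda>x. gap (p x) (u x) (v x) + gap (p x) (G x) (K x)) \<in> borel_measurable M" by auto
  then show "(\<lambda>x. (gap (p x) (u x) (v x) + gap (p x) (G x) (K x)) / p x) \<in> borel_measurable M" by measurable
  show "AE x in M. norm ((gap (p x) (u x) (v x) + gap (p x) (G x) (K x)) / p x) \<le> norm (gap (p x) (u x) (v x) + gap (p x) (G x) (K x))"
  proof (rule AE_I2)
    fix x assume "x \<in> space M"
    from p_gt_1[OF this] show "norm ((gap (p x) (u x) (v x) + gap (p x) (G x) (K x)) / p x) \<le> norm (gap (p x) (u x) (v x) + gap (p x) (G x) (K x))"
      using mult_left_mono[of 1 "p x" "\<bar>gap (p x) (u x) (v x) + gap (p x) (G x) (K x)\<bar>"]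
      by (simp add: divide_le_eq)
  qed
qed

lemma distance_le_gap_int:
  assumes e: "e > 0"
  obtains C where "C > 0" "\<And>u G v K. (u, G) \<in> V \<Longrightarrow> (v, K) \<in> V \<Longrightarrow>
     total (\<lambda>x. u x - v x) (\<lambda>x. G x - K x) \<le> e * (total u G + total v K) + C * gap_int u G v K"
proof -
  obtain C1 where C1: "C1 > 0" "\<And>q a b::real. q \<in> {pm..pp} \<Longrightarrow>
     norm (a - b) powr q \<le> e * (norm a powr q + norm b powr q) + C1 * gap q a b"
    using gap_controls_distance[OF pm e, where 'b = real] by metis
  obtain C2 where C2: "C2 > 0" "\<And>q a b::'b. q \<in> {pm..pp} \<Longrightarrow>
     norm (a - b) powr q \<le> e * (norm a powr q + norm b powr q) + C2 * gap q a b"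
    using gap_controls_distance[OF pm e, where 'b = 'b] by metis
  \<comment> \<open>The factor \<open>max 1 pp\<close> compensates the division by p x inside
    \<open>gap_int\<close>.\<close>
  define C where "C = (C1 + C2) * max 1 pp"
  have C: "C > 0" using C1(1) C2(1) unfolding C_def by (intro mult_pos_pos) auto
  have "total (\<lambda>x. u x - v x) (\<lambda>x. G x - K x) \<le> e * (total u G + total v K) + C * gap_int u G v K"
    if "(u, G) \<in> V" "(v, K) \<in> V" for u G v K
  proof -
    note Lp = V_Lp[OF that(1)] V_Lp[OF that(2)]
    note int = total_integrable[OF Lp(1,2)] total_integrable[OF Lp(3,4)] gap_div_integrable[OF Lp(1,3,2,4)]
    have "total (\<lambda>x. u x - v x) (\<lambda>x. G x - K x) \<le> (\<integral>x. e * ((norm (u x) powr p x + norm (G x) powr p x)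
         + (norm (v x) powr p x + norm (K x) powr p x))
       + C * ((gap (p x) (u x) (v x) + gap (p x) (G x) (K x)) / p x) \<partial>M)"
      unfolding total_def
    proof (rule integral_mono)
      show "integrable M (\<lambda>x. norm (u x - v x) powr p x + norm (G x - K x) powr p x)"
        using Lp by (intro total_integrable Lp_diff)
      show "integrable M (\<lambda>x. e * ((norm (u x) powr p x + norm (G x) powr p x)
         + (norm (v x) powr p x + norm (K x) powr p x))
       + C * ((gap (p x) (u x) (v x) + gap (p x) (G x) (K x)) / p x))"
        by (rule Bochner_Integration.integrable_add[OF integrable_mult_right[OF
             Bochner_Integration.integrable_add[OF int(1,2)]] integrable_mult_right[OF int(3)]])
      fix x assume x: "x \<in> space M"
      have g: "gap (p x) (u x) (v x) \<ge> 0" "gap (p x) (G x) (K x) \<ge> 0"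
        using gap_nonneg[OF p_gt_1[OF x]] by auto
      have "C1 * gap (p x) (u x) (v x) + C2 * gap (p x) (G x) (K x)
         \<le> (C1 + C2) * gap (p x) (u x) (v x) + (C1 + C2) * gap (p x) (G x) (K x)"
        using C1(1) C2(1) g by (intro add_mono mult_right_mono) auto
      also have "\<dots> = (C1 + C2) * p x * ((gap (p x) (u x) (v x) + gap (p x) (G x) (K x)) / p x)"
        using p_gt_1[OF x] by (simp add: field_simps)
      also have "\<dots> \<le> C * ((gap (p x) (u x) (v x) + gap (p x) (G x) (K x)) / p x)"
        unfolding C_def using C1(1) C2(1) p_gt_1[OF x] p_le[OF x] g
        by (intro mult_right_mono mult_left_mono) auto
      finally show "norm (u x - v x) powr p x + norm (G x - K x) powr p x \<le>
          e * ((norm (u x) powr p x + norm (G x) powr p x) + (norm (v x) powr p x + norm (K x) powr p x))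
            + C * ((gap (p x) (u x) (v x) + gap (p x) (G x) (K x)) / p x)"
        using C1(2)[OF p_mem[OF x], of "u x" "v x"] C2(2)[OF p_mem[OF x], of "G x" "K x"]
        by (simp add: algebra_simps)
    qed
    also have "\<dots> = e * (total u G + total v K) + C * gap_int u G v K"
      unfolding total_def gap_int_def
      by (subst Bochner_Integration.integral_add[OF integrable_mult_right[OF
            Bochner_Integration.integrable_add[OF int(1,2)]] integrable_mult_right[OF int(3)]])
         (simp only: integral_mult_right_zero Bochner_Integration.integral_add[OF int(1,2)])
    finally show ?thesis .
  qed
  with C that show ?thesis by blast
qed

text \<open>The power terms give the gap exactly, and the linear terms cancel at the midpoint up to
  the coupling of h - k with u - v. With h = k this controls minimising sequences; with two
  right-hand sides it compares their minimisers.\<close>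

lemma gap_int_eq:
  assumes "(u, G) \<in> V" "(v, K) \<in> V" "adm H h" "adm H k"
  shows "gap_int u G v K = energy h u G + energy k v K - energy h (mid u v) (mid G K) - energy k (mid u v) (mid G K)
     + (1/2) * (\<integral>x. (h x - k x) * (u x - v x) \<partial>M)"
proof -
  note Lp = V_Lp[OF assms(1)] V_Lp[OF assms(2)] V_Lp[OF V_mid[OF assms(1,2)]]
  note i = dens_integrable[OF Lp(1,2)] dens_integrable[OF Lp(3,4)] dens_integrable[OF Lp(5,6)]
  note j = adm_integrable[OF assms(3) Lp(1)] adm_integrable[OF assms(3) Lp(3)]
    adm_integrable[OF assms(4) Lp(1)] adm_integrable[OF assms(4) Lp(3)]
  have "gap_int u G v K = (\<integral>x. dens u G x + dens v K x - 2 * dens (mid u v) (mid G K) x \<partial>M)"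
    unfolding gap_int_def dens_def gap_def
    by (intro Bochner_Integration.integral_cong refl) (simp add: add_divide_distrib diff_divide_distrib)
  also have "\<dots> = (\<integral>x. dens u G x \<partial>M) + (\<integral>x. dens v K x \<partial>M) - 2 * (\<integral>x. dens (mid u v) (mid G K) x \<partial>M)"
    using i by simp
  finally have g: "gap_int u G v K = \<dots>" .
  have 1: "(\<integral>x. h x * mid u v x \<partial>M) = (1/2) * ((\<integral>x. h x * u x \<partial>M) + (\<integral>x. h x * v x \<partial>M))"
  proof -
    have "(\<integral>x. h x * mid u v x \<partial>M) = (\<integral>x. (1/2) * (h x * u x + h x * v x) \<partial>M)"
      by (intro Bochner_Integration.integral_cong refl) (simp add: field_simps)
    also have "\<dots> = (1/2) * ((\<integral>x. h x * u x \<partial>M) + (\<integral>x. h x * v x \<partial>M))" using j by simp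
    finally show ?thesis .
  qed
  have 2: "(\<integral>x. k x * mid u v x \<partial>M) = (1/2) * ((\<integral>x. k x * u x \<partial>M) + (\<integral>x. k x * v x \<partial>M))"
  proof -
    have "(\<integral>x. k x * mid u v x \<partial>M) = (\<integral>x. (1/2) * (k x * u x + k x * v x) \<partial>M)"
      by (intro Bochner_Integration.integral_cong refl) (simp add: field_simps)
    also have "\<dots> = (1/2) * ((\<integral>x. k x * u x \<partial>M) + (\<integral>x. k x * v x \<partial>M))" using j by simp
    finally show ?thesis .
  qed
  have 3: "(\<integral>x. (h x - k x) * (u x - v x) \<partial>M) = ((\<integral>x. h x * u x \<partial>M) - (\<integral>x. h x * v x \<partial>M)) - ((\<integral>x. k x * u x \<partial>M) - (\<integral>x. k x * v x \<partial>M))"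
  proof -
    have "(\<integral>x. (h x - k x) * (u x - v x) \<partial>M) = (\<integral>x. (h x * u x - h x * v x) - (k x * u x - k x * v x) \<partial>M)"
      by (simp add: algebra_simps)
    then show ?thesis using j by simp
  qed
  show ?thesis unfolding g energy_def 1 2 3 by (simp add: field_simps)
qed

lemma linear_le_powr:
  assumes H: "H \<ge> 0"
  obtains T where "T \<ge> 0" "\<And>x t. x \<in> space M \<Longrightarrow> t \<ge> 0 \<Longrightarrow> H * t \<le> t powr p x / (2 * p x) + T"
proof -
  \<comment> \<open>Beyond this level t^(pm-1) is at least 2 pp H, and since t > 1 a larger exponent
    only helps. Below it, H t is at most the constant H T0.\<close>
  define T0 where "T0 = max 1 ((2 * pp * H) powr (1 / (pm - 1)))"
  have "H * t \<le> t powr p x / (2 * p x) + H * T0" if x: "x \<in> space M" and t: "t \<ge> 0" for x t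
  proof (cases "t \<le> T0")
    case True
    then have "H * t \<le> H * T0" using H by (intro mult_left_mono)
    then show ?thesis using p_gt_1[OF x] by (simp add: add_increasing)
  next
    case False
    have t1: "t > 1" "t > (2 * pp * H) powr (1 / (pm - 1))" using False unfolding T0_def by auto
    have px: "p x > 1" "pm \<le> p x" "p x \<le> pp" using p_gt_1 p_ge p_le x by auto
    have "2 * pp * H = ((2 * pp * H) powr (1 / (pm - 1))) powr (pm - 1)"
      using pm px H by (simp add: powr_powr)
    also have "\<dots> \<le> t powr (pm - 1)" using t1 pm by (intro powr_mono2) auto
    also have "\<dots> \<le> t powr (p x - 1)" using t1 px by (intro powr_mono) auto
    finally have "2 * pp * H * t \<le> t powr (p x - 1) * t" using t by (intro mult_right_mono)
    also have "\<dots> = t powr p x" using t1 by (simp add: powr_diff)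
    finally have "2 * pp * H * t \<le> t powr p x" .
    moreover have "2 * p x * H * t \<le> 2 * pp * H * t" using px H t by (intro mult_right_mono) auto
    ultimately have "H * t \<le> t powr p x / (2 * p x)" using px by (simp add: field_simps)
    then show ?thesis using H by (simp add: add_increasing2 T0_def)
  qed
  moreover have "H * T0 \<ge> 0" using H by (simp add: T0_def)
  ultimately show ?thesis using that by blast
qed

text \<open>Half of the term |u|^p / p, which comes from the penalty, absorbs the linear term; the
  other half and the gradient term remain.\<close>

lemma total_le_energy:
  assumes H: "H \<ge> 0"
  obtains C where "C \<ge> 0" "\<And>h u G. adm H h \<Longrightarrow> (u, G) \<in> V \<Longrightarrow> total u G \<le> 2 * max 1 pp * (energy h u G + C)"
proof -
  obtain T where T: "T \<ge> 0" "\<And>x t. x \<in> space M \<Longrightarrow> t \<ge> 0 \<Longrightarrow> H * t \<le> t powr p x / (2 * p x) + T"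
    using linear_le_powr[OF H] by metis
  define C where "C = T * measure M (space M)"
  have "total u G \<le> 2 * max 1 pp * (energy h u G + C)" if h: "adm H h" and V: "(u, G) \<in> V" for h u G
  proof -
    note Lp = V_Lp[OF V]
    have "total u G / (2 * max 1 pp) = (\<integral>x. (norm (u x) powr p x + norm (G x) powr p x) / (2 * max 1 pp) \<partial>M)"
      unfolding total_def by simp
    also have "\<dots> \<le> (\<integral>x. dens u G x - h x * u x + T \<partial>M)"
    proof (rule integral_mono_AE)
      show "integrable M (\<lambda>x. (norm (u x) powr p x + norm (G x) powr p x) / (2 * max 1 pp))"
        using total_integrable[OF Lp] by simp
      show "integrable M (\<lambda>x. dens u G x - h x * u x + T)"
        using dens_integrable[OF Lp] adm_integrable[OF h Lp(1)] by simp
      have "AE x in M. \<bar>h x\<bar> \<le> H" using h by (simp add: adm_def)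
      then show "AE x in M. (norm (u x) powr p x + norm (G x) powr p x) / (2 * max 1 pp) \<le> dens u G x - h x * u x + T"
        using AE_space
      proof eventually_elim
        case (elim x)
        have px: "p x > 1" "p x \<le> pp" using p_gt_1 p_le elim by auto
        have "h x * u x \<le> \<bar>h x\<bar> * \<bar>u x\<bar>" by (simp add: abs_mult[symmetric])
        also have "\<dots> \<le> H * \<bar>u x\<bar>" using elim by (intro mult_right_mono) auto
        also have "\<dots> \<le> \<bar>u x\<bar> powr p x / (2 * p x) + T" using T(2)[of x "\<bar>u x\<bar>"] elim by simp
        finally have 1: "h x * u x \<le> \<bar>u x\<bar> powr p x / (2 * p x) + T" .
        have "(norm (u x) powr p x + norm (G x) powr p x) / (2 * max 1 pp) \<le> (norm (u x) powr p x + norm (G x) powr p x) / (2 * p x)"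
          using px by (intro divide_left_mono) auto
        also have "\<dots> \<le> dens u G x - \<bar>u x\<bar> powr p x / (2 * p x)"
          using px by (simp add: dens_def field_simps)
        finally show ?case using 1 by simp
      qed
    qed
    also have "\<dots> = energy h u G + C"
      unfolding energy_def C_def using dens_integrable[OF Lp] adm_integrable[OF h Lp(1)] by simp
    finally have "total u G / (2 * max 1 pp) \<le> energy h u G + C" .
    then show ?thesis by (simp add: pos_divide_le_eq mult.commute)
  qed
  moreover have "C \<ge> 0" unfolding C_def using T(1) by simp
  ultimately show ?thesis using that by blast
qed

definition is_minimizer :: "('x \<Rightarrow> real) \<Rightarrow> ('x \<Rightarrow> real) \<Rightarrow> ('x \<Rightarrow> 'b) \<Rightarrow> bool" where
  "is_minimizer h u G \<longleftrightarrow> (u, G) \<in> V \<and> (\<forall>v K. (v, K) \<in> V \<longrightarrow> energy h u G \<le> energy h v K)"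

lemma energy_zero: "energy h (\<lambda>_. 0) (\<lambda>_. 0) = 0"
  by (simp add: energy_def dens_def)

lemma integral_liminf_le:
  fixes f :: "nat \<Rightarrow> 'x \<Rightarrow> real"
  assumes f: "\<And>n. integrable M (f n)" "\<And>n x. x \<in> space M \<Longrightarrow> f n x \<ge> 0" and g: "integrable M g" "\<And>x. x \<in> space M \<Longrightarrow> g x \<ge> 0"
    and lim: "AE x in M. (\<lambda>n. f n x) \<longlonglongrightarrow> g x" and conv: "(\<lambda>n. \<integral>x. f n x \<partial>M) \<longlonglongrightarrow> L"
  shows "(\<integral>x. g x \<partial>M) \<le> L"
proof -
  have L: "L \<ge> 0" using f(2) by (intro LIMSEQ_le_const[OF conv]) (auto intro!: integral_nonneg_AE AE_I2)
  have "ennreal (\<integral>x. g x \<partial>M) = (\<integral>\<^sup>+x. ennreal (g x) \<partial>M)"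
    using g by (intro nn_integral_eq_integral[symmetric]) (auto intro: AE_I2)
  also have "\<dots> = (\<integral>\<^sup>+x. liminf (\<lambda>n. ennreal (f n x)) \<partial>M)"
    using lim by (intro nn_integral_cong_AE) (auto elim!: eventually_mono intro!: lim_imp_Liminf[symmetric] tendsto_ennrealI)
  also have "\<dots> \<le> liminf (\<lambda>n. \<integral>\<^sup>+x. ennreal (f n x) \<partial>M)"
    using f(1) by (intro nn_integral_liminf) auto
  also have "\<dots> = liminf (\<lambda>n. ennreal (\<integral>x. f n x \<partial>M))"
    using f by (intro arg_cong[where f = liminf] ext nn_integral_eq_integral) (auto intro: AE_I2)
  also have "\<dots> = ennreal L" using conv by (intro lim_imp_Liminf tendsto_ennrealI) auto
  finally show ?thesis using L by simp
qed

lemma V_complete: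
  fixes us :: "nat \<Rightarrow> 'x \<Rightarrow> real" and Gs :: "nat \<Rightarrow> 'x \<Rightarrow> 'b"
  assumes V: "\<And>n. (us n, Gs n) \<in> V"
    and cauchy: "\<And>e. e > 0 \<Longrightarrow> \<exists>N. \<forall>m\<ge>N. \<forall>n\<ge>N. total (\<lambda>x. us m x - us n x) (\<lambda>x. Gs m x - Gs n x) < e"
  obtains u G where "(u, G) \<in> V" "(\<lambda>n. mdl (\<lambda>x. us n x - u x)) \<longlonglongrightarrow> 0" "(\<lambda>n. mdl (\<lambda>x. Gs n x - G x)) \<longlonglongrightarrow> 0"
proof -
  have D: "(\<lambda>x. us m x - us n x) \<in> Lp" "(\<lambda>x. Gs m x - Gs n x) \<in> Lp" for m n
    using V_Lp[OF V] Lp_diff by blast+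
  have "\<exists>N. \<forall>m\<ge>N. \<forall>n\<ge>N. mdl (\<lambda>x. us m x - us n x) < ennreal e \<and> mdl (\<lambda>x. Gs m x - Gs n x) < ennreal e" if e: "e > 0" for e
  proof -
    obtain N where N: "\<And>m n. m \<ge> N \<Longrightarrow> n \<ge> N \<Longrightarrow> total (\<lambda>x. us m x - us n x) (\<lambda>x. Gs m x - Gs n x) < e"
      using cauchy[OF e] by blast
    have "mdl (\<lambda>x. us m x - us n x) < ennreal e \<and> mdl (\<lambda>x. Gs m x - Gs n x) < ennreal e" if "m \<ge> N" "n \<ge> N" for m n
    proof -
      have "ennreal (total (\<lambda>x. us m x - us n x) (\<lambda>x. Gs m x - Gs n x)) < ennreal e"
        using N[OF that] total_nonneg by (simp add: ennreal_less_iff)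
      then show ?thesis using mdl_le_total[OF D] by (meson le_less_trans)
    qed
    then show ?thesis by blast
  qed
  note c = this
  obtain u where u: "u \<in> Lp" "(\<lambda>n. mdl (\<lambda>x. us n x - u x)) \<longlonglongrightarrow> 0"
  proof (rule mdl_complete[of us])
    show "us n \<in> Lp" for n using V_Lp[OF V] by blast
    show "\<exists>N. \<forall>m\<ge>N. \<forall>n\<ge>N. mdl (\<lambda>x. us m x - us n x) < ennreal e" if "e > 0" for e using c[OF that] by blast
  qed blast
  obtain G where G: "G \<in> Lp" "(\<lambda>n. mdl (\<lambda>x. Gs n x - G x)) \<longlonglongrightarrow> 0"
  proof (rule mdl_complete[of Gs])
    show "Gs n \<in> Lp" for n using V_Lp[OF V] by blast
    show "\<exists>N. \<forall>m\<ge>N. \<forall>n\<ge>N. mdl (\<lambda>x. Gs m x - Gs n x) < ennreal e" if "e > 0" for e using c[OF that] by blast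
  qed blast
  show ?thesis using that V_closed[OF V u(1) G(1) u(2) G(2)] u(2) G(2) by blast
qed

text \<open>Midpoints cannot go below the infimum, so along a minimising sequence the gaps tend to 0
  and uniform convexity makes the sequence Cauchy. Convergence is then strong, and Fatou's lemma
  along an almost everywhere convergent subsequence takes the place of weak compactness.\<close>

lemma minimizer_exists:
  assumes H: "H \<ge> 0" and h: "adm H h"
  shows "\<exists>u G. is_minimizer h u G"
proof -
  obtain C where C: "C \<ge> 0" "\<And>h u G. adm H h \<Longrightarrow> (u, G) \<in> V \<Longrightarrow> total u G \<le> 2 * max 1 pp * (energy h u G + C)"
    by (rule total_le_energy[OF H]) blast
  define E where "E = (\<lambda>(u, G). energy h u G) ` V"
  define m where "m = Inf E"
  have lb: "- C \<le> y" if y: "y \<in> E" for y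
  proof -
    obtain u G where uG: "(u, G) \<in> V" "y = energy h u G" using y by (force simp: E_def)
    have "0 \<le> 2 * max 1 pp * (energy h u G + C)" using C(2)[OF h uG(1)] total_nonneg[of u G] by linarith
    then show ?thesis using uG(2) by (simp add: zero_le_mult_iff)
  qed
  then have bdd: "bdd_below E" by (rule bdd_belowI)
  have m_le: "m \<le> energy h u G" if "(u, G) \<in> V" for u G
    unfolding m_def using that by (intro cInf_lower[OF _ bdd]) (auto simp: E_def)
  have "E \<noteq> {}" using V_zero by (auto simp: E_def)
  then have "\<exists>y\<in>E. y < m + 1 / real (Suc n)" for n
    unfolding m_def using cInf_lessD[of E "Inf E + 1 / real (Suc n)"] by fastforce
  then have "\<exists>z\<in>V. energy h (fst z) (snd z) < m + 1 / real (Suc n)" for n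
    unfolding E_def by (force simp: split_beta)
  then obtain z where z: "\<And>n. z n \<in> V" "\<And>n. energy h (fst (z n)) (snd (z n)) < m + 1 / real (Suc n)" by metis
  define us Gs where "us = (\<lambda>n. fst (z n))" and "Gs = (\<lambda>n. snd (z n))"
  have V: "(us n, Gs n) \<in> V" and en: "energy h (us n) (Gs n) < m + 1 / real (Suc n)" for n
    using z unfolding us_def Gs_def by auto
  define S where "S = 2 * max 1 pp * (m + 1 + C)"
  have S: "total (us n) (Gs n) \<le> S" for n
  proof -
    have "1 / real (Suc n) \<le> 1" by simp
    then have "energy h (us n) (Gs n) + C \<le> m + 1 + C" using en[of n] by linarith
    then have "2 * max 1 pp * (energy h (us n) (Gs n) + C) \<le> S" unfolding S_def by (intro mult_left_mono) auto
    then show ?thesis using C(2)[OF h V, of n] by linarith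
  qed
  have S0: "S \<ge> 0" using S[of 0] total_nonneg[of "us 0" "Gs 0"] by linarith
  have gapb: "gap_int (us k) (Gs k) (us l) (Gs l) \<le> 1 / real (Suc k) + 1 / real (Suc l)" for k l
    using gap_int_eq[OF V V h h, of k l] en[of k] en[of l] m_le[OF V_mid[OF V V, of k l]] by simp
  obtain u G where uG: "(u, G) \<in> V" "(\<lambda>n. mdl (\<lambda>x. us n x - u x)) \<longlonglongrightarrow> 0" "(\<lambda>n. mdl (\<lambda>x. Gs n x - G x)) \<longlonglongrightarrow> 0"
  proof (rule V_complete[OF V])
    fix e :: real assume e: "e > 0"
    \<comment> \<open>Both totals are at most S, so the first term of
      \<open>distance_le_gap_int\<close> costs at most e/2; the 1 keeps the divisor positive when S
      = 0.\<close>
    define e1 where "e1 = e / (4 * (S + 1))"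
    have e1: "e1 > 0" using e S0 by (simp add: e1_def)
    have e1S: "e1 * (S + S) \<le> e / 2"
    proof -
      have "e1 * (S + S) \<le> e1 * (2 * (S + 1))" using e1 by (intro mult_left_mono) auto
      also have "\<dots> = e / 2" using S0 by (simp add: e1_def field_simps)
      finally show ?thesis .
    qed
    obtain C' where C': "C' > 0" "\<And>u G v K. (u, G) \<in> V \<Longrightarrow> (v, K) \<in> V \<Longrightarrow>
      total (\<lambda>x. u x - v x) (\<lambda>x. G x - K x) \<le> e1 * (total u G + total v K) + C' * gap_int u G v K"
      by (rule distance_le_gap_int[OF e1]) blast
    obtain N where N: "1 / real (Suc N) < e / (4 * C')" using nat_approx_posE[of "e / (4 * C')"] e C'(1) by auto
    have "total (\<lambda>x. us k x - us l x) (\<lambda>x. Gs k x - Gs l x) < e" if "k \<ge> N" "l \<ge> N" for k l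
    proof -
      have "1 / real (Suc k) \<le> 1 / real (Suc N)" "1 / real (Suc l) \<le> 1 / real (Suc N)"
        using that by (auto simp: frac_le)
      then have "gap_int (us k) (Gs k) (us l) (Gs l) < e / (2 * C')" using gapb[of k l] N by simp
      then have "C' * gap_int (us k) (Gs k) (us l) (Gs l) < e / 2"
        using C'(1) by (simp add: field_simps)
      moreover have "e1 * (total (us k) (Gs k) + total (us l) (Gs l)) \<le> e / 2"
        using e1S S[of k] S[of l] e1 by (intro order_trans[OF mult_left_mono e1S] add_mono) auto
      ultimately show ?thesis using C'(2)[OF V V, of k l] by linarith
    qed
    then show "\<exists>N. \<forall>m\<ge>N. \<forall>n\<ge>N. total (\<lambda>x. us m x - us n x) (\<lambda>x. Gs m x - Gs n x) < e" by blast
  qed blast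
  note Lp = V_Lp[OF uG(1)]
  obtain r1 :: "nat \<Rightarrow> nat" where r1: "strict_mono r1" "AE x in M. (\<lambda>n. us (r1 n) x) \<longlonglongrightarrow> u x"
    using mdl_tendsto_AE_subseq[OF V_Lp(1)[OF V] Lp(1) uG(2)] by metis
  have "(\<lambda>n. mdl (\<lambda>x. Gs (r1 n) x - G x)) \<longlonglongrightarrow> 0"
    using LIMSEQ_subseq_LIMSEQ[OF uG(3) r1(1)] by (simp add: o_def)
  from mdl_tendsto_AE_subseq[OF V_Lp(2)[OF V] Lp(2) this]
  obtain r2 :: "nat \<Rightarrow> nat" where r2: "strict_mono r2" "AE x in M. (\<lambda>n. Gs (r1 (r2 n)) x) \<longlonglongrightarrow> G x" by metis
  define r where "r = r1 \<circ> r2"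
  have r: "strict_mono r" unfolding r_def using r1(1) r2(1) by (rule strict_mono_o)
  have lim: "AE x in M. (\<lambda>n. dens (us (r n)) (Gs (r n)) x) \<longlonglongrightarrow> dens u G x"
    using r1(2) r2(2) AE_space
  proof eventually_elim
    case (elim x)
    have "(\<lambda>n. us (r n) x) \<longlonglongrightarrow> u x" using LIMSEQ_subseq_LIMSEQ[OF elim(1) r2(1)] by (simp add: r_def o_def)
    moreover have "(\<lambda>n. Gs (r n) x) \<longlonglongrightarrow> G x" using elim(2) by (simp add: r_def)
    ultimately show ?case unfolding dens_def using p_gt_1[OF elim(3)]
      by (intro tendsto_divide tendsto_add tendsto_powr' tendsto_norm tendsto_const) auto
  qed
  have hu: "(\<lambda>n. \<integral>x. h x * us n x \<partial>M) \<longlonglongrightarrow> (\<integral>x. h x * u x \<partial>M)"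
  proof -
    have d: "(\<lambda>x. us n x - u x) \<in> Lp" for n using V_Lp(1)[OF V] Lp(1) by (intro Lp_diff)
    have "(\<lambda>n. H * (\<integral>x. norm (us n x - u x) \<partial>M)) \<longlonglongrightarrow> 0"
      using tendsto_mult_right_zero[OF mdl_tendsto_imp_L1[OF d uG(2)]] .
    then have "(\<lambda>n. (\<integral>x. h x * us n x \<partial>M) - (\<integral>x. h x * u x \<partial>M)) \<longlonglongrightarrow> 0"
    proof (rule Lim_null_comparison[rotated], intro always_eventually allI)
      fix n
      have "(\<integral>x. h x * us n x \<partial>M) - (\<integral>x. h x * u x \<partial>M) = (\<integral>x. h x * (us n x - u x) \<partial>M)"
        using adm_integrable[OF h V_Lp(1)[OF V]] adm_integrable[OF h Lp(1)] by (simp add: right_diff_distrib)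
      also have "norm \<dots> \<le> (\<integral>x. norm (h x * (us n x - u x)) \<partial>M)" by (rule Bochner_Integration.integral_norm_bound)
      also have "\<dots> \<le> (\<integral>x. H * norm (us n x - u x) \<partial>M)"
      proof (rule integral_mono_AE)
        show "integrable M (\<lambda>x. norm (h x * (us n x - u x)))" using adm_integrable[OF h d] by (rule integrable_norm)
        show "integrable M (\<lambda>x. H * norm (us n x - u x))" using Lp_integrable[OF d, of n] by simp
        show "AE x in M. norm (h x * (us n x - u x)) \<le> H * norm (us n x - u x)"
          using h unfolding adm_def by (auto simp: abs_mult elim!: eventually_mono intro!: mult_right_mono)
      qed
      finally show "norm ((\<integral>x. h x * us n x \<partial>M) - (\<integral>x. h x * u x \<partial>M)) \<le> H * (\<integral>x. norm (us n x - u x) \<partial>M)" by simp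
    qed
    then show ?thesis by (rule LIM_zero_cancel)
  qed
  have "(\<lambda>n. energy h (us n) (Gs n)) \<longlonglongrightarrow> m"
  proof (rule tendsto_sandwich)
    show "\<forall>\<^sub>F n in sequentially. m \<le> energy h (us n) (Gs n)" using m_le[OF V] by simp
    show "\<forall>\<^sub>F n in sequentially. energy h (us n) (Gs n) \<le> m + 1 / real (Suc n)" using less_imp_le[OF en] by simp
    show "(\<lambda>n. m + 1 / real (Suc n)) \<longlonglongrightarrow> m"
      using tendsto_add[OF tendsto_const LIMSEQ_inverse_real_of_nat, of m] by (simp add: inverse_eq_divide)
  qed simp
  from tendsto_add[OF this hu] have "(\<lambda>n. \<integral>x. dens (us n) (Gs n) x \<partial>M) \<longlonglongrightarrow> m + (\<integral>x. h x * u x \<partial>M)"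
    by (simp add: energy_def)
  from LIMSEQ_subseq_LIMSEQ[OF this r]
  have "(\<lambda>n. \<integral>x. dens (us (r n)) (Gs (r n)) x \<partial>M) \<longlonglongrightarrow> m + (\<integral>x. h x * u x \<partial>M)" by (simp add: o_def)
  with lim have "(\<integral>x. dens u G x \<partial>M) \<le> m + (\<integral>x. h x * u x \<partial>M)"
    by (intro integral_liminf_le[of "\<lambda>n. dens (us (r n)) (Gs (r n))" "dens u G"]
        dens_integrable V_Lp[OF V] Lp dens_nonneg)
  then have "energy h u G \<le> m" by (simp add: energy_def)
  then show ?thesis unfolding is_minimizer_def using uG(1) m_le by (meson order_trans)
qed


text \<open>A minimiser has energy at most that of the zero pair, which is 0; coercivity does the
  rest.\<close>

lemma minimizer_total_bound:
  assumes H: "H \<ge> 0"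
  obtains S where "S \<ge> 0" "\<And>h u G. adm H h \<Longrightarrow> is_minimizer h u G \<Longrightarrow> total u G \<le> S"
proof -
  obtain C where C: "C \<ge> 0" "\<And>h u G. adm H h \<Longrightarrow> (u, G) \<in> V \<Longrightarrow> total u G \<le> 2 * max 1 pp * (energy h u G + C)"
    by (rule total_le_energy[OF H]) blast
  have "total u G \<le> 2 * max 1 pp * C" if h: "adm H h" and m: "is_minimizer h u G" for h u G
  proof -
    have V: "(u, G) \<in> V" and "energy h u G \<le> energy h (\<lambda>_. 0) (\<lambda>_. 0)"
      using m V_zero unfolding is_minimizer_def by auto
    then have "energy h u G + C \<le> C" by (simp add: energy_zero)
    then have "2 * max 1 pp * (energy h u G + C) \<le> 2 * max 1 pp * C" by (intro mult_left_mono) auto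
    with C(2)[OF h V] show ?thesis by linarith
  qed
  moreover have "2 * max 1 pp * C \<ge> 0" using C by simp
  ultimately show ?thesis using that by blast
qed

text \<open>Each minimiser is tested against the common midpoint, so only the coupling term of
  \<open>gap_int_eq\<close> is left to bound the gap. With equal right-hand sides it vanishes, so
  minimisers coincide up to null sets.\<close>

lemma minimizer_stability:
  assumes H: "H \<ge> 0" and e: "e > 0"
  obtains \<delta> where "\<delta> > 0" "\<And>h k u G v K. adm H h \<Longrightarrow> adm H k \<Longrightarrow> is_minimizer h u G \<Longrightarrow> is_minimizer k v K \<Longrightarrow>
     (\<integral>x. (h x - k x) * (u x - v x) \<partial>M) < \<delta> \<Longrightarrow> total (\<lambda>x. u x - v x) (\<lambda>x. G x - K x) < e"
proof -
  obtain S where S: "S \<ge> 0" "\<And>h u G. adm H h \<Longrightarrow> is_minimizer h u G \<Longrightarrow> total u G \<le> S"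
    by (rule minimizer_total_bound[OF H]) blast
  define e1 where "e1 = e / (4 * (S + 1))"
  have e1: "e1 > 0" using e S(1) by (simp add: e1_def)
  have e1S: "e1 * (S + S) \<le> e / 2"
  proof -
    have "e1 * (S + S) \<le> e1 * (2 * (S + 1))" using e1 by (intro mult_left_mono) auto
    also have "\<dots> = e / 2" using S(1) by (simp add: e1_def field_simps)
    finally show ?thesis .
  qed
  obtain C where C: "C > 0" "\<And>u G v K. (u, G) \<in> V \<Longrightarrow> (v, K) \<in> V \<Longrightarrow>
      total (\<lambda>x. u x - v x) (\<lambda>x. G x - K x) \<le> e1 * (total u G + total v K) + C * gap_int u G v K"
    by (rule distance_le_gap_int[OF e1]) blast
  have "total (\<lambda>x. u x - v x) (\<lambda>x. G x - K x) < e"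
    if a: "adm H h" "adm H k" "is_minimizer h u G" "is_minimizer k v K"
      and small: "(\<integral>x. (h x - k x) * (u x - v x) \<partial>M) < e / C" for h k u G v K
  proof -
    have V: "(u, G) \<in> V" "(v, K) \<in> V" using a unfolding is_minimizer_def by auto
    have "energy h u G \<le> energy h (mid u v) (mid G K)" "energy k v K \<le> energy k (mid u v) (mid G K)"
      using a(3,4) V_mid[OF V] unfolding is_minimizer_def by blast+
    then have "gap_int u G v K \<le> (1/2) * (\<integral>x. (h x - k x) * (u x - v x) \<partial>M)"
      using gap_int_eq[OF V a(1,2)] by linarith
    also have "\<dots> < (1/2) * (e / C)" using small by simp
    finally have "gap_int u G v K < (1/2) * (e / C)" .
    then have "C * gap_int u G v K < C * ((1/2) * (e / C))" using C(1) by (rule mult_strict_left_mono)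
    also have "\<dots> = e / 2" using C(1) by simp
    finally have "C * gap_int u G v K < e / 2" .
    moreover have "e1 * (total u G + total v K) \<le> e1 * (S + S)"
      using S(2)[OF a(1,3)] S(2)[OF a(2,4)] e1 by (intro mult_left_mono) auto
    ultimately show ?thesis using C(2)[OF V] e1S by linarith
  qed
  moreover have "e / C > 0" using e C by simp
  ultimately show ?thesis using that by blast
qed

text \<open>The right-hand sides are close only in \<open>L\<^sup>1\<close> while u - v is
  unbounded. Where |u - v| \<le> t the coupling is at most t |h - k|; above, |u - v| is at most t^(1
  - pm) |u - v|^p, whose integral is bounded by the energy.\<close>

lemma minimizer_stability_rhs:
  assumes H: "H \<ge> 0" and e: "e > 0"
  obtains \<delta> where "\<delta> > 0" "\<And>h k u G v K. adm H h \<Longrightarrow> adm H k \<Longrightarrow> is_minimizer h u G \<Longrightarrow> is_minimizer k v K \<Longrightarrow>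
     (\<integral>x. \<bar>h x - k x\<bar> \<partial>M) < \<delta> \<Longrightarrow> total (\<lambda>x. u x - v x) (\<lambda>x. G x - K x) < e"
proof -
  obtain d where d: "d > 0" "\<And>h k u G v K. adm H h \<Longrightarrow> adm H k \<Longrightarrow> is_minimizer h u G \<Longrightarrow> is_minimizer k v K \<Longrightarrow>
     (\<integral>x. (h x - k x) * (u x - v x) \<partial>M) < d \<Longrightarrow> total (\<lambda>x. u x - v x) (\<lambda>x. G x - K x) < e"
    by (rule minimizer_stability[OF H e]) blast
  obtain S where S: "S \<ge> 0" "\<And>h u G. adm H h \<Longrightarrow> is_minimizer h u G \<Longrightarrow> total u G \<le> S"
    by (rule minimizer_total_bound[OF H]) blast
  define Q where "Q = 2 powr pp * (2 * S)"
  have Q: "Q \<ge> 0" using S by (simp add: Q_def)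
  \<comment> \<open>The level t is fixed first, so that the part above it costs less than d/2; then
    d / (2 t) is the admissible distance of the right-hand sides.\<close>
  have "((\<lambda>t. 2 * H * Q * t powr (1 - pm)) \<longlongrightarrow> 0) at_top"
    using tendsto_mult_right_zero[OF tendsto_neg_powr[OF _ filterlim_ident, of "1 - pm"]] pm by simp
  from order_tendstoD(2)[OF this, of "d / 2"] d(1)
  have "\<forall>\<^sub>F t in at_top. 2 * H * Q * t powr (1 - pm) < d / 2" by simp
  with eventually_ge_at_top[of 1] have "\<forall>\<^sub>F t in at_top. t \<ge> 1 \<and> 2 * H * Q * t powr (1 - pm) < d / 2"
    by eventually_elim simp
  then obtain t where t: "t \<ge> 1" "2 * H * Q * t powr (1 - pm) < d / 2"
    by (auto simp: eventually_at_top_linorder)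
  have "total (\<lambda>x. u x - v x) (\<lambda>x. G x - K x) < e"
    if a: "adm H h" "adm H k" "is_minimizer h u G" "is_minimizer k v K"
      and small: "(\<integral>x. \<bar>h x - k x\<bar> \<partial>M) < d / (2 * t)" for h k u G v K
  proof (rule d(2)[OF a])
    have V: "(u, G) \<in> V" "(v, K) \<in> V" using a unfolding is_minimizer_def by auto
    note Lp = V_Lp[OF V(1)] V_Lp[OF V(2)]
    have uv: "(\<lambda>x. u x - v x) \<in> Lp" using Lp by (intro Lp_diff)
    note hk = adm_integrable_self[OF a(1)] adm_integrable_self[OF a(2)]
    have bnd: "t powr (1 - pm) \<ge> 0" by simp
    have "(\<integral>x. (h x - k x) * (u x - v x) \<partial>M) \<le> (\<integral>x. t * \<bar>h x - k x\<bar> + 2 * H * t powr (1 - pm) * norm (u x - v x) powr p x \<partial>M)"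
    proof (rule integral_mono_AE)
      have "integrable M (\<lambda>x. h x * (u x - v x) - k x * (u x - v x))"
        by (intro Bochner_Integration.integrable_diff adm_integrable[OF a(1) uv] adm_integrable[OF a(2) uv])
      then show "integrable M (\<lambda>x. (h x - k x) * (u x - v x))" by (simp add: left_diff_distrib)
      show "integrable M (\<lambda>x. t * \<bar>h x - k x\<bar> + 2 * H * t powr (1 - pm) * norm (u x - v x) powr p x)"
        by (intro Bochner_Integration.integrable_add integrable_mult_right integrable_abs
            Bochner_Integration.integrable_diff hk integrable_powr uv)
      have "AE x in M. \<bar>h x\<bar> \<le> H" "AE x in M. \<bar>k x\<bar> \<le> H" using a(1,2) by (auto simp: adm_def)
      then show "AE x in M. (h x - k x) * (u x - v x) \<le> t * \<bar>h x - k x\<bar> + 2 * H * t powr (1 - pm) * norm (u x - v x) powr p x"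
        using AE_space
      proof eventually_elim
        case (elim x)
        define y where "y = \<bar>u x - v x\<bar>"
        have px: "p x > 1" "pm \<le> p x" using p_gt_1 p_ge elim by auto
        have "y \<le> t + t powr (1 - pm) * y powr p x"
        proof (cases "y \<le> t")
          case False
          then have y: "y > 1" using t by simp
          have "y = y powr (1 - p x) * y powr p x" using y by (simp flip: powr_add)
          also have "\<dots> \<le> t powr (1 - pm) * y powr p x"
          proof (intro mult_right_mono)
            have "y powr (1 - p x) \<le> t powr (1 - p x)" using False t px by (intro powr_mono2') auto
            also have "\<dots> \<le> t powr (1 - pm)" using t px by (intro powr_mono) auto
            finally show "y powr (1 - p x) \<le> t powr (1 - pm)" .
          qed simp
          finally show ?thesis using t by linarith
        qed (simp add: add_increasing2)
        have "(h x - k x) * (u x - v x) \<le> \<bar>h x - k x\<bar> * y" unfolding y_def by (simp add: abs_mult[symmetric])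
        also have "\<dots> \<le> \<bar>h x - k x\<bar> * (t + t powr (1 - pm) * y powr p x)"
          using \<open>y \<le> _\<close> by (intro mult_left_mono) auto
        also have "\<dots> = t * \<bar>h x - k x\<bar> + \<bar>h x - k x\<bar> * (t powr (1 - pm) * y powr p x)" by (simp add: algebra_simps)
        also have "\<bar>h x - k x\<bar> * (t powr (1 - pm) * y powr p x) \<le> (2 * H) * (t powr (1 - pm) * y powr p x)"
          using elim by (intro mult_right_mono) auto
        finally show ?case by (simp add: y_def mult_ac)
      qed
    qed
    also have "\<dots> = t * (\<integral>x. \<bar>h x - k x\<bar> \<partial>M) + 2 * H * t powr (1 - pm) * (\<integral>x. norm (u x - v x) powr p x \<partial>M)"
      using hk integrable_powr[OF uv] by simp
    also have "\<dots> < d / 2 + d / 2"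
    proof (rule add_strict_mono)
      have "t * (\<integral>x. \<bar>h x - k x\<bar> \<partial>M) < t * (d / (2 * t))" using small t by (intro mult_strict_left_mono) auto
      then show "t * (\<integral>x. \<bar>h x - k x\<bar> \<partial>M) < d / 2" using t by simp
      have "(\<integral>x. norm (u x - v x) powr p x \<partial>M) \<le> (\<integral>x. 2 powr pp * (norm (u x) powr p x + norm (v x) powr p x) \<partial>M)"
      proof (rule integral_mono)
        show "integrable M (\<lambda>x. 2 powr pp * (norm (u x) powr p x + norm (v x) powr p x))"
          by (intro integrable_mult_right Bochner_Integration.integrable_add integrable_powr Lp)
        show "norm (u x - v x) powr p x \<le> 2 powr pp * (norm (u x) powr p x + norm (v x) powr p x)" if "x \<in> space M" for x
          using powr_add_le[OF that, of "u x" "- v x"] by simp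
      qed (rule integrable_powr[OF uv])
      also have "\<dots> = 2 powr pp * ((\<integral>x. norm (u x) powr p x \<partial>M) + (\<integral>x. norm (v x) powr p x \<partial>M))"
        using integrable_powr[OF Lp(1)] integrable_powr[OF Lp(3)] by simp
      also have "\<dots> \<le> 2 powr pp * (S + S)"
      proof (intro mult_left_mono add_mono)
        have "(\<integral>x. norm (u x) powr p x \<partial>M) \<le> total u G"
          unfolding total_def using total_integrable[OF Lp(1,2)] integrable_powr[OF Lp(1)] by (intro integral_mono) auto
        then show "(\<integral>x. norm (u x) powr p x \<partial>M) \<le> S" using S(2)[OF a(1,3)] by linarith
        have "(\<integral>x. norm (v x) powr p x \<partial>M) \<le> total v K"
          unfolding total_def using total_integrable[OF Lp(3,4)] integrable_powr[OF Lp(3)] by (intro integral_mono) auto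
        then show "(\<integral>x. norm (v x) powr p x \<partial>M) \<le> S" using S(2)[OF a(2,4)] by linarith
      qed simp
      finally have "(\<integral>x. norm (u x - v x) powr p x \<partial>M) \<le> Q" by (simp add: Q_def)
      then have "2 * H * t powr (1 - pm) * (\<integral>x. norm (u x - v x) powr p x \<partial>M) \<le> 2 * H * t powr (1 - pm) * Q"
        using H bnd by (intro mult_left_mono) auto
      then show "2 * H * t powr (1 - pm) * (\<integral>x. norm (u x - v x) powr p x \<partial>M) < d / 2"
        using t(2) by (simp add: mult_ac)
    qed
    finally show "(\<integral>x. (h x - k x) * (u x - v x) \<partial>M) < d" by simp
  qed
  moreover have "d / (2 * t) > 0" using d t by simp
  ultimately show ?thesis using that by blast
qed

text \<open>In the mean value bound the step length cancels the factor n + 1, which leaves a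
  dominating function independent of n.\<close>

lemma quotient_bound:
  fixes a b :: "'c::euclidean_space"
  assumes x: "x \<in> space M"
  shows "\<bar>(norm (a + (1 / real (Suc n)) *\<^sub>R b) powr p x - norm a powr p x) / p x * real (Suc n)\<bar>
     \<le> 2 powr pp * (norm a powr p x + norm b powr p x)"
proof -
  have px: "p x > 1" using p_gt_1[OF x] .
  define c where "c = a + (1 / real (Suc n)) *\<^sub>R b"
  define z where "z = norm a + norm b"
  have cb: "\<bar>norm c - norm a\<bar> \<le> norm b / real (Suc n)"
    using norm_triangle_ineq3[of c a] unfolding c_def by simp
  have "norm b / real (Suc n) \<le> norm b" 
    using mult_left_mono[of 1 "real (Suc n)" "norm b"] by (simp add: divide_le_eq)
  then have cz: "norm c \<le> z" using cb unfolding z_def by linarith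
  have "\<bar>norm c powr p x - norm a powr p x\<bar> \<le> p x * z powr (p x - 1) * \<bar>norm c - norm a\<bar>"
    by (rule powr_diff_bound[OF px]) (use cz in \<open>auto simp: z_def\<close>)
  also have "\<dots> \<le> p x * z powr (p x - 1) * (norm b / real (Suc n))"
    using cb px by (intro mult_left_mono) auto
  finally have "\<bar>norm c powr p x - norm a powr p x\<bar> \<le> p x * z powr (p x - 1) * (norm b / real (Suc n))" .
  from mult_right_mono[OF divide_right_mono[OF this, of "p x"], of "real (Suc n)"] px
  have "\<bar>(norm c powr p x - norm a powr p x) / p x * real (Suc n)\<bar>
      \<le> (p x * z powr (p x - 1) * (norm b / real (Suc n))) / p x * real (Suc n)"
    by (simp only: abs_mult abs_divide abs_of_nat abs_of_pos[of "p x"])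
  also have "\<dots> = z powr (p x - 1) * norm b" using px by simp
  also have "\<dots> \<le> z powr (p x - 1) * z" by (intro mult_left_mono) (auto simp: z_def)
  also have "\<dots> = z powr p x" by (cases "z = 0") (auto simp: powr_diff z_def)
  also have "\<dots> = norm (norm a + norm b) powr p x" by (simp add: z_def)
  also have "\<dots> \<le> 2 powr pp * (norm a powr p x + norm b powr p x)"
    using powr_add_le[OF x, of "norm a" "norm b"] by simp
  finally show ?thesis by (simp add: c_def)
qed

lemma quotient_integral_tendsto:
  fixes f g :: "'x \<Rightarrow> 'c::euclidean_space"
  assumes f: "f \<in> Lp" and g: "g \<in> Lp"
  shows "(\<lambda>n. \<integral>x. (norm (f x + (1 / real (Suc n)) *\<^sub>R g x) powr p x - norm (f x) powr p x) / p x * real (Suc n) \<partial>M)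
    \<longlonglongrightarrow> (\<integral>x. flux (p x) (f x) \<bullet> g x \<partial>M)"
    and "integrable M (\<lambda>x. (norm (f x + (1 / real (Suc n)) *\<^sub>R g x) powr p x - norm (f x) powr p x) / p x * real (Suc n))"
proof -
  note [measurable] = Lp_measurable[OF f] Lp_measurable[OF g]
  have dom: "integrable M (\<lambda>x. 2 powr pp * (norm (f x) powr p x + norm (g x) powr p x))"
    by (intro integrable_mult_right Bochner_Integration.integrable_add integrable_powr f g)
  show "(\<lambda>n. \<integral>x. (norm (f x + (1 / real (Suc n)) *\<^sub>R g x) powr p x - norm (f x) powr p x) / p x * real (Suc n) \<partial>M)
    \<longlonglongrightarrow> (\<integral>x. flux (p x) (f x) \<bullet> g x \<partial>M)"
  proof (rule integral_dominated_convergence[OF _ _ dom])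
    show "AE x in M. (\<lambda>n. (norm (f x + (1 / real (Suc n)) *\<^sub>R g x) powr p x - norm (f x) powr p x) / p x * real (Suc n))
       \<longlonglongrightarrow> flux (p x) (f x) \<bullet> g x"
      using p_gt_1 by (intro AE_I2 norm_powr_quotient_tendsto)
    show "AE x in M. norm ((norm (f x + (1 / real (Suc n)) *\<^sub>R g x) powr p x - norm (f x) powr p x) / p x * real (Suc n))
      \<le> 2 powr pp * (norm (f x) powr p x + norm (g x) powr p x)" for n
      unfolding real_norm_def by (intro AE_I2 quotient_bound)
  qed measurable
  show "integrable M (\<lambda>x. (norm (f x + (1 / real (Suc n)) *\<^sub>R g x) powr p x - norm (f x) powr p x) / p x * real (Suc n))"
  proof (rule Bochner_Integration.integrable_bound[OF dom])
    show "AE x in M. norm ((norm (f x + (1 / real (Suc n)) *\<^sub>R g x) powr p x - norm (f x) powr p x) / p x * real (Suc n))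
      \<le> norm (2 powr pp * (norm (f x) powr p x + norm (g x) powr p x))"
      unfolding real_norm_def by (intro AE_I2 order_trans[OF quotient_bound abs_ge_self])
  qed measurable
qed

text \<open>Only the positive steps 1/(n+1) are used; the opposite inequality follows from the
  negated direction.\<close>

lemma euler_lagrange_ge:
  assumes h: "adm H h" and m: "is_minimizer h u G" and \<phi>: "(\<phi>, K) \<in> V"
  shows "(\<integral>x. h x * \<phi> x \<partial>M) \<le> (\<integral>x. flux (p x) (u x) * \<phi> x \<partial>M) + (\<integral>x. flux (p x) (G x) \<bullet> K x \<partial>M)"
proof -
  have V: "(u, G) \<in> V" using m by (simp add: is_minimizer_def)
  note Lp = V_Lp[OF V] V_Lp[OF \<phi>]
  define A where "A = (\<lambda>n. \<integral>x. (norm (u x + (1 / real (Suc n)) *\<^sub>R \<phi> x) powr p x - norm (u x) powr p x) / p x * real (Suc n) \<partial>M)"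
  define B where "B = (\<lambda>n. \<integral>x. (norm (G x + (1 / real (Suc n)) *\<^sub>R K x) powr p x - norm (G x) powr p x) / p x * real (Suc n) \<partial>M)"
  have le: "(\<integral>x. h x * \<phi> x \<partial>M) \<le> A n + B n" for n
  proof -
    define t where "t = 1 / real (Suc n)"
    have t: "t > 0" "real (Suc n) = 1 / t" by (auto simp: t_def)
    have V': "(\<lambda>x. u x + t * \<phi> x, \<lambda>x. G x + t *\<^sub>R K x) \<in> V" using V_add[OF V V_cmult[OF \<phi>]] .
    then have "energy h u G \<le> energy h (\<lambda>x. u x + t * \<phi> x) (\<lambda>x. G x + t *\<^sub>R K x)"
      using m unfolding is_minimizer_def by blast
    moreover have "(\<integral>x. h x * (u x + t * \<phi> x) \<partial>M) = (\<integral>x. h x * u x \<partial>M) + t * (\<integral>x. h x * \<phi> x \<partial>M)"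
    proof -
      have "(\<integral>x. h x * (u x + t * \<phi> x) \<partial>M) = (\<integral>x. h x * u x + t * (h x * \<phi> x) \<partial>M)" by (simp add: algebra_simps)
      then show ?thesis using adm_integrable[OF h Lp(1)] adm_integrable[OF h Lp(3)] by simp
    qed
    ultimately have "t * (\<integral>x. h x * \<phi> x \<partial>M) \<le>
        (\<integral>x. dens (\<lambda>x. u x + t * \<phi> x) (\<lambda>x. G x + t *\<^sub>R K x) x \<partial>M) - (\<integral>x. dens u G x \<partial>M)"
      by (simp add: energy_def)
    also have "\<dots> = (\<integral>x. dens (\<lambda>x. u x + t * \<phi> x) (\<lambda>x. G x + t *\<^sub>R K x) x - dens u G x \<partial>M)"
      using dens_integrable[OF V_Lp[OF V']] dens_integrable[OF Lp(1,2)] by simp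
    finally have "(\<integral>x. h x * \<phi> x \<partial>M) \<le>
       (\<integral>x. dens (\<lambda>x. u x + t * \<phi> x) (\<lambda>x. G x + t *\<^sub>R K x) x - dens u G x \<partial>M) * real (Suc n)"
      using t(1) unfolding t(2) by (simp add: field_simps)
    also have "\<dots> = (\<integral>x. (dens (\<lambda>x. u x + t * \<phi> x) (\<lambda>x. G x + t *\<^sub>R K x) x - dens u G x) * real (Suc n) \<partial>M)"
      by (rule integral_mult_left_zero[symmetric])
    also have "\<dots> = (\<integral>x. (norm (u x + t *\<^sub>R \<phi> x) powr p x - norm (u x) powr p x) / p x * real (Suc n)
        + (norm (G x + t *\<^sub>R K x) powr p x - norm (G x) powr p x) / p x * real (Suc n) \<partial>M)"
      unfolding dens_def by (intro Bochner_Integration.integral_cong refl) (simp add: diff_divide_distrib add_divide_distrib algebra_simps)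
    also have "\<dots> = A n + B n" unfolding A_def B_def t_def
      by (rule Bochner_Integration.integral_add[OF quotient_integral_tendsto(2)[OF Lp(1,3)] quotient_integral_tendsto(2)[OF Lp(2,4)]])
    finally show ?thesis .
  qed
  have "(\<lambda>n. A n + B n) \<longlonglongrightarrow> (\<integral>x. flux (p x) (u x) \<bullet> \<phi> x \<partial>M) + (\<integral>x. flux (p x) (G x) \<bullet> K x \<partial>M)"
    unfolding A_def B_def
    by (rule tendsto_add[OF quotient_integral_tendsto(1)[OF Lp(1,3)] quotient_integral_tendsto(1)[OF Lp(2,4)]])
  from LIMSEQ_le_const[OF this] le show ?thesis by simp
qed

lemma euler_lagrange:
  assumes h: "adm H h" and m: "is_minimizer h u G" and \<phi>: "(\<phi>, K) \<in> V"
  shows "(\<integral>x. flux (p x) (u x) * \<phi> x \<partial>M) + (\<integral>x. flux (p x) (G x) \<bullet> K x \<partial>M) = (\<integral>x. h x * \<phi> x \<partial>M)"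
  using euler_lagrange_ge[OF h m \<phi>] euler_lagrange_ge[OF h m V_cmult[OF \<phi>, of "-1"]] by simp

end

subsection \<open>Fixed points of compact maps on \<open>L\<^sup>1\<close>\<close>

text \<open>The library proves Brouwer's theorem only for a fixed Euclidean type; the dimension of the
  finite-dimensional approximations below varies, so the cube is indexed by \<open>{..<n}\<close>.\<close>

lemma brouwer_cube_nat:
  fixes F :: "(nat \<Rightarrow> real) \<Rightarrow> nat \<Rightarrow> real"
  assumes F01: "\<And>c i. (\<And>j. 0 \<le> c j \<and> c j \<le> 1) \<Longrightarrow> 0 \<le> F c i \<and> F c i \<le> 1"
    and cont: "\<And>cs c i. (\<And>k j. 0 \<le> cs k j \<and> cs k j \<le> 1) \<Longrightarrow> (\<And>j. j < n \<Longrightarrow> (\<lambda>k. cs k j) \<longlonglongrightarrow> c j) \<Longrightarrow>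
       (\<And>j. 0 \<le> c j \<and> c j \<le> 1) \<Longrightarrow> (\<lambda>k. F (cs k) i) \<longlonglongrightarrow> F c i"
  obtains c where "\<And>j. 0 \<le> c j \<and> c j \<le> 1" "\<And>i. i < n \<Longrightarrow> F c i = c i"
proof -
  \<comment> \<open>Grid points of mesh 1/(N+1). Coordinates from n on are frozen at 0, and
    \<open>min 1\<close> keeps every index function inside the cube.\<close>
  define pt :: "nat \<Rightarrow> (nat \<Rightarrow> nat) \<Rightarrow> nat \<Rightarrow> real"
    where "pt N x = (\<lambda>i. if i < n then min 1 (real (x i) / real (Suc N)) else 0)" for N x
  have pt01: "0 \<le> pt N x j \<and> pt N x j \<le> 1" for N x j by (simp add: pt_def)
  have "\<exists>q R S. (\<forall>i<n. q i < Suc N) \<and> (\<forall>i<n. (\<forall>j<n. q j \<le> R i j \<and> R i j \<le> q j + 1) \<and> (\<forall>j<n. q j \<le> S i j \<and> S i j \<le> q j + 1) \<and>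
      pt N (R i) i \<le> F (pt N (R i)) i \<and> F (pt N (S i)) i \<le> pt N (S i) i)" for N
  proof -
    \<comment> \<open>Label 0 marks a coordinate that F does not decrease. The labels on the faces
      are forced by the hypotheses of \<open>kuhn_lemma\<close> and agree with this meaning, because
      F maps into the cube.\<close>
    define label :: "(nat \<Rightarrow> nat) \<Rightarrow> nat \<Rightarrow> nat" where
      "label x i = (if x i = 0 then 0 else if x i = Suc N then 1 else if pt N x i \<le> F (pt N x) i then 0 else 1)" for x i
    have lab0: "pt N x i \<le> F (pt N x) i" if "label x i = 0" "i < n" for x i
      using that F01[of "pt N x" i, OF pt01] by (auto simp: label_def pt_def split: if_splits)
    have lab1: "F (pt N x) i \<le> pt N x i" if "label x i = 1" "i < n" "x i \<le> Suc N" for x i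
      using that F01[of "pt N x" i, OF pt01] by (auto simp: label_def pt_def split: if_splits)
    obtain q where q: "\<forall>i<n. q i < Suc N" and q2: "\<forall>i<n. \<exists>r s. (\<forall>j<n. q j \<le> r j \<and> r j \<le> q j + 1) \<and>
        (\<forall>j<n. q j \<le> s j \<and> s j \<le> q j + 1) \<and> label r i \<noteq> label s i"
      by (rule kuhn_lemma[of "Suc N" n label]) (auto simp: label_def)
    have aux: "\<exists>r s. (\<forall>j<n. q j \<le> r j \<and> r j \<le> q j + 1) \<and> (\<forall>j<n. q j \<le> s j \<and> s j \<le> q j + 1) \<and>
       pt N r i \<le> F (pt N r) i \<and> F (pt N s) i \<le> pt N s i"
      if "label a i = 0" "label b i = 1" "i < n" "\<forall>j<n. q j \<le> a j \<and> a j \<le> q j + 1"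
        "\<forall>j<n. q j \<le> b j \<and> b j \<le> q j + 1" for a b i
    proof -
      have "b i \<le> Suc N" using that(3,5) q by fastforce
      then show ?thesis using lab0[OF that(1,3)] lab1[OF that(2,3)] that(4,5)
        by (intro exI[of _ a] exI[of _ b] conjI)
    qed
    have step: "\<exists>r s. (\<forall>j<n. q j \<le> r j \<and> r j \<le> q j + 1) \<and> (\<forall>j<n. q j \<le> s j \<and> s j \<le> q j + 1) \<and>
       pt N r i \<le> F (pt N r) i \<and> F (pt N s) i \<le> pt N s i"
      if i: "i < n" and rs: "\<forall>j<n. q j \<le> r j \<and> r j \<le> q j + 1" "\<forall>j<n. q j \<le> s j \<and> s j \<le> q j + 1" "label r i \<noteq> label s i" for i r s
    proof (cases "label r i = 0")
      case True
      then have "label s i = 1" using rs(3) by (auto simp: label_def split: if_splits)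
      from aux[OF True this i rs(1,2)] show ?thesis .
    next
      case False
      then have "label r i = 1" "label s i = 0" using rs(3) by (auto simp: label_def split: if_splits)
      from aux[OF this(2,1) i rs(2,1)] show ?thesis .
    qed
    have "\<exists>r s. i < n \<longrightarrow> (\<forall>j<n. q j \<le> r j \<and> r j \<le> q j + 1) \<and> (\<forall>j<n. q j \<le> s j \<and> s j \<le> q j + 1) \<and>
       pt N r i \<le> F (pt N r) i \<and> F (pt N s) i \<le> pt N s i" for i
    proof (cases "i < n")
      case True
      obtain r s where "\<forall>j<n. q j \<le> r j \<and> r j \<le> q j + 1" "\<forall>j<n. q j \<le> s j \<and> s j \<le> q j + 1"
         "label r i \<noteq> label s i"
        using mp[OF spec[OF q2] True] by (elim exE conjE)
      from step[OF True this] obtain r s where "(\<forall>j<n. q j \<le> r j \<and> r j \<le> q j + 1) \<and> (\<forall>j<n. q j \<le> s j \<and> s j \<le> q j + 1) \<and>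
       pt N r i \<le> F (pt N r) i \<and> F (pt N s) i \<le> pt N s i" by (elim exE)
      then show ?thesis by (intro exI[of _ r] exI[of _ s] impI)
    qed blast
    then obtain R S where "\<forall>i. i < n \<longrightarrow> (\<forall>j<n. q j \<le> R i j \<and> R i j \<le> q j + 1) \<and> (\<forall>j<n. q j \<le> S i j \<and> S i j \<le> q j + 1) \<and>
       pt N (R i) i \<le> F (pt N (R i)) i \<and> F (pt N (S i)) i \<le> pt N (S i) i" by metis
    with q show ?thesis by (intro exI[of _ q] exI[of _ R] exI[of _ S]) auto
  qed
  then obtain q :: "nat \<Rightarrow> nat \<Rightarrow> nat" and R S :: "nat \<Rightarrow> nat \<Rightarrow> nat \<Rightarrow> nat" where
    all: "\<And>N. (\<forall>i<n. q N i < Suc N) \<and> (\<forall>i<n. (\<forall>j<n. q N j \<le> R N i j \<and> R N i j \<le> q N j + 1) \<and>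
      (\<forall>j<n. q N j \<le> S N i j \<and> S N i j \<le> q N j + 1) \<and>
      pt N (R N i) i \<le> F (pt N (R N i)) i \<and> F (pt N (S N i)) i \<le> pt N (S N i) i)"
    by metis
  have R: "q N j \<le> R N i j \<and> R N i j \<le> q N j + 1" and S: "q N j \<le> S N i j \<and> S N i j \<le> q N j + 1"
    if "i < n" "j < n" for N i j
    using all[of N] that by simp_all
  have FR: "pt N (R N i) i \<le> F (pt N (R N i)) i" and FS: "F (pt N (S N i)) i \<le> pt N (S N i) i" if "i < n" for N i
    using all[of N] that by simp_all
  \<comment> \<open>The base corners of the labelled cells converge along a subsequence. The other
    vertices differ by at most one mesh width in each coordinate, so they have the same
    limit.\<close>
  obtain r :: "nat \<Rightarrow> nat" where r: "strict_mono r" "\<And>j. convergent (\<lambda>k. pt (r k) (q (r k)) j)"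
    by (rule diagonal_subsequence[of "\<lambda>j N. pt N (q N) j" "\<lambda>_. 1"]) (use pt01 in auto)
  define c where "c = (\<lambda>j. lim (\<lambda>k. pt (r k) (q (r k)) j))"
  have c: "(\<lambda>k. pt (r k) (q (r k)) j) \<longlonglongrightarrow> c j" for j
    using r(2)[of j] by (simp add: c_def convergent_LIMSEQ_iff)
  have c01: "0 \<le> c j \<and> c j \<le> 1" for j
    using LIMSEQ_le_const[OF c, of 0 j] LIMSEQ_le_const2[OF c, of j 1] pt01 by auto
  have near: "\<bar>pt N x j - pt N (q N) j\<bar> \<le> 1 / real (Suc N)" if "j < n" "q N j \<le> x j" "x j \<le> q N j + 1" for N x j
  proof -
    have "real (x j) / real (Suc N) \<le> real (q N j) / real (Suc N) + 1 / real (Suc N)"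
      using that by (simp add: add_divide_distrib[symmetric] divide_right_mono)
    moreover have "real (q N j) / real (Suc N) \<le> real (x j) / real (Suc N)"
      using that by (simp add: divide_right_mono)
    moreover have "\<bar>min 1 b - min 1 a\<bar> \<le> t" if "b \<le> a + t" "a \<le> b" for a b t :: real
      using that by (auto simp: min_def)
    ultimately show ?thesis using \<open>j < n\<close> by (simp add: pt_def)
  qed
  have inv0: "(\<lambda>k. 1 / real (Suc (r k))) \<longlonglongrightarrow> 0"
    using LIMSEQ_subseq_LIMSEQ[OF LIMSEQ_inverse_real_of_nat r(1)] by (simp add: o_def inverse_eq_divide)
  have conv: "(\<lambda>k. pt (r k) (X k) j) \<longlonglongrightarrow> c j" if "j < n" "\<And>k. q (r k) j \<le> X k j \<and> X k j \<le> q (r k) j + 1" for X j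
  proof -
    have "(\<lambda>k. pt (r k) (X k) j - pt (r k) (q (r k)) j) \<longlonglongrightarrow> 0"
      by (rule Lim_null_comparison[OF _ inv0]) (use near that in auto)
    from tendsto_add[OF this c[of j]] show ?thesis by simp
  qed
  have "F c i = c i" if i: "i < n" for i
  \<comment> \<open>The vertices S satisfy one inequality and the vertices R the other; continuity
    takes both to the same point c.\<close>
  proof (rule antisym)
    have "(\<lambda>k. F (pt (r k) (S (r k) i)) i) \<longlonglongrightarrow> F c i"
      using conv S i by (intro cont pt01 c01) auto
    moreover have "(\<lambda>k. pt (r k) (S (r k) i) i) \<longlonglongrightarrow> c i" using conv[of i "\<lambda>k. S (r k) i"] S i by auto
    ultimately show "F c i \<le> c i" using FS[OF i] by (intro LIMSEQ_le) auto
    have "(\<lambda>k. F (pt (r k) (R (r k) i)) i) \<longlonglongrightarrow> F c i"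
      using conv R i by (intro cont pt01 c01) auto
    moreover have "(\<lambda>k. pt (r k) (R (r k) i) i) \<longlonglongrightarrow> c i" using conv[of i "\<lambda>k. R (r k) i"] R i by auto
    ultimately show "c i \<le> F c i" using FR[OF i] by (intro LIMSEQ_le) auto
  qed
  with c01 that show ?thesis by blast
qed

text \<open>The Schauder projection: the range of S has a finite e-net \<open>y i\<close>, and
  weights that vanish at distance e or more from S (W c) produce a self-map of a cube of
  coefficients. At a fixed point, W c is an average of net points within e of S (W c).\<close>

lemma schauder_L1_approx:
  fixes S :: "('x \<Rightarrow> real) \<Rightarrow> 'x \<Rightarrow> real"
  assumes int: "\<And>w. integrable M w \<Longrightarrow> integrable M (S w)"
    and compact: "\<And>ws :: nat \<Rightarrow> 'x \<Rightarrow> real. (\<And>n. integrable M (ws n)) \<Longrightarrow>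
       \<exists>r :: nat \<Rightarrow> nat. strict_mono r \<and> (\<forall>e>0. \<exists>N. \<forall>k\<ge>N. \<forall>l\<ge>N. (\<integral>x. \<bar>S (ws (r k)) x - S (ws (r l)) x\<bar> \<partial>M) < e)"
    and cont: "\<And>ws w. (\<And>n. integrable M (ws n)) \<Longrightarrow> integrable M w \<Longrightarrow> (\<And>x. x \<in> space M \<Longrightarrow> (\<lambda>n. ws n x) \<longlonglongrightarrow> w x) \<Longrightarrow>
       (\<lambda>n. \<integral>x. \<bar>S (ws n) x - S w x\<bar> \<partial>M) \<longlonglongrightarrow> 0"
    and e: "e > 0"
  obtains w where "integrable M w" "(\<integral>x. \<bar>S w x - w x\<bar> \<partial>M) \<le> e"
proof -
  define D :: "('x \<Rightarrow> real) \<Rightarrow> ('x \<Rightarrow> real) \<Rightarrow> real" where "D = (\<lambda>u v. \<integral>x. \<bar>u x - v x\<bar> \<partial>M)"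
  have "\<exists>A. finite A \<and> (\<forall>a\<in>A. integrable M a) \<and> (\<forall>w. integrable M w \<longrightarrow> (\<exists>a\<in>A. D (S w) (S a) < e))"
  \<comment> \<open>Without a finite net, repeated picking yields a sequence whose images have
    mutual distance at least e, which contradicts \<open>compact\<close>.\<close>
  proof (rule ccontr)
    assume "\<not> ?thesis"
    then have "\<forall>A. \<exists>w. finite A \<and> (\<forall>a\<in>A. integrable M a) \<longrightarrow> integrable M w \<and> (\<forall>a\<in>A. D (S w) (S a) \<ge> e)"
      by (meson not_less)
    then obtain pick where pick: "\<And>A. finite A \<Longrightarrow> (\<And>a. a \<in> A \<Longrightarrow> integrable M a) \<Longrightarrow>
        integrable M (pick A) \<and> (\<forall>a\<in>A. D (S (pick A)) (S a) \<ge> e)" by metis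
    define g where "g = rec_nat {} (\<lambda>_ A. insert (pick A) A)"
    have g: "g 0 = {}" "g (Suc n) = insert (pick (g n)) (g n)" for n by (auto simp: g_def)
    have gfin: "finite (g n) \<and> (\<forall>a\<in>g n. integrable M a)" for n
    proof (induction n)
      case (Suc n) then show ?case using pick[of "g n"] by (simp add: g)
    qed (simp add: g)
    define ws where "ws = (\<lambda>n. pick (g n))"
    have ws: "integrable M (ws n)" for n using pick[of "g n"] gfin[of n] by (simp add: ws_def)
    have mem: "ws i \<in> g j" if "i < j" for i j
      using that by (induction j) (auto simp: g ws_def less_Suc_eq)
    have sep: "D (S (ws j)) (S (ws i)) \<ge> e" if "i < j" for i j
      using pick[of "g j"] gfin[of j] mem[OF that] by (simp add: ws_def)
    obtain r :: "nat \<Rightarrow> nat" where r: "strict_mono r" "\<forall>e>0. \<exists>N. \<forall>k\<ge>N. \<forall>l\<ge>N. D (S (ws (r k))) (S (ws (r l))) < e"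
      using compact[of ws, OF ws] unfolding D_def by blast
    then obtain N where "\<And>k l. k \<ge> N \<Longrightarrow> l \<ge> N \<Longrightarrow> D (S (ws (r k))) (S (ws (r l))) < e" using e by blast
    from this[of "Suc N" N] sep[of "r N" "r (Suc N)"] show False
      using strict_monoD[OF r(1), of N "Suc N"] by simp
  qed
  then obtain A where A: "finite A" "\<And>a. a \<in> A \<Longrightarrow> integrable M a"
    "\<And>w. integrable M w \<Longrightarrow> \<exists>a\<in>A. D (S w) (S a) < e" by blast
  obtain n and f :: "nat \<Rightarrow> 'x \<Rightarrow> real" where f: "A = f ` {i::nat. i < n}"
    using finite_imp_nat_seg_image_inj_on[OF A(1)] by blast
  define y where "y = (\<lambda>i. S (f i))"
  have y: "integrable M (y i)" if "i < n" for i unfolding y_def using f A(2) that by (intro int) auto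
  define W where "W = (\<lambda>c x. \<Sum>i<n. c i * y i x)"
  have W: "integrable M (W c)" for c unfolding W_def using y by (intro Bochner_Integration.integrable_sum integrable_mult_right) auto
  \<comment> \<open>Positive exactly for net points nearer than e; the net property makes the sum
    \<open>Z\<close> positive, so it may be divided by.\<close>
  define L where "L = (\<lambda>c i. if i < n then max 0 (e - D (S (W c)) (y i)) else 0)"
  define Z where "Z = (\<lambda>c. \<Sum>i<n. L c i)"
  have L0: "L c i \<ge> 0" for c i by (simp add: L_def)
  have Z: "Z c > 0" for c
  proof -
    obtain a where "a \<in> A" "D (S (W c)) (S a) < e" using A(3)[OF W] by blast
    then obtain i where "i < n" "D (S (W c)) (y i) < e" using f unfolding y_def by auto
    then have "i \<in> {..<n}" "L c i > 0" by (auto simp: L_def)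
    then show ?thesis unfolding Z_def using L0 by (intro sum_pos2[of _ i]) auto
  qed
  have LZ: "L c i \<le> Z c" for c i
  proof (cases "i < n")
    case True then show ?thesis unfolding Z_def using L0 by (intro member_le_sum) auto
  next
    case False then show ?thesis using less_imp_le[OF Z[of c]] by (simp add: L_def)
  qed
  \<comment> \<open>The normalised weights sum to 1, so a fixed point in the cube has coefficients
    forming a convex combination.\<close>
  define F where "F = (\<lambda>c i. L c i / Z c)"
  obtain c where c: "\<And>j. 0 \<le> c j \<and> c j \<le> 1" "\<And>i. i < n \<Longrightarrow> F c i = c i"
  proof (rule brouwer_cube_nat[of F n])
    fix c i show "0 \<le> F c i \<and> F c i \<le> 1"
      using L0[of c i] LZ[of c i] Z[of c] by (simp add: F_def)
  next
    fix cs :: "nat \<Rightarrow> nat \<Rightarrow> real" and c i assume lim: "\<And>j. j < n \<Longrightarrow> (\<lambda>k. cs k j) \<longlonglongrightarrow> c j"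
    have "(\<lambda>k. W (cs k) x) \<longlonglongrightarrow> W c x" for x
      unfolding W_def using lim by (intro tendsto_sum tendsto_mult tendsto_const) auto
    then have S0: "(\<lambda>k. D (S (W (cs k))) (S (W c))) \<longlonglongrightarrow> 0"
      unfolding D_def by (intro cont W)
    have D: "(\<lambda>k. D (S (W (cs k))) (y i)) \<longlonglongrightarrow> D (S (W c)) (y i)" if i: "i < n" for i
    proof -
      have "\<bar>D (S (W (cs k))) (y i) - D (S (W c)) (y i)\<bar> \<le> D (S (W (cs k))) (S (W c))" for k
      proof -
        note ii = int[OF W[of "cs k"]] int[OF W[of c]] y[OF i]
        have "D (S (W (cs k))) (y i) - D (S (W c)) (y i) = (\<integral>x. \<bar>S (W (cs k)) x - y i x\<bar> - \<bar>S (W c) x - y i x\<bar> \<partial>M)"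
          unfolding D_def using ii by (intro Bochner_Integration.integral_diff[symmetric]) auto
        also have "\<bar>\<dots>\<bar> \<le> (\<integral>x. \<bar>\<bar>S (W (cs k)) x - y i x\<bar> - \<bar>S (W c) x - y i x\<bar>\<bar> \<partial>M)" by (rule integral_abs_bound)
        also have "\<dots> \<le> D (S (W (cs k))) (S (W c))"
          unfolding D_def using ii by (intro integral_mono) auto
        finally show ?thesis .
      qed
      then have "(\<lambda>k. D (S (W (cs k))) (y i) - D (S (W c)) (y i)) \<longlonglongrightarrow> 0"
        by (intro Lim_null_comparison[OF _ S0]) auto
      then show ?thesis by (rule LIM_zero_cancel)
    qed
    have Lc: "(\<lambda>k. L (cs k) i) \<longlonglongrightarrow> L c i" for i
    proof (cases "i < n")
      case True
      then show ?thesis unfolding L_def using D[OF True] by (auto intro!: tendsto_max tendsto_diff tendsto_const)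
    qed (simp add: L_def)
    then have "(\<lambda>k. Z (cs k)) \<longlonglongrightarrow> Z c" unfolding Z_def by (intro tendsto_sum)
    with Lc show "(\<lambda>k. F (cs k) i) \<longlonglongrightarrow> F c i" unfolding F_def using Z[of c] by (intro tendsto_divide) auto
  qed blast
  have csum: "(\<Sum>i<n. c i) = 1"
  proof -
    have "(\<Sum>i<n. c i) = (\<Sum>i<n. L c i / Z c)" using c(2) by (intro sum.cong) (auto simp: F_def)
    also have "\<dots> = Z c / Z c" unfolding Z_def by (rule sum_divide_distrib[symmetric])
    also have "\<dots> = 1" using Z[of c] by simp
    finally show ?thesis .
  qed
  have cD: "c i * D (S (W c)) (y i) \<le> c i * e" if "i < n" for i
  proof (cases "D (S (W c)) (y i) < e")
    case False
    then have "L c i = 0" using that by (simp add: L_def)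
    then have "c i = 0" using c(2)[OF that] by (simp add: F_def)
    then show ?thesis by simp
  qed (use c(1) in \<open>auto intro!: mult_left_mono\<close>)
  have "D (S (W c)) (W c) \<le> (\<integral>x. (\<Sum>i<n. c i * \<bar>S (W c) x - y i x\<bar>) \<partial>M)"
    unfolding D_def
  proof (rule integral_mono)
    show "integrable M (\<lambda>x. \<bar>S (W c) x - W c x\<bar>)" using int[OF W[of c]] W[of c] by auto
    show "integrable M (\<lambda>x. \<Sum>i<n. c i * \<bar>S (W c) x - y i x\<bar>)"
      using int[OF W[of c]] y by (intro Bochner_Integration.integrable_sum integrable_mult_right integrable_abs Bochner_Integration.integrable_diff) auto
    fix x
    have "S (W c) x - W c x = (\<Sum>i<n. c i) * S (W c) x - W c x" by (simp add: csum)
    also have "\<dots> = (\<Sum>i<n. c i * (S (W c) x - y i x))"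
      unfolding W_def by (simp add: sum_distrib_right sum_subtractf right_diff_distrib)
    finally have "\<bar>S (W c) x - W c x\<bar> \<le> (\<Sum>i<n. \<bar>c i * (S (W c) x - y i x)\<bar>)" by simp
    also have "\<dots> = (\<Sum>i<n. c i * \<bar>S (W c) x - y i x\<bar>)" using c(1) by (simp add: abs_mult)
    finally show "\<bar>S (W c) x - W c x\<bar> \<le> (\<Sum>i<n. c i * \<bar>S (W c) x - y i x\<bar>)" .
  qed
  also have "\<dots> = (\<Sum>i<n. c i * D (S (W c)) (y i))"
    unfolding D_def using int[OF W[of c]] y by (subst Bochner_Integration.integral_sum) auto
  also have "\<dots> \<le> (\<Sum>i<n. c i * e)" using cD by (intro sum_mono) auto
  also have "\<dots> = e" using csum by (simp add: sum_distrib_right[symmetric])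
  finally show ?thesis using that[OF W[of c]] by (simp add: D_def)
qed

context variable_exponent
begin

subsection \<open>Sobolev spaces with zero boundary values\<close>

lemma mdl_tendsto_add:
  assumes "\<And>n. f n \<in> borel_measurable M" "\<And>n. g n \<in> borel_measurable M"
    and "(\<lambda>n. mdl (f n)) \<longlonglongrightarrow> 0" "(\<lambda>n. mdl (g n)) \<longlonglongrightarrow> 0"
  shows "(\<lambda>n. mdl (\<lambda>x. f n x + g n x)) \<longlonglongrightarrow> 0"
proof (rule tendsto_sandwich[OF _ _ tendsto_const])
  show "\<forall>\<^sub>F n in sequentially. mdl (\<lambda>x. f n x + g n x) \<le> ennreal (2 powr pp) * (mdl (f n) + mdl (g n))"
    using mdl_add_le[OF assms(1,2)] by simp
  have "(\<lambda>n. ennreal (2 powr pp) * (mdl (f n) + mdl (g n))) \<longlonglongrightarrow> ennreal (2 powr pp) * (0 + 0)"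
    by (intro ennreal_tendsto_cmult tendsto_add assms) simp
  then show "(\<lambda>n. ennreal (2 powr pp) * (mdl (f n) + mdl (g n))) \<longlonglongrightarrow> 0" by simp
qed simp

lemma mdl_tendsto_cmult:
  assumes "\<And>n. f n \<in> borel_measurable M" "(\<lambda>n. mdl (f n)) \<longlonglongrightarrow> 0"
  shows "(\<lambda>n. mdl (\<lambda>x. c *\<^sub>R f n x)) \<longlonglongrightarrow> 0"
proof (rule tendsto_sandwich[OF _ _ tendsto_const])
  show "\<forall>\<^sub>F n in sequentially. mdl (\<lambda>x. c *\<^sub>R f n x) \<le> ennreal (max 1 \<bar>c\<bar> powr pp) * mdl (f n)"
    using mdl_cmult_le[OF assms(1)] by simp
  have "(\<lambda>n. ennreal (max 1 \<bar>c\<bar> powr pp) * mdl (f n)) \<longlonglongrightarrow> ennreal (max 1 \<bar>c\<bar> powr pp) * 0"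
    by (intro ennreal_tendsto_cmult assms) simp
  then show "(\<lambda>n. ennreal (max 1 \<bar>c\<bar> powr pp) * mdl (f n)) \<longlonglongrightarrow> 0" by simp
qed simp

lemma mdl_tendsto_sum:
  assumes "finite I" "\<And>i n. i \<in> I \<Longrightarrow> f i n \<in> borel_measurable M" "\<And>i. i \<in> I \<Longrightarrow> (\<lambda>n. mdl (f i n)) \<longlonglongrightarrow> 0"
  shows "(\<lambda>n. mdl (\<lambda>x. \<Sum>i\<in>I. f i n x)) \<longlonglongrightarrow> 0"
  using assms
proof (induction I)
  case empty then show ?case by (simp add: mdl_def)
next
  case (insert i I)
  have "(\<lambda>n. mdl (\<lambda>x. f i n x + (\<Sum>i\<in>I. f i n x))) \<longlonglongrightarrow> 0"
    using insert by (intro mdl_tendsto_add borel_measurable_sum) auto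
  then show ?case using insert(1,2) by simp
qed

lemma mdl_tendsto_mono:
  assumes "\<And>n. AE x in M. norm (f n x) \<le> norm (g n x)" "(\<lambda>n. mdl (g n)) \<longlonglongrightarrow> 0"
  shows "(\<lambda>n. mdl (f n)) \<longlonglongrightarrow> 0"
  by (rule tendsto_sandwich[OF _ _ tendsto_const assms(2)]) (use mdl_mono_AE[OF assms(1)] in auto)

lemma mdl_tendsto_components:
  fixes f :: "nat \<Rightarrow> 'x \<Rightarrow> 'b::euclidean_space"
  assumes "\<And>n. f n \<in> borel_measurable M" "\<And>b. b \<in> Basis \<Longrightarrow> (\<lambda>n. mdl (\<lambda>x. f n x \<bullet> b)) \<longlonglongrightarrow> 0"
  shows "(\<lambda>n. mdl (f n)) \<longlonglongrightarrow> 0"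
proof -
  have "(\<lambda>n. mdl (\<lambda>x. \<Sum>b\<in>Basis. (f n x \<bullet> b) *\<^sub>R b)) \<longlonglongrightarrow> 0"
  proof (rule mdl_tendsto_sum)
    fix b :: 'b assume b: "b \<in> Basis"
    show "(\<lambda>x. (f n x \<bullet> b) *\<^sub>R b) \<in> borel_measurable M" for n using assms(1)[of n] by measurable
    have "mdl (\<lambda>x. (f n x \<bullet> b) *\<^sub>R b) = mdl (\<lambda>x. f n x \<bullet> b)" for n using b by (simp add: mdl_def)
    then show "(\<lambda>n. mdl (\<lambda>x. (f n x \<bullet> b) *\<^sub>R b)) \<longlonglongrightarrow> 0" using assms(2)[OF b] by simp
  qed simp
  then show ?thesis by (simp add: euclidean_representation)
qed

lemma Lp_components:
  fixes f :: "'x \<Rightarrow> 'b::euclidean_space"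
  assumes "\<And>b. b \<in> Basis \<Longrightarrow> (\<lambda>x. f x \<bullet> b) \<in> Lp"
  shows "f \<in> Lp"
proof -
  have [measurable]: "(\<lambda>x. f x \<bullet> b) \<in> borel_measurable M" if "b \<in> Basis" for b using assms[OF that] by (rule Lp_measurable)
  have "(\<lambda>x. \<Sum>b\<in>B. (f x \<bullet> b) *\<^sub>R b) \<in> Lp" if "finite B" "B \<subseteq> Basis" for B
    using that
  proof (induction B)
    case empty then show ?case using Lp_zero by simp
  next
    case (insert b B)
    have "(\<lambda>x. (f x \<bullet> b) *\<^sub>R b) \<in> Lp"
    proof -
      have "mdl (\<lambda>x. (f x \<bullet> b) *\<^sub>R b) = mdl (\<lambda>x. f x \<bullet> b)" using insert by (simp add: mdl_def)
      moreover have "(\<lambda>x. (f x \<bullet> b) *\<^sub>R b) \<in> borel_measurable M"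
        using insert by (intro borel_measurable_scaleR borel_measurable_const Lp_measurable assms) auto
      ultimately show ?thesis using assms[of b] insert by (simp add: Lp_def)
    qed
    then show ?case using insert Lp_add by simp
  qed
  from this[of Basis] show ?thesis by (simp add: euclidean_representation)
qed

lemma Lp_component: "f \<in> Lp \<Longrightarrow> b \<in> Basis \<Longrightarrow> (\<lambda>x. f x \<bullet> b) \<in> Lp"
  by (rule Lp_bound) (auto intro!: borel_measurable_inner Lp_measurable simp: Basis_le_norm)

end

text \<open>The Lipschitz condition is asked only when a whole ball lies in \<Omega>: the mean value
  inequality requires a convex region inside \<Omega>, and mollification near a compact set compares
  only such points.\<close>

locale pde_domain =
  fixes \<Omega> :: "'a::euclidean_space set" and p :: "'a \<Rightarrow> real" and pm pp L :: real
  assumes \<Omega>_open: "open \<Omega>" and \<Omega>_bounded: "bounded \<Omega>" and \<Omega>_ne: "\<Omega> \<noteq> {}"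
    and p_meas: "p \<in> borel_measurable (lebesgue_on \<Omega>)"
    and pm_gt_1: "1 < pm" and p_bounds: "\<And>x. x \<in> \<Omega> \<Longrightarrow> pm \<le> p x \<and> p x \<le> pp"
    and L_nonneg: "L \<ge> 0"
    and p_lipschitz: "\<And>x y. cball x (norm (y - x)) \<subseteq> \<Omega> \<Longrightarrow> \<bar>p y - p x\<bar> \<le> L * norm (y - x)"
begin

lemma \<Omega>_lebesgue [measurable]: "\<Omega> \<in> sets lebesgue" using \<Omega>_open by simp

abbreviation "leb \<equiv> lebesgue_on \<Omega>"

sublocale variable_exponent leb p pm pp
proof (intro variable_exponent.intro variable_exponent_axioms.intro finite_measureI)
  have "emeasure lebesgue \<Omega> < \<infinity>"
    using \<Omega>_bounded \<Omega>_lebesgue emeasure_bounded_finite[of \<Omega>] \<Omega>_open by simp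
  then show "emeasure leb (space leb) \<noteq> \<infinity>"
    using \<Omega>_lebesgue by (simp add: emeasure_restrict_space)
qed (use p_meas pm_gt_1 p_bounds in auto)

lemma lebesgue_on_borel: "f \<in> borel_measurable borel \<Longrightarrow> f \<in> borel_measurable leb"
  by (rule borel_measurable_lebesgue_on)

lemma test_fun_Lp:
  assumes "\<phi> \<in> test_fun \<Omega>" shows "\<phi> \<in> Lp" "grad \<phi> \<in> Lp"
proof -
  obtain B where B: "\<And>x. \<bar>\<phi> x\<bar> \<le> B" "\<And>x. norm (grad \<phi> x) \<le> B" using test_fun_bounded[OF assms] by metis
  show "\<phi> \<in> Lp"
    by (rule Lp_bounded[OF lebesgue_on_borel[OF test_fun_measurable(1)[OF assms]], of B]) (simp add: B)
  show "grad \<phi> \<in> Lp"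
    by (rule Lp_bounded[OF lebesgue_on_borel[OF test_fun_measurable(2)[OF assms]], of B]) (simp add: B)
qed

definition approx :: "(nat \<Rightarrow> 'a \<Rightarrow> real) \<Rightarrow> ('a \<Rightarrow> real) \<Rightarrow> ('a \<Rightarrow> 'a) \<Rightarrow> bool" where
  "approx \<phi> u G \<longleftrightarrow> (\<forall>n. \<phi> n \<in> test_fun \<Omega>) \<and> (\<lambda>n. mdl (\<lambda>x. \<phi> n x - u x)) \<longlonglongrightarrow> 0 \<and>
     (\<lambda>n. mdl (\<lambda>x. grad (\<phi> n) x - G x)) \<longlonglongrightarrow> 0"

text \<open>The graph of the gradient on test functions, closed under modular convergence. Carrying
  the gradient along keeps the choice operator in \<open>weak_grad\<close> out of the
  analysis.\<close>

definition V :: "(('a \<Rightarrow> real) \<times> ('a \<Rightarrow> 'a)) set" where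
  "V = {(u, G). u \<in> Lp \<and> G \<in> Lp \<and> (\<exists>\<phi>. approx \<phi> u G)}"

lemma V_E:
  assumes "(u, G) \<in> V"
  obtains \<phi> where "u \<in> Lp" "G \<in> Lp" "\<And>n. \<phi> n \<in> test_fun \<Omega>" "(\<lambda>n. mdl (\<lambda>x. \<phi> n x - u x)) \<longlonglongrightarrow> 0"
     "(\<lambda>n. mdl (\<lambda>x. grad (\<phi> n) x - G x)) \<longlonglongrightarrow> 0"
  using assms unfolding V_def approx_def by auto

lemma V_I:
  assumes "u \<in> Lp" "G \<in> Lp" "\<And>n. \<phi> n \<in> test_fun \<Omega>" "(\<lambda>n. mdl (\<lambda>x. \<phi> n x - u x)) \<longlonglongrightarrow> 0"
     "(\<lambda>n. mdl (\<lambda>x. grad (\<phi> n) x - G x)) \<longlonglongrightarrow> 0"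
  shows "(u, G) \<in> V"
  using assms unfolding V_def approx_def by auto

lemma V_test_fun: "\<phi> \<in> test_fun \<Omega> \<Longrightarrow> (\<phi>, grad \<phi>) \<in> V"
  by (rule V_I[where \<phi> = "\<lambda>_. \<phi>"]) (auto intro: test_fun_Lp simp: mdl_def)

sublocale energy_space leb p pm pp V
proof
  fix u v :: "'a \<Rightarrow> real" and G K :: "'a \<Rightarrow> 'a"
  { assume "(u, G) \<in> V" then show "u \<in> Lp" "G \<in> Lp" by (auto simp: V_def) }
  { assume 1: "(u, G) \<in> V" and 2: "(v, K) \<in> V"
    obtain \<phi> where \<phi>: "u \<in> Lp" "G \<in> Lp" "\<And>n. \<phi> n \<in> test_fun \<Omega>" "(\<lambda>n. mdl (\<lambda>x. \<phi> n x - u x)) \<longlonglongrightarrow> 0"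
     "(\<lambda>n. mdl (\<lambda>x. grad (\<phi> n) x - G x)) \<longlonglongrightarrow> 0" by (rule V_E[OF 1]) blast
    obtain \<psi> where \<psi>: "v \<in> Lp" "K \<in> Lp" "\<And>n. \<psi> n \<in> test_fun \<Omega>" "(\<lambda>n. mdl (\<lambda>x. \<psi> n x - v x)) \<longlonglongrightarrow> 0"
     "(\<lambda>n. mdl (\<lambda>x. grad (\<psi> n) x - K x)) \<longlonglongrightarrow> 0" by (rule V_E[OF 2]) blast
    note Lps = test_fun_Lp[OF \<phi>(3)] test_fun_Lp[OF \<psi>(3)]
    show "(\<lambda>x. u x + v x, \<lambda>x. G x + K x) \<in> V"
    proof (rule V_I)
      show "(\<lambda>x. \<phi> n x + \<psi> n x) \<in> test_fun \<Omega>" for n using \<phi>(3) \<psi>(3) by (rule test_fun_add)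
      have "(\<lambda>n. mdl (\<lambda>x. (\<phi> n x - u x) + (\<psi> n x - v x))) \<longlonglongrightarrow> 0"
        using \<phi> \<psi> Lps by (intro mdl_tendsto_add Lp_measurable Lp_diff) auto
      then show "(\<lambda>n. mdl (\<lambda>x. \<phi> n x + \<psi> n x - (u x + v x))) \<longlonglongrightarrow> 0" by (simp add: algebra_simps)
      have "(\<lambda>n. mdl (\<lambda>x. (grad (\<phi> n) x - G x) + (grad (\<psi> n) x - K x))) \<longlonglongrightarrow> 0"
        using \<phi> \<psi> Lps by (intro mdl_tendsto_add Lp_measurable Lp_diff) auto
      then show "(\<lambda>n. mdl (\<lambda>x. grad (\<lambda>x. \<phi> n x + \<psi> n x) x - (G x + K x))) \<longlonglongrightarrow> 0"
        by (simp add: grad_add test_fun_differentiable[OF \<phi>(3)] test_fun_differentiable[OF \<psi>(3)] algebra_simps)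
    qed (use \<phi> \<psi> Lp_add in auto) }
  { fix c :: real assume 1: "(u, G) \<in> V"
    obtain \<phi> where \<phi>: "u \<in> Lp" "G \<in> Lp" "\<And>n. \<phi> n \<in> test_fun \<Omega>" "(\<lambda>n. mdl (\<lambda>x. \<phi> n x - u x)) \<longlonglongrightarrow> 0"
     "(\<lambda>n. mdl (\<lambda>x. grad (\<phi> n) x - G x)) \<longlonglongrightarrow> 0" by (rule V_E[OF 1]) blast
    note Lps = test_fun_Lp[OF \<phi>(3)]
    show "(\<lambda>x. c * u x, \<lambda>x. c *\<^sub>R G x) \<in> V"
    proof (rule V_I)
      show "(\<lambda>x. c * \<phi> n x) \<in> test_fun \<Omega>" for n using \<phi>(3) by (rule test_fun_cmult)
      have "(\<lambda>n. mdl (\<lambda>x. c *\<^sub>R (\<phi> n x - u x))) \<longlonglongrightarrow> 0"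
        using \<phi> Lps by (intro mdl_tendsto_cmult Lp_measurable Lp_diff) auto
      then show "(\<lambda>n. mdl (\<lambda>x. c * \<phi> n x - c * u x)) \<longlonglongrightarrow> 0" by (simp add: right_diff_distrib)
      have "(\<lambda>n. mdl (\<lambda>x. c *\<^sub>R (grad (\<phi> n) x - G x))) \<longlonglongrightarrow> 0"
        using \<phi> Lps by (intro mdl_tendsto_cmult Lp_measurable Lp_diff) auto
      then show "(\<lambda>n. mdl (\<lambda>x. grad (\<lambda>x. c * \<phi> n x) x - c *\<^sub>R G x)) \<longlonglongrightarrow> 0"
        by (simp add: grad_cmult test_fun_differentiable[OF \<phi>(3)] scaleR_diff_right)
      show "(\<lambda>x. c * u x) \<in> Lp" using Lp_cmult[OF \<phi>(1), of c] by simp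
    qed (use \<phi> Lp_cmult in auto) }
  { have "grad (\<lambda>_. 0) = (\<lambda>_::'a. 0)"
      using grad_cmult[OF differentiable_const, of 0] by (auto simp: fun_eq_iff)
    then show "(\<lambda>_. 0, \<lambda>_. 0) \<in> V" using V_test_fun[OF test_fun_zero] by simp }
  fix us :: "nat \<Rightarrow> 'a \<Rightarrow> real" and Gs :: "nat \<Rightarrow> 'a \<Rightarrow> 'a"
  assume us: "\<And>n. (us n, Gs n) \<in> V" and Lps: "u \<in> Lp" "G \<in> Lp"
    and lim: "(\<lambda>n. mdl (\<lambda>x. us n x - u x)) \<longlonglongrightarrow> 0" "(\<lambda>n. mdl (\<lambda>x. Gs n x - G x)) \<longlonglongrightarrow> 0"
  \<comment> \<open>A diagonal choice: one test function within 1/(n+1) of the n-th pair, in both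
    components.\<close>
  have "\<exists>\<phi>\<in>test_fun \<Omega>. mdl (\<lambda>x. \<phi> x - us n x) < ennreal (1 / real (Suc n)) \<and> mdl (\<lambda>x. grad \<phi> x - Gs n x) < ennreal (1 / real (Suc n))" for n
  proof -
    obtain \<phi> where \<phi>: "\<And>k. \<phi> k \<in> test_fun \<Omega>" "(\<lambda>k. mdl (\<lambda>x. \<phi> k x - us n x)) \<longlonglongrightarrow> 0"
     "(\<lambda>k. mdl (\<lambda>x. grad (\<phi> k) x - Gs n x)) \<longlonglongrightarrow> 0" by (rule V_E[OF us[of n]]) blast
    have "ennreal (1 / real (Suc n)) > 0" by simp
    from eventually_conj[OF order_tendstoD(2)[OF \<phi>(2) this] order_tendstoD(2)[OF \<phi>(3) this]]
    show ?thesis using \<phi>(1) by (auto simp: eventually_sequentially)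
  qed
  then obtain \<phi> where \<phi>: "\<And>n. \<phi> n \<in> test_fun \<Omega>" "\<And>n. mdl (\<lambda>x. \<phi> n x - us n x) < ennreal (1 / real (Suc n))"
    "\<And>n. mdl (\<lambda>x. grad (\<phi> n) x - Gs n x) < ennreal (1 / real (Suc n))" by metis
  have inv: "(\<lambda>n. ennreal (1 / real (Suc n))) \<longlonglongrightarrow> 0"
    using tendsto_ennrealI[OF LIMSEQ_inverse_real_of_nat] by (simp add: inverse_eq_divide)
  have l1: "(\<lambda>n. mdl (\<lambda>x. \<phi> n x - us n x)) \<longlonglongrightarrow> 0"
    by (rule tendsto_sandwich[OF _ _ tendsto_const inv]) (use less_imp_le[OF \<phi>(2)] in auto)
  have l2: "(\<lambda>n. mdl (\<lambda>x. grad (\<phi> n) x - Gs n x)) \<longlonglongrightarrow> 0"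
    by (rule tendsto_sandwich[OF _ _ tendsto_const inv]) (use less_imp_le[OF \<phi>(3)] in auto)
  have usL: "us n \<in> Lp" "Gs n \<in> Lp" for n using us[of n] by (auto simp: V_def)
  show "(u, G) \<in> V"
  proof (rule V_I[OF Lps \<phi>(1)])
    have "(\<lambda>n. mdl (\<lambda>x. (\<phi> n x - us n x) + (us n x - u x))) \<longlonglongrightarrow> 0"
      by (intro mdl_tendsto_add l1 lim Lp_measurable Lp_diff usL Lps test_fun_Lp \<phi>)
    then show "(\<lambda>n. mdl (\<lambda>x. \<phi> n x - u x)) \<longlonglongrightarrow> 0" by simp
    have "(\<lambda>n. mdl (\<lambda>x. (grad (\<phi> n) x - Gs n x) + (Gs n x - G x))) \<longlonglongrightarrow> 0"
      by (intro mdl_tendsto_add l2 lim Lp_measurable Lp_diff usL Lps test_fun_Lp \<phi>)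
    then show "(\<lambda>n. mdl (\<lambda>x. grad (\<phi> n) x - G x)) \<longlonglongrightarrow> 0" by simp
  qed
qed

section \<open>Weak gradients\<close>

lemma integral_test_fun_eq:
  fixes f :: "'a \<Rightarrow> real"
  assumes "f \<in> borel_measurable borel" "\<And>x. x \<notin> \<Omega> \<Longrightarrow> f x = 0"
  shows "integral\<^sup>L leb f = integral\<^sup>L lborel f"
  using integral_lebesgue_on_zero_outside(1)[OF \<Omega>_lebesgue, of f] assms by (simp add: integral_completion)

text \<open>The gradient of the product of the two test functions has integral 0.\<close>

lemma test_fun_parts:
  assumes \<phi>: "\<phi> \<in> test_fun \<Omega>" and \<psi>: "\<psi> \<in> test_fun \<Omega>" and b: "b \<in> Basis"
  shows "integral\<^sup>L leb (\<lambda>x. \<phi> x * partial \<psi> b x) = - integral\<^sup>L leb (\<lambda>x. (grad \<phi> x \<bullet> b) * \<psi> x)"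
proof -
  note m [measurable] = test_fun_measurable[OF \<phi>] test_fun_measurable[OF \<psi>]
    test_fun_measurable(1)[OF test_fun_partial[OF \<phi> b]] test_fun_measurable(1)[OF test_fun_partial[OF \<psi> b]]
  have prod: "(\<lambda>x. \<phi> x * \<psi> x) \<in> test_fun \<Omega>" using test_fun_smooth_mult[OF \<psi> test_fun_smooth[OF \<phi>]] .
  have i1: "integrable lborel (\<lambda>x. \<phi> x * partial \<psi> b x)"
    using test_fun_integrable(1)[OF test_fun_smooth_mult[OF test_fun_partial[OF \<psi> b] test_fun_smooth[OF \<phi>]]] .
  have i2: "integrable lborel (\<lambda>x. \<psi> x * partial \<phi> b x)"
    using test_fun_integrable(1)[OF test_fun_smooth_mult[OF test_fun_partial[OF \<phi> b] test_fun_smooth[OF \<psi>]]] .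
  have "0 = (\<integral>x. grad (\<lambda>x. \<phi> x * \<psi> x) x \<bullet> b \<partial>lborel)" using integral_grad_test_fun[OF prod] by simp
  also have "\<dots> = (\<integral>x. \<phi> x * partial \<psi> b x + \<psi> x * partial \<phi> b x \<partial>lborel)"
    using b by (simp add: grad_mult test_fun_differentiable[OF \<phi>] test_fun_differentiable[OF \<psi>] inner_add_left)
  also have "\<dots> = (\<integral>x. \<phi> x * partial \<psi> b x \<partial>lborel) + (\<integral>x. \<psi> x * partial \<phi> b x \<partial>lborel)"
    using i1 i2 by (rule Bochner_Integration.integral_add)
  finally have eq: "(\<integral>x. \<phi> x * partial \<psi> b x \<partial>lborel) = - (\<integral>x. \<psi> x * partial \<phi> b x \<partial>lborel)" by simp
  have "integral\<^sup>L leb (\<lambda>x. \<phi> x * partial \<psi> b x) = (\<integral>x. \<phi> x * partial \<psi> b x \<partial>lborel)"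
    using test_fun_outside[OF \<phi>] by (intro integral_test_fun_eq) auto
  moreover have "integral\<^sup>L leb (\<lambda>x. (grad \<phi> x \<bullet> b) * \<psi> x) = (\<integral>x. \<psi> x * partial \<phi> b x \<partial>lborel)"
    using test_fun_outside[OF \<psi>] b by (subst integral_test_fun_eq) (auto simp: mult.commute)
  ultimately show ?thesis using eq by simp
qed

lemma integrable_lebesgue_on_compact:
  fixes f :: "'a \<Rightarrow> real"
  assumes f: "integrable leb f" and K: "compact K" "K \<subseteq> \<Omega>"
  shows "integrable (lebesgue_on K) f"
proof -
  have Ks: "K \<in> sets lebesgue" using K(1) by (simp add: compact_imp_closed)
  have "integrable lebesgue (\<lambda>x. indicator \<Omega> x *\<^sub>R f x)"
    using f by (simp add: integrable_restrict_space)
  from integrable_mult_indicator[OF Ks this]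
  have "integrable lebesgue (\<lambda>x. indicator K x *\<^sub>R (indicator \<Omega> x *\<^sub>R f x))" .
  moreover have "(\<lambda>x. indicator K x *\<^sub>R (indicator \<Omega> x *\<^sub>R f x)) = (\<lambda>x. indicator K x *\<^sub>R f x)"
    using K(2) by (auto simp: indicator_def fun_eq_iff)
  ultimately show ?thesis using Ks by (simp add: integrable_restrict_space)
qed

lemma integral_mult_bounded_tendsto:
  assumes f: "\<And>n. f n \<in> Lp" "g \<in> Lp" "(\<lambda>n. mdl (\<lambda>x. f n x - g x)) \<longlonglongrightarrow> 0" and h: "adm H h"
  shows "(\<lambda>n. integral\<^sup>L leb (\<lambda>x. h x * f n x)) \<longlonglongrightarrow> integral\<^sup>L leb (\<lambda>x. h x * g x)"
proof -
  have d: "(\<lambda>x. f n x - g x) \<in> Lp" for n using f by (intro Lp_diff)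
  have "(\<lambda>n. H * (\<integral>x. norm (f n x - g x) \<partial>leb)) \<longlonglongrightarrow> 0"
    using tendsto_mult_right_zero[OF mdl_tendsto_imp_L1[OF d f(3)]] .
  then have "(\<lambda>n. integral\<^sup>L leb (\<lambda>x. h x * f n x) - integral\<^sup>L leb (\<lambda>x. h x * g x)) \<longlonglongrightarrow> 0"
  proof (rule Lim_null_comparison[rotated], intro always_eventually allI)
    fix n
    have "integral\<^sup>L leb (\<lambda>x. h x * f n x) - integral\<^sup>L leb (\<lambda>x. h x * g x) = integral\<^sup>L leb (\<lambda>x. h x * (f n x - g x))"
      using adm_integrable[OF h f(1)] adm_integrable[OF h f(2)] by (simp add: right_diff_distrib)
    also have "norm \<dots> \<le> integral\<^sup>L leb (\<lambda>x. norm (h x * (f n x - g x)))" by (rule Bochner_Integration.integral_norm_bound)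
    also have "\<dots> \<le> integral\<^sup>L leb (\<lambda>x. H * norm (f n x - g x))"
    proof (rule integral_mono_AE)
      show "integrable leb (\<lambda>x. norm (h x * (f n x - g x)))" using adm_integrable[OF h d] by (rule integrable_norm)
      show "integrable leb (\<lambda>x. H * norm (f n x - g x))" using Lp_integrable[OF d, of n] by simp
      show "AE x in leb. norm (h x * (f n x - g x)) \<le> H * norm (f n x - g x)"
        using h unfolding adm_def by (auto simp: abs_mult elim!: eventually_mono intro!: mult_right_mono)
    qed
    finally show "norm (integral\<^sup>L leb (\<lambda>x. h x * f n x) - integral\<^sup>L leb (\<lambda>x. h x * g x)) \<le> H * (\<integral>x. norm (f n x - g x) \<partial>leb)" by simp
  qed
  then show ?thesis by (rule LIM_zero_cancel)
qed

text \<open>Integration by parts holds for the approximating test functions and passes to the limit,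
  because the fixed test function and its derivatives are bounded.\<close>

lemma V_has_weak_gradient:
  assumes "(u, G) \<in> V"
  shows "has_weak_gradient \<Omega> u G"
  unfolding has_weak_gradient_def
proof (intro conjI allI impI ballI)
  obtain \<phi> where \<phi>: "u \<in> Lp" "G \<in> Lp" "\<And>n. \<phi> n \<in> test_fun \<Omega>" "(\<lambda>n. mdl (\<lambda>x. \<phi> n x - u x)) \<longlonglongrightarrow> 0"
     "(\<lambda>n. mdl (\<lambda>x. grad (\<phi> n) x - G x)) \<longlonglongrightarrow> 0" by (rule V_E[OF assms]) blast
  note Gb = Lp_component[OF \<phi>(2)]
  { fix K assume K: "compact K \<and> K \<subseteq> \<Omega>"
    then show "integrable (lebesgue_on K) u" using Lp_integrable[OF \<phi>(1)] integrable_lebesgue_on_compact by blast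
    fix b :: 'a assume "b \<in> Basis"
    then show "integrable (lebesgue_on K) (\<lambda>x. G x \<bullet> b)"
      using Lp_integrable[OF Gb] integrable_lebesgue_on_compact K by blast }
  fix \<psi> b assume \<psi>: "\<psi> \<in> test_fun \<Omega>" and b: "b \<in> (Basis :: 'a set)"
  have adm: "\<exists>H. adm H \<eta>" if \<eta>: "\<eta> \<in> test_fun \<Omega>" for \<eta>
  proof -
    obtain B where "\<And>x. \<bar>\<eta> x\<bar> \<le> B" using test_fun_bounded[OF \<eta>] by metis
    then show ?thesis unfolding adm_def using lebesgue_on_borel[OF test_fun_measurable(1)[OF that]] by (intro exI[of _ B]) simp
  qed
  obtain H1 where H1: "adm H1 (partial \<psi> b)" using adm[OF test_fun_partial[OF \<psi> b]] by blast
  obtain H2 where H2: "adm H2 \<psi>" using adm[OF \<psi>] by blast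
  have l1: "(\<lambda>n. integral\<^sup>L leb (\<lambda>x. partial \<psi> b x * \<phi> n x)) \<longlonglongrightarrow> integral\<^sup>L leb (\<lambda>x. partial \<psi> b x * u x)"
    by (rule integral_mult_bounded_tendsto[OF test_fun_Lp(1)[OF \<phi>(3)] \<phi>(1,4) H1])
  have lb: "(\<lambda>n. mdl (\<lambda>x. grad (\<phi> n) x \<bullet> b - G x \<bullet> b)) \<longlonglongrightarrow> 0"
  proof (rule mdl_tendsto_mono[OF _ \<phi>(5)])
    have "norm (grad (\<phi> n) x \<bullet> b - G x \<bullet> b) \<le> norm (grad (\<phi> n) x - G x)" for n x
      using Basis_le_norm[OF b, of "grad (\<phi> n) x - G x"] by (simp only: inner_diff_left real_norm_def)
    then show "AE x in leb. norm (grad (\<phi> n) x \<bullet> b - G x \<bullet> b) \<le> norm (grad (\<phi> n) x - G x)" for n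
      by (intro AE_I2)
  qed
  have l2: "(\<lambda>n. integral\<^sup>L leb (\<lambda>x. \<psi> x * (grad (\<phi> n) x \<bullet> b))) \<longlonglongrightarrow> integral\<^sup>L leb (\<lambda>x. \<psi> x * (G x \<bullet> b))"
    by (rule integral_mult_bounded_tendsto[OF Lp_component[OF test_fun_Lp(2)[OF \<phi>(3)] b] Gb[OF b] lb H2])
  have "integral\<^sup>L leb (\<lambda>x. partial \<psi> b x * \<phi> n x) = - integral\<^sup>L leb (\<lambda>x. \<psi> x * (grad (\<phi> n) x \<bullet> b))" for n
    using test_fun_parts[OF \<phi>(3) \<psi> b, of n] by (simp add: mult.commute)
  with l1 have "(\<lambda>n. - integral\<^sup>L leb (\<lambda>x. \<psi> x * (grad (\<phi> n) x \<bullet> b))) \<longlonglongrightarrow> integral\<^sup>L leb (\<lambda>x. partial \<psi> b x * u x)" by simp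
  from LIMSEQ_unique[OF this tendsto_minus[OF l2]]
  show "integral\<^sup>L leb (\<lambda>x. u x * partial \<psi> b x) = - integral\<^sup>L leb (\<lambda>x. (G x \<bullet> b) * \<psi> x)"
    by (simp add: mult.commute)
qed


lemma locally_integrable_mult_test_fun:
  fixes f :: "'a \<Rightarrow> real"
  assumes loc: "\<And>K. compact K \<Longrightarrow> K \<subseteq> \<Omega> \<Longrightarrow> integrable (lebesgue_on K) f" and \<zeta>: "\<zeta> \<in> test_fun \<Omega>"
  shows "integrable leb (\<lambda>x. f x * \<zeta> x)"
proof -
  obtain K where K: "compact K" "K \<subseteq> \<Omega>" "\<And>x. x \<notin> K \<Longrightarrow> \<zeta> x = 0" using test_funE[OF \<zeta>] by metis
  obtain B where B: "B > 0" "\<And>x. \<bar>\<zeta> x\<bar> \<le> B" using test_fun_bounded[OF \<zeta>] by metis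
  have Ks: "K \<in> sets lebesgue" using K(1) by (simp add: compact_imp_closed)
  have "integrable (lebesgue_on K) (\<lambda>x. f x * \<zeta> x)"
  proof (rule Bochner_Integration.integrable_bound)
    show "integrable (lebesgue_on K) (\<lambda>x. f x * B)" using loc[OF K(1,2)] by simp
    have "f \<in> borel_measurable (lebesgue_on K)" using loc[OF K(1,2)] by auto
    then show "(\<lambda>x. f x * \<zeta> x) \<in> borel_measurable (lebesgue_on K)"
      using test_fun_measurable(1)[OF \<zeta>] borel_measurable_lebesgue_on by (intro borel_measurable_times) auto
    have "\<bar>f x * \<zeta> x\<bar> \<le> \<bar>f x * B\<bar>" for x
      using order_trans[OF B(2)[of x] abs_ge_self] unfolding abs_mult by (intro mult_left_mono) auto
    then show "AE x in lebesgue_on K. norm (f x * \<zeta> x) \<le> norm (f x * B)" by simp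
  qed
  then show ?thesis
    using integral_lebesgue_on_zero_outside(2)[OF Ks, of "\<lambda>x. f x * \<zeta> x"] K
      integral_lebesgue_on_zero_outside(2)[OF \<Omega>_lebesgue, of "\<lambda>x. f x * \<zeta> x"] by auto
qed

lemma weak_gradientD:
  assumes "has_weak_gradient \<Omega> u G"
  shows "compact K \<Longrightarrow> K \<subseteq> \<Omega> \<Longrightarrow> integrable (lebesgue_on K) u"
    and "compact K \<Longrightarrow> K \<subseteq> \<Omega> \<Longrightarrow> b \<in> Basis \<Longrightarrow> integrable (lebesgue_on K) (\<lambda>x. G x \<bullet> b)"
    and "\<phi> \<in> test_fun \<Omega> \<Longrightarrow> b \<in> Basis \<Longrightarrow> integral\<^sup>L leb (\<lambda>x. u x * partial \<phi> b x) =
        - integral\<^sup>L leb (\<lambda>x. (G x \<bullet> b) * \<phi> x)"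
  using assms unfolding has_weak_gradient_def by blast+

lemma weak_gradient_unique:
  assumes G: "has_weak_gradient \<Omega> u G" and K: "has_weak_gradient \<Omega> u K"
  shows "AE x in leb. G x = K x"
proof -
  have "AE x in leb. G x \<bullet> b - K x \<bullet> b = 0" if b: "b \<in> Basis" for b
  proof (rule fundamental_lemma[OF \<Omega>_open])
    show "integrable (lebesgue_on C) (\<lambda>x. G x \<bullet> b - K x \<bullet> b)" if "compact C" "C \<subseteq> \<Omega>" for C
      using weak_gradientD(2)[OF G that b] weak_gradientD(2)[OF K that b] by simp
    fix \<phi> assume \<phi>: "\<phi> \<in> test_fun \<Omega>"
    have "integrable leb (\<lambda>x. (G x \<bullet> b) * \<phi> x)" "integrable leb (\<lambda>x. (K x \<bullet> b) * \<phi> x)"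
      using weak_gradientD(2)[OF G _ _ b] weak_gradientD(2)[OF K _ _ b] \<phi> by (auto intro!: locally_integrable_mult_test_fun)
    then show "integral\<^sup>L leb (\<lambda>x. (G x \<bullet> b - K x \<bullet> b) * \<phi> x) = 0"
      using weak_gradientD(3)[OF G \<phi> b] weak_gradientD(3)[OF K \<phi> b] by (simp add: left_diff_distrib)
  qed
  then have "AE x in leb. \<forall>b\<in>Basis. G x \<bullet> b - K x \<bullet> b = 0"
    by (subst AE_ball_countable) (auto intro: countable_finite)
  then show ?thesis by eventually_elim (rule euclidean_eqI, simp)
qed

lemma weak_grad_eq:
  assumes "has_weak_gradient \<Omega> u G"
  shows "AE x in leb. weak_grad \<Omega> u x = G x"
  using weak_gradient_unique[OF _ assms] someI[of "has_weak_gradient \<Omega> u" G] assms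
  unfolding weak_grad_def by blast

text \<open>\<open>weak_grad\<close> is chosen by \<open>SOME\<close> and determined only up to a
  null set; completeness of Lebesgue measure still makes it measurable.\<close>

lemma borel_measurable_AE_eq:
  fixes f g :: "'a \<Rightarrow> 'b::euclidean_space"
  assumes f: "f \<in> borel_measurable leb" and eq: "AE x in leb. g x = f x"
  shows "g \<in> borel_measurable leb"
proof -
  have "AE x in lebesgue. x \<in> \<Omega> \<longrightarrow> g x = f x" using eq by (simp add: AE_restrict_space_iff)
  then have "AE x in lebesgue. indicator \<Omega> x *\<^sub>R f x = indicator \<Omega> x *\<^sub>R g x"
    by eventually_elim (auto simp: indicator_def)
  then have ae: "AE x in lebesgue. indicator \<Omega> x *\<^sub>R g x - indicator \<Omega> x *\<^sub>R f x = 0"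
    by eventually_elim auto
  have f': "(\<lambda>x. indicator \<Omega> x *\<^sub>R f x) \<in> borel_measurable lebesgue"
    using f by (simp add: borel_measurable_restrict_space_iff)
  \<comment> \<open>A preimage under such a function is a null set or the complement of one,
    according to whether S contains 0.\<close>
  have null: "h \<in> borel_measurable lebesgue" if h: "AE x in lebesgue. h x = 0" for h :: "'a \<Rightarrow> 'b"
  proof (rule borel_measurableI)
    fix S :: "'b set"
    have pred: "Measurable.pred lebesgue P" if "AE x in lebesgue. \<not> P x" for P :: "'a \<Rightarrow> bool"
      using that by (intro sets_completion_AE) (simp add: AE_completion_iff)
    show "h -` S \<inter> space lebesgue \<in> sets lebesgue"
    proof (cases "0 \<in> S")
      case True
      have "Measurable.pred lebesgue (\<lambda>x. h x \<notin> S)"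
        using h True by (intro pred) (auto elim!: eventually_mono)
      then have "Measurable.pred lebesgue (\<lambda>x. h x \<in> S)" using pred_intros_logic(2) by fastforce
      then show ?thesis by (simp add: pred_def vimage_def)
    next
      case False
      have "Measurable.pred lebesgue (\<lambda>x. h x \<in> S)"
        using h False by (intro pred) (auto elim!: eventually_mono)
      then show ?thesis by (simp add: pred_def vimage_def)
    qed
  qed
  from borel_measurable_add[OF null[OF ae] f']
  have "(\<lambda>x. indicator \<Omega> x *\<^sub>R g x) \<in> borel_measurable lebesgue" by simp
  then show ?thesis by (simp add: borel_measurable_restrict_space_iff)
qed

lemma V_cong_AE:
  assumes V: "(u, G) \<in> V" and "AE x in leb. v x = u x" "AE x in leb. K x = G x"
  shows "(v, K) \<in> V"
proof -
  obtain \<phi> where \<phi>: "u \<in> Lp" "G \<in> Lp" "\<And>n. \<phi> n \<in> test_fun \<Omega>" "(\<lambda>n. mdl (\<lambda>x. \<phi> n x - u x)) \<longlonglongrightarrow> 0"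
     "(\<lambda>n. mdl (\<lambda>x. grad (\<phi> n) x - G x)) \<longlonglongrightarrow> 0" by (rule V_E[OF V]) blast
  have m: "v \<in> borel_measurable leb" "K \<in> borel_measurable leb"
    using borel_measurable_AE_eq[OF Lp_measurable[OF \<phi>(1)] assms(2)]
      borel_measurable_AE_eq[OF Lp_measurable[OF \<phi>(2)] assms(3)] by blast+
  have "mdl (\<lambda>x. \<phi> n x - v x) = mdl (\<lambda>x. \<phi> n x - u x)" for n
    using assms(2) by (intro mdl_cong_AE) (auto elim: eventually_mono)
  moreover have "mdl (\<lambda>x. grad (\<phi> n) x - K x) = mdl (\<lambda>x. grad (\<phi> n) x - G x)" for n
    using assms(3) by (intro mdl_cong_AE) (auto elim: eventually_mono)
  moreover have "v \<in> Lp" "K \<in> Lp"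
    using \<phi>(1,2) m mdl_cong_AE[OF assms(2)] mdl_cong_AE[OF assms(3)] by (auto simp: Lp_def)
  ultimately show ?thesis using \<phi> by (intro V_I[where \<phi> = \<phi>]) auto
qed

lemma has_weak_gradient_test_diff:
  assumes G: "has_weak_gradient \<Omega> u G" and \<phi>: "\<phi> \<in> test_fun \<Omega>"
  shows "has_weak_gradient \<Omega> (\<lambda>x. \<phi> x - u x) (\<lambda>x. grad \<phi> x - G x)"
proof -
  note G\<phi> = V_has_weak_gradient[OF V_test_fun[OF \<phi>]]
  show ?thesis unfolding has_weak_gradient_def
  proof (intro conjI allI impI ballI)
    fix K assume K: "compact K \<and> K \<subseteq> \<Omega>"
    then show "integrable (lebesgue_on K) (\<lambda>x. \<phi> x - u x)"
      using weak_gradientD(1)[OF G, of K] weak_gradientD(1)[OF G\<phi>, of K] by simp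
    fix b :: 'a assume b: "b \<in> Basis"
    then have "integrable (lebesgue_on K) (\<lambda>x. grad \<phi> x \<bullet> b - G x \<bullet> b)"
      using weak_gradientD(2)[OF G, of K b] weak_gradientD(2)[OF G\<phi>, of K b] K by (intro Bochner_Integration.integrable_diff) auto
    then show "integrable (lebesgue_on K) (\<lambda>x. (grad \<phi> x - G x) \<bullet> b)" by (simp add: inner_diff_left)
  next
    fix \<psi> b assume \<psi>: "\<psi> \<in> test_fun \<Omega>" and b: "b \<in> (Basis :: 'a set)"
    note \<psi>b = test_fun_partial[OF \<psi> b]
    have i: "integrable leb (\<lambda>x. \<phi> x * partial \<psi> b x)" "integrable leb (\<lambda>x. u x * partial \<psi> b x)"
      "integrable leb (\<lambda>x. (grad \<phi> x \<bullet> b) * \<psi> x)" "integrable leb (\<lambda>x. (G x \<bullet> b) * \<psi> x)"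
      using weak_gradientD(1)[OF G] weak_gradientD(1)[OF G\<phi>] weak_gradientD(2)[OF G _ _ b] weak_gradientD(2)[OF G\<phi> _ _ b]
      by (intro locally_integrable_mult_test_fun \<psi> \<psi>b; blast)+
    have "integral\<^sup>L leb (\<lambda>x. (\<phi> x - u x) * partial \<psi> b x) =
       integral\<^sup>L leb (\<lambda>x. \<phi> x * partial \<psi> b x) - integral\<^sup>L leb (\<lambda>x. u x * partial \<psi> b x)"
      unfolding left_diff_distrib using i by (intro Bochner_Integration.integral_diff)
    also have "\<dots> = - (integral\<^sup>L leb (\<lambda>x. (grad \<phi> x \<bullet> b) * \<psi> x) - integral\<^sup>L leb (\<lambda>x. (G x \<bullet> b) * \<psi> x))"
      using weak_gradientD(3)[OF G \<psi> b] weak_gradientD(3)[OF G\<phi> \<psi> b] by linarith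
    also have "integral\<^sup>L leb (\<lambda>x. (grad \<phi> x \<bullet> b) * \<psi> x) - integral\<^sup>L leb (\<lambda>x. (G x \<bullet> b) * \<psi> x)
       = integral\<^sup>L leb (\<lambda>x. ((grad \<phi> x - G x) \<bullet> b) * \<psi> x)"
      unfolding inner_diff_left left_diff_distrib using i by (intro Bochner_Integration.integral_diff[symmetric])
    finally show "integral\<^sup>L leb (\<lambda>x. (\<phi> x - u x) * partial \<psi> b x) =
       - integral\<^sup>L leb (\<lambda>x. ((grad \<phi> x - G x) \<bullet> b) * \<psi> x)" .
  qed
qed

section \<open>Luxemburg norms and the identification of \<open>W10\<close> with
  \<open>V\<close>\<close>

lemma modular_eq_mdl: "modular \<Omega> p f = mdl f"
  by (simp add: modular_def mdl_def)

lemma Lvar_eq_Lp: "Lvar \<Omega> p = Lp"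
  by (auto simp: Lvar_def Lp_def modular_eq_mdl)

lemma mdl_divide_le:
  fixes f :: "'a \<Rightarrow> real"
  assumes [measurable]: "f \<in> borel_measurable leb" and c: "c \<ge> 1"
  shows "mdl (\<lambda>x. f x / c) \<le> ennreal (1 / c) * mdl f"
proof -
  have "mdl (\<lambda>x. f x / c) \<le> (\<integral>\<^sup>+x. ennreal (1 / c) * ennreal (norm (f x) powr p x) \<partial>leb)"
    unfolding mdl_def
  proof (rule nn_integral_mono)
    fix x assume "x \<in> space leb"
    then have px: "p x > 1" using p_gt_1 by blast
    have "norm (f x / c) powr p x = norm (f x) powr p x / c powr p x" using c by (simp add: powr_divide)
    also have "\<dots> \<le> norm (f x) powr p x / c powr 1" using c px by (intro divide_left_mono powr_mono) auto
    finally show "ennreal (norm (f x / c) powr p x) \<le> ennreal (1 / c) * ennreal (norm (f x) powr p x)"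
      using c by (simp add: ennreal_mult[symmetric] ennreal_leI)
  qed
  then show ?thesis by (simp add: mdl_def nn_integral_cmult)
qed

abbreviation lux where "lux f \<equiv> lux_norm \<Omega> p f"

lemma lux_set_nonempty:
  assumes f: "f \<in> Lp"
  shows "{c. c > 0 \<and> modular \<Omega> p (\<lambda>x. f x / c) \<le> 1} \<noteq> {}"
proof -
  define c where "c = max 1 (enn2real (mdl f))"
  have c: "c \<ge> 1" by (simp add: c_def)
  have "mdl f \<le> ennreal c" unfolding mdl_eq_integral[OF f] c_def by (intro ennreal_leI) simp
  have "mdl (\<lambda>x. f x / c) \<le> ennreal (1 / c) * mdl f" using mdl_divide_le[OF Lp_measurable[OF f] c] .
  also have "\<dots> \<le> ennreal (1 / c) * ennreal c" using \<open>mdl f \<le> ennreal c\<close> by (intro mult_left_mono) auto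
  also have "\<dots> = 1" using c by (simp add: ennreal_mult[symmetric])
  finally have "c > 0 \<and> modular \<Omega> p (\<lambda>x. f x / c) \<le> 1" using c by (simp add: modular_eq_mdl)
  then show ?thesis by blast
qed

lemma lux_nonneg: "f \<in> Lp \<Longrightarrow> lux f \<ge> 0"
  unfolding lux_norm_def using lux_set_nonempty by (intro cInf_greatest) auto

lemma lux_le: "c > 0 \<Longrightarrow> mdl (\<lambda>x. f x / c) \<le> 1 \<Longrightarrow> lux f \<le> c"
  unfolding lux_norm_def modular_eq_mdl by (intro cInf_lower bdd_belowI[of _ 0]) auto

lemma mdl_le_lux:
  assumes f: "f \<in> Lp" and e: "lux f < e" "e \<le> 1"
  shows "mdl f \<le> ennreal e"
proof -
  obtain c where c: "c > 0" "mdl (\<lambda>x. f x / c) \<le> 1" "c < e"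
    using cInf_lessD[OF lux_set_nonempty[OF f], of e] e unfolding lux_norm_def modular_eq_mdl by auto
  note [measurable] = Lp_measurable[OF f]
  have "mdl f \<le> (\<integral>\<^sup>+x. ennreal c * ennreal (norm (f x / c) powr p x) \<partial>leb)"
    unfolding mdl_def
  proof (rule nn_integral_mono)
    fix x assume "x \<in> space leb"
    then have px: "p x > 1" using p_gt_1 by blast
    have "norm (f x) powr p x = c powr p x * norm (f x / c) powr p x" using c by (simp add: powr_divide)
    also have "\<dots> \<le> c powr 1 * norm (f x / c) powr p x" using c e px by (intro mult_right_mono powr_mono') auto
    finally show "ennreal (norm (f x) powr p x) \<le> ennreal c * ennreal (norm (f x / c) powr p x)"
      using c by (simp add: ennreal_mult[symmetric] ennreal_leI del: norm_divide)
  qed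
  also have "\<dots> = ennreal c * mdl (\<lambda>x. f x / c)" unfolding mdl_def by (rule nn_integral_cmult) measurable
  also have "\<dots> \<le> ennreal e * 1" using c by (intro mult_mono ennreal_leI) auto
  finally show ?thesis by simp
qed

text \<open>The exponent is bounded, so scaling by a constant changes the modular by a bounded
  factor. The equivalence translates convergence in \<open>W1_norm\<close> into modular
  convergence.\<close>

lemma lux_tendsto_iff:
  assumes f: "\<And>n. f n \<in> Lp"
  shows "(\<lambda>n. lux (f n)) \<longlonglongrightarrow> 0 \<longleftrightarrow> (\<lambda>n. mdl (f n)) \<longlonglongrightarrow> 0"
proof
  assume lim: "(\<lambda>n. lux (f n)) \<longlonglongrightarrow> 0"
  show "(\<lambda>n. mdl (f n)) \<longlonglongrightarrow> 0"
  proof (rule tendsto_zero_ennreal)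
    fix e :: real assume e: "e > 0"
    define d where "d = min 1 (e / 2)"
    have d: "d > 0" "d \<le> 1" "d < e" using e by (auto simp: d_def)
    from order_tendstoD(2)[OF lim d(1)] show "\<forall>\<^sub>F n in sequentially. mdl (f n) < ennreal e"
    proof eventually_elim
      case (elim n)
      have "mdl (f n) \<le> ennreal d" by (rule mdl_le_lux[OF f elim d(2)])
      also have "\<dots> < ennreal e" using d by (simp add: ennreal_less_iff)
      finally show ?case .
    qed
  qed
next
  assume lim: "(\<lambda>n. mdl (f n)) \<longlonglongrightarrow> 0"
  show "(\<lambda>n. lux (f n)) \<longlonglongrightarrow> 0"
  proof (rule LIMSEQ_I)
    fix e :: real assume e: "e > 0"
    have "(\<lambda>n. mdl (\<lambda>x. (2 / e) *\<^sub>R f n x)) \<longlonglongrightarrow> 0" using lim by (intro mdl_tendsto_cmult Lp_measurable f)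
    from order_tendstoD(2)[OF this, of 1]
    obtain N where N: "\<And>n. n \<ge> N \<Longrightarrow> mdl (\<lambda>x. (2 / e) *\<^sub>R f n x) < 1" by (auto simp: eventually_sequentially)
    have "norm (lux (f n) - 0) < e" if "n \<ge> N" for n
    proof -
      have "mdl (\<lambda>x. f n x / (e / 2)) \<le> 1" using N[OF that] by (simp add: field_simps less_imp_le)
      then have "lux (f n) \<le> e / 2" using e by (intro lux_le) auto
      then show ?thesis using lux_nonneg[OF f, of n] e by simp
    qed
    then show "\<exists>N. \<forall>n\<ge>N. norm (lux (f n) - 0) < e" by blast
  qed
qed

lemma W1_weak_grad:
  assumes "u \<in> W1 \<Omega> p"
  shows "u \<in> Lp" "weak_grad \<Omega> u \<in> Lp" "has_weak_gradient \<Omega> u (weak_grad \<Omega> u)"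
proof -
  obtain G where G: "u \<in> Lp" "has_weak_gradient \<Omega> u G" "\<And>b. b \<in> Basis \<Longrightarrow> (\<lambda>x. G x \<bullet> b) \<in> Lp"
    using assms unfolding W1_def Lvar_eq_Lp by blast
  show "u \<in> Lp" by (rule G)
  show "has_weak_gradient \<Omega> u (weak_grad \<Omega> u)" unfolding weak_grad_def by (rule someI[of "has_weak_gradient \<Omega> u", OF G(2)])
  have GL: "G \<in> Lp" using G(3) by (rule Lp_components)
  have ae: "AE x in leb. weak_grad \<Omega> u x = G x" by (rule weak_grad_eq[OF G(2)])
  show "weak_grad \<Omega> u \<in> Lp"
    using GL borel_measurable_AE_eq[OF Lp_measurable[OF GL] ae] mdl_cong_AE[OF ae] by (simp add: Lp_def)
qed

lemma W1_norm_eq: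
  assumes G: "has_weak_gradient \<Omega> v G"
  shows "W1_norm \<Omega> p v = lux v + (\<Sum>b\<in>Basis. lux (\<lambda>x. G x \<bullet> b))"
proof -
  have "lux (\<lambda>x. weak_grad \<Omega> v x \<bullet> b) = lux (\<lambda>x. G x \<bullet> b)" for b
  proof -
    have "mdl (\<lambda>x. weak_grad \<Omega> v x \<bullet> b / c) = mdl (\<lambda>x. G x \<bullet> b / c)" for c :: real
    proof (rule mdl_cong_AE)
      show "AE x in leb. weak_grad \<Omega> v x \<bullet> b / c = G x \<bullet> b / c"
        using weak_grad_eq[OF G] by eventually_elim simp
    qed
    then show ?thesis by (simp add: lux_norm_def modular_eq_mdl)
  qed
  then show ?thesis by (simp add: W1_norm_def)
qed

text \<open>All summands of \<open>W1_norm\<close> are nonnegative, so each of them tends to 0 with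
  the sum, and modular convergence follows componentwise.\<close>

lemma W10_imp_V:
  assumes u: "u \<in> W10 \<Omega> p"
  shows "(u, weak_grad \<Omega> u) \<in> V"
proof -
  obtain \<phi> where W1: "u \<in> W1 \<Omega> p" and \<phi>: "\<And>n. \<phi> n \<in> test_fun \<Omega>" and lim: "(\<lambda>n. W1_norm \<Omega> p (\<lambda>x. \<phi> n x - u x)) \<longlonglongrightarrow> 0"
    using u unfolding W10_def by blast
  note w = W1_weak_grad[OF W1]
  define G where "G = (\<lambda>n x. grad (\<phi> n) x - weak_grad \<Omega> u x)"
  have dL: "(\<lambda>x. \<phi> n x - u x) \<in> Lp" and GL: "G n \<in> Lp" for n
    unfolding G_def using test_fun_Lp[OF \<phi>] w by (auto intro: Lp_diff)
  have eq: "W1_norm \<Omega> p (\<lambda>x. \<phi> n x - u x) = lux (\<lambda>x. \<phi> n x - u x) + (\<Sum>b\<in>Basis. lux (\<lambda>x. G n x \<bullet> b))" for n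
    unfolding G_def by (rule W1_norm_eq[OF has_weak_gradient_test_diff[OF w(3) \<phi>]])
  have nn: "lux (\<lambda>x. \<phi> n x - u x) \<ge> 0" "b \<in> Basis \<Longrightarrow> lux (\<lambda>x. G n x \<bullet> b) \<ge> 0" for n b
    using lux_nonneg[OF dL] lux_nonneg[OF Lp_component[OF GL]] by auto
  have sn: "(\<Sum>b\<in>Basis. lux (\<lambda>x. G n x \<bullet> b)) \<ge> 0" for n using nn(2) by (rule sum_nonneg)
  show ?thesis
  proof (rule V_I[OF w(1,2) \<phi>])
    have "(\<lambda>n. lux (\<lambda>x. \<phi> n x - u x)) \<longlonglongrightarrow> 0"
      by (rule tendsto_sandwich[OF _ _ tendsto_const lim]) (use nn sn in \<open>auto simp: eq\<close>)
    then show "(\<lambda>n. mdl (\<lambda>x. \<phi> n x - u x)) \<longlonglongrightarrow> 0" using lux_tendsto_iff[OF dL] by simp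
    have "(\<lambda>n. mdl (G n)) \<longlonglongrightarrow> 0"
    proof (rule mdl_tendsto_components[OF Lp_measurable[OF GL]])
      fix b :: 'a assume b: "b \<in> Basis"
      have "lux (\<lambda>x. G n x \<bullet> b) \<le> (\<Sum>b\<in>Basis. lux (\<lambda>x. G n x \<bullet> b))" for n
        using nn(2) b by (intro member_le_sum) auto
      then have "(\<lambda>n. lux (\<lambda>x. G n x \<bullet> b)) \<longlonglongrightarrow> 0"
        using add_increasing[OF nn(1)] nn(2)[OF b]
        by (intro tendsto_sandwich[OF _ _ tendsto_const lim] always_eventually allI) (simp_all add: eq)
      then show "(\<lambda>n. mdl (\<lambda>x. G n x \<bullet> b)) \<longlonglongrightarrow> 0" using lux_tendsto_iff[OF Lp_component[OF GL b]] by simp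
    qed
    then show "(\<lambda>n. mdl (\<lambda>x. grad (\<phi> n) x - weak_grad \<Omega> u x)) \<longlonglongrightarrow> 0" by (simp add: G_def)
  qed
qed

lemma V_imp_W10:
  assumes V: "(u, G) \<in> V"
  shows "u \<in> W10 \<Omega> p"
proof -
  obtain \<phi> where \<phi>: "u \<in> Lp" "G \<in> Lp" "\<And>n. \<phi> n \<in> test_fun \<Omega>" "(\<lambda>n. mdl (\<lambda>x. \<phi> n x - u x)) \<longlonglongrightarrow> 0"
     "(\<lambda>n. mdl (\<lambda>x. grad (\<phi> n) x - G x)) \<longlonglongrightarrow> 0" by (rule V_E[OF V]) blast
  note wg = V_has_weak_gradient[OF V]
  have W1: "u \<in> W1 \<Omega> p" unfolding W1_def Lvar_eq_Lp using \<phi>(1) wg Lp_component[OF \<phi>(2)] by blast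
  have dL: "(\<lambda>x. \<phi> n x - u x) \<in> Lp" "(\<lambda>x. grad (\<phi> n) x - G x) \<in> Lp" for n
    using test_fun_Lp[OF \<phi>(3)] \<phi>(1,2) by (auto intro: Lp_diff)
  have "(\<lambda>n. lux (\<lambda>x. \<phi> n x - u x) + (\<Sum>b\<in>Basis. lux (\<lambda>x. (grad (\<phi> n) x - G x) \<bullet> b))) \<longlonglongrightarrow> 0 + (\<Sum>b\<in>(Basis :: 'a set). 0)"
  proof (intro tendsto_add tendsto_sum)
    show "(\<lambda>n. lux (\<lambda>x. \<phi> n x - u x)) \<longlonglongrightarrow> 0" using lux_tendsto_iff[OF dL(1)] \<phi>(4) by simp
    fix b :: 'a assume b: "b \<in> Basis"
    have "(\<lambda>n. mdl (\<lambda>x. (grad (\<phi> n) x - G x) \<bullet> b)) \<longlonglongrightarrow> 0"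
      by (rule mdl_tendsto_mono[OF _ \<phi>(5)]) (use b in \<open>auto simp: Basis_le_norm\<close>)
    then show "(\<lambda>n. lux (\<lambda>x. (grad (\<phi> n) x - G x) \<bullet> b)) \<longlonglongrightarrow> 0"
      using lux_tendsto_iff[OF Lp_component[OF dL(2) b]] by simp
  qed
  then have "(\<lambda>n. W1_norm \<Omega> p (\<lambda>x. \<phi> n x - u x)) \<longlonglongrightarrow> 0"
    using W1_norm_eq[OF has_weak_gradient_test_diff[OF wg \<phi>(3)]] by simp
  then show ?thesis unfolding W10_def using W1 \<phi>(3) by blast
qed

end

section \<open>Mollification in variable exponent spaces\<close>

lemma moll_le: "moll n (x::'a::euclidean_space) \<le> real (Suc n) ^ DIM('a) / integral\<^sup>L lborel (bump :: 'a \<Rightarrow> real)"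
  unfolding moll_def using bump_integral_pos[where 'a='a] bump_bounds
  by (intro mult_left_le) auto

lemma conv_moll_nonneg: "(\<And>y. v y \<ge> 0) \<Longrightarrow> conv (moll n) v x \<ge> 0"
  unfolding conv_def by (intro integral_nonneg_AE AE_I2 mult_nonneg_nonneg moll_nonneg)

text \<open>Almost everywhere convergence of mollifications is available only along subsequences;
  this recovers the full sequence.\<close>

lemma tendsto_0_subsequenceI:
  fixes X :: "nat \<Rightarrow> ennreal"
  assumes "\<And>s :: nat \<Rightarrow> nat. strict_mono s \<Longrightarrow> \<exists>r :: nat \<Rightarrow> nat. strict_mono r \<and> (\<lambda>n. X (s (r n))) \<longlonglongrightarrow> 0"
  shows "X \<longlonglongrightarrow> 0"
proof (rule ccontr)
  assume "\<not> X \<longlonglongrightarrow> 0"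
  then obtain e where e: "e > 0" "\<not> (\<forall>\<^sub>F n in sequentially. X n < e)"
    unfolding order_tendsto_iff by auto
  then obtain s :: "nat \<Rightarrow> nat" where s: "strict_mono s" "\<And>n. \<not> X (s n) < e"
    using not_eventually_sequentiallyD by blast
  obtain r :: "nat \<Rightarrow> nat" where "(\<lambda>n. X (s (r n))) \<longlonglongrightarrow> 0" using assms[OF s(1)] by blast
  from order_tendstoD(2)[OF this e(1)] s(2) show False by (auto simp: eventually_sequentially)
qed

text \<open>Pratt's version of dominated convergence, with dominating functions that vary but
  converge in \<open>L\<^sup>1\<close>. The part of f n above |G| is at most |g n - G|, and the part
  below is dominated by |G|.\<close>

lemma nn_integral_tendsto_0_pratt:
  fixes f g :: "nat \<Rightarrow> 'x \<Rightarrow> real"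
  assumes [measurable]: "\<And>n. f n \<in> borel_measurable M" "\<And>n. g n \<in> borel_measurable M" and G: "integrable M G"
    and nonneg: "\<And>n x. f n x \<ge> 0"
    and le: "\<And>n. AE x in M. f n x \<le> g n x" and lim: "AE x in M. (\<lambda>n. f n x) \<longlonglongrightarrow> 0"
    and L1: "(\<lambda>n. \<integral>\<^sup>+x. ennreal \<bar>g n x - G x\<bar> \<partial>M) \<longlonglongrightarrow> 0"
  shows "(\<lambda>n. \<integral>\<^sup>+x. ennreal (f n x) \<partial>M) \<longlonglongrightarrow> 0"
proof -
  have [measurable]: "G \<in> borel_measurable M" using G by auto
  have "(\<lambda>n. \<integral>\<^sup>+x. ennreal (min (f n x) \<bar>G x\<bar>) \<partial>M) \<longlonglongrightarrow> (\<integral>\<^sup>+x. 0 \<partial>M)"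
  proof (rule nn_integral_dominated_convergence[where w = "\<lambda>x. ennreal \<bar>G x\<bar>"])
    show "(\<integral>\<^sup>+x. ennreal \<bar>G x\<bar> \<partial>M) < \<infinity>" using G by (simp add: integrable_iff_bounded)
    show "AE x in M. (\<lambda>n. ennreal (min (f n x) \<bar>G x\<bar>)) \<longlonglongrightarrow> 0"
      using lim
    proof eventually_elim
      case (elim x)
      have "(\<lambda>n. min (f n x) \<bar>G x\<bar>) \<longlonglongrightarrow> min 0 \<bar>G x\<bar>" by (intro tendsto_min elim tendsto_const)
      then show ?case using tendsto_ennrealI by fastforce
    qed
  qed (auto intro!: AE_I2 ennreal_leI)
  then have 1: "(\<lambda>n. \<integral>\<^sup>+x. ennreal (min (f n x) \<bar>G x\<bar>) \<partial>M) \<longlonglongrightarrow> 0" by simp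
  have le': "(\<integral>\<^sup>+x. ennreal (f n x) \<partial>M) \<le> (\<integral>\<^sup>+x. ennreal \<bar>g n x - G x\<bar> \<partial>M) + (\<integral>\<^sup>+x. ennreal (min (f n x) \<bar>G x\<bar>) \<partial>M)" for n
  proof -
    have "(\<integral>\<^sup>+x. ennreal (f n x) \<partial>M) \<le> (\<integral>\<^sup>+x. ennreal \<bar>g n x - G x\<bar> + ennreal (min (f n x) \<bar>G x\<bar>) \<partial>M)"
    proof (rule nn_integral_mono_AE)
      show "AE x in M. ennreal (f n x) \<le> ennreal \<bar>g n x - G x\<bar> + ennreal (min (f n x) \<bar>G x\<bar>)"
        using le[of n]
      proof eventually_elim
        case (elim x)
        have "f n x \<le> \<bar>g n x - G x\<bar> + min (f n x) \<bar>G x\<bar>" using elim by (auto simp: min_def)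
        then have "ennreal (f n x) \<le> ennreal (\<bar>g n x - G x\<bar> + min (f n x) \<bar>G x\<bar>)" by (rule ennreal_leI)
        then show ?case using nonneg[of n x] by (subst (asm) ennreal_plus) auto
      qed
    qed
    also have "\<dots> = (\<integral>\<^sup>+x. ennreal \<bar>g n x - G x\<bar> \<partial>M) + (\<integral>\<^sup>+x. ennreal (min (f n x) \<bar>G x\<bar>) \<partial>M)"
      by (rule nn_integral_add) measurable
    finally show ?thesis .
  qed
  have "(\<lambda>n. (\<integral>\<^sup>+x. ennreal \<bar>g n x - G x\<bar> \<partial>M) + (\<integral>\<^sup>+x. ennreal (min (f n x) \<bar>G x\<bar>) \<partial>M)) \<longlonglongrightarrow> 0"
    using tendsto_add[OF L1 1] by simp
  then show ?thesis by (rule tendsto_sandwich[OF _ _ tendsto_const, rotated 2]) (use le' in auto)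
qed

text \<open>Since ln k \<le> k, the power k^(1/k) is at most e, so a polynomial growth in k is
  harmless under the exponent L/k.\<close>

lemma powr_reciprocal_bounded:
  fixes c L :: real and k N :: nat
  assumes c: "c \<ge> 0" and L: "L \<ge> 0" and k: "k \<ge> 1"
  shows "(1 + c * real k ^ N) powr (L / real k) \<le> (1 + c) powr L * exp (L * real N)"
proof -
  have k1: "real k \<ge> 1" using k by simp
  have "1 + c * real k ^ N \<le> (1 + c) * real k ^ N"
    using one_le_power[OF k1, of N] c by (simp add: algebra_simps)
  then have "(1 + c * real k ^ N) powr (L / real k) \<le> ((1 + c) * real k ^ N) powr (L / real k)"
    using c L by (intro powr_mono2) auto
  also have "\<dots> = (1 + c) powr (L / real k) * (real k ^ N) powr (L / real k)"
    using c by (simp add: powr_mult)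
  also have "\<dots> \<le> (1 + c) powr L * exp (L * real N)"
  proof (intro mult_mono)
    show "(1 + c) powr (L / real k) \<le> (1 + c) powr L"
      using c L k1 mult_left_mono[of 1 "real k" L] by (intro powr_mono) (auto simp: divide_le_eq)
    have "(real k ^ N) powr (L / real k) = exp (L / real k * ln (real k ^ N))"
      using k1 by (simp add: powr_def)
    also have "L / real k * ln (real k ^ N) = L * real N * (ln (real k) / real k)"
      using k1 by (simp add: ln_realpow)
    also have "\<dots> \<le> L * real N * 1"
      using ln_le_minus_one[of "real k"] k1 L by (intro mult_left_mono) (auto simp: divide_le_eq)
    finally show "(real k ^ N) powr (L / real k) \<le> exp (L * real N)" by simp
  qed auto
  finally show ?thesis .
qed

lemma nn_integral_lebesgue_on_le:
  assumes "S \<in> sets lebesgue"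
  shows "(\<integral>\<^sup>+x. f x \<partial>lebesgue_on S) \<le> (\<integral>\<^sup>+x. f x \<partial>lborel)"
proof -
  have "(\<integral>\<^sup>+x. f x \<partial>lebesgue_on S) = (\<integral>\<^sup>+x. f x * indicator S x \<partial>lebesgue)"
    using assms by (intro nn_integral_restrict_space) simp
  also have "\<dots> \<le> (\<integral>\<^sup>+x. f x \<partial>lebesgue)" by (intro nn_integral_mono) (auto simp: indicator_def)
  also have "\<dots> = (\<integral>\<^sup>+x. f x \<partial>lborel)" by (rule nn_integral_completion)
  finally show ?thesis .
qed

lemma AE_lborel_imp_lebesgue_on:
  assumes "S \<in> sets lebesgue" "AE x in lborel. P x"
  shows "AE x in lebesgue_on S. P x"
proof -
  have "AE x in lebesgue. x \<in> S \<longrightarrow> P x" using AE_completion[OF assms(2)] by eventually_elim simp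
  then show ?thesis using assms(1) by (simp add: AE_restrict_space_iff)
qed

context pde_domain
begin

text \<open>This is the only place where the regularity of the exponent is used: over a ball of radius
  \<open>1/n\<close> the exponent oscillates by \<open>L/n\<close>, and \<open>n\<close> raised to the power \<open>L/n\<close> stays bounded.\<close>

lemma conv_moll_powr_le:
  assumes F: "integrable lborel F" and K: "compact K" "\<And>y. y \<notin> K \<Longrightarrow> F y = 0"
    and d: "d > 0" "(\<Union>y\<in>K. cball y d) \<subseteq> \<Omega>"
    and \<Phi>: "integrable lborel \<Phi>" "\<And>y. \<Phi> y \<ge> 0" "AE y in lborel. y \<in> \<Omega> \<longrightarrow> \<Phi> y = \<bar>F y\<bar> powr p y"
  shows "\<exists>C n0. C > 0 \<and> (\<forall>n\<ge>n0. \<forall>x\<in>\<Omega>. \<bar>conv (moll n) F x\<bar> powr p x \<le> C * (1 + conv (moll n) \<Phi> x))"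
proof -
  define Z where "Z = integral\<^sup>L lborel (bump :: 'a \<Rightarrow> real)"
  have Z: "Z > 0" unfolding Z_def by (rule bump_integral_pos)
  define I where "I = integral\<^sup>L lborel \<Phi>"
  have I: "I \<ge> 0" unfolding I_def using \<Phi>(2) by (intro integral_nonneg_AE) auto
  define c where "c = I / Z"
  have c: "c \<ge> 0" using I Z by (simp add: c_def)
  define C where "C = 2 powr pp * ((1 + c) powr L * exp (L * real DIM('a)))"
  have C: "C > 0" using c by (simp add: C_def)
  obtain n1 where n1: "1 / real (Suc n1) < d / 2" using nat_approx_posE[of "d / 2"] d by auto
  \<comment> \<open>For n \<ge> n2 the oscillation L/(n+1) is at most pm - 1, so the lowest exponent
    m on the ball is still at least 1.\<close>
  have "(pm - 1) / (L + 1) > 0" using pm_gt_1 L_nonneg by simp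
  then obtain n2 where n2: "1 / real (Suc n2) < (pm - 1) / (L + 1)" using nat_approx_posE by auto
  define n0 where "n0 = max n1 n2"
  have "\<bar>conv (moll n) F x\<bar> powr p x \<le> C * (1 + conv (moll n) \<Phi> x)" if n: "n \<ge> n0" and x: "x \<in> \<Omega>" for n x
  proof -
    define \<epsilon> where "\<epsilon> = 1 / real (Suc n)"
    have e1: "\<epsilon> \<le> 1 / real (Suc n1)" "\<epsilon> \<le> 1 / real (Suc n2)"
      using n unfolding \<epsilon>_def n0_def by (auto intro!: divide_left_mono)
    have \<epsilon>: "\<epsilon> > 0" "2 * \<epsilon> \<le> d" using e1 n1 unfolding \<epsilon>_def by auto
    have "\<epsilon> * (L + 1) \<le> pm - 1" using e1 n2 L_nonneg by (simp add: pos_less_divide_eq[symmetric] le_less_trans less_imp_le pos_le_divide_eq[symmetric])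
    then have L\<epsilon>: "L * \<epsilon> \<le> pm - 1" using \<epsilon>(1) by (simp add: algebra_simps)
    have c\<Phi>0: "conv (moll n) \<Phi> x \<ge> 0"
      using \<Phi>(2) by (rule conv_moll_nonneg)
    show ?thesis
    proof (cases "x \<in> (\<Union>y\<in>K. cball y (1 / real (Suc n)))")
      case False
      then have "conv (moll n) F x = 0" using K(2) by (intro conv_moll_support)
      then show ?thesis using C c\<Phi>0 by simp
    next
      case True
      then obtain k where k: "k \<in> K" "dist k x \<le> \<epsilon>" unfolding \<epsilon>_def by auto
      have sub: "cball x \<epsilon> \<subseteq> \<Omega>"
      proof
        fix y assume "y \<in> cball x \<epsilon>"
        then have "dist k y \<le> d" using k dist_triangle[of k y x] \<epsilon> by simp
        then have "y \<in> (\<Union>y\<in>K. cball y d)" using k by auto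
        then show "y \<in> \<Omega>" using d(2) by blast
      qed
      define m where "m = p x - L * \<epsilon>"
      have px: "pm \<le> p x" "p x \<le> pp" using p_bounds[OF x] by auto
      have m: "m \<ge> 1" using px L\<epsilon> unfolding m_def by linarith
      have pm': "m \<le> p y" "y \<in> \<Omega>" if "norm (x - y) < \<epsilon>" for y
      proof -
        have "cball x (norm (y - x)) \<subseteq> cball x \<epsilon>" using that by (intro subset_cball) (simp add: norm_minus_commute)
        then have "\<bar>p y - p x\<bar> \<le> L * norm (y - x)" using sub by (intro p_lipschitz) auto
        also have "\<dots> \<le> L * \<epsilon>" using that L_nonneg by (intro mult_left_mono) (auto simp: norm_minus_commute)
        finally show "m \<le> p y" unfolding m_def by linarith
        show "y \<in> \<Omega>" using sub that by (auto simp: dist_norm)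
      qed
      define A where "A = 1 + conv (moll n) \<Phi> x"
      have A: "A \<ge> 1" using c\<Phi>0 by (simp add: A_def)
      \<comment> \<open>The level at which the values of F are split. With l^m = A the two
        contributions balance: l^(1 - m) * A = l.\<close>
      define l where "l = A powr (1 / m)"
      have l: "l \<ge> 1" using A m unfolding l_def by (intro ge_one_powr_ge_zero) auto
      have lm: "l powr m = A" using A m by (simp add: l_def powr_powr)
      note iF = conv_integrable[OF moll_test_fun F, of n x] and i\<Phi> = conv_integrable[OF moll_test_fun \<Phi>(1), of n x]
      have imoll: "integrable lborel (\<lambda>y. moll n (x - y))"
        using integrable_lborel_reflect[OF test_fun_measurable(1)[OF moll_test_fun[of n]], of x]
          test_fun_integrable(1)[OF moll_test_fun[of n]] by simp
      have "\<bar>conv (moll n) F x\<bar> \<le> (\<integral>y. \<bar>moll n (x - y) * F y\<bar> \<partial>lborel)"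
        unfolding conv_def by (rule integral_abs_bound)
      also have "\<dots> \<le> (\<integral>y. l * moll n (x - y) + l powr (1 - m) * (moll n (x - y) * \<Phi> y) \<partial>lborel)"
      proof (rule integral_mono_AE)
        show "integrable lborel (\<lambda>y. \<bar>moll n (x - y) * F y\<bar>)" using iF by (rule integrable_abs)
        show "integrable lborel (\<lambda>y. l * moll n (x - y) + l powr (1 - m) * (moll n (x - y) * \<Phi> y))"
          using imoll i\<Phi> by (intro Bochner_Integration.integrable_add integrable_mult_right)
        show "AE y in lborel. \<bar>moll n (x - y) * F y\<bar> \<le> l * moll n (x - y) + l powr (1 - m) * (moll n (x - y) * \<Phi> y)"
          using \<Phi>(3)
        proof eventually_elim
          case (elim y)
          show ?case
          proof (cases "norm (x - y) < \<epsilon>")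
            case True
            have y: "m \<le> p y" "y \<in> \<Omega>" using pm'[OF True] by auto
            have "\<bar>F y\<bar> \<le> l + l powr (1 - m) * \<Phi> y"
            proof (cases "\<bar>F y\<bar> \<le> l")
              case True then show ?thesis using \<Phi>(2)[of y] by (simp add: add_increasing2)
            next
              case False
              have "\<bar>F y\<bar> = \<bar>F y\<bar> powr (1 - p y) * \<bar>F y\<bar> powr p y" using False l by (simp flip: powr_add)
              also have "\<dots> \<le> l powr (1 - m) * \<bar>F y\<bar> powr p y"
              proof (intro mult_right_mono)
                have "\<bar>F y\<bar> powr (1 - p y) \<le> l powr (1 - p y)" using False l y m by (intro powr_mono2') auto
                also have "\<dots> \<le> l powr (1 - m)" using l y by (intro powr_mono) auto
                finally show "\<bar>F y\<bar> powr (1 - p y) \<le> l powr (1 - m)" .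
              qed simp
              finally show ?thesis using elim y l by simp
            qed
            then have "moll n (x - y) * \<bar>F y\<bar> \<le> moll n (x - y) * (l + l powr (1 - m) * \<Phi> y)"
              using moll_nonneg by (intro mult_left_mono)
            then show ?thesis by (simp add: abs_mult moll_nonneg algebra_simps)
          next
            case False
            then have "moll n (x - y) = 0" unfolding \<epsilon>_def by (intro moll_outside) simp
            then show ?thesis by simp
          qed
        qed
      qed
      also have "\<dots> = l * 1 + l powr (1 - m) * conv (moll n) \<Phi> x"
        using imoll i\<Phi> integral_lborel_reflect[OF test_fun_measurable(1)[OF moll_test_fun], of n x] moll_integral[of n, where 'a='a]
        unfolding conv_def by simp
      also have "\<dots> \<le> l + l powr (1 - m) * A" by (simp add: A_def mult_left_mono)
      also have "l powr (1 - m) * A = l" unfolding lm[symmetric] using l by (simp flip: powr_add)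
      finally have "\<bar>conv (moll n) F x\<bar> \<le> 2 * l" by simp
      then have "\<bar>conv (moll n) F x\<bar> powr p x \<le> (2 * l) powr p x" using px pm_gt_1 by (intro powr_mono2) auto
      also have "\<dots> = 2 powr p x * l powr p x" using l by (simp add: powr_mult)
      also have "l powr p x = A powr (p x / m)" by (simp add: l_def powr_powr)
      \<comment> \<open>Since m \<ge> 1, the quotient p x / m exceeds 1 by at most L \<epsilon>.
        Only the surplus A^(L \<epsilon>) has to be bounded.\<close>
      also have "2 powr p x * A powr (p x / m) \<le> 2 powr pp * A powr (1 + L * \<epsilon>)"
      proof (intro mult_mono powr_mono)
        have "p x / m = 1 + L * \<epsilon> / m" using m unfolding m_def by (simp add: field_simps)
        also have "\<dots> \<le> 1 + L * \<epsilon>" using divide_left_mono[of 1 m "L * \<epsilon>"] m L_nonneg \<epsilon>(1) by simp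
        finally show "p x / m \<le> 1 + L * \<epsilon>" .
      qed (use px A in auto)
      also have "A powr (1 + L * \<epsilon>) = A * A powr (L * \<epsilon>)" using A by (simp add: powr_add)
      \<comment> \<open>A grows at most like the height of the mollifier, a multiple of (n+1)^N with
        N the dimension, and the exponent is L/(n+1).\<close>
      also have "A powr (L * \<epsilon>) \<le> (1 + c) powr L * exp (L * real DIM('a))"
      proof -
        have "conv (moll n) \<Phi> x \<le> (\<integral>y. real (Suc n) ^ DIM('a) / Z * \<Phi> y \<partial>lborel)"
          unfolding conv_def Z_def using i\<Phi> \<Phi>(1,2) by (intro integral_mono mult_right_mono moll_le) auto
        also have "\<dots> = c * real (Suc n) ^ DIM('a)" unfolding c_def I_def by simp
        finally have "A \<le> 1 + c * real (Suc n) ^ DIM('a)" by (simp add: A_def)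
        then have "A powr (L * \<epsilon>) \<le> (1 + c * real (Suc n) ^ DIM('a)) powr (L / real (Suc n))"
          using A L_nonneg unfolding \<epsilon>_def by (auto intro!: powr_mono2)
        also have "\<dots> \<le> (1 + c) powr L * exp (L * real DIM('a))"
          by (rule powr_reciprocal_bounded[OF c L_nonneg]) simp
        finally show ?thesis .
      qed
      finally show ?thesis using A by (simp add: C_def A_def mult_ac mult_left_mono)
    qed
  qed
  with C show ?thesis by (intro exI[of _ C] exI[of _ n0]) simp
qed

text \<open>The modular density of the mollification is bounded by 1 plus the mollification of
  |F|^p, up to a factor. The latter converges in \<open>L\<^sup>1\<close>, so Pratt's version of
  dominated convergence applies along almost everywhere convergent subsequences.\<close>

lemma conv_moll_tendsto_mdl:
  assumes F: "integrable lborel F" and K: "compact K" "K \<subseteq> \<Omega>" "\<And>y. y \<notin> K \<Longrightarrow> F y = 0" and FL: "F \<in> Lp"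
  shows "(\<lambda>n. mdl (\<lambda>x. conv (moll n) F x - F x)) \<longlonglongrightarrow> 0"
proof -
  obtain d where d: "d > 0" "(\<Union>y\<in>K. cball y d) \<subseteq> \<Omega>" using compact_margin[OF K(1) \<Omega>_open K(2)] by blast
  have [measurable]: "F \<in> borel_measurable borel" using F by auto
  have "integrable lebesgue (\<lambda>x. indicator \<Omega> x *\<^sub>R (norm (F x) powr p x))"
    using integrable_powr[OF FL] by (simp add: integrable_restrict_space)
  then have "(\<lambda>x. indicator \<Omega> x *\<^sub>R (norm (F x) powr p x)) \<in> borel_measurable lebesgue" by auto
  \<comment> \<open>A Borel version of |F|^p is taken because \<open>p\<close> is only Lebesgue
    measurable.\<close>
  from completion_ex_borel_measurable_real[OF this]
  obtain \<Phi>0 where \<Phi>0: "\<Phi>0 \<in> borel_measurable lborel" "AE x in lborel. indicator \<Omega> x *\<^sub>R (norm (F x) powr p x) = \<Phi>0 x" by blast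
  define \<Phi> where "\<Phi> = (\<lambda>x. max 0 (\<Phi>0 x))"
  have [measurable]: "\<Phi> \<in> borel_measurable borel" using \<Phi>0(1) unfolding \<Phi>_def by auto
  have ae: "AE x in lborel. indicator \<Omega> x *\<^sub>R (norm (F x) powr p x) = \<Phi> x"
    using \<Phi>0(2)
  proof eventually_elim
    case (elim x)
    have "\<Phi>0 x \<ge> 0" unfolding elim[symmetric] by simp
    then show ?case using elim by (simp add: \<Phi>_def)
  qed
  have "integrable lebesgue \<Phi>"
  proof (rule integrable_cong_AE_imp)
    show "integrable lebesgue (\<lambda>x. indicator \<Omega> x *\<^sub>R (norm (F x) powr p x))" by fact
    show "\<Phi> \<in> borel_measurable lebesgue" by (intro measurable_completion) simp
    show "AE x in lebesgue. indicator \<Omega> x *\<^sub>R (norm (F x) powr p x) = \<Phi> x" by (rule AE_completion[OF ae])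
  qed
  then have \<Phi>: "integrable lborel \<Phi>" by (simp add: integrable_completion)
  have \<Phi>nn: "\<Phi> y \<ge> 0" for y by (simp add: \<Phi>_def)
  have \<Phi>ae: "AE y in lborel. y \<in> \<Omega> \<longrightarrow> \<Phi> y = \<bar>F y\<bar> powr p y" using ae by eventually_elim (auto simp: indicator_def)
  obtain C n0 where C0: "C > 0" "\<forall>n\<ge>n0. \<forall>x\<in>\<Omega>. \<bar>conv (moll n) F x\<bar> powr p x \<le> C * (1 + conv (moll n) \<Phi> x)"
  proof -
    have "\<exists>C n0. C > 0 \<and> (\<forall>n\<ge>n0. \<forall>x\<in>\<Omega>. \<bar>conv (moll n) F x\<bar> powr p x \<le> C * (1 + conv (moll n) \<Phi> x))"
      by (rule conv_moll_powr_le[OF F K(1,3) d \<Phi> \<Phi>nn \<Phi>ae])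
    then show ?thesis using that by (elim exE conjE)
  qed
  have C: "C > 0" "\<And>n x. n \<ge> n0 \<Longrightarrow> x \<in> \<Omega> \<Longrightarrow> \<bar>conv (moll n) F x\<bar> powr p x \<le> C * (1 + conv (moll n) \<Phi> x)"
    using C0 by simp_all
  have cm: "conv (moll n) f \<in> borel_measurable borel" if "integrable lborel f" for n and f :: "'a \<Rightarrow> real"
    by (intro borel_measurable_continuous_onI smooth_continuous conv_smooth[OF moll_test_fun that])
  note [measurable] = cm[OF F] cm[OF \<Phi>]
  define B where "B = 2 powr pp * (C + 1)"
  have B: "B > 0" using C by (simp add: B_def)
  show ?thesis
  proof (rule tendsto_0_subsequenceI)
    fix s :: "nat \<Rightarrow> nat" assume s: "strict_mono s"
    have L1: "(\<lambda>n. \<integral>\<^sup>+x. ennreal \<bar>conv (moll (s n)) F x - F x\<bar> \<partial>lborel) \<longlonglongrightarrow> 0"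
      using LIMSEQ_subseq_LIMSEQ[OF conv_moll_tendsto_L1[OF F] s] by (simp add: o_def)
    then have "\<forall>\<^sub>F n in sequentially. (\<integral>\<^sup>+x. ennreal \<bar>conv (moll (s n)) F x - F x\<bar> \<partial>lborel) < 1"
      by (rule order_tendstoD) simp
    then obtain N where N: "\<And>n. n \<ge> N \<Longrightarrow> (\<integral>\<^sup>+x. ennreal \<bar>conv (moll (s n)) F x - F x\<bar> \<partial>lborel) < 1"
      by (auto simp: eventually_sequentially)
    \<comment> \<open>From \<open>N\<close> on the \<open>L\<^sup>1\<close> distance is below 1,
      which makes these differences integrable.\<close>
    define q where "q = (\<lambda>n x. conv (moll (s (n + N))) F x - F x)"
    have qi: "integrable lborel (q n)" for n
      unfolding q_def using N[of "n + N"] by (intro integrableI_bounded) (auto intro: less_trans)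
    have "(\<lambda>n. \<integral>x. norm (q n x) \<partial>lborel) \<longlonglongrightarrow> 0"
    proof -
      have "(\<lambda>n. ennreal (\<integral>x. norm (q n x) \<partial>lborel)) \<longlonglongrightarrow> ennreal 0"
        using LIMSEQ_ignore_initial_segment[OF L1, of N] nn_integral_eq_integral[OF integrable_norm[OF qi]]
        by (simp add: q_def)
      then show ?thesis by (subst (asm) tendsto_ennreal_iff) auto
    qed
    from tendsto_L1_AE_subseq[OF qi this]
    obtain r1 :: "nat \<Rightarrow> nat" where r1: "strict_mono r1" "AE x in lborel. (\<lambda>n. q (r1 n) x) \<longlonglongrightarrow> 0" by blast
    \<comment> \<open>The shift by \<open>n0\<close> keeps all indices in the range where the bound
      on the mollification holds.\<close>
    define r where "r = (\<lambda>n. r1 (n + n0) + N)"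
    have r: "strict_mono r" unfolding r_def strict_mono_def using r1(1) by (simp add: strict_mono_def)
    have sr: "s (r n) \<ge> n0" for n
      using seq_suble[OF s, of "r n"] seq_suble[OF r1(1), of "n + n0"] unfolding r_def by linarith
    have sr_mono: "strict_mono (\<lambda>n. s (r n))" using strict_mono_o[OF s r] by (simp add: o_def)
    have lim: "AE x in lborel. (\<lambda>n. conv (moll (s (r n))) F x - F x) \<longlonglongrightarrow> 0"
      using r1(2)
    proof eventually_elim
      case (elim x)
      from LIMSEQ_ignore_initial_segment[OF this, of n0] show ?case by (simp add: q_def r_def)
    qed
    have "(\<lambda>n. \<integral>\<^sup>+x. ennreal (norm (conv (moll (s (r n))) F x - F x) powr p x) \<partial>leb) \<longlonglongrightarrow> 0"
    proof (rule nn_integral_tendsto_0_pratt[where g = "\<lambda>n x. B * (1 + conv (moll (s (r n))) \<Phi> x + \<Phi> x)"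
          and G = "\<lambda>x. B * (1 + \<Phi> x + \<Phi> x)"])
      have m: "(\<lambda>x. conv (moll (s (r n))) F x - F x) \<in> borel_measurable leb"
        "(\<lambda>x. B * (1 + conv (moll (s (r n))) \<Phi> x + \<Phi> x)) \<in> borel_measurable leb" for n
        by (intro lebesgue_on_borel; measurable)+
      show "(\<lambda>x. B * (1 + conv (moll (s (r n))) \<Phi> x + \<Phi> x)) \<in> borel_measurable leb" for n by (rule m)
      show "(\<lambda>x. norm (conv (moll (s (r n))) F x - F x) powr p x) \<in> borel_measurable leb" for n
        using m(1)[of n] by measurable
      have "integrable leb \<Phi>"
        using \<open>integrable lebesgue \<Phi>\<close> integrable_mult_indicator[OF \<Omega>_lebesgue, of \<Phi>] by (simp add: integrable_restrict_space)
      then show "integrable leb (\<lambda>x. B * (1 + \<Phi> x + \<Phi> x))" by simp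
      show "AE x in leb. norm (conv (moll (s (r n))) F x - F x) powr p x \<le> B * (1 + conv (moll (s (r n))) \<Phi> x + \<Phi> x)" for n
        using AE_lborel_imp_lebesgue_on[OF \<Omega>_lebesgue \<Phi>ae] AE_space
      proof eventually_elim
        case (elim x)
        have x: "x \<in> \<Omega>" using elim by simp
        have "norm (conv (moll (s (r n))) F x - F x) powr p x \<le> 2 powr pp * (norm (conv (moll (s (r n))) F x) powr p x + norm (- F x) powr p x)"
          using powr_add_le[OF elim(2), of "conv (moll (s (r n))) F x" "- F x"] by simp
        also have "\<dots> \<le> 2 powr pp * (C * (1 + conv (moll (s (r n))) \<Phi> x) + \<Phi> x)"
          using C(2)[OF sr x, of n] elim(1) x by (intro mult_left_mono add_mono) auto
        also have "\<dots> \<le> 2 powr pp * ((C + 1) * (1 + conv (moll (s (r n))) \<Phi> x + \<Phi> x))"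
        proof -
          have "conv (moll (s (r n))) \<Phi> x \<ge> 0"
            using \<Phi>nn by (rule conv_moll_nonneg)
          then show ?thesis using C(1) \<Phi>nn[of x] by (intro mult_left_mono) (auto simp: algebra_simps)
        qed
        finally show ?case by (simp add: B_def mult_ac)
      qed
      show "AE x in leb. (\<lambda>n. norm (conv (moll (s (r n))) F x - F x) powr p x) \<longlonglongrightarrow> 0"
        using AE_lborel_imp_lebesgue_on[OF \<Omega>_lebesgue lim] AE_space
      proof eventually_elim
        case (elim x)
        have "(\<lambda>n. norm (conv (moll (s (r n))) F x - F x) powr p x) \<longlonglongrightarrow> 0 powr p x"
          using elim p_gt_1[OF elim(2)] by (intro tendsto_powr' tendsto_norm_zero tendsto_const) auto
        then show ?case by simp
      qed
      have "(\<lambda>n. ennreal B * (\<integral>\<^sup>+x. ennreal \<bar>conv (moll (s (r n))) \<Phi> x - \<Phi> x\<bar> \<partial>lborel)) \<longlonglongrightarrow> ennreal B * 0"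
        using LIMSEQ_subseq_LIMSEQ[OF conv_moll_tendsto_L1[OF \<Phi>] sr_mono] by (intro ennreal_tendsto_cmult) (auto simp: o_def)
      then have "(\<lambda>n. ennreal B * (\<integral>\<^sup>+x. ennreal \<bar>conv (moll (s (r n))) \<Phi> x - \<Phi> x\<bar> \<partial>lborel)) \<longlonglongrightarrow> 0" by simp
      then show "(\<lambda>n. \<integral>\<^sup>+x. ennreal \<bar>B * (1 + conv (moll (s (r n))) \<Phi> x + \<Phi> x) - B * (1 + \<Phi> x + \<Phi> x)\<bar> \<partial>leb) \<longlonglongrightarrow> 0"
      proof (rule tendsto_sandwich[OF _ _ tendsto_const, rotated 2])
        have "(\<integral>\<^sup>+x. ennreal \<bar>B * (1 + conv (moll (s (r n))) \<Phi> x + \<Phi> x) - B * (1 + \<Phi> x + \<Phi> x)\<bar> \<partial>leb)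
           \<le> ennreal B * (\<integral>\<^sup>+x. ennreal \<bar>conv (moll (s (r n))) \<Phi> x - \<Phi> x\<bar> \<partial>lborel)" for n
        proof -
          have "\<bar>B * (1 + conv (moll (s (r n))) \<Phi> x + \<Phi> x) - B * (1 + \<Phi> x + \<Phi> x)\<bar> = B * \<bar>conv (moll (s (r n))) \<Phi> x - \<Phi> x\<bar>" for x
            using B by (simp add: right_diff_distrib[symmetric] abs_mult)
          then have "(\<integral>\<^sup>+x. ennreal \<bar>B * (1 + conv (moll (s (r n))) \<Phi> x + \<Phi> x) - B * (1 + \<Phi> x + \<Phi> x)\<bar> \<partial>leb)
            = (\<integral>\<^sup>+x. ennreal (B * \<bar>conv (moll (s (r n))) \<Phi> x - \<Phi> x\<bar>) \<partial>leb)" by simp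
          also have "\<dots> \<le> (\<integral>\<^sup>+x. ennreal (B * \<bar>conv (moll (s (r n))) \<Phi> x - \<Phi> x\<bar>) \<partial>lborel)"
            by (rule nn_integral_lebesgue_on_le[OF \<Omega>_lebesgue])
          also have "\<dots> = ennreal B * (\<integral>\<^sup>+x. ennreal \<bar>conv (moll (s (r n))) \<Phi> x - \<Phi> x\<bar> \<partial>lborel)"
            using B by (simp add: ennreal_mult nn_integral_cmult)
          finally show ?thesis .
        qed
        then show "\<forall>\<^sub>F n in sequentially. (\<integral>\<^sup>+x. ennreal \<bar>B * (1 + conv (moll (s (r n))) \<Phi> x + \<Phi> x) - B * (1 + \<Phi> x + \<Phi> x)\<bar> \<partial>leb)
           \<le> ennreal B * (\<integral>\<^sup>+x. ennreal \<bar>conv (moll (s (r n))) \<Phi> x - \<Phi> x\<bar> \<partial>lborel)" by simp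
      qed simp
    qed simp
    then show "\<exists>r. strict_mono r \<and> (\<lambda>n. mdl (\<lambda>x. conv (moll (s (r n))) F x - F x)) \<longlonglongrightarrow> 0"
      unfolding mdl_def using r by blast
  qed
qed


text \<open>\<open>conv\<close> is defined over \<open>lborel\<close>; the Borel version must keep
  the compact support, hence the indicator of K.\<close>

lemma borel_representative:
  fixes f :: "'a \<Rightarrow> real"
  assumes K: "compact K" "K \<subseteq> \<Omega>" and f: "f \<in> Lp" "\<And>x. x \<notin> K \<Longrightarrow> f x = 0"
  shows "\<exists>F. integrable lborel F \<and> (\<forall>x. x \<notin> K \<longrightarrow> F x = 0) \<and> (AE x in lebesgue. F x = f x) \<and> F \<in> Lp \<and>
    (AE x in leb. F x = f x)"
proof -
  have out: "f x = 0" if "x \<notin> \<Omega>" for x using f(2) K(2) that by blast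
  have fi: "integrable lebesgue f"
    using integral_lebesgue_on_zero_outside(2)[OF \<Omega>_lebesgue, of f] out Lp_integrable[OF f(1)] by blast
  then have "f \<in> borel_measurable lebesgue" by auto
  from completion_ex_borel_measurable_real[OF this]
  obtain g where g: "g \<in> borel_measurable lborel" "AE x in lborel. f x = g x" by blast
  define F where "F = (\<lambda>x. indicator K x * g x)"
  have [measurable]: "g \<in> borel_measurable borel" "K \<in> sets borel" using g K(1) by (auto simp: compact_imp_closed)
  have Fm: "F \<in> borel_measurable borel" unfolding F_def by measurable
  have ae: "AE x in lebesgue. F x = f x"
    using AE_completion[OF g(2)] by eventually_elim (auto simp: F_def f(2) indicator_def)
  have "integrable lebesgue F"
  proof (rule integrable_cong_AE_imp[OF fi])
    show "F \<in> borel_measurable lebesgue" using Fm by (intro measurable_completion) simp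
    show "AE x in lebesgue. f x = F x" using ae by eventually_elim simp
  qed
  then have 1: "integrable lborel F" using Fm by (simp add: integrable_completion)
  have 2: "AE x in leb. F x = f x" using ae by (simp add: AE_restrict_space_iff) (auto elim: eventually_mono)
  have 3: "F \<in> Lp" using f(1) lebesgue_on_borel[OF Fm] mdl_cong_AE[OF 2] by (simp add: Lp_def)
  show ?thesis using 1 ae 3 2 by (intro exI[of _ F] conjI) (auto simp: F_def)
qed

lemma Lp_mult_bounded:
  fixes f :: "'a \<Rightarrow> 'b::euclidean_space"
  assumes f: "f \<in> Lp" and g: "g \<in> borel_measurable leb" "AE x in leb. \<bar>g x\<bar> \<le> C"
  shows "(\<lambda>x. g x *\<^sub>R f x) \<in> Lp"
proof (rule Lp_bound[OF Lp_cmult[OF f, of C]])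
  show "(\<lambda>x. g x *\<^sub>R f x) \<in> borel_measurable leb"
    using g(1) Lp_measurable[OF f] by (rule borel_measurable_scaleR)
  show "AE x in leb. norm (g x *\<^sub>R f x) \<le> norm (C *\<^sub>R f x)"
    using g(2)
  proof eventually_elim
    case (elim x)
    then have "\<bar>g x\<bar> \<le> \<bar>C\<bar>" by linarith
    then show ?case by (simp add: mult_right_mono)
  qed
qed

text \<open>\<zeta> w has compact support, so its mollifications are eventually test functions.
  Their derivatives are mollifications of the weak gradient given by the product rule, and both
  converge in the modular.\<close>

lemma V_cutoff:
  assumes w: "w \<in> Lp" "AE x in leb. \<bar>w x\<bar> \<le> C" and W: "W \<in> Lp" "has_weak_gradient \<Omega> w W"
    and \<zeta>: "\<zeta> \<in> test_fun \<Omega>"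
  shows "(\<lambda>x. \<zeta> x * w x, \<lambda>x. \<zeta> x *\<^sub>R W x + w x *\<^sub>R grad \<zeta> x) \<in> V"
proof -
  obtain K where K: "compact K" "K \<subseteq> \<Omega>" "\<And>x. x \<notin> K \<Longrightarrow> \<zeta> x = 0" "\<And>x. x \<notin> K \<Longrightarrow> grad \<zeta> x = 0"
    using test_funE[OF \<zeta>] by metis
  obtain B where B: "\<And>x. \<bar>\<zeta> x\<bar> \<le> B" "\<And>x. norm (grad \<zeta> x) \<le> B" using test_fun_bounded[OF \<zeta>] by metis
  note \<zeta>m = lebesgue_on_borel[OF test_fun_measurable(1)[OF \<zeta>]]
  define v where "v = (\<lambda>x. \<zeta> x * w x)"
  define H where "H = (\<lambda>x. \<zeta> x *\<^sub>R W x + w x *\<^sub>R grad \<zeta> x)"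
  have v: "v \<in> Lp" using Lp_mult_bounded[OF w(1) \<zeta>m, of B] B by (simp add: v_def)
  have H: "H \<in> Lp" unfolding H_def
  proof (rule Lp_add)
    show "(\<lambda>x. \<zeta> x *\<^sub>R W x) \<in> Lp" using Lp_mult_bounded[OF W(1) \<zeta>m, of B] B by simp
    show "(\<lambda>x. w x *\<^sub>R grad \<zeta> x) \<in> Lp" by (rule Lp_mult_bounded[OF test_fun_Lp(2)[OF \<zeta>] Lp_measurable[OF w(1)] w(2)])
  qed
  have v0: "v x = 0" and H0: "H x = 0" if "x \<notin> K" for x using K(3,4)[OF that] by (auto simp: v_def H_def)
  obtain F where F': "integrable lborel F" "\<forall>x. x \<notin> K \<longrightarrow> F x = 0" "AE x in lebesgue. F x = v x" "F \<in> Lp"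
    "AE x in leb. F x = v x"
  proof -
    have "\<exists>F. integrable lborel F \<and> (\<forall>x. x \<notin> K \<longrightarrow> F x = 0) \<and> (AE x in lebesgue. F x = v x) \<and> F \<in> Lp \<and>
      (AE x in leb. F x = v x)" by (rule borel_representative[OF K(1,2) v v0])
    then show ?thesis using that by (elim exE conjE)
  qed
  note F = F'(1) F'(2)[rule_format] F'(3-)
  have "\<exists>Fb. integrable lborel Fb \<and> (\<forall>x. x \<notin> K \<longrightarrow> Fb x = 0) \<and> (AE x in lebesgue. Fb x = H x \<bullet> b) \<and> Fb \<in> Lp \<and>
    (AE x in leb. Fb x = H x \<bullet> b)" if b: "b \<in> Basis" for b
  proof -
    have "(\<lambda>x. H x \<bullet> b) x = 0" if "x \<notin> K" for x using H0[OF that] by simp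
    from borel_representative[OF K(1,2) Lp_component[OF H b] this] show ?thesis by simp
  qed
  then have "\<exists>Fb. \<forall>b\<in>Basis. integrable lborel (Fb b) \<and> (\<forall>x. x \<notin> K \<longrightarrow> Fb b x = 0) \<and> (AE x in lebesgue. Fb b x = H x \<bullet> b) \<and>
      Fb b \<in> Lp \<and> (AE x in leb. Fb b x = H x \<bullet> b)"
    by (intro bchoice ballI)
  then obtain Fb where all: "\<forall>b\<in>Basis. integrable lborel (Fb b) \<and> (\<forall>x. x \<notin> K \<longrightarrow> Fb b x = 0) \<and> (AE x in lebesgue. Fb b x = H x \<bullet> b) \<and>
      Fb b \<in> Lp \<and> (AE x in leb. Fb b x = H x \<bullet> b)" ..
  have Fb: "\<And>b. b \<in> Basis \<Longrightarrow> integrable lborel (Fb b)" "\<And>b x. b \<in> Basis \<Longrightarrow> x \<notin> K \<Longrightarrow> Fb b x = 0"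
     "\<And>b. b \<in> Basis \<Longrightarrow> AE x in lebesgue. Fb b x = H x \<bullet> b" "\<And>b. b \<in> Basis \<Longrightarrow> Fb b \<in> Lp"
     "\<And>b. b \<in> Basis \<Longrightarrow> AE x in leb. Fb b x = H x \<bullet> b"
    using all by simp_all
  have partial_eq: "partial (conv (moll n) F) b x = conv (moll n) (Fb b) x" if b: "b \<in> Basis" for n b x
  proof -
    \<comment> \<open>The mollifier as a function of the integration variable. Its product with
      \<zeta> is the test function to which the weak gradient of w is applied; differentiation in y
      accounts for the sign.\<close>
    define \<rho> where "\<rho> = (\<lambda>y. moll n (x + (- 1) *\<^sub>R y))"
    have \<rho>s: "smooth_on UNIV \<rho>" unfolding \<rho>_def by (intro smooth_affine test_fun_smooth[OF moll_test_fun])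
    have \<rho>d: "\<rho> differentiable (at y)" for y by (rule smooth_imp_differentiable[OF \<rho>s])
    have g\<rho>: "partial \<rho> b y = - partial (moll n) b (x - y)" for y
    proof -
      have "grad \<rho> y = (- 1) *\<^sub>R grad (moll n) (x + (- 1) *\<^sub>R y)" unfolding \<rho>_def
        by (rule grad_affine[OF test_fun_differentiable[OF moll_test_fun]])
      then have "grad \<rho> y \<bullet> b = - (grad (moll n) (x - y) \<bullet> b)" by simp
      then show ?thesis using b by simp
    qed
    define \<psi> where "\<psi> = (\<lambda>y. \<rho> y * \<zeta> y)"
    have \<psi>: "\<psi> \<in> test_fun \<Omega>" unfolding \<psi>_def by (rule test_fun_smooth_mult[OF \<zeta> \<rho>s])
    have p\<psi>: "partial \<psi> b y = \<rho> y * partial \<zeta> b y - \<zeta> y * partial (moll n) b (x - y)" for y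
    proof -
      have "grad \<psi> y \<bullet> b = \<rho> y * (grad \<zeta> y \<bullet> b) + \<zeta> y * (grad \<rho> y \<bullet> b)"
        unfolding \<psi>_def grad_mult[OF \<rho>d test_fun_differentiable[OF \<zeta>]] by (simp add: inner_add_left)
      then show ?thesis using b by (simp add: g\<rho>)
    qed
    note wi = weak_gradientD[OF W(2)]
    have mollb: "partial (moll n) b \<in> test_fun UNIV" by (rule test_fun_partial[OF moll_test_fun b])
    have s1: "(\<lambda>y. \<zeta> y * partial (moll n) b (x - y)) \<in> test_fun \<Omega>"
    proof -
      have "smooth_on UNIV (\<lambda>y. partial (moll n) b (x + (- 1) *\<^sub>R y))"
        by (intro smooth_affine test_fun_smooth[OF mollb])
      from test_fun_smooth_mult[OF \<zeta> this] show ?thesis by (simp add: mult.commute)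
    qed
    have s2: "(\<lambda>y. \<rho> y * partial \<zeta> b y) \<in> test_fun \<Omega>" by (rule test_fun_smooth_mult[OF test_fun_partial[OF \<zeta> b] \<rho>s])
    have i1: "integrable leb (\<lambda>y. w y * (\<zeta> y * partial (moll n) b (x - y)))"
      using wi(1) by (intro locally_integrable_mult_test_fun[OF _ s1])
    have i2: "integrable leb (\<lambda>y. w y * (\<rho> y * partial \<zeta> b y))"
      using wi(1) by (intro locally_integrable_mult_test_fun[OF _ s2])
    have i3: "integrable leb (\<lambda>y. (W y \<bullet> b) * \<psi> y)"
      using wi(2)[OF _ _ b] by (intro locally_integrable_mult_test_fun[OF _ \<psi>])
    \<comment> \<open>Passes from the Borel version in \<open>conv\<close> back to the function on
      \<Omega>.\<close>
    have to_leb: "conv \<eta> f x = integral\<^sup>L leb (\<lambda>y. \<eta> (x - y) * g y)"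
      if \<eta>: "\<eta> \<in> test_fun UNIV" and f: "integrable lborel f" and ae: "AE y in lebesgue. f y = g y" and g0: "\<And>y. y \<notin> K \<Longrightarrow> g y = 0"
        and gm: "g \<in> Lp" for \<eta> f and g :: "'a \<Rightarrow> real"
    proof -
      have [measurable]: "\<eta> \<in> borel_measurable borel" "f \<in> borel_measurable borel" using test_fun_measurable(1)[OF \<eta>] f by auto
      have em: "(\<lambda>y. \<eta> (x - y)) \<in> borel_measurable lebesgue" by (intro measurable_completion) measurable
      have out: "g y = 0" if "y \<notin> \<Omega>" for y using g0 K(2) that by blast
      have gl: "g \<in> borel_measurable lebesgue"
        using integral_lebesgue_on_zero_outside(2)[OF \<Omega>_lebesgue, of g] out Lp_integrable[OF gm] by auto
      have fl: "f \<in> borel_measurable lebesgue" by (intro measurable_completion) simp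
      have "conv \<eta> f x = (\<integral>y. \<eta> (x - y) * f y \<partial>lebesgue)"
        unfolding conv_def by (intro integral_completion[symmetric]) measurable
      also have "\<dots> = (\<integral>y. \<eta> (x - y) * g y \<partial>lebesgue)"
        using ae by (intro integral_cong_AE borel_measurable_times em fl gl) (auto elim!: eventually_mono)
      also have "\<dots> = integral\<^sup>L leb (\<lambda>y. \<eta> (x - y) * g y)"
        using out by (intro integral_lebesgue_on_zero_outside(1)[OF \<Omega>_lebesgue, symmetric]) auto
      finally show ?thesis .
    qed
    have "partial (conv (moll n) F) b x = conv (partial (moll n) b) F x"
      by (rule partial_conv[OF moll_test_fun F(1) b])
    also have "\<dots> = integral\<^sup>L leb (\<lambda>y. partial (moll n) b (x - y) * v y)"
      by (rule to_leb[OF mollb F(1,3) v0 v])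
    also have "\<dots> = integral\<^sup>L leb (\<lambda>y. w y * (\<zeta> y * partial (moll n) b (x - y)))"
      by (simp add: v_def mult_ac)
    also have "\<dots> = integral\<^sup>L leb (\<lambda>y. w y * (\<rho> y * partial \<zeta> b y)) - integral\<^sup>L leb (\<lambda>y. w y * partial \<psi> b y)"
      using i1 i2 by (simp add: p\<psi> right_diff_distrib)
    also have "\<dots> = integral\<^sup>L leb (\<lambda>y. w y * (\<rho> y * partial \<zeta> b y)) + integral\<^sup>L leb (\<lambda>y. (W y \<bullet> b) * \<psi> y)"
      using wi(3)[OF \<psi> b] by simp
    also have "\<dots> = integral\<^sup>L leb (\<lambda>y. w y * (\<rho> y * partial \<zeta> b y) + (W y \<bullet> b) * \<psi> y)"
      using i2 i3 by (intro Bochner_Integration.integral_add[symmetric])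
    also have "\<dots> = integral\<^sup>L leb (\<lambda>y. moll n (x - y) * (H y \<bullet> b))"
      using b by (intro Bochner_Integration.integral_cong refl) (simp add: H_def \<psi>_def \<rho>_def inner_add_left algebra_simps)
    also have "\<dots> = conv (moll n) (Fb b) x"
      by (rule to_leb[OF moll_test_fun Fb(1,3)[OF b] _ Lp_component[OF H b], symmetric]) (simp add: H0)
    finally show ?thesis .
  qed
  obtain d where d: "d > 0" "(\<Union>y\<in>K. cball y d) \<subseteq> \<Omega>" using compact_margin[OF K(1) \<Omega>_open K(2)] by blast
  \<comment> \<open>From this scale on the enlarged support stays inside \<Omega>.\<close>
  obtain N where N: "1 / real (Suc N) < d" using nat_approx_posE[OF d(1)] by auto
  define \<phi> where "\<phi> = (\<lambda>n. conv (moll (n + N)) F)"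
  have "(v, H) \<in> V"
  proof (rule V_I[OF v H])
    show \<phi>t: "\<phi> n \<in> test_fun \<Omega>" for n
      unfolding \<phi>_def
    proof (rule conv_moll_test_fun[OF F(1) K(1) F(2)])
      have "1 / real (Suc (n + N)) \<le> 1 / real (Suc N)" by (intro divide_left_mono) auto
      then have "1 / real (Suc (n + N)) \<le> d" using N by linarith
      then have "(\<Union>y\<in>K. cball y (1 / real (Suc (n + N)))) \<subseteq> (\<Union>y\<in>K. cball y d)" by (intro UN_mono subset_cball) auto
      then show "(\<Union>y\<in>K. cball y (1 / real (Suc (n + N)))) \<subseteq> \<Omega>" using d(2) by blast
    qed
    have "(\<lambda>n. mdl (\<lambda>x. conv (moll n) F x - F x)) \<longlonglongrightarrow> 0"
      by (rule conv_moll_tendsto_mdl[OF F(1) K(1,2) F(2) F(4)])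
    from LIMSEQ_ignore_initial_segment[OF this, of N]
    show "(\<lambda>n. mdl (\<lambda>x. \<phi> n x - v x)) \<longlonglongrightarrow> 0"
    proof (rule mdl_tendsto_mono[rotated])
      show "AE x in leb. norm (\<phi> n x - v x) \<le> norm (conv (moll (n + N)) F x - F x)" for n
        using F(5) by eventually_elim (simp add: \<phi>_def)
    qed
    show "(\<lambda>n. mdl (\<lambda>x. grad (\<phi> n) x - H x)) \<longlonglongrightarrow> 0"
    proof (rule mdl_tendsto_components)
      show "(\<lambda>x. grad (\<phi> n) x - H x) \<in> borel_measurable leb" for n
        using test_fun_Lp(2)[OF \<phi>t] H by (intro borel_measurable_diff Lp_measurable)
      fix b :: 'a assume b: "b \<in> Basis"
      have "(\<lambda>n. mdl (\<lambda>x. conv (moll n) (Fb b) x - Fb b x)) \<longlonglongrightarrow> 0"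
        by (rule conv_moll_tendsto_mdl[OF Fb(1)[OF b] K(1,2) Fb(2)[OF b] Fb(4)[OF b]])
      from LIMSEQ_ignore_initial_segment[OF this, of N]
      show "(\<lambda>n. mdl (\<lambda>x. (grad (\<phi> n) x - H x) \<bullet> b)) \<longlonglongrightarrow> 0"
      proof (rule mdl_tendsto_mono[rotated])
        show "AE x in leb. norm ((grad (\<phi> n) x - H x) \<bullet> b) \<le> norm (conv (moll (n + N)) (Fb b) x - Fb b x)" for n
          using Fb(5)[OF b] by eventually_elim (simp add: \<phi>_def inner_diff_left b partial_eq[OF b])
      qed
    qed
  qed
  then show ?thesis by (simp add: v_def H_def)
qed

section \<open>Composition with the smooth positive part\<close>

text \<open>The values converge because \<open>ramp\<close> is 1-Lipschitz. The gradients differ by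
  a bounded factor times \<Gamma> n - G and by a difference of slopes times the fixed G - W; the
  latter needs an almost everywhere convergent subsequence and domination.\<close>

lemma ramp_V_tendsto:
  assumes \<phi>: "\<And>n. \<phi> n \<in> Lp" "\<And>n. \<Gamma> n \<in> Lp" and u: "u \<in> Lp" "G \<in> Lp" and w: "w \<in> Lp" "W \<in> Lp"
    and V: "\<And>n. (\<lambda>x. ramp (\<phi> n x - w x), \<lambda>x. ramp' (\<phi> n x - w x) *\<^sub>R (\<Gamma> n x - W x)) \<in> V"
    and lim: "(\<lambda>n. mdl (\<lambda>x. \<phi> n x - u x)) \<longlonglongrightarrow> 0" "(\<lambda>n. mdl (\<lambda>x. \<Gamma> n x - G x)) \<longlonglongrightarrow> 0"
  shows "(\<lambda>x. ramp (u x - w x), \<lambda>x. ramp' (u x - w x) *\<^sub>R (G x - W x)) \<in> V"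
proof -
  obtain r :: "nat \<Rightarrow> nat" where r: "strict_mono r" "AE x in leb. (\<lambda>n. \<phi> (r n) x) \<longlonglongrightarrow> u x"
    using mdl_tendsto_AE_subseq[OF \<phi>(1) u(1) lim(1)] by metis
  have rampm: "(\<lambda>x. ramp (f x)) \<in> borel_measurable leb" "(\<lambda>x. ramp' (f x)) \<in> borel_measurable leb"
    if "f \<in> Lp" for f :: "'a \<Rightarrow> real"
    using measurable_compose[OF Lp_measurable[OF that] borel_measurable_continuous_onI[OF continuous_ramp(1)]]
      measurable_compose[OF Lp_measurable[OF that] borel_measurable_continuous_onI[OF continuous_ramp(2)]] by auto
  have ramp'b: "\<bar>ramp' t\<bar> \<le> 1" for t using ramp'_bounds[of t] by simp
  have rL: "(\<lambda>x. ramp (f x)) \<in> Lp" if "f \<in> Lp" for f :: "'a \<Rightarrow> real"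
    by (rule Lp_bound[OF that rampm(1)[OF that]]) (simp add: ramp_nonneg ramp_le)
  have r'L: "(\<lambda>x. ramp' (f x) *\<^sub>R K x) \<in> Lp" if "f \<in> Lp" "K \<in> Lp" for f :: "'a \<Rightarrow> real" and K :: "'a \<Rightarrow> 'a"
    by (rule Lp_mult_bounded[OF that(2) rampm(2)[OF that(1)], of 1]) (simp add: ramp'b)
  have uw: "(\<lambda>x. u x - w x) \<in> Lp" "(\<lambda>x. G x - W x) \<in> Lp" using u w by (auto intro: Lp_diff)
  have \<phi>w: "(\<lambda>x. \<phi> n x - w x) \<in> Lp" "(\<lambda>x. \<Gamma> n x - W x) \<in> Lp" for n using \<phi> w by (auto intro: Lp_diff)
  show ?thesis
  proof (rule V_closed[OF V rL[OF uw(1)] r'L[OF uw]])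
    have "(\<lambda>n. mdl (\<lambda>x. \<phi> (r n) x - u x)) \<longlonglongrightarrow> 0" using LIMSEQ_subseq_LIMSEQ[OF lim(1) r(1)] by (simp add: o_def)
    then show "(\<lambda>n. mdl (\<lambda>x. ramp (\<phi> (r n) x - w x) - ramp (u x - w x))) \<longlonglongrightarrow> 0"
    proof (rule mdl_tendsto_mono[rotated])
      have "norm (ramp (\<phi> (r n) x - w x) - ramp (u x - w x)) \<le> norm (\<phi> (r n) x - u x)" for n x
        using ramp_lipschitz[of "\<phi> (r n) x - w x" "u x - w x"] by simp
      then show "AE x in leb. norm (ramp (\<phi> (r n) x - w x) - ramp (u x - w x)) \<le> norm (\<phi> (r n) x - u x)" for n
        by simp
    qed
    have l1: "(\<lambda>n. mdl (\<lambda>x. ramp' (\<phi> (r n) x - w x) *\<^sub>R (\<Gamma> (r n) x - G x))) \<longlonglongrightarrow> 0"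
    proof (rule mdl_tendsto_mono)
      show "(\<lambda>n. mdl (\<lambda>x. \<Gamma> (r n) x - G x)) \<longlonglongrightarrow> 0" using LIMSEQ_subseq_LIMSEQ[OF lim(2) r(1)] by (simp add: o_def)
      show "AE x in leb. norm (ramp' (\<phi> (r n) x - w x) *\<^sub>R (\<Gamma> (r n) x - G x)) \<le> norm (\<Gamma> (r n) x - G x)" for n
        using ramp'b by (simp add: mult_left_le_one_le)
    qed
    have l2: "(\<lambda>n. mdl (\<lambda>x. ramp' (\<phi> (r n) x - w x) *\<^sub>R (G x - W x) - ramp' (u x - w x) *\<^sub>R (G x - W x))) \<longlonglongrightarrow> 0"
    proof (rule mdl_dominated[OF _ _ uw(2)])
      show "(\<lambda>x. ramp' (\<phi> (r n) x - w x) *\<^sub>R (G x - W x)) \<in> borel_measurable leb" for n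
        by (rule Lp_measurable[OF r'L[OF \<phi>w(1) uw(2)]])
      show "(\<lambda>x. ramp' (u x - w x) *\<^sub>R (G x - W x)) \<in> borel_measurable leb"
        by (rule Lp_measurable[OF r'L[OF uw]])
      show "AE x in leb. norm (ramp' (\<phi> (r n) x - w x) *\<^sub>R (G x - W x)) \<le> norm (G x - W x)" for n
        using ramp'b by (simp add: mult_left_le_one_le)
      show "AE x in leb. (\<lambda>n. ramp' (\<phi> (r n) x - w x) *\<^sub>R (G x - W x)) \<longlonglongrightarrow> ramp' (u x - w x) *\<^sub>R (G x - W x)"
        using r(2)
      proof eventually_elim
        case (elim x)
        have "isCont ramp' (u x - w x)" using continuous_ramp(2) by (simp add: continuous_on_eq_continuous_at)
        from isCont_tendsto_compose[OF this tendsto_diff[OF elim tendsto_const]]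
        show ?case by (intro tendsto_scaleR tendsto_const)
      qed
    qed
    have "(\<lambda>n. mdl (\<lambda>x. ramp' (\<phi> (r n) x - w x) *\<^sub>R (\<Gamma> (r n) x - G x)
       + (ramp' (\<phi> (r n) x - w x) *\<^sub>R (G x - W x) - ramp' (u x - w x) *\<^sub>R (G x - W x)))) \<longlonglongrightarrow> 0"
    proof (rule mdl_tendsto_add[OF _ _ l1 l2])
      show "(\<lambda>x. ramp' (\<phi> (r n) x - w x) *\<^sub>R (\<Gamma> (r n) x - G x)) \<in> borel_measurable leb" for n
        by (rule Lp_measurable[OF r'L[OF \<phi>w(1) Lp_diff[OF \<phi>(2) u(2)]]])
      show "(\<lambda>x. ramp' (\<phi> (r n) x - w x) *\<^sub>R (G x - W x) - ramp' (u x - w x) *\<^sub>R (G x - W x)) \<in> borel_measurable leb" for n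
        by (rule Lp_measurable[OF Lp_diff[OF r'L[OF \<phi>w(1) uw(2)] r'L[OF uw]]])
    qed
    then show "(\<lambda>n. mdl (\<lambda>x. ramp' (\<phi> (r n) x - w x) *\<^sub>R (\<Gamma> (r n) x - W x) - ramp' (u x - w x) *\<^sub>R (G x - W x))) \<longlonglongrightarrow> 0"
      by (simp add: algebra_simps)
  qed
qed

lemma V_ramp:
  assumes V: "(u, G) \<in> V"
  shows "(\<lambda>x. ramp (u x), \<lambda>x. ramp' (u x) *\<^sub>R G x) \<in> V"
proof -
  obtain \<phi> where \<phi>: "u \<in> Lp" "G \<in> Lp" "\<And>n. \<phi> n \<in> test_fun \<Omega>" "(\<lambda>n. mdl (\<lambda>x. \<phi> n x - u x)) \<longlonglongrightarrow> 0"
     "(\<lambda>n. mdl (\<lambda>x. grad (\<phi> n) x - G x)) \<longlonglongrightarrow> 0" by (rule V_E[OF V]) blast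
  have "(\<lambda>x. ramp (\<phi> n x), grad (\<lambda>x. ramp (\<phi> n x))) \<in> V" for n by (rule V_test_fun[OF test_fun_ramp[OF \<phi>(3)]])
  moreover have "grad (\<lambda>x. ramp (\<phi> n x)) = (\<lambda>x. ramp' (\<phi> n x) *\<^sub>R grad (\<phi> n) x)" for n
    using grad_comp_real[OF test_fun_differentiable[OF \<phi>(3)] ramp_has_derivative] by blast
  ultimately have "(\<lambda>x. ramp (\<phi> n x - 0), \<lambda>x. ramp' (\<phi> n x - 0) *\<^sub>R (grad (\<phi> n) x - 0)) \<in> V" for n by simp
  from ramp_V_tendsto[OF test_fun_Lp[OF \<phi>(3)] \<phi>(1,2) Lp_zero Lp_zero this \<phi>(4,5)]
  show ?thesis by simp
qed

text \<open>Zero boundary values come from u alone. For a test function \<phi> and w \<ge> 0 the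
  expression ramp (\<phi> - w) vanishes off the support of \<phi>, so w may be replaced by \<zeta> w
  with a cutoff \<zeta>, and \<open>V_cutoff\<close> applies.\<close>

lemma V_ramp_minus:
  assumes V: "(u, G) \<in> V" and w: "w \<in> Lp" "AE x in leb. \<bar>w x\<bar> \<le> C" "AE x in leb. w x \<ge> 0"
    and W: "W \<in> Lp" "has_weak_gradient \<Omega> w W"
  shows "(\<lambda>x. ramp (u x - w x), \<lambda>x. ramp' (u x - w x) *\<^sub>R (G x - W x)) \<in> V"
proof -
  have step: "(\<lambda>x. ramp (\<phi> x - w x), \<lambda>x. ramp' (\<phi> x - w x) *\<^sub>R (grad \<phi> x - W x)) \<in> V" if \<phi>: "\<phi> \<in> test_fun \<Omega>" for \<phi>
  proof -
    obtain K where K: "compact K" "K \<subseteq> \<Omega>" "\<And>x. x \<notin> K \<Longrightarrow> \<phi> x = 0" "\<And>x. x \<notin> K \<Longrightarrow> grad \<phi> x = 0"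
      using test_funE[OF \<phi>] by metis
    obtain d where d: "d > 0" "(\<Union>y\<in>K. cball y d) \<subseteq> \<Omega>" using compact_margin[OF K(1) \<Omega>_open K(2)] by blast
    \<comment> \<open>The cutoff is 1 on a neighbourhood of K, so that its gradient vanishes on
      K.\<close>
    obtain \<zeta> where \<zeta>: "\<zeta> \<in> test_fun \<Omega>" "\<And>x. \<zeta> x \<ge> 0" "\<And>x. x \<in> (\<Union>y\<in>K. cball y d) \<Longrightarrow> \<zeta> x = 1"
      using test_fun_cutoff[OF compact_UN_cball[OF K(1)] \<Omega>_open d(2)] by metis
    have \<zeta>K: "\<zeta> x = 1" "grad \<zeta> x = 0" if "x \<in> K" for x
    proof -
      have near: "\<zeta> y = 1" if "y \<in> ball x d" for y using that \<open>x \<in> K\<close> by (intro \<zeta>(3) UN_I[of x]) auto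
      show "\<zeta> x = 1" using near d(1) by simp
      have "(\<zeta> has_derivative (\<lambda>_. 0)) (at x)"
        by (rule has_derivative_transform_within_open[OF has_derivative_const[of 1], of "ball x d"])
           (use near d in auto)
      moreover have "(\<bullet>) (0::'a) = (\<lambda>_. 0)" by auto
      ultimately show "grad \<zeta> x = 0" by (intro grad_eqI) simp
    qed
    note V1 = V_ramp[OF V_diff[OF V_test_fun[OF \<phi>] V_cutoff[OF w(1,2) W \<zeta>(1)]]]
    \<comment> \<open>Off K both arguments are nonpositive, where \<open>ramp\<close> and its
      derivative are 0.\<close>
    have pt: "ramp (\<phi> x - w x) = ramp (\<phi> x - \<zeta> x * w x) \<and> ramp' (\<phi> x - w x) *\<^sub>R (grad \<phi> x - W x)
        = ramp' (\<phi> x - \<zeta> x * w x) *\<^sub>R (grad \<phi> x - (\<zeta> x *\<^sub>R W x + w x *\<^sub>R grad \<zeta> x))" if "w x \<ge> 0" for x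
    proof (cases "x \<in> K")
      case True then show ?thesis using \<zeta>K by simp
    next
      case False
      then show ?thesis using K(3,4)[OF False] that \<zeta>(2)[of x] by simp
    qed
    show ?thesis
      by (rule V_cong_AE[OF V1]) (use w(3) pt in \<open>auto elim!: eventually_mono\<close>)
  qed
  obtain \<phi> where \<phi>: "u \<in> Lp" "G \<in> Lp" "\<And>n. \<phi> n \<in> test_fun \<Omega>" "(\<lambda>n. mdl (\<lambda>x. \<phi> n x - u x)) \<longlonglongrightarrow> 0"
     "(\<lambda>n. mdl (\<lambda>x. grad (\<phi> n) x - G x)) \<longlonglongrightarrow> 0" by (rule V_E[OF V]) blast
  show ?thesis by (rule ramp_V_tendsto[OF test_fun_Lp[OF \<phi>(3)] \<phi>(1,2) w(1) W(1) step[OF \<phi>(3)] \<phi>(4,5)])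
qed


text \<open>Each pair is replaced by a test function within 1/(n+1) in the modular. On a set of
  finite measure bounded modulars give the \<open>L\<^sup>1\<close> bounds of functions and
  gradients that \<open>rellich\<close> asks for.\<close>

lemma V_rellich:
  fixes us :: "nat \<Rightarrow> 'a \<Rightarrow> real" and Gs :: "nat \<Rightarrow> 'a \<Rightarrow> 'a"
  assumes V: "\<And>n. (us n, Gs n) \<in> V" and S: "\<And>n. total (us n) (Gs n) \<le> S"
  shows "\<exists>r :: nat \<Rightarrow> nat. strict_mono r \<and> (\<forall>e>0. \<exists>N. \<forall>k\<ge>N. \<forall>l\<ge>N.
     (\<integral>x. \<bar>us (r k) x - us (r l) x\<bar> \<partial>leb) < e)"
proof -
  have "\<exists>\<phi>\<in>test_fun \<Omega>. mdl (\<lambda>x. \<phi> x - us n x) < ennreal (1 / real (Suc n)) \<and> mdl (\<lambda>x. grad \<phi> x - Gs n x) < ennreal (1 / real (Suc n))" for n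
  proof -
    obtain \<phi> where \<phi>: "\<And>k. \<phi> k \<in> test_fun \<Omega>" "(\<lambda>k. mdl (\<lambda>x. \<phi> k x - us n x)) \<longlonglongrightarrow> 0"
     "(\<lambda>k. mdl (\<lambda>x. grad (\<phi> k) x - Gs n x)) \<longlonglongrightarrow> 0" by (rule V_E[OF V[of n]]) blast
    have "ennreal (1 / real (Suc n)) > 0" by simp
    from eventually_conj[OF order_tendstoD(2)[OF \<phi>(2) this] order_tendstoD(2)[OF \<phi>(3) this]]
    show ?thesis using \<phi>(1) by (auto simp: eventually_sequentially)
  qed
  then obtain \<phi> where \<phi>: "\<And>n. \<phi> n \<in> test_fun \<Omega>" "\<And>n. mdl (\<lambda>x. \<phi> n x - us n x) < ennreal (1 / real (Suc n))"
    "\<And>n. mdl (\<lambda>x. grad (\<phi> n) x - Gs n x) < ennreal (1 / real (Suc n))" by metis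
  note uL = V_Lp(1)[OF V] and GL = V_Lp(2)[OF V] and \<phi>L = test_fun_Lp[OF \<phi>(1)]
  have d1: "(\<lambda>x. \<phi> n x - us n x) \<in> Lp" and d2: "(\<lambda>x. grad (\<phi> n) x - Gs n x) \<in> Lp" for n
    using uL GL \<phi>L by (auto intro: Lp_diff)
  have inv: "(\<lambda>n. ennreal (1 / real (Suc n))) \<longlonglongrightarrow> 0"
    using tendsto_ennrealI[OF LIMSEQ_inverse_real_of_nat] by (simp add: inverse_eq_divide)
  have "(\<lambda>n. mdl (\<lambda>x. \<phi> n x - us n x)) \<longlonglongrightarrow> 0"
    by (rule tendsto_sandwich[OF _ _ tendsto_const inv]) (use less_imp_le[OF \<phi>(2)] in auto)
  from mdl_tendsto_imp_L1[OF d1 this]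
  have L1: "(\<lambda>n. \<integral>x. \<bar>\<phi> n x - us n x\<bar> \<partial>leb) \<longlonglongrightarrow> 0" by simp
  define v where "v = measure leb \<Omega>"
  have le1: "(\<integral>x. norm (f x) \<partial>leb) \<le> v + c" if "f \<in> Lp" "mdl f \<le> ennreal c" "c \<ge> 0" for f :: "'a \<Rightarrow> 'c::euclidean_space" and c
  proof -
    have "enn2real (mdl f) \<le> c" using that(2,3) mdl_eq_integral[OF that(1)] by simp
    then show ?thesis using integral_norm_le_mdl[OF that(1), of 1] by (simp add: v_def)
  qed
  have S0: "S \<ge> 0" using S[of 0] total_nonneg[of "us 0" "Gs 0"] by linarith
  have m1: "mdl (us n) \<le> ennreal S" "mdl (Gs n) \<le> ennreal S" for n
    using mdl_le_total[OF uL GL, of n] ennreal_leI[OF S[of n]] by (auto intro: order_trans)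
  have m2: "mdl (\<lambda>x. \<phi> n x - us n x) \<le> ennreal 1" "mdl (\<lambda>x. grad (\<phi> n) x - Gs n x) \<le> ennreal 1" for n
  proof -
    have "ennreal (1 / real (Suc n)) \<le> ennreal 1" by (intro ennreal_leI) simp
    then show "mdl (\<lambda>x. \<phi> n x - us n x) \<le> ennreal 1" "mdl (\<lambda>x. grad (\<phi> n) x - Gs n x) \<le> ennreal 1"
      using \<phi>(2,3)[of n] by (meson less_imp_le order_trans)+
  qed
  \<comment> \<open>The \<open>L\<^sup>1\<close> norm is at most the measure \<open>v\<close> plus
    the modular; this is applied once to the pair and once to the approximation error.\<close>
  define C where "C = 2 * v + S + 1"
  have tri: "(\<integral>x. norm (f x) \<partial>leb) \<le> C" if "f \<in> Lp" "g \<in> Lp" "mdl g \<le> ennreal S" "mdl (\<lambda>x. f x - g x) \<le> ennreal 1" for f g :: "'a \<Rightarrow> 'c::euclidean_space"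
  proof -
    have d: "(\<lambda>x. f x - g x) \<in> Lp" using that by (intro Lp_diff)
    have "(\<integral>x. norm (f x) \<partial>leb) \<le> (\<integral>x. norm (g x) + norm (f x - g x) \<partial>leb)"
      using Lp_integrable[OF that(1)] Lp_integrable[OF that(2)] Lp_integrable[OF d]
      by (intro integral_mono) (auto intro: norm_triangle_sub)
    also have "\<dots> = (\<integral>x. norm (g x) \<partial>leb) + (\<integral>x. norm (f x - g x) \<partial>leb)"
      using Lp_integrable[OF that(2)] Lp_integrable[OF d] by (intro Bochner_Integration.integral_add integrable_norm)
    also have "\<dots> \<le> (v + S) + (v + 1)" using le1[OF that(2,3) S0] le1[OF d that(4)] by simp
    finally show ?thesis by (simp add: C_def)
  qed
  have eq: "(\<integral>x. norm (h x) \<partial>lborel) = (\<integral>x. norm (h x) \<partial>leb)"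
    if "h \<in> borel_measurable borel" "\<And>x. x \<notin> \<Omega> \<Longrightarrow> h x = 0" for h :: "'a \<Rightarrow> 'c::euclidean_space"
    using that by (intro integral_test_fun_eq[symmetric]) auto
  have C1: "(\<integral>x. \<bar>\<phi> n x\<bar> \<partial>lborel) \<le> C" for n
    using eq[OF test_fun_measurable(1)[OF \<phi>(1)]] test_fun_outside[OF \<phi>(1)] tri[OF \<phi>L(1) uL m1(1) m2(1), of n] by simp
  have C2: "(\<integral>x. norm (grad (\<phi> n) x) \<partial>lborel) \<le> C" for n
    using eq[OF test_fun_measurable(2)[OF \<phi>(1)]] test_fun_outside[OF \<phi>(1)] tri[OF \<phi>L(2) GL m1(2) m2(2), of n] by simp
  obtain r :: "nat \<Rightarrow> nat" where r: "strict_mono r"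
    "\<And>e. e > 0 \<Longrightarrow> \<exists>N. \<forall>k\<ge>N. \<forall>l\<ge>N. (\<integral>x. \<bar>\<phi> (r k) x - \<phi> (r l) x\<bar> \<partial>lborel) < e"
    by (rule rellich[of \<phi> \<Omega> C, OF \<phi>(1) \<Omega>_bounded C1 C2]) blast
  have "\<exists>N. \<forall>k\<ge>N. \<forall>l\<ge>N. (\<integral>x. \<bar>us (r k) x - us (r l) x\<bar> \<partial>leb) < e" if e: "e > 0" for e
  proof -
    obtain N1 where N1: "\<And>k l. k \<ge> N1 \<Longrightarrow> l \<ge> N1 \<Longrightarrow> (\<integral>x. \<bar>\<phi> (r k) x - \<phi> (r l) x\<bar> \<partial>lborel) < e / 3"
      using r(2)[of "e / 3"] e by auto
    obtain N2 where N2: "\<And>k. k \<ge> N2 \<Longrightarrow> (\<integral>x. \<bar>\<phi> k x - us k x\<bar> \<partial>leb) < e / 3"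
      using order_tendstoD(2)[OF L1, of "e / 3"] e by (auto simp: eventually_sequentially)
    have "(\<integral>x. \<bar>us (r k) x - us (r l) x\<bar> \<partial>leb) < e" if kl: "k \<ge> max N1 N2" "l \<ge> max N1 N2" for k l
    proof -
      have rk: "r k \<ge> N2" "r l \<ge> N2" using seq_suble[OF r(1), of k] seq_suble[OF r(1), of l] kl by auto
      note i = Lp_integrable[OF uL] Lp_integrable[OF \<phi>L(1)]
      have "(\<integral>x. \<bar>us (r k) x - us (r l) x\<bar> \<partial>leb) \<le>
        (\<integral>x. (\<bar>\<phi> (r k) x - us (r k) x\<bar> + \<bar>\<phi> (r l) x - us (r l) x\<bar>) + \<bar>\<phi> (r k) x - \<phi> (r l) x\<bar> \<partial>leb)"
        using i by (intro integral_mono) auto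
      also have "\<dots> = ((\<integral>x. \<bar>\<phi> (r k) x - us (r k) x\<bar> \<partial>leb) + (\<integral>x. \<bar>\<phi> (r l) x - us (r l) x\<bar> \<partial>leb))
         + (\<integral>x. \<bar>\<phi> (r k) x - \<phi> (r l) x\<bar> \<partial>leb)"
        using i by simp
      also have "(\<integral>x. \<bar>\<phi> (r k) x - \<phi> (r l) x\<bar> \<partial>leb) = (\<integral>x. \<bar>\<phi> (r k) x - \<phi> (r l) x\<bar> \<partial>lborel)"
        using test_fun_outside[OF \<phi>(1)] test_fun_measurable(1)[OF \<phi>(1)] by (intro integral_test_fun_eq) auto
      finally show ?thesis using N1[of k l] N2[OF rk(1)] N2[OF rk(2)] kl by simp
    qed
    then show ?thesis by blast
  qed
  with r(1) show ?thesis by blast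
qed

text \<open>An essential infimum is a supremum of almost sure lower bounds; countably many of them,
  namely 1 - 1/(n+1), give the bound 1 outside one null set.\<close>

lemma AE_bounds_Linf_plus:
  assumes "q \<in> Linf_plus \<Omega>"
  obtains Q where "q \<in> borel_measurable leb" "Q \<ge> 1" "AE x in leb. 1 \<le> q x \<and> q x \<le> Q"
proof -
  obtain C where C: "q \<in> borel_measurable leb" "AE x in leb. \<bar>q x\<bar> \<le> C" "ess_inf \<Omega> q \<ge> 1"
    using assms by (auto simp: Linf_plus_def Linf_def)
  define X where "X = {c. AE x in leb. c \<le> q x}"
  have "- C \<in> X" unfolding X_def using C(2) by (auto elim!: eventually_mono)
  then have "X \<noteq> {}" by blast
  have "AE x in leb. 1 - 1 / real (Suc n) \<le> q x" for n
  proof -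
    have "1 - 1 / real (Suc n) < Sup X" using C(3) unfolding ess_inf_def X_def[symmetric] by (simp add: less_le_trans[of _ 1])
    from less_cSupD[OF \<open>X \<noteq> {}\<close> this] obtain c where "c \<in> X" "1 - 1 / real (Suc n) < c" by blast
    then show ?thesis unfolding X_def by (auto elim!: eventually_mono)
  qed
  then have "AE x in leb. \<forall>n. 1 - 1 / real (Suc n) \<le> q x" by (subst AE_all_countable) blast
  then have 1: "AE x in leb. 1 \<le> q x"
  proof eventually_elim
    case (elim x)
    have "(\<lambda>n. 1 - 1 / real (Suc n)) \<longlonglongrightarrow> 1 - 0"
      using LIMSEQ_inverse_real_of_nat by (intro tendsto_diff tendsto_const) (simp add: inverse_eq_divide)
    then show ?case using elim by (intro LIMSEQ_le_const2) auto
  qed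
  have "AE x in leb. 1 \<le> q x \<and> q x \<le> max 1 C" using 1 C(2) by eventually_elim auto
  then show ?thesis using that[OF C(1), of "max 1 C"] by simp
qed

end

subsection \<open>Luxemburg norms\<close>

text \<open>The exponents of the nonlocal terms are bounded only almost everywhere and may equal 1,
  so they fall outside the theory made for \<open>p\<close>.\<close>

locale linf_exponent = pde_domain +
  fixes q :: "'a \<Rightarrow> real" and Q :: real
  assumes q_meas [measurable]: "q \<in> borel_measurable leb" and Q_ge: "Q \<ge> 1"
    and q_AE: "AE x in leb. 1 \<le> q x \<and> q x \<le> Q"
begin

abbreviation "mq \<equiv> modular \<Omega> q"
abbreviation "lq \<equiv> lux_norm \<Omega> q"

lemma mq_mono_AE:
  assumes "AE x in leb. \<bar>u x\<bar> \<le> \<bar>v x\<bar>"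
  shows "mq u \<le> mq v"
  unfolding modular_def
proof (rule nn_integral_mono_AE)
  show "AE x in leb. ennreal (\<bar>u x\<bar> powr q x) \<le> ennreal (\<bar>v x\<bar> powr q x)"
    using assms q_AE by eventually_elim (auto intro!: ennreal_leI powr_mono2)
qed

text \<open>As q \<ge> 1 and c / c' \<le> 1, the power (c / c')^q is at most c / c'. The factor
  yields strict inequalities when c < c'.\<close>

lemma mq_scale:
  assumes [measurable]: "u \<in> borel_measurable leb" and c: "0 < c" "c \<le> c'"
  shows "mq (\<lambda>x. u x / c') \<le> ennreal (c / c') * mq (\<lambda>x. u x / c)"
proof -
  have "mq (\<lambda>x. u x / c') \<le> (\<integral>\<^sup>+x. ennreal (c / c') * ennreal (\<bar>u x / c\<bar> powr q x) \<partial>leb)"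
    unfolding modular_def
  proof (rule nn_integral_mono_AE)
    show "AE x in leb. ennreal (\<bar>u x / c'\<bar> powr q x) \<le> ennreal (c / c') * ennreal (\<bar>u x / c\<bar> powr q x)"
      using q_AE
    proof eventually_elim
      case (elim x)
      have eq: "\<bar>u x / c'\<bar> = (c / c') * \<bar>u x / c\<bar>" using c by (simp add: abs_mult)
      have "\<bar>u x / c'\<bar> powr q x = (c / c') powr q x * \<bar>u x / c\<bar> powr q x"
        unfolding eq by (rule powr_mult)
      also have "\<dots> \<le> (c / c') powr 1 * \<bar>u x / c\<bar> powr q x"
        using c elim by (intro mult_right_mono powr_mono') auto
      finally have "\<bar>u x / c'\<bar> powr q x \<le> (c / c') * \<bar>u x / c\<bar> powr q x" using c by simp
      then show ?case using c by (subst ennreal_mult[symmetric]) (auto intro: ennreal_leI)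
    qed
  qed
  also have "\<dots> = ennreal (c / c') * mq (\<lambda>x. u x / c)" unfolding modular_def by (rule nn_integral_cmult) measurable
  finally show ?thesis .
qed

lemma lq_set_nonempty:
  assumes [measurable]: "u \<in> borel_measurable leb" and u: "AE x in leb. \<bar>u x\<bar> \<le> C"
  shows "{c. c > 0 \<and> mq (\<lambda>x. u x / c) \<le> 1} \<noteq> {}"
proof -
  define C' where "C' = max 1 C"
  have C': "C' \<ge> 1" "C' \<ge> C" by (auto simp: C'_def)
  define v where "v = measure leb \<Omega>"
  have v: "v \<ge> 0" by (simp add: v_def)
  have "mq (\<lambda>x. u x / C') \<le> (\<integral>\<^sup>+x. 1 \<partial>leb)"
    unfolding modular_def
  proof (rule nn_integral_mono_AE)
    show "AE x in leb. ennreal (\<bar>u x / C'\<bar> powr q x) \<le> 1"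
      using u q_AE
    proof eventually_elim
      case (elim x)
      have "\<bar>u x / C'\<bar> \<le> 1" using elim C' by simp
      then have "\<bar>u x / C'\<bar> powr q x \<le> 1 powr q x" using elim by (intro powr_mono2) auto
      then show ?case by (simp add: ennreal_le_1)
    qed
  qed
  also have "\<dots> = ennreal v" using emeasure_eq_measure[of \<Omega>] by (simp add: v_def)
  finally have 1: "mq (\<lambda>x. u x / C') \<le> ennreal v" .
  \<comment> \<open>Dividing by C' makes |u| at most 1 and the modular at most \<open>v\<close>; the
    further factor v + 1 brings it below 1.\<close>
  define c where "c = C' * (v + 1)"
  have c: "c > 0" "C' \<le> c" using C' v by (auto simp: c_def algebra_simps add_pos_nonneg)
  have "mq (\<lambda>x. u x / c) \<le> ennreal (C' / c) * mq (\<lambda>x. u x / C')" using C' c by (intro mq_scale) auto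
  also have "\<dots> \<le> ennreal (C' / c) * ennreal v" using 1 by (intro mult_left_mono) auto
  also have "\<dots> = ennreal (C' / c * v)" using c C' v by (subst ennreal_mult) auto
  also have "\<dots> \<le> 1"
  proof -
    have "C' / c * v = v / (v + 1)" using C' by (simp add: c_def)
    also have "\<dots> \<le> 1" using v by simp
    finally show ?thesis by (simp add: ennreal_le_1)
  qed
  finally show ?thesis using c(1) by blast
qed

lemma lq_le: "c > 0 \<Longrightarrow> mq (\<lambda>x. u x / c) \<le> 1 \<Longrightarrow> lq u \<le> c"
  unfolding lux_norm_def by (intro cInf_lower bdd_belowI[of _ 0]) auto

lemma lq_less_imp:
  assumes u: "u \<in> borel_measurable leb" "AE x in leb. \<bar>u x\<bar> \<le> C" and c: "lq u < c"
  obtains c0 where "0 < c0" "c0 < c" "mq (\<lambda>x. u x / c0) \<le> 1"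
  using cInf_lessD[OF lq_set_nonempty[OF u], of c] c unfolding lux_norm_def by auto

lemma lq_nonneg:
  assumes "u \<in> borel_measurable leb" "AE x in leb. \<bar>u x\<bar> \<le> C"
  shows "lq u \<ge> 0"
  unfolding lux_norm_def using lq_set_nonempty[OF assms] by (intro cInf_greatest) auto

lemma lq_mono:
  assumes v: "v \<in> borel_measurable leb" "AE x in leb. \<bar>v x\<bar> \<le> C"
    and le: "AE x in leb. \<bar>u x\<bar> \<le> \<bar>v x\<bar>"
  shows "lq u \<le> lq v"
  unfolding lux_norm_def
proof (rule cInf_superset_mono[OF lq_set_nonempty[OF v]])
  show "bdd_below {c. 0 < c \<and> mq (\<lambda>x. u x / c) \<le> 1}" by (intro bdd_belowI[of _ 0]) auto
  show "{c. 0 < c \<and> mq (\<lambda>x. v x / c) \<le> 1} \<subseteq> {c. 0 < c \<and> mq (\<lambda>x. u x / c) \<le> 1}"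
  proof safe
    fix c :: real assume c: "0 < c" "mq (\<lambda>x. v x / c) \<le> 1"
    have "mq (\<lambda>x. u x / c) \<le> mq (\<lambda>x. v x / c)"
      using le c(1) by (intro mq_mono_AE) (auto elim!: eventually_mono intro: divide_right_mono)
    then show "mq (\<lambda>x. u x / c) \<le> 1" using c(2) by (rule order_trans)
  qed
qed

lemma lq_cong_AE:
  assumes "AE x in leb. u x = v x"
  shows "lq u = lq v"
proof -
  have "mq (\<lambda>x. u x / c) = mq (\<lambda>x. v x / c)" for c
    using assms by (intro antisym mq_mono_AE) (auto elim!: eventually_mono)
  then show ?thesis by (simp add: lux_norm_def)
qed

text \<open>A zero norm forces a zero modular, so u would vanish almost everywhere on a nonempty
  open set. Positivity keeps the second argument of \<open>A\<close> in the half-line where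
  \<open>A\<close> is continuous.\<close>

lemma lq_pos:
  assumes u: "u \<in> borel_measurable leb" "AE x in leb. \<bar>u x\<bar> \<le> C" "AE x in leb. u x > 0"
  shows "lq u > 0"
proof (rule ccontr)
  note [measurable] = u(1)
  assume "\<not> lq u > 0"
  then have z: "lq u = 0" using lq_nonneg[OF u(1,2)] by simp
  have small: "mq u \<le> ennreal e" if e: "e > 0" for e
  proof -
    define c where "c = min e 1"
    have "lq u < c" using z e by (simp add: c_def)
    then obtain c0 where c0: "0 < c0" "c0 < c" "mq (\<lambda>x. u x / c0) \<le> 1" using lq_less_imp[OF u(1,2)] by blast
    have "mq (\<lambda>x. u x / 1) \<le> ennreal (c0 / 1) * mq (\<lambda>x. u x / c0)" using c0 by (intro mq_scale) (auto simp: c_def)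
    also have "\<dots> \<le> ennreal c0 * 1" using c0 by (intro mult_mono) auto
    also have "\<dots> \<le> ennreal e" using c0 by (simp add: c_def ennreal_leI)
    finally show ?thesis by simp
  qed
  have "mq u \<le> 0" by (rule ennreal_le_epsilon) (use small in simp)
  then have "(\<integral>\<^sup>+x. ennreal (\<bar>u x\<bar> powr q x) \<partial>leb) = 0" by (simp add: modular_def)
  then have "AE x in leb. ennreal (\<bar>u x\<bar> powr q x) = 0" by (subst (asm) nn_integral_0_iff_AE) auto
  with u(3) have "AE x in leb. False" by eventually_elim auto
  then have "AE x in lebesgue. x \<notin> \<Omega>" by (simp add: AE_restrict_space_iff)
  then have "\<Omega> \<in> null_sets lebesgue" by (simp add: AE_iff_null_sets)
  then have "negligible \<Omega>" by (simp add: negligible_iff_null_sets)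
  then show False using open_not_negligible[OF \<Omega>_open \<Omega>_ne] by blast
qed

lemma mq_tendsto:
  assumes [measurable]: "\<And>n. us n \<in> borel_measurable leb" "u \<in> borel_measurable leb"
    and bd: "\<And>n. AE x in leb. \<bar>us n x\<bar> \<le> C" and lim: "AE x in leb. (\<lambda>n. us n x) \<longlonglongrightarrow> u x" and c: "c > 0"
  shows "(\<lambda>n. mq (\<lambda>x. us n x / c)) \<longlonglongrightarrow> mq (\<lambda>x. u x / c)"
  unfolding modular_def
proof (rule nn_integral_dominated_convergence[where w = "\<lambda>x. ennreal (max 1 (\<bar>C\<bar> / c) powr Q)"])
  show "(\<integral>\<^sup>+x. ennreal (max 1 (\<bar>C\<bar> / c) powr Q) \<partial>leb) < \<infinity>"
    using finite_emeasure_space by (simp add: ennreal_mult_eq_top_iff less_top[symmetric])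
  show "AE x in leb. ennreal (\<bar>us n x / c\<bar> powr q x) \<le> ennreal (max 1 (\<bar>C\<bar> / c) powr Q)" for n
    using bd[of n] q_AE
  proof eventually_elim
    case (elim x)
    have "\<bar>us n x / c\<bar> \<le> \<bar>C\<bar> / c" using elim c by (auto intro!: divide_right_mono)
    then have "\<bar>us n x / c\<bar> \<le> max 1 (\<bar>C\<bar> / c)" by simp
    then have "\<bar>us n x / c\<bar> powr q x \<le> max 1 (\<bar>C\<bar> / c) powr q x" using elim by (intro powr_mono2) auto
    also have "\<dots> \<le> max 1 (\<bar>C\<bar> / c) powr Q" using elim by (intro powr_mono) auto
    finally show ?case by (rule ennreal_leI)
  qed
  show "AE x in leb. (\<lambda>n. ennreal (\<bar>us n x / c\<bar> powr q x)) \<longlonglongrightarrow> ennreal (\<bar>u x / c\<bar> powr q x)"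
    using lim q_AE
  proof eventually_elim
    case (elim x)
    then show ?case using c by (intro tendsto_ennrealI tendsto_powr' tendsto_rabs tendsto_divide tendsto_const) auto
  qed
qed measurable

text \<open>The norm is the threshold at which the modular of u / c crosses 1. For each fixed c the
  modulars converge by domination, so a strict inequality at c slightly off the threshold persists
  for large n.\<close>

lemma lq_tendsto:
  assumes us: "\<And>n. us n \<in> borel_measurable leb" "\<And>n. AE x in leb. \<bar>us n x\<bar> \<le> C"
    and u: "u \<in> borel_measurable leb" "AE x in leb. \<bar>u x\<bar> \<le> C"
    and lim: "AE x in leb. (\<lambda>n. us n x) \<longlonglongrightarrow> u x"
  shows "(\<lambda>n. lq (us n)) \<longlonglongrightarrow> lq u"
proof (rule order_tendstoI)
  note mt = mq_tendsto[OF us(1) u(1) us(2) lim]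
  fix a assume a: "a < lq u"
  show "\<forall>\<^sub>F n in sequentially. a < lq (us n)"
  proof (cases "a < 0")
    case True
    then show ?thesis using lq_nonneg[OF us] by (intro always_eventually allI) (meson less_le_trans)
  next
    case False
    define c where "c = (a + lq u) / 2"
    have c: "0 < c" "a < c" "c < lq u" using a False by (auto simp: c_def)
    have "\<not> mq (\<lambda>x. u x / c) \<le> 1" using lq_le[of c u] c by force
    then have "1 < mq (\<lambda>x. u x / c)" by simp
    from order_tendstoD(1)[OF mt[OF c(1)] this] show ?thesis
    proof eventually_elim
      case (elim n)
      have "c \<le> lq (us n)"
      proof (rule ccontr)
        assume "\<not> c \<le> lq (us n)"
        then obtain c0 where c0: "0 < c0" "c0 < c" "mq (\<lambda>x. us n x / c0) \<le> 1" using lq_less_imp[OF us(1) us(2), of n c] by auto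
        have "mq (\<lambda>x. us n x / c) \<le> ennreal (c0 / c) * mq (\<lambda>x. us n x / c0)" using c0 us(1) by (intro mq_scale) auto
        also have "\<dots> \<le> 1 * 1" using c0 by (intro mult_mono) (auto simp: ennreal_le_1)
        finally show False using elim by simp
      qed
      then show ?case using c by simp
    qed
  qed
next
  note mt = mq_tendsto[OF us(1) u(1) us(2) lim]
  fix a assume a: "lq u < a"
  define c where "c = (a + lq u) / 2"
  have lu: "lq u \<ge> 0" by (rule lq_nonneg[OF u])
  have c: "0 < c" "c < a" "lq u < c" using a lu by (auto simp: c_def)
  \<comment> \<open>A level c0 < c with modular at most 1 makes the modular at c strictly smaller
    than 1, which survives the limit.\<close>
  obtain c0 where c0: "0 < c0" "c0 < c" "mq (\<lambda>x. u x / c0) \<le> 1" using lq_less_imp[OF u c(3)] by blast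
  have "mq (\<lambda>x. u x / c) \<le> ennreal (c0 / c) * mq (\<lambda>x. u x / c0)" using c0 u(1) by (intro mq_scale) auto
  also have "\<dots> \<le> ennreal (c0 / c) * 1" using c0 by (intro mult_left_mono) auto
  also have "\<dots> < 1" using c0 c by (simp add: ennreal_less_one_iff)
  finally have "mq (\<lambda>x. u x / c) < 1" .
  from order_tendstoD(2)[OF mt[OF c(1)] this] show "\<forall>\<^sub>F n in sequentially. lq (us n) < a"
  proof eventually_elim
    case (elim n)
    then have "lq (us n) \<le> c" using c by (intro lq_le) auto
    then show ?case using c by simp
  qed
qed

end

subsection \<open>The truncated problem\<close>

locale pde_problem = pde_domain +
  fixes r q s \<alpha> \<gamma> :: "'a \<Rightarrow> real" and f g A :: "'a \<Rightarrow> real \<Rightarrow> real" and ul uu :: "'a \<Rightarrow> real"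
    and Qr Qq Qs E C :: real
  assumes exp_r: "linf_exponent \<Omega> p pm pp L r Qr" and exp_q: "linf_exponent \<Omega> p pm pp L q Qq"
    and exp_s: "linf_exponent \<Omega> p pm pp L s Qs"
    and \<alpha>: "\<alpha> \<in> borel_measurable leb" "AE x in leb. 0 \<le> \<alpha> x \<and> \<alpha> x \<le> E"
    and \<gamma>: "\<gamma> \<in> borel_measurable leb" "AE x in leb. 0 \<le> \<gamma> x \<and> \<gamma> x \<le> E"
    and f_cont: "continuous_on (closure \<Omega> \<times> UNIV) (\<lambda>(x, t). f x t)"
    and g_cont: "continuous_on (closure \<Omega> \<times> UNIV) (\<lambda>(x, t). g x t)"
    and A_cont: "continuous_on (closure \<Omega> \<times> {0<..}) (\<lambda>(x, t). A x t)"
    and ul_meas [measurable]: "ul \<in> borel_measurable leb"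
    and uu_meas [measurable]: "uu \<in> borel_measurable leb"
    and ul_uu: "AE x in leb. 0 < ul x \<and> ul x \<le> uu x \<and> uu x \<le> C"
    and f_nonneg: "\<forall>x\<in>closure \<Omega>. \<forall>t\<in>{0..C}. f x t \<ge> 0"
    and g_nonneg: "\<forall>x\<in>closure \<Omega>. \<forall>t\<in>{0..C}. g x t \<ge> 0"
    and A_pos: "\<forall>x\<in>closure \<Omega>. \<forall>t\<in>{lux_norm \<Omega> r ul..lux_norm \<Omega> r uu}. A x t > 0"
begin

sublocale er: linf_exponent \<Omega> p pm pp L r Qr by (rule exp_r)
sublocale eq: linf_exponent \<Omega> p pm pp L q Qq by (rule exp_q)
sublocale es: linf_exponent \<Omega> p pm pp L s Qs by (rule exp_s)

definition enclosed :: "('a \<Rightarrow> real) \<Rightarrow> bool" where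
  "enclosed v \<longleftrightarrow> v \<in> borel_measurable leb \<and> (AE x in leb. ul x \<le> v x \<and> v x \<le> uu x)"

lemma enclosedD:
  assumes "enclosed v"
  shows "v \<in> borel_measurable leb" "AE x in leb. 0 < ul x \<and> ul x \<le> v x \<and> v x \<le> uu x \<and> uu x \<le> C"
    "AE x in leb. \<bar>v x\<bar> \<le> C" "AE x in leb. \<bar>ul x\<bar> \<le> \<bar>v x\<bar>" "AE x in leb. \<bar>v x\<bar> \<le> \<bar>uu x\<bar>"
    "AE x in leb. v x > 0"
proof -
  show "v \<in> borel_measurable leb" using assms by (simp add: enclosed_def)
  have "AE x in leb. ul x \<le> v x \<and> v x \<le> uu x" using assms by (simp add: enclosed_def)
  with ul_uu show ae: "AE x in leb. 0 < ul x \<and> ul x \<le> v x \<and> v x \<le> uu x \<and> uu x \<le> C" by eventually_elim simp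
  show "AE x in leb. \<bar>v x\<bar> \<le> C" using ae by eventually_elim simp
  show "AE x in leb. \<bar>ul x\<bar> \<le> \<bar>v x\<bar>" using ae by eventually_elim simp
  show "AE x in leb. \<bar>v x\<bar> \<le> \<bar>uu x\<bar>" using ae by eventually_elim simp
  show "AE x in leb. v x > 0" using ae by eventually_elim simp
qed

lemma enclosed_ul: "enclosed ul" unfolding enclosed_def using ul_uu by (auto elim: eventually_mono)
lemma enclosed_uu: "enclosed uu" unfolding enclosed_def using ul_uu by (auto elim: eventually_mono)

lemma lux_enclosed:
  assumes "enclosed v"
  shows "lux_norm \<Omega> q ul \<le> lux_norm \<Omega> q v" "lux_norm \<Omega> q v \<le> lux_norm \<Omega> q uu"
    "lux_norm \<Omega> s ul \<le> lux_norm \<Omega> s v" "lux_norm \<Omega> s v \<le> lux_norm \<Omega> s uu"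
    "lux_norm \<Omega> r ul \<le> lux_norm \<Omega> r v" "lux_norm \<Omega> r v \<le> lux_norm \<Omega> r uu"
    "lux_norm \<Omega> r v > 0" "lux_norm \<Omega> q v > 0" "lux_norm \<Omega> s v > 0"
  using eq.lq_mono[OF enclosedD(1,3)[OF assms] enclosedD(4)[OF assms]] es.lq_mono[OF enclosedD(1,3)[OF assms] enclosedD(4)[OF assms]]
    er.lq_mono[OF enclosedD(1,3)[OF assms] enclosedD(4)[OF assms]]
    eq.lq_mono[OF enclosedD(1,3)[OF enclosed_uu] enclosedD(5)[OF assms]] es.lq_mono[OF enclosedD(1,3)[OF enclosed_uu] enclosedD(5)[OF assms]]
    er.lq_mono[OF enclosedD(1,3)[OF enclosed_uu] enclosedD(5)[OF assms]]
    er.lq_pos[OF enclosedD(1,3,6)[OF assms]] eq.lq_pos[OF enclosedD(1,3,6)[OF assms]] es.lq_pos[OF enclosedD(1,3,6)[OF assms]]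
  by simp_all

text \<open>Numerator and denominator take separate functions because the barrier inequalities fix
  the numerator at \<open>ul\<close> or \<open>uu\<close> and let the denominator range over the
  order interval.\<close>

definition source :: "('a \<Rightarrow> real) \<Rightarrow> ('a \<Rightarrow> real) \<Rightarrow> 'a \<Rightarrow> real" where
  "source v w x = (f x (v x) * lux_norm \<Omega> q v powr \<alpha> x + g x (v x) * lux_norm \<Omega> s v powr \<gamma> x) / A x (lux_norm \<Omega> r w)"

lemma caratheodory_measurable:
  assumes F: "continuous_on (closure \<Omega> \<times> UNIV) (\<lambda>(x, t). F x t)" and v: "v \<in> borel_measurable leb"
  shows "(\<lambda>x. F x (v x :: real) :: real) \<in> borel_measurable leb"
proof -
  have 1: "(\<lambda>z. indicator (closure \<Omega> \<times> UNIV) z *\<^sub>R (case z of (x, t) \<Rightarrow> F x t)) \<in> borel_measurable borel"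
    by (rule borel_measurable_continuous_on_indicator[OF _ F]) (intro borel_closed closed_Times closed_closure closed_UNIV)
  have 2: "(\<lambda>x. (x, v x)) \<in> borel_measurable leb"
    using v lebesgue_on_borel[of "\<lambda>x. x"] by (intro borel_measurable_Pair) auto
  have "(\<lambda>x. indicator (closure \<Omega> \<times> UNIV) (x, v x) *\<^sub>R F x (v x)) \<in> borel_measurable leb"
    using measurable_compose[OF 2 1] by simp
  then show ?thesis
    by (rule measurable_cong[THEN iffD1, rotated]) (auto simp: indicator_def closure_subset[THEN subsetD])
qed

lemma A_measurable:
  assumes "c > 0" shows "(\<lambda>x. A x c) \<in> borel_measurable leb"
proof -
  have "continuous_on (closure \<Omega>) (\<lambda>x. A x c)"
    using continuous_on_compose2[OF A_cont continuous_on_Pair[OF continuous_on_id continuous_on_const], of c "closure \<Omega>"] assms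
    by (simp add: image_subset_iff)
  then have "(\<lambda>x. indicator (closure \<Omega>) x *\<^sub>R A x c) \<in> borel_measurable borel"
    by (intro borel_measurable_continuous_on_indicator) auto
  from lebesgue_on_borel[OF this] show ?thesis
    by (rule measurable_cong[THEN iffD1, rotated]) (auto simp: indicator_def closure_subset[THEN subsetD])
qed

lemma source_measurable:
  assumes "enclosed v" "enclosed w"
  shows "source v w \<in> borel_measurable leb"
proof -
  note [measurable] = caratheodory_measurable[OF f_cont enclosedD(1)[OF assms(1)]]
    caratheodory_measurable[OF g_cont enclosedD(1)[OF assms(1)]] A_measurable[OF lux_enclosed(7)[OF assms(2)]] \<alpha>(1) \<gamma>(1)
  show ?thesis unfolding source_def[abs_def] by measurable
qed

lemma compact_closure_\<Omega>: "compact (closure \<Omega>)" using \<Omega>_bounded by (simp add: compact_closure)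

text \<open>Norms of enclosed functions lie in a compact interval of positive numbers, so
  \<open>A\<close> attains a positive minimum over its product with the closure of \<Omega>.\<close>

lemma A_lower:
  obtains A0 where "A0 > 0" "\<And>x w. x \<in> \<Omega> \<Longrightarrow> enclosed w \<Longrightarrow> A0 \<le> A x (lux_norm \<Omega> r w)"
proof -
  let ?S = "closure \<Omega> \<times> {lux_norm \<Omega> r ul..lux_norm \<Omega> r uu}"
  have S: "compact ?S" by (intro compact_Times compact_closure_\<Omega> compact_Icc)
  have ne: "?S \<noteq> {}" using \<Omega>_ne lux_enclosed(6)[OF enclosed_ul] by simp
  have "continuous_on ?S (\<lambda>(x, t). A x t)"
    by (rule continuous_on_subset[OF A_cont]) (use lux_enclosed(7)[OF enclosed_ul] in auto)
  from continuous_attains_inf[OF S ne this] obtain z where z: "z \<in> ?S" "\<And>y. y \<in> ?S \<Longrightarrow> (case z of (x, t) \<Rightarrow> A x t) \<le> (case y of (x, t) \<Rightarrow> A x t)" by blast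
  show ?thesis
  proof (rule that)
    show "(case z of (x, t) \<Rightarrow> A x t) > 0" using z(1) A_pos by auto
    fix x w assume "x \<in> \<Omega>" "enclosed w"
    then have "(x, lux_norm \<Omega> r w) \<in> ?S" using lux_enclosed(5,6) closure_subset by auto
    from z(2)[OF this] show "(case z of (x, t) \<Rightarrow> A x t) \<le> A x (lux_norm \<Omega> r w)" by simp
  qed
qed

lemma caratheodory_bounded:
  assumes F: "continuous_on (closure \<Omega> \<times> UNIV) (\<lambda>(x, t). F x t)"
  obtains B :: real where "B > 0" "\<And>x t. x \<in> \<Omega> \<Longrightarrow> 0 \<le> t \<Longrightarrow> t \<le> C \<Longrightarrow> \<bar>F x (t::real)\<bar> \<le> B"
proof -
  have "compact ((\<lambda>(x, t). F x t) ` (closure \<Omega> \<times> {0..C}))"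
    by (intro compact_continuous_image continuous_on_subset[OF F] compact_Times compact_closure_\<Omega> compact_Icc) auto
  then obtain B where B: "B > 0" "\<forall>y\<in>(\<lambda>(x, t). F x t) ` (closure \<Omega> \<times> {0..C}). norm y \<le> B"
    using compact_imp_bounded bounded_pos by metis
  have "\<bar>F x t\<bar> \<le> B" if "x \<in> \<Omega>" "0 \<le> t" "t \<le> C" for x t
  proof -
    have "F x t \<in> (\<lambda>(x, t). F x t) ` (closure \<Omega> \<times> {0..C})" using that closure_subset by (intro image_eqI[of _ _ "(x, t)"]) auto
    then show ?thesis using B(2) by (metis real_norm_def)
  qed
  with B(1) that show ?thesis by blast
qed

lemma powr_exponent_le:
  assumes "0 \<le> a" "a \<le> b" "0 \<le> t" "t \<le> E"
  shows "a powr t \<le> max 1 b powr E"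
proof -
  have "a powr t \<le> max 1 b powr t" using assms by (intro powr_mono2) auto
  also have "\<dots> \<le> max 1 b powr E" using assms by (intro powr_mono) auto
  finally show ?thesis .
qed

lemma source_bounded:
  obtains H where "H \<ge> 0" "\<And>v w. enclosed v \<Longrightarrow> enclosed w \<Longrightarrow> AE x in leb. \<bar>source v w x\<bar> \<le> H"
proof -
  obtain A0 where A0: "A0 > 0" "\<And>x w. x \<in> \<Omega> \<Longrightarrow> enclosed w \<Longrightarrow> A0 \<le> A x (lux_norm \<Omega> r w)" by (rule A_lower) blast
  obtain Bf where Bf: "Bf > 0" "\<And>x t. x \<in> \<Omega> \<Longrightarrow> 0 \<le> t \<Longrightarrow> t \<le> C \<Longrightarrow> \<bar>f x t\<bar> \<le> Bf" by (rule caratheodory_bounded[OF f_cont]) blast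
  obtain Bg where Bg: "Bg > 0" "\<And>x t. x \<in> \<Omega> \<Longrightarrow> 0 \<le> t \<Longrightarrow> t \<le> C \<Longrightarrow> \<bar>g x t\<bar> \<le> Bg" by (rule caratheodory_bounded[OF g_cont]) blast
  define Eq Es where "Eq = max 1 (lux_norm \<Omega> q uu) powr E" and "Es = max 1 (lux_norm \<Omega> s uu) powr E"
  define H where "H = (Bf * Eq + Bg * Es) / A0"
  have "AE x in leb. \<bar>source v w x\<bar> \<le> H" if v: "enclosed v" and w: "enclosed w" for v w
    using enclosedD(2)[OF v] \<alpha>(2) \<gamma>(2) AE_space
  proof eventually_elim
    case (elim x)
    have x: "x \<in> \<Omega>" using elim by simp
    have v0: "0 \<le> v x" "v x \<le> C" using elim by auto
    have "\<bar>f x (v x) * lux_norm \<Omega> q v powr \<alpha> x\<bar> \<le> Bf * Eq"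
      unfolding abs_mult Eq_def using Bf(1) Bf(2)[OF x v0] elim lux_enclosed(2,8)[OF v] by (auto intro!: mult_mono powr_exponent_le)
    moreover have "\<bar>g x (v x) * lux_norm \<Omega> s v powr \<gamma> x\<bar> \<le> Bg * Es"
      unfolding abs_mult Es_def using Bg(1) Bg(2)[OF x v0] elim lux_enclosed(4,9)[OF v] by (auto intro!: mult_mono powr_exponent_le)
    ultimately have num: "\<bar>f x (v x) * lux_norm \<Omega> q v powr \<alpha> x + g x (v x) * lux_norm \<Omega> s v powr \<gamma> x\<bar> \<le> Bf * Eq + Bg * Es"
      by linarith
    have den: "A0 \<le> \<bar>A x (lux_norm \<Omega> r w)\<bar>" using A0(2)[OF x w] by linarith
    show ?case unfolding source_def abs_divide H_def using num den A0(1) by (intro frac_le) auto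
  qed
  moreover have "H \<ge> 0" unfolding H_def Eq_def Es_def using Bf(1) Bg(1) A0(1) by (intro divide_nonneg_pos add_nonneg_nonneg mult_nonneg_nonneg) auto
  ultimately show ?thesis using that by blast
qed

definition trunc :: "('a \<Rightarrow> real) \<Rightarrow> 'a \<Rightarrow> real" where
  "trunc w x = max (ul x) (min (uu x) (w x))"

text \<open>The part of the penalty that depends on the truncation is moved to the right-hand side;
  the other part is the derivative of |u|^p / p in the energy.\<close>

definition load :: "('a \<Rightarrow> real) \<Rightarrow> 'a \<Rightarrow> real" where
  "load w x = source (trunc w) (trunc w) x + flux (p x) (trunc w x)"

lemma enclosed_trunc:
  assumes [measurable]: "w \<in> borel_measurable leb"
  shows "enclosed (trunc w)"
proof -
  have "trunc w \<in> borel_measurable leb" unfolding trunc_def[abs_def] by measurable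
  moreover have "AE x in leb. ul x \<le> trunc w x \<and> trunc w x \<le> uu x"
    using ul_uu by eventually_elim (auto simp: trunc_def)
  ultimately show ?thesis by (simp add: enclosed_def)
qed

lemma load_adm:
  obtains H where "H \<ge> 0" "\<And>w. w \<in> borel_measurable leb \<Longrightarrow> adm H (load w)"
proof -
  obtain H1 where H1: "H1 \<ge> 0" "\<And>v w. enclosed v \<Longrightarrow> enclosed w \<Longrightarrow> AE x in leb. \<bar>source v w x\<bar> \<le> H1"
    by (rule source_bounded) blast
  define H where "H = H1 + max 1 C powr pp"
  have "adm H (load w)" if w: "w \<in> borel_measurable leb" for w
    unfolding adm_def
  proof
    note wt = enclosed_trunc[OF w]
    show "load w \<in> borel_measurable leb"
      unfolding load_def[abs_def] using source_measurable[OF wt wt] flux_measurable[OF enclosedD(1)[OF wt]]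
      by (intro borel_measurable_add)
    show "AE x in leb. \<bar>load w x\<bar> \<le> H"
      using H1(2)[OF wt wt] enclosedD(3)[OF wt] AE_space
    proof eventually_elim
      case (elim x)
      have px: "p x > 1" "p x \<le> pp" using p_gt_1[OF elim(3)] p_le[OF elim(3)] by auto
      have "norm (flux (p x) (trunc w x)) = \<bar>trunc w x\<bar> powr (p x - 1)" using norm_flux[of "p x" "trunc w x"] by simp
      also have "\<dots> \<le> max 1 C powr (p x - 1)" using elim px by (intro powr_mono2) auto
      also have "\<dots> \<le> max 1 C powr pp" using px by (intro powr_mono) auto
      finally show ?case using elim(1) unfolding load_def H_def by simp
    qed
  qed
  moreover have "H \<ge> 0" using H1 by (simp add: H_def)
  ultimately show ?thesis using that by blast
qed

text \<open>Used for the fixed point, which is found only up to a null set; the nonlocal terms see w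
  only through Luxemburg norms.\<close>

lemma load_cong_AE:
  assumes "AE x in leb. v x = w x"
  shows "AE x in leb. load v x = load w x"
proof -
  have t: "AE x in leb. trunc v x = trunc w x" using assms by eventually_elim (simp add: trunc_def)
  have "lux_norm \<Omega> q (trunc v) = lux_norm \<Omega> q (trunc w)" "lux_norm \<Omega> s (trunc v) = lux_norm \<Omega> s (trunc w)"
    "lux_norm \<Omega> r (trunc v) = lux_norm \<Omega> r (trunc w)"
    using eq.lq_cong_AE[OF t] es.lq_cong_AE[OF t] er.lq_cong_AE[OF t] by auto
  with t show ?thesis by (auto simp: load_def source_def elim!: eventually_mono)
qed

lemma caratheodory_tendsto:
  assumes F: "continuous_on (closure \<Omega> \<times> S) (\<lambda>(x, t). F x t)" and x: "x \<in> \<Omega>"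
    and t: "ts \<longlonglongrightarrow> t" "t \<in> S" "\<And>n. ts n \<in> S"
  shows "(\<lambda>n. F x (ts n :: real) :: real) \<longlonglongrightarrow> F x t"
proof -
  have "x \<in> closure \<Omega>" using x closure_subset by blast
  then have "(\<lambda>n. (\<lambda>(x, t). F x t) (x, ts n)) \<longlonglongrightarrow> (\<lambda>(x, t). F x t) (x, t)"
    using t by (intro continuous_on_tendsto_compose[OF F]) (auto intro!: tendsto_Pair)
  then show ?thesis by simp
qed

text \<open>Truncations and their Luxemburg norms converge, so the loads converge almost everywhere,
  and the common sup bound dominates.\<close>

lemma load_tendsto:
  assumes ws: "\<And>n. ws n \<in> borel_measurable leb" and w: "w \<in> borel_measurable leb"
    and lim: "AE x in leb. (\<lambda>n. ws n x) \<longlonglongrightarrow> w x"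
  shows "(\<lambda>n. \<integral>x. \<bar>load (ws n) x - load w x\<bar> \<partial>leb) \<longlonglongrightarrow> 0"
proof -
  note wn = enclosed_trunc[OF ws] and ww = enclosed_trunc[OF w]
  have tlim: "AE x in leb. (\<lambda>n. trunc (ws n) x) \<longlonglongrightarrow> trunc w x"
    using lim unfolding trunc_def by eventually_elim (intro tendsto_max tendsto_min tendsto_const)
  have lq: "(\<lambda>n. lux_norm \<Omega> q (trunc (ws n))) \<longlonglongrightarrow> lux_norm \<Omega> q (trunc w)"
    by (rule eq.lq_tendsto[OF enclosedD(1,3)[OF wn] enclosedD(1,3)[OF ww] tlim])
  have ls: "(\<lambda>n. lux_norm \<Omega> s (trunc (ws n))) \<longlonglongrightarrow> lux_norm \<Omega> s (trunc w)"
    by (rule es.lq_tendsto[OF enclosedD(1,3)[OF wn] enclosedD(1,3)[OF ww] tlim])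
  have lr: "(\<lambda>n. lux_norm \<Omega> r (trunc (ws n))) \<longlonglongrightarrow> lux_norm \<Omega> r (trunc w)"
    by (rule er.lq_tendsto[OF enclosedD(1,3)[OF wn] enclosedD(1,3)[OF ww] tlim])
  obtain A0 where A0: "A0 > 0" "\<And>x w. x \<in> \<Omega> \<Longrightarrow> enclosed w \<Longrightarrow> A0 \<le> A x (lux_norm \<Omega> r w)" by (rule A_lower) blast
  obtain H where H: "H \<ge> 0" "\<And>w. w \<in> borel_measurable leb \<Longrightarrow> adm H (load w)" by (rule load_adm) blast
  have hm: "load v \<in> borel_measurable leb" and hb: "AE x in leb. \<bar>load v x\<bar> \<le> H"
    if "v \<in> borel_measurable leb" for v using H(2)[OF that] by (auto simp: adm_def)
  have "(\<lambda>n. \<integral>x. \<bar>load (ws n) x - load w x\<bar> \<partial>leb) \<longlonglongrightarrow> (\<integral>x. 0 \<partial>leb)"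
  proof (rule integral_dominated_convergence[where w = "\<lambda>_. 2 * H"])
    show "(\<lambda>x. \<bar>load (ws n) x - load w x\<bar>) \<in> borel_measurable leb" for n
      using hm[OF ws] hm[OF w] by (intro borel_measurable_abs borel_measurable_diff)
    show "AE x in leb. norm \<bar>load (ws n) x - load w x\<bar> \<le> 2 * H" for n
      using hb[OF ws[of n]] hb[OF w] by eventually_elim simp
    show "AE x in leb. (\<lambda>n. \<bar>load (ws n) x - load w x\<bar>) \<longlonglongrightarrow> 0"
      using tlim AE_space
    proof eventually_elim
      case (elim x)
      have x: "x \<in> \<Omega>" using elim by simp
      have fl: "(\<lambda>n. f x (trunc (ws n) x)) \<longlonglongrightarrow> f x (trunc w x)" by (rule caratheodory_tendsto[OF f_cont x elim(1)]) auto
      have gl: "(\<lambda>n. g x (trunc (ws n) x)) \<longlonglongrightarrow> g x (trunc w x)" by (rule caratheodory_tendsto[OF g_cont x elim(1)]) auto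
      have Al: "(\<lambda>n. A x (lux_norm \<Omega> r (trunc (ws n)))) \<longlonglongrightarrow> A x (lux_norm \<Omega> r (trunc w))"
        by (rule caratheodory_tendsto[OF A_cont x lr]) (use lux_enclosed(7)[OF wn] lux_enclosed(7)[OF ww] in auto)
      have An: "A x (lux_norm \<Omega> r (trunc w)) \<noteq> 0" using A0(1) A0(2)[OF x ww] by auto
      have sl: "(\<lambda>n. source (trunc (ws n)) (trunc (ws n)) x) \<longlonglongrightarrow> source (trunc w) (trunc w) x"
        unfolding source_def using lux_enclosed(8,9)[OF ww]
        by (intro tendsto_divide tendsto_add tendsto_mult tendsto_powr fl gl Al An lq ls tendsto_const) auto
      have "isCont (\<lambda>t::real. flux (p x) t) t" for t
      proof -
        have "continuous_on UNIV (\<lambda>t::real. sgn t * \<bar>t\<bar> powr (p x - 1))"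
        proof -
          \<comment> \<open>Splitting into powers of the positive and negative parts shows
            continuity across 0, where p x - 1 is a positive exponent.\<close>
          have eq: "(\<lambda>t::real. sgn t * \<bar>t\<bar> powr (p x - 1)) = (\<lambda>t. max 0 t powr (p x - 1) - max 0 (- t) powr (p x - 1))"
            using p_gt_1[OF elim(2)] by (auto simp: fun_eq_iff sgn_if max_def)
          show ?thesis unfolding eq using p_gt_1[OF elim(2)]
            by (intro continuous_on_diff continuous_on_powr' continuous_intros) auto
        qed
        then show ?thesis by (simp add: continuous_on_eq_continuous_at flux_real)
      qed
      from isCont_tendsto_compose[OF this elim(1)]
      have "(\<lambda>n. load (ws n) x) \<longlonglongrightarrow> load w x" unfolding load_def by (intro tendsto_add sl)
      then show ?case by (intro tendsto_rabs_zero) (simp add: LIM_zero)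
    qed
  qed auto
  then show ?thesis by simp
qed

lemma total_tendsto_imp_L1:
  assumes d: "\<And>n. us n \<in> Lp" "\<And>n. Gs n \<in> Lp" and lim: "(\<lambda>n. total (us n) (Gs n)) \<longlonglongrightarrow> 0"
  shows "(\<lambda>n. \<integral>x. \<bar>us n x\<bar> \<partial>leb) \<longlonglongrightarrow> 0"
proof -
  have "(\<lambda>n. ennreal (total (us n) (Gs n))) \<longlonglongrightarrow> 0" using tendsto_ennrealI[OF lim] by simp
  then have "(\<lambda>n. mdl (us n)) \<longlonglongrightarrow> 0"
    by (rule tendsto_sandwich[OF _ _ tendsto_const, rotated 2]) (use mdl_le_total(1)[OF d] in auto)
  from mdl_tendsto_imp_L1[OF d(1) this] show ?thesis by simp
qed

lemma minimizer_tendsto_L1: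
  assumes ws: "\<And>n. ws n \<in> borel_measurable leb" and w: "w \<in> borel_measurable leb"
    and lim: "AE x in leb. (\<lambda>n. ws n x) \<longlonglongrightarrow> w x"
    and m: "\<And>n. is_minimizer (load (ws n)) (us n) (Gs n)" "is_minimizer (load w) u G"
  shows "(\<lambda>n. \<integral>x. \<bar>us n x - u x\<bar> \<partial>leb) \<longlonglongrightarrow> 0"
proof -
  obtain H where H: "H \<ge> 0" "\<And>w. w \<in> borel_measurable leb \<Longrightarrow> adm H (load w)" by (rule load_adm) blast
  have V: "(us n, Gs n) \<in> V" "(u, G) \<in> V" for n using m by (auto simp: is_minimizer_def)
  have L: "(\<lambda>x. us n x - u x) \<in> Lp" "(\<lambda>x. Gs n x - G x) \<in> Lp" for n
    using V_Lp[OF V(1)] V_Lp[OF V(2)] by (auto intro: Lp_diff)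
  have "(\<lambda>n. total (\<lambda>x. us n x - u x) (\<lambda>x. Gs n x - G x)) \<longlonglongrightarrow> 0"
  proof (rule LIMSEQ_I)
    fix e :: real assume e: "e > 0"
    obtain \<delta> where \<delta>: "\<delta> > 0" "\<And>h k u G v K. adm H h \<Longrightarrow> adm H k \<Longrightarrow> is_minimizer h u G \<Longrightarrow> is_minimizer k v K \<Longrightarrow>
      (\<integral>x. \<bar>h x - k x\<bar> \<partial>leb) < \<delta> \<Longrightarrow> total (\<lambda>x. u x - v x) (\<lambda>x. G x - K x) < e"
      by (rule minimizer_stability_rhs[OF H(1) e]) blast
    obtain N where N: "\<And>n. n \<ge> N \<Longrightarrow> (\<integral>x. \<bar>load (ws n) x - load w x\<bar> \<partial>leb) < \<delta>"
      using order_tendstoD(2)[OF load_tendsto[OF ws w lim] \<delta>(1)] by (auto simp: eventually_sequentially)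
    have "total (\<lambda>x. us n x - u x) (\<lambda>x. Gs n x - G x) < e" if "n \<ge> N" for n
      by (rule \<delta>(2)[OF H(2)[OF ws] H(2)[OF w] m(1) m(2) N[OF that]])
    then show "\<exists>N. \<forall>n\<ge>N. norm (total (\<lambda>x. us n x - u x) (\<lambda>x. Gs n x - G x) - 0) < e"
      using total_nonneg by (intro exI[of _ N]) simp
  qed
  from total_tendsto_imp_L1[OF L this] show ?thesis .
qed

text \<open>Compactness gives only \<open>L\<^sup>1\<close> convergence of the images; stability
  upgrades it to convergence in the energy space. The approximants lie within 1/(n+1) of their
  images and so share the limit, and continuity of the solution map identifies it.\<close>

lemma fixed_point:
  obtains u v G where "u \<in> borel_measurable leb" "is_minimizer (load u) v G" "AE x in leb. v x = u x"
proof -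
  obtain H where H: "H \<ge> 0" "\<And>w. w \<in> borel_measurable leb \<Longrightarrow> adm H (load w)" by (rule load_adm) blast
  \<comment> \<open>One minimiser is selected for each w; the stability estimates hold for any
    selection.\<close>
  define sol where "sol = (\<lambda>w. SOME z. is_minimizer (load w) (fst z) (snd z))"
  define Su SG where "Su = (\<lambda>w. fst (sol w))" and "SG = (\<lambda>w. snd (sol w))"
  have sol: "is_minimizer (load w) (Su w) (SG w)" if w: "w \<in> borel_measurable leb" for w
  proof -
    obtain u G where "is_minimizer (load w) u G" using minimizer_exists[OF H(1) H(2)[OF w]] by blast
    then show ?thesis unfolding Su_def SG_def sol_def by (intro someI[of "\<lambda>z. is_minimizer (load w) (fst z) (snd z)" "(u, G)"]) simp
  qed
  have V: "(Su w, SG w) \<in> V" if "w \<in> borel_measurable leb" for w using sol[OF that] by (simp add: is_minimizer_def)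
  obtain S0 where S0: "S0 \<ge> 0" "\<And>h u G. adm H h \<Longrightarrow> is_minimizer h u G \<Longrightarrow> total u G \<le> S0"
    by (rule minimizer_total_bound[OF H(1)]) blast
  have m: "w \<in> borel_measurable leb" if "integrable leb w" for w :: "'a \<Rightarrow> real" using that by auto
  have Si: "integrable leb (Su w)" if "integrable leb w" for w
    using Lp_integrable[OF V_Lp(1)[OF V[OF m[OF that]]]] .
  have comp: "\<exists>r :: nat \<Rightarrow> nat. strict_mono r \<and> (\<forall>e>0. \<exists>N. \<forall>k\<ge>N. \<forall>l\<ge>N. (\<integral>x. \<bar>Su (ws (r k)) x - Su (ws (r l)) x\<bar> \<partial>leb) < e)"
    if "\<And>n. integrable leb (ws n)" for ws :: "nat \<Rightarrow> 'a \<Rightarrow> real"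
    by (rule V_rellich[OF V[OF m[OF that]] S0(2)[OF H(2)[OF m[OF that]] sol[OF m[OF that]]]])
  have "\<exists>w. integrable leb w \<and> (\<integral>x. \<bar>Su w x - w x\<bar> \<partial>leb) \<le> 1 / real (Suc n)" for n
  proof -
    obtain w where "integrable leb w" "(\<integral>x. \<bar>Su w x - w x\<bar> \<partial>leb) \<le> 1 / real (Suc n)"
    proof (rule schauder_L1_approx[of leb Su "1 / real (Suc n)"])
      fix ws :: "nat \<Rightarrow> 'a \<Rightarrow> real" and w
      assume i: "\<And>n. integrable leb (ws n)" "integrable leb w"
        and lim: "\<And>x. x \<in> space leb \<Longrightarrow> (\<lambda>n. ws n x) \<longlonglongrightarrow> w x"
      show "(\<lambda>n. \<integral>x. \<bar>Su (ws n) x - Su w x\<bar> \<partial>leb) \<longlonglongrightarrow> 0"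
        by (rule minimizer_tendsto_L1[OF m[OF i(1)] m[OF i(2)] AE_I2[OF lim] sol[OF m[OF i(1)]] sol[OF m[OF i(2)]]])
    next
      show "\<exists>r :: nat \<Rightarrow> nat. strict_mono r \<and> (\<forall>e>0. \<exists>N. \<forall>k\<ge>N. \<forall>l\<ge>N. (\<integral>x. \<bar>Su (ws (r k)) x - Su (ws (r l)) x\<bar> \<partial>leb) < e)"
        if "\<And>n. integrable leb (ws n)" for ws :: "nat \<Rightarrow> 'a \<Rightarrow> real" by (rule comp[OF that])
    qed (use Si in auto)
    then show ?thesis by blast
  qed
  then have "\<exists>ws. \<forall>n. integrable leb (ws n) \<and> (\<integral>x. \<bar>Su (ws n) x - ws n x\<bar> \<partial>leb) \<le> 1 / real (Suc n)"
    by (intro choice allI)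
  then obtain ws where ws0: "\<forall>n. integrable leb (ws n) \<and> (\<integral>x. \<bar>Su (ws n) x - ws n x\<bar> \<partial>leb) \<le> 1 / real (Suc n)" ..
  have ws: "integrable leb (ws n)" "(\<integral>x. \<bar>Su (ws n) x - ws n x\<bar> \<partial>leb) \<le> 1 / real (Suc n)" for n
    using ws0 by simp_all
  obtain r :: "nat \<Rightarrow> nat" where r: "strict_mono r"
    "\<forall>e>0. \<exists>N. \<forall>k\<ge>N. \<forall>l\<ge>N. (\<integral>x. \<bar>Su (ws (r k)) x - Su (ws (r l)) x\<bar> \<partial>leb) < e"
    using comp[of ws, OF ws(1)] by (elim exE conjE)
  define us Gs where "us = (\<lambda>k. Su (ws (r k)))" and "Gs = (\<lambda>k. SG (ws (r k)))"
  have usV: "(us k, Gs k) \<in> V" and usm: "is_minimizer (load (ws (r k))) (us k) (Gs k)" for k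
    using V[OF m[OF ws(1)]] sol[OF m[OF ws(1)]] by (auto simp: us_def Gs_def)
  note usi = Lp_integrable[OF V_Lp(1)[OF usV]]
  obtain u G where uG: "(u, G) \<in> V" "(\<lambda>n. mdl (\<lambda>x. us n x - u x)) \<longlonglongrightarrow> 0" "(\<lambda>n. mdl (\<lambda>x. Gs n x - G x)) \<longlonglongrightarrow> 0"
  proof (rule V_complete[OF usV])
    fix e :: real assume e: "e > 0"
    obtain \<delta> where \<delta>: "\<delta> > 0" "\<And>h k u G v K. adm H h \<Longrightarrow> adm H k \<Longrightarrow> is_minimizer h u G \<Longrightarrow> is_minimizer k v K \<Longrightarrow>
      (\<integral>x. (h x - k x) * (u x - v x) \<partial>leb) < \<delta> \<Longrightarrow> total (\<lambda>x. u x - v x) (\<lambda>x. G x - K x) < e"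
      by (rule minimizer_stability[OF H(1) e]) blast
    \<comment> \<open>Two loads differ by at most 2 H, so the coupling term is at most 2 H times the
      \<open>L\<^sup>1\<close> distance of the solutions; the 1 covers H = 0.\<close>
    have "\<delta> / (2 * H + 1) > 0" using \<delta>(1) H(1) by simp
    with r(2) obtain N where N: "\<And>k l. k \<ge> N \<Longrightarrow> l \<ge> N \<Longrightarrow> (\<integral>x. \<bar>us k x - us l x\<bar> \<partial>leb) < \<delta> / (2 * H + 1)"
      unfolding us_def by meson
    have "total (\<lambda>x. us k x - us l x) (\<lambda>x. Gs k x - Gs l x) < e" if kl: "k \<ge> N" "l \<ge> N" for k l
    proof (rule \<delta>(2)[OF H(2)[OF m[OF ws(1)]] H(2)[OF m[OF ws(1)]] usm usm])
      have a: "adm H (load (ws (r k)))" "adm H (load (ws (r l)))" using H(2)[OF m[OF ws(1)]] by auto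
      have uv: "(\<lambda>x. us k x - us l x) \<in> Lp" using V_Lp(1)[OF usV] by (intro Lp_diff)
      have "(\<integral>x. (load (ws (r k)) x - load (ws (r l)) x) * (us k x - us l x) \<partial>leb) \<le> (\<integral>x. 2 * H * \<bar>us k x - us l x\<bar> \<partial>leb)"
      proof (rule integral_mono_AE)
        show "integrable leb (\<lambda>x. (load (ws (r k)) x - load (ws (r l)) x) * (us k x - us l x))"
          using Bochner_Integration.integrable_diff[OF adm_integrable[OF a(1) uv] adm_integrable[OF a(2) uv]] by (simp add: left_diff_distrib)
        show "integrable leb (\<lambda>x. 2 * H * \<bar>us k x - us l x\<bar>)" using Lp_integrable[OF uv] by simp
        have "AE x in leb. \<bar>load (ws (r k)) x\<bar> \<le> H" "AE x in leb. \<bar>load (ws (r l)) x\<bar> \<le> H" using a by (auto simp: adm_def)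
        then show "AE x in leb. (load (ws (r k)) x - load (ws (r l)) x) * (us k x - us l x) \<le> 2 * H * \<bar>us k x - us l x\<bar>"
        proof eventually_elim
          case (elim x)
          have "(load (ws (r k)) x - load (ws (r l)) x) * (us k x - us l x) \<le> \<bar>load (ws (r k)) x - load (ws (r l)) x\<bar> * \<bar>us k x - us l x\<bar>"
            by (simp add: abs_mult[symmetric])
          also have "\<dots> \<le> (2 * H) * \<bar>us k x - us l x\<bar>" using elim by (intro mult_right_mono) auto
          finally show ?case .
        qed
      qed
      also have "\<dots> = 2 * H * (\<integral>x. \<bar>us k x - us l x\<bar> \<partial>leb)" by simp
      also have "\<dots> \<le> (2 * H) * (\<delta> / (2 * H + 1))" using N[OF kl] H(1) by (intro mult_left_mono) auto
      also have "\<dots> < \<delta>" using \<delta>(1) H(1) by (simp add: field_simps)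
      finally show "(\<integral>x. (load (ws (r k)) x - load (ws (r l)) x) * (us k x - us l x) \<partial>leb) < \<delta>" .
    qed
    then show "\<exists>N. \<forall>m\<ge>N. \<forall>n\<ge>N. total (\<lambda>x. us m x - us n x) (\<lambda>x. Gs m x - Gs n x) < e" by blast
  qed blast
  note uL = V_Lp(1)[OF uG(1)]
  have L1: "(\<lambda>n. \<integral>x. \<bar>us n x - u x\<bar> \<partial>leb) \<longlonglongrightarrow> 0"
    using mdl_tendsto_imp_L1[OF Lp_diff[OF V_Lp(1)[OF usV] uL] uG(2)] by simp
  have wu: "(\<lambda>n. \<integral>x. norm (ws (r n) x - u x) \<partial>leb) \<longlonglongrightarrow> 0"
  proof (rule tendsto_sandwich[OF _ _ tendsto_const])
    show "\<forall>\<^sub>F n in sequentially. (\<integral>x. norm (ws (r n) x - u x) \<partial>leb) \<le> 1 / real (Suc n) + (\<integral>x. \<bar>us n x - u x\<bar> \<partial>leb)"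
    proof (intro always_eventually allI)
      fix n
      have "(\<integral>x. norm (ws (r n) x - u x) \<partial>leb) \<le> (\<integral>x. \<bar>us n x - ws (r n) x\<bar> + \<bar>us n x - u x\<bar> \<partial>leb)"
        using ws(1)[of "r n"] Lp_integrable[OF uL] usi[of n] by (intro integral_mono) auto
      also have "\<dots> = (\<integral>x. \<bar>us n x - ws (r n) x\<bar> \<partial>leb) + (\<integral>x. \<bar>us n x - u x\<bar> \<partial>leb)"
        using ws(1)[of "r n"] Lp_integrable[OF uL] usi[of n] by simp
      also have "(\<integral>x. \<bar>us n x - ws (r n) x\<bar> \<partial>leb) \<le> 1 / real (Suc (r n))" using ws(2)[of "r n"] by (simp add: us_def)
      also have "\<dots> \<le> 1 / real (Suc n)" using seq_suble[OF r(1), of n] by (intro divide_left_mono) auto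
      finally show "(\<integral>x. norm (ws (r n) x - u x) \<partial>leb) \<le> 1 / real (Suc n) + (\<integral>x. \<bar>us n x - u x\<bar> \<partial>leb)" by simp
    qed
    show "(\<lambda>n. 1 / real (Suc n) + (\<integral>x. \<bar>us n x - u x\<bar> \<partial>leb)) \<longlonglongrightarrow> 0"
      using tendsto_add[OF LIMSEQ_inverse_real_of_nat L1] by (simp add: inverse_eq_divide)
  qed simp
  have "integrable leb (\<lambda>x. ws (r n) x - u x)" for n using ws(1)[of "r n"] Lp_integrable[OF uL] by simp
  from tendsto_L1_AE_subseq[OF this wu]
  obtain t :: "nat \<Rightarrow> nat" where t: "strict_mono t" "AE x in leb. (\<lambda>n. ws (r (t n)) x - u x) \<longlonglongrightarrow> 0" by blast
  have tl: "AE x in leb. (\<lambda>n. ws (r (t n)) x) \<longlonglongrightarrow> u x" using t(2) by eventually_elim (simp add: LIM_zero_cancel)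
  note um = Lp_measurable[OF uL]
  \<comment> \<open>The same sequence of solutions tends to \<open>Su u\<close> and to
    \<open>u\<close>, so the two agree almost everywhere.\<close>
  have "(\<lambda>n. \<integral>x. \<bar>us (t n) x - Su u x\<bar> \<partial>leb) \<longlonglongrightarrow> 0"
    by (rule minimizer_tendsto_L1[OF m[OF ws(1)] um tl usm sol[OF um]])
  moreover have "(\<lambda>n. \<integral>x. \<bar>us (t n) x - u x\<bar> \<partial>leb) \<longlonglongrightarrow> 0"
    using LIMSEQ_subseq_LIMSEQ[OF L1 t(1)] by (simp add: o_def)
  ultimately have s0: "(\<lambda>n. (\<integral>x. \<bar>us (t n) x - Su u x\<bar> \<partial>leb) + (\<integral>x. \<bar>us (t n) x - u x\<bar> \<partial>leb)) \<longlonglongrightarrow> 0"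
    using tendsto_add[of _ 0 _ _ 0] by fastforce
  have Sui: "integrable leb (Su u)" using Lp_integrable[OF V_Lp(1)[OF V[OF um]]] .
  have le: "(\<integral>x. \<bar>Su u x - u x\<bar> \<partial>leb) \<le> (\<integral>x. \<bar>us (t n) x - Su u x\<bar> \<partial>leb) + (\<integral>x. \<bar>us (t n) x - u x\<bar> \<partial>leb)" for n
  proof -
    have "(\<integral>x. \<bar>Su u x - u x\<bar> \<partial>leb) \<le> (\<integral>x. \<bar>us (t n) x - Su u x\<bar> + \<bar>us (t n) x - u x\<bar> \<partial>leb)"
      using Sui Lp_integrable[OF uL] usi[of "t n"] by (intro integral_mono) auto
    then show ?thesis using Sui Lp_integrable[OF uL] usi[of "t n"] by simp
  qed
  have "(\<integral>x. \<bar>Su u x - u x\<bar> \<partial>leb) \<le> 0" by (rule LIMSEQ_le_const[OF s0]) (use le in auto)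
  moreover have "(\<integral>x. \<bar>Su u x - u x\<bar> \<partial>leb) \<ge> 0" by simp
  ultimately have "(\<integral>x. \<bar>Su u x - u x\<bar> \<partial>leb) = 0" by linarith
  then have "AE x in leb. \<bar>Su u x - u x\<bar> = 0"
    using Sui Lp_integrable[OF uL] by (subst (asm) integral_nonneg_eq_0_iff_AE) auto
  then have "AE x in leb. Su u x = u x" by eventually_elim simp
  with sol[OF um] um that show ?thesis by blast
qed


subsection \<open>Comparison\<close>

text \<open>Trades the chosen gradients of the weak formulation for those carried by
  \<open>V\<close>.\<close>

lemma pLap_form_eq:
  assumes u: "weak_grad \<Omega> u \<in> Lp" and G: "G \<in> Lp" "AE x in leb. weak_grad \<Omega> u x = G x" and \<phi>: "(\<phi>, K) \<in> V"
  shows "pLap_form \<Omega> p u \<phi> = (\<integral>x. flux (p x) (G x) \<bullet> K x \<partial>leb)"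
proof -
  have W: "weak_grad \<Omega> \<phi> \<in> Lp" using V_Lp(2)[OF W10_imp_V[OF V_imp_W10[OF \<phi>]]] .
  have "pLap_form \<Omega> p u \<phi> = (\<integral>x. flux (p x) (weak_grad \<Omega> u x) \<bullet> weak_grad \<Omega> \<phi> x \<partial>leb)"
    by (simp add: pLap_form_def flux_def)
  also have "\<dots> = (\<integral>x. flux (p x) (G x) \<bullet> K x \<partial>leb)"
  proof (rule integral_cong_AE)
    show "(\<lambda>x. flux (p x) (weak_grad \<Omega> u x) \<bullet> weak_grad \<Omega> \<phi> x) \<in> borel_measurable leb"
      by (rule borel_measurable_integrable[OF flux_inner_integrable[OF u W]])
    show "(\<lambda>x. flux (p x) (G x) \<bullet> K x) \<in> borel_measurable leb"
      by (rule borel_measurable_integrable[OF flux_inner_integrable[OF G(1) V_Lp(2)[OF \<phi>]]])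
    show "AE x in leb. flux (p x) (weak_grad \<Omega> u x) \<bullet> weak_grad \<Omega> \<phi> x = flux (p x) (G x) \<bullet> K x"
      using G(2) weak_grad_eq[OF V_has_weak_gradient[OF \<phi>]] by eventually_elim simp
  qed
  finally show ?thesis .
qed

lemma rhs_eq: "rhs \<Omega> r q s \<alpha> \<gamma> f g A v w \<phi> = (\<integral>x. source v w x * \<phi> x \<partial>leb)"
  by (simp add: rhs_def source_def)

lemma source_integrable:
  assumes "enclosed v" "enclosed w" "\<phi> \<in> Lp"
  shows "integrable leb (\<lambda>x. source v w x * \<phi> x)"
proof -
  obtain H where "H \<ge> 0" "\<And>v w. enclosed v \<Longrightarrow> enclosed w \<Longrightarrow> AE x in leb. \<bar>source v w x\<bar> \<le> H"
    by (rule source_bounded) blast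
  then have "adm H (source v w)" using source_measurable[OF assms(1,2)] assms(1,2) by (simp add: adm_def)
  from adm_integrable[OF this assms(3)] show ?thesis .
qed

text \<open>Where the values agree, only the nonlocal powers differ. They grow with the norms
  because \<alpha> and \<gamma> are nonnegative, and their coefficients are nonnegative by the sign
  conditions on f, g and A.\<close>

lemma source_mono:
  assumes z: "enclosed z" "enclosed z'" "enclosed w"
    and le: "lux_norm \<Omega> q z \<le> lux_norm \<Omega> q z'" "lux_norm \<Omega> s z \<le> lux_norm \<Omega> s z'"
  shows "AE x in leb. z x = z' x \<longrightarrow> source z w x \<le> source z' w x"
  using enclosedD(2)[OF z(1)] \<alpha>(2) \<gamma>(2) AE_space
proof eventually_elim
  case (elim x)
  obtain A0 where A0: "A0 > 0" "\<And>x w. x \<in> \<Omega> \<Longrightarrow> enclosed w \<Longrightarrow> A0 \<le> A x (lux_norm \<Omega> r w)" by (rule A_lower) blast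
  have x: "x \<in> \<Omega>" "x \<in> closure \<Omega>" using elim closure_subset by auto
  have A: "A x (lux_norm \<Omega> r w) > 0" using A0(1) A0(2)[OF x(1) z(3)] by simp
  have fg: "f x (z x) \<ge> 0" "g x (z x) \<ge> 0" using f_nonneg g_nonneg x(2) elim by auto
  have "lux_norm \<Omega> q z powr \<alpha> x \<le> lux_norm \<Omega> q z' powr \<alpha> x" "lux_norm \<Omega> s z powr \<gamma> x \<le> lux_norm \<Omega> s z' powr \<gamma> x"
    using elim le lux_enclosed(8,9)[OF z(1)] by (auto intro!: powr_mono2)
  then show ?case unfolding source_def using A fg by (auto intro!: divide_right_mono add_mono mult_left_mono)
qed

text \<open>One argument for both barriers, with W the gradient of the barrier. Subtracting its
  inequality from the Euler-Lagrange equation leaves a gradient part and a penalty part, both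
  nonnegative, with integral at most 0; hence each vanishes almost everywhere.\<close>

lemma comparison:
  assumes V: "(v, G) \<in> V"
    and EL: "(\<integral>x. flux (p x) (v x) * \<phi> x \<partial>leb) + (\<integral>x. flux (p x) (G x) \<bullet> K x \<partial>leb)
       = (\<integral>x. load v x * \<phi> x \<partial>leb)"
    and \<phi>: "(\<phi>, K) \<in> V" and W: "W \<in> Lp" and K: "\<And>x. K x = \<theta> x *\<^sub>R (G x - W x)" "\<And>x. \<theta> x \<ge> 0"
    and z: "enclosed z"
    and ineq: "(\<integral>x. source z (trunc v) x * \<phi> x \<partial>leb) \<le> (\<integral>x. flux (p x) (W x) \<bullet> K x \<partial>leb)"
    and src: "AE x in leb. (source (trunc v) (trunc v) x - source z (trunc v) x) * \<phi> x \<le> 0"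
    and sgn: "AE x in leb. (flux (p x) (v x) - flux (p x) (trunc v x)) * \<phi> x \<ge> 0"
  shows "AE x in leb. (flux (p x) (v x) - flux (p x) (trunc v x)) * \<phi> x = 0"
proof -
  note vL = V_Lp[OF V] and \<phi>L = V_Lp[OF \<phi>]
  have vm: "v \<in> borel_measurable leb" by (rule Lp_measurable[OF vL(1)])
  note tr = enclosed_trunc[OF vm]
  obtain H where H: "H \<ge> 0" "\<And>w. w \<in> borel_measurable leb \<Longrightarrow> adm H (load w)" by (rule load_adm) blast
  have i1: "integrable leb (\<lambda>x. flux (p x) (v x) * \<phi> x)" using flux_inner_integrable[OF vL(1) \<phi>L(1)] by simp
  note i2 = flux_inner_integrable[OF vL(2) \<phi>L(2)] and i3 = adm_integrable[OF H(2)[OF vm] \<phi>L(1)]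
    and i4 = source_integrable[OF z tr \<phi>L(1)] and i5 = source_integrable[OF tr tr \<phi>L(1)] and i6 = flux_inner_integrable[OF W \<phi>L(2)]
  define I where "I = (\<lambda>x. (flux (p x) (G x) - flux (p x) (W x)) \<bullet> K x + (flux (p x) (v x) - flux (p x) (trunc v x)) * \<phi> x)"
  \<comment> \<open>Regrouped as the Euler-Lagrange density, minus the density of the barrier
    inequality, plus the difference of the sources.\<close>
  have I_eq: "I = (\<lambda>x. (flux (p x) (v x) * \<phi> x + flux (p x) (G x) \<bullet> K x - load v x * \<phi> x)
      - (flux (p x) (W x) \<bullet> K x - source z (trunc v) x * \<phi> x)
      + (source (trunc v) (trunc v) x * \<phi> x - source z (trunc v) x * \<phi> x))"
    by (simp add: I_def fun_eq_iff load_def inner_diff_left algebra_simps)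
  note ii = i1 i2 i3 i4 i5 i6
  have Ii: "integrable leb I" unfolding I_eq using ii by simp
  have "(\<integral>x. I x \<partial>leb) = ((\<integral>x. flux (p x) (v x) * \<phi> x \<partial>leb) + (\<integral>x. flux (p x) (G x) \<bullet> K x \<partial>leb)
       - (\<integral>x. load v x * \<phi> x \<partial>leb)) - ((\<integral>x. flux (p x) (W x) \<bullet> K x \<partial>leb) - (\<integral>x. source z (trunc v) x * \<phi> x \<partial>leb))
       + (\<integral>x. source (trunc v) (trunc v) x * \<phi> x - source z (trunc v) x * \<phi> x \<partial>leb)"
    unfolding I_eq using ii by simp
  also have "\<dots> \<le> (\<integral>x. source (trunc v) (trunc v) x * \<phi> x - source z (trunc v) x * \<phi> x \<partial>leb)" using EL ineq by simp
  also have "\<dots> \<le> (\<integral>x. 0 \<partial>leb)" using i4 i5 src by (intro integral_mono_AE) (auto simp: left_diff_distrib)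
  finally have le: "(\<integral>x. I x \<partial>leb) \<le> 0" by simp
  have mono: "(flux (p x) (G x) - flux (p x) (W x)) \<bullet> K x \<ge> 0" if "x \<in> \<Omega>" for x
    unfolding K(1) inner_scaleR_right using flux_monotone[of "p x" "G x" "W x"] p_gt_1[of x] that K(2) by simp
  have ge: "AE x in leb. I x \<ge> 0" using sgn AE_space by eventually_elim (use mono in \<open>auto simp: I_def\<close>)
  have "(\<integral>x. I x \<partial>leb) = 0" using le integral_nonneg_AE[OF ge] by linarith
  then have "AE x in leb. I x = 0" using integral_nonneg_eq_0_iff_AE[OF Ii ge] by simp
  then show ?thesis using sgn AE_space
  proof eventually_elim
    case (elim x)
    then show ?case using mono[of x] unfolding I_def space_lebesgue_on by linarith
  qed
qed

lemma solution_exists: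
  assumes pair: "sub_super_pair \<Omega> p r q s \<alpha> \<gamma> f g A ul uu"
  shows "\<exists>u. weak_solution \<Omega> p r q s \<alpha> \<gamma> f g A u \<and> (AE x in leb. 0 < u x \<and> ul x \<le> u x \<and> u x \<le> uu x)"
proof -
  have ulW: "ul \<in> W10 \<Omega> p" and uuW: "uu \<in> W1 \<Omega> p"
    and sub: "\<And>w \<phi>. w \<in> order_interval \<Omega> ul uu \<Longrightarrow> \<phi> \<in> W10 \<Omega> p \<Longrightarrow> (AE x in leb. \<phi> x \<ge> 0) \<Longrightarrow>
        pLap_form \<Omega> p ul \<phi> \<le> rhs \<Omega> r q s \<alpha> \<gamma> f g A ul w \<phi>"
    and super: "\<And>w \<phi>. w \<in> order_interval \<Omega> ul uu \<Longrightarrow> \<phi> \<in> W10 \<Omega> p \<Longrightarrow> (AE x in leb. \<phi> x \<ge> 0) \<Longrightarrow>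
        pLap_form \<Omega> p uu \<phi> \<ge> rhs \<Omega> r q s \<alpha> \<gamma> f g A uu w \<phi>"
    using pair unfolding sub_super_pair_def by blast+
  obtain u v G where u: "u \<in> borel_measurable leb" and m: "is_minimizer (load u) v G" and vu: "AE x in leb. v x = u x"
    by (rule fixed_point)
  obtain H where H: "H \<ge> 0" "\<And>w. w \<in> borel_measurable leb \<Longrightarrow> adm H (load w)" by (rule load_adm) blast
  have V: "(v, G) \<in> V" using m by (simp add: is_minimizer_def)
  have vm: "v \<in> borel_measurable leb" by (rule Lp_measurable[OF V_Lp(1)[OF V]])
  have EL: "(\<integral>x. flux (p x) (v x) * \<phi> x \<partial>leb) + (\<integral>x. flux (p x) (G x) \<bullet> K x \<partial>leb)
      = (\<integral>x. load v x * \<phi> x \<partial>leb)" if \<phi>: "(\<phi>, K) \<in> V" for \<phi> K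
  proof -
    have "(\<integral>x. load u x * \<phi> x \<partial>leb) = (\<integral>x. load v x * \<phi> x \<partial>leb)"
    proof (rule integral_cong_AE)
      show "(\<lambda>x. load u x * \<phi> x) \<in> borel_measurable leb"
        by (rule borel_measurable_integrable[OF adm_integrable[OF H(2)[OF u] V_Lp(1)[OF \<phi>]]])
      show "(\<lambda>x. load v x * \<phi> x) \<in> borel_measurable leb"
        by (rule borel_measurable_integrable[OF adm_integrable[OF H(2)[OF vm] V_Lp(1)[OF \<phi>]]])
      show "AE x in leb. load u x * \<phi> x = load v x * \<phi> x" using load_cong_AE[OF vu] by eventually_elim simp
    qed
    then show ?thesis using euler_lagrange[OF H(2)[OF u] m \<phi>] by simp
  qed
  note tr = enclosed_trunc[OF vm]
  have oi: "trunc v \<in> order_interval \<Omega> ul uu" using tr by (simp add: order_interval_def enclosed_def)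
  note uuG = W1_weak_grad[OF uuW] and ulV = W10_imp_V[OF ulW]
  have ge: "AE x in leb. ul x \<le> v x"
  proof -
    define \<phi> K where "\<phi> = (\<lambda>x. ramp (ul x - v x))" and "K = (\<lambda>x. ramp' (ul x - v x) *\<^sub>R (weak_grad \<Omega> ul x - G x))"
    have \<phi>: "(\<phi>, K) \<in> V" unfolding \<phi>_def K_def by (rule V_ramp[OF V_diff[OF ulV V]])
    \<comment> \<open>The sign is reversed so that the gradient of the test function is a
      nonnegative multiple of G minus the gradient of the barrier.\<close>
    have n: "(\<lambda>x. - \<phi> x, \<lambda>x. - K x) \<in> V" using V_cmult[OF \<phi>, of "-1"] by simp
    have "pLap_form \<Omega> p ul \<phi> \<le> rhs \<Omega> r q s \<alpha> \<gamma> f g A ul (trunc v) \<phi>"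
      by (rule sub[OF oi V_imp_W10[OF \<phi>]]) (simp add: \<phi>_def ramp_nonneg)
    then have ineq: "(\<integral>x. source ul (trunc v) x * - \<phi> x \<partial>leb) \<le> (\<integral>x. flux (p x) (weak_grad \<Omega> ul x) \<bullet> - K x \<partial>leb)"
      using pLap_form_eq[OF V_Lp(2)[OF ulV] V_Lp(2)[OF ulV] _ \<phi>] by (simp add: rhs_eq)
    have "AE x in leb. (flux (p x) (v x) - flux (p x) (trunc v x)) * - \<phi> x = 0"
    proof (rule comparison[OF V EL[OF n] n V_Lp(2)[OF ulV] _ _ enclosed_ul ineq])
      show "- K x = ramp' (ul x - v x) *\<^sub>R (G x - weak_grad \<Omega> ul x)" for x by (simp add: K_def scaleR_right_diff_distrib)
      show "ramp' (ul x - v x) \<ge> 0" for x by (rule ramp'_bounds)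
      show "AE x in leb. (source (trunc v) (trunc v) x - source ul (trunc v) x) * - \<phi> x \<le> 0"
        using source_mono[OF enclosed_ul tr tr lux_enclosed(1)[OF tr] lux_enclosed(3)[OF tr]] ul_uu
      \<comment> \<open>Where v < ul the truncation equals \<open>ul\<close> while its norms are at
        least those of \<open>ul\<close>, so \<open>source_mono\<close> gives the sign; elsewhere
        the test function is 0.\<close>
      proof eventually_elim
        case (elim x)
        show ?case
        proof (cases "v x < ul x")
          case True
          then have "source ul (trunc v) x \<le> source (trunc v) (trunc v) x" using elim by (auto simp: trunc_def)
          then show ?thesis using ramp_nonneg by (simp add: \<phi>_def)
        qed (simp add: \<phi>_def)
      qed
      show "AE x in leb. (flux (p x) (v x) - flux (p x) (trunc v x)) * - \<phi> x \<ge> 0"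
        using ul_uu AE_space
      proof eventually_elim
        case (elim x)
        show ?case
        proof (cases "v x < ul x")
          case True
          then have "flux (p x) (v x) < flux (p x) (trunc v x)" using elim p_gt_1[of x] by (intro flux_real_less) (auto simp: trunc_def)
          then show ?thesis using ramp_nonneg[of "ul x - v x"] unfolding \<phi>_def by (intro mult_nonpos_nonpos) auto
        qed (simp add: \<phi>_def)
      qed
    qed
    then show ?thesis using ul_uu AE_space
    \<comment> \<open>At a point with v < ul both factors of the penalty term are nonzero: the flux
      is strictly increasing and \<open>ramp\<close> is positive on positive arguments.\<close>
    proof eventually_elim
      case (elim x)
      show ?case
      proof (rule ccontr)
        assume "\<not> ul x \<le> v x"
        then have "flux (p x) (v x) < flux (p x) (trunc v x)" "\<phi> x > 0" using elim p_gt_1[of x]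
          by (auto simp: trunc_def \<phi>_def intro!: flux_real_less ramp_pos)
        then show False using elim(1) by simp
      qed
    qed
  qed
  have le: "AE x in leb. v x \<le> uu x"
  proof -
    define \<phi> K where "\<phi> = (\<lambda>x. ramp (v x - uu x))" and "K = (\<lambda>x. ramp' (v x - uu x) *\<^sub>R (G x - weak_grad \<Omega> uu x))"
    have uu0: "AE x in leb. uu x \<ge> 0" using ul_uu by eventually_elim simp
    have \<phi>: "(\<phi>, K) \<in> V" unfolding \<phi>_def K_def by (rule V_ramp_minus[OF V uuG(1) enclosedD(3)[OF enclosed_uu] uu0 uuG(2,3)])
    have "pLap_form \<Omega> p uu \<phi> \<ge> rhs \<Omega> r q s \<alpha> \<gamma> f g A uu (trunc v) \<phi>"
      by (rule super[OF oi V_imp_W10[OF \<phi>]]) (simp add: \<phi>_def ramp_nonneg)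
    then have ineq: "(\<integral>x. source uu (trunc v) x * \<phi> x \<partial>leb) \<le> (\<integral>x. flux (p x) (weak_grad \<Omega> uu x) \<bullet> K x \<partial>leb)"
      using pLap_form_eq[OF uuG(2) uuG(2) _ \<phi>] by (simp add: rhs_eq)
    have "AE x in leb. (flux (p x) (v x) - flux (p x) (trunc v x)) * \<phi> x = 0"
    proof (rule comparison[OF V EL[OF \<phi>] \<phi> uuG(2) _ _ enclosed_uu ineq])
      show "K x = ramp' (v x - uu x) *\<^sub>R (G x - weak_grad \<Omega> uu x)" for x by (simp add: K_def)
      show "ramp' (v x - uu x) \<ge> 0" for x by (rule ramp'_bounds)
      show "AE x in leb. (source (trunc v) (trunc v) x - source uu (trunc v) x) * \<phi> x \<le> 0"
        using source_mono[OF tr enclosed_uu tr lux_enclosed(2)[OF tr] lux_enclosed(4)[OF tr]] ul_uu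
      proof eventually_elim
        case (elim x)
        show ?case
        proof (cases "v x > uu x")
          case True
          then have "source (trunc v) (trunc v) x \<le> source uu (trunc v) x" using elim by (auto simp: trunc_def)
          then show ?thesis using ramp_nonneg[of "v x - uu x"] by (simp add: \<phi>_def mult_nonpos_nonneg)
        qed (simp add: \<phi>_def)
      qed
      show "AE x in leb. (flux (p x) (v x) - flux (p x) (trunc v x)) * \<phi> x \<ge> 0"
        using ul_uu AE_space
      proof eventually_elim
        case (elim x)
        show ?case
        proof (cases "v x > uu x")
          case True
          then have "flux (p x) (trunc v x) < flux (p x) (v x)" using elim p_gt_1[of x] by (intro flux_real_less) (auto simp: trunc_def)
          then show ?thesis using ramp_nonneg[of "v x - uu x"] unfolding \<phi>_def by (intro mult_nonneg_nonneg) auto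
        qed (simp add: \<phi>_def)
      qed
    qed
    then show ?thesis using ul_uu AE_space
    proof eventually_elim
      case (elim x)
      show ?case
      proof (rule ccontr)
        assume "\<not> v x \<le> uu x"
        then have "flux (p x) (trunc v x) < flux (p x) (v x)" "\<phi> x > 0" using elim p_gt_1[of x]
          by (auto simp: trunc_def \<phi>_def intro!: flux_real_less ramp_pos)
        then show False using elim(1) by simp
      qed
    qed
  qed
  \<comment> \<open>Within the barriers the truncation is inactive, so the two flux terms of the
    penalty cancel and the Euler-Lagrange equation becomes the weak formulation.\<close>
  have tv: "AE x in leb. trunc v x = v x" using ge le by eventually_elim (simp add: trunc_def)
  have ev: "enclosed v" using vm ge le by (simp add: enclosed_def AE_conjI)
  have load: "AE x in leb. load v x = source v v x + flux (p x) (v x)"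
    using tv unfolding load_def source_def eq.lq_cong_AE[OF tv] es.lq_cong_AE[OF tv] er.lq_cong_AE[OF tv] by eventually_elim simp
  have "pLap_form \<Omega> p v \<phi> = rhs \<Omega> r q s \<alpha> \<gamma> f g A v v \<phi>" if "\<phi> \<in> W10 \<Omega> p" for \<phi>
  proof -
    note \<phi> = W10_imp_V[OF that]
    note i1 = flux_inner_integrable[OF V_Lp(1)[OF V] V_Lp(1)[OF \<phi>], simplified] and i2 = source_integrable[OF ev ev V_Lp(1)[OF \<phi>]]
    have "(\<integral>x. load v x * \<phi> x \<partial>leb) = (\<integral>x. source v v x * \<phi> x + flux (p x) (v x) * \<phi> x \<partial>leb)"
    proof (rule integral_cong_AE)
      show "(\<lambda>x. load v x * \<phi> x) \<in> borel_measurable leb"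
        by (rule borel_measurable_integrable[OF adm_integrable[OF H(2)[OF vm] V_Lp(1)[OF \<phi>]]])
      show "(\<lambda>x. source v v x * \<phi> x + flux (p x) (v x) * \<phi> x) \<in> borel_measurable leb" using i1 i2 by simp
      show "AE x in leb. load v x * \<phi> x = source v v x * \<phi> x + flux (p x) (v x) * \<phi> x"
        using load by eventually_elim (simp add: distrib_right)
    qed
    also have "\<dots> = (\<integral>x. source v v x * \<phi> x \<partial>leb) + (\<integral>x. flux (p x) (v x) * \<phi> x \<partial>leb)" using i1 i2 by simp
    finally show ?thesis
      using EL[OF \<phi>] pLap_form_eq[OF V_Lp(2)[OF W10_imp_V[OF V_imp_W10[OF V]]] V_Lp(2)[OF V] weak_grad_eq[OF V_has_weak_gradient[OF V]] \<phi>]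
      by (simp add: rhs_eq)
  qed
  moreover have "v \<in> Linf \<Omega>" using vm enclosedD(3)[OF ev] by (auto simp: Linf_def)
  ultimately have "weak_solution \<Omega> p r q s \<alpha> \<gamma> f g A v" using V_imp_W10[OF V] by (simp add: weak_solution_def)
  moreover have "AE x in leb. 0 < v x \<and> ul x \<le> v x \<and> v x \<le> uu x" using ul_uu ge le by eventually_elim simp
  ultimately show ?thesis by blast
qed

end

section \<open>From the hypotheses of the theorem to the analytic setting\<close>

lemma AE_le_Linf_norm:
  assumes "u \<in> Linf \<Omega>"
  shows "AE x in lebesgue_on \<Omega>. \<bar>u x\<bar> \<le> Linf_norm \<Omega> u"
proof -
  define X where "X = {c. AE x in lebesgue_on \<Omega>. \<bar>u x\<bar> \<le> c}"
  have "X \<noteq> {}" using assms by (auto simp: Linf_def X_def)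
  have "AE x in lebesgue_on \<Omega>. \<bar>u x\<bar> \<le> Inf X + 1 / real (Suc n)" for n
  proof -
    have "Inf X < Inf X + 1 / real (Suc n)" by simp
    from cInf_lessD[OF \<open>X \<noteq> {}\<close> this] obtain c where "c \<in> X" "c < Inf X + 1 / real (Suc n)" by blast
    then show ?thesis unfolding X_def by (auto elim!: eventually_mono)
  qed
  then have "AE x in lebesgue_on \<Omega>. \<forall>n. \<bar>u x\<bar> \<le> Inf X + 1 / real (Suc n)" by (subst AE_all_countable) blast
  then show ?thesis unfolding Linf_norm_def ess_sup_def X_def[symmetric]
  proof eventually_elim
    case (elim x)
    have "(\<lambda>n. Inf X + 1 / real (Suc n)) \<longlonglongrightarrow> Inf X + 0"
      using LIMSEQ_inverse_real_of_nat by (intro tendsto_add tendsto_const) (simp add: inverse_eq_divide)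
    then show ?case using elim by (intro LIMSEQ_le_const) auto
  qed
qed

text \<open>The set where the bound fails is open and null, hence empty. This makes the essential
  lower bound of p a pointwise one.\<close>

lemma AE_le_imp_le_on_open:
  fixes f :: "'a::euclidean_space \<Rightarrow> real"
  assumes \<Omega>: "open \<Omega>" and f: "continuous_on \<Omega> f" and ae: "AE x in lebesgue_on \<Omega>. c \<le> f x" and x: "x \<in> \<Omega>"
  shows "c \<le> f x"
proof (rule ccontr)
  assume "\<not> c \<le> f x"
  define U where "U = \<Omega> \<inter> f -` {..<c}"
  have U: "open U" unfolding U_def by (rule continuous_open_preimage[OF f \<Omega> open_lessThan])
  have "x \<in> U" using x \<open>\<not> c \<le> f x\<close> by (simp add: U_def)
  have "AE y in lebesgue. y \<in> \<Omega> \<longrightarrow> c \<le> f y" using ae \<Omega> by (subst (asm) AE_restrict_space_iff) auto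
  then have "AE y in lebesgue. y \<notin> U" by eventually_elim (auto simp: U_def)
  then have "U \<in> null_sets lebesgue" using U by (subst AE_iff_null_sets) auto
  then have "negligible U" by (simp add: negligible_iff_null_sets)
  then show False using open_not_negligible[OF U] \<open>x \<in> U\<close> by blast
qed

lemma pde_domain_exists:
  assumes \<Omega>: "open \<Omega>" "bounded \<Omega>" "\<Omega> \<noteq> {}" and p: "C1_on_closure \<Omega> p" "1 < ess_inf \<Omega> p"
  obtains pm pp L where "pde_domain \<Omega> p pm pp L"
proof -
  obtain D :: "'a \<Rightarrow> 'a \<Rightarrow>\<^sub>L real" where pc: "continuous_on (closure \<Omega>) p" and D: "\<And>x. x \<in> \<Omega> \<Longrightarrow> (p has_derivative blinfun_apply (D x)) (at x)"
    "continuous_on (closure \<Omega>) D" using p(1) unfolding C1_on_closure_def by blast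
  have cl: "compact (closure \<Omega>)" using \<Omega>(2) by (simp add: compact_closure)
  have pc': "continuous_on \<Omega> p" by (rule continuous_on_subset[OF pc closure_subset])
  obtain P where P: "\<And>x. x \<in> closure \<Omega> \<Longrightarrow> norm (p x) \<le> P"
    using compact_imp_bounded[OF compact_continuous_image[OF pc cl]] by (auto simp: bounded_iff)
  obtain L where L: "\<And>x. x \<in> closure \<Omega> \<Longrightarrow> norm (D x) \<le> L"
    using compact_imp_bounded[OF compact_continuous_image[OF D(2) cl]] by (auto simp: bounded_iff)
  define X where "X = {c. AE x in lebesgue_on \<Omega>. c \<le> p x}"
  have "- P \<in> X" unfolding X_def mem_Collect_eq
  proof (rule AE_I2)
    fix x assume "x \<in> space (lebesgue_on \<Omega>)"
    then have "x \<in> closure \<Omega>" using closure_subset by auto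
    from P[OF this] show "- P \<le> p x" by simp
  qed
  then have "X \<noteq> {}" by blast
  \<comment> \<open>An essential infimum above 1 leaves room for an almost sure lower bound pm that
    is itself above 1.\<close>
  from less_cSupD[OF this p(2)[unfolded ess_inf_def X_def[symmetric]]] obtain pm where pm: "pm \<in> X" "1 < pm" by blast
  \<comment> \<open>The mean value inequality on the convex ball inside \<Omega>, with L a bound of
    the derivative on the compact closure.\<close>
  have lip: "\<bar>p y - p x\<bar> \<le> L * norm (y - x)" if c: "cball x (norm (y - x)) \<subseteq> \<Omega>" for x y
  proof -
    have "norm (p y - p x) \<le> L * norm (y - x)"
    proof (rule differentiable_bound[of "cball x (norm (y - x))"])
      fix z assume z: "z \<in> cball x (norm (y - x))"
      then have "z \<in> \<Omega>" using c by blast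
      moreover from this have "z \<in> closure \<Omega>" using closure_subset by blast
      ultimately show "(p has_derivative blinfun_apply (D z)) (at z within cball x (norm (y - x)))" "onorm (blinfun_apply (D z)) \<le> L"
        using D(1)[of z] L[of z] by (auto intro: has_derivative_at_withinI simp: norm_blinfun.rep_eq)
    qed (auto simp: dist_norm norm_minus_commute)
    then show ?thesis by simp
  qed
  have "pde_domain \<Omega> p pm P L"
  proof
    show "p \<in> borel_measurable (lebesgue_on \<Omega>)" using \<Omega>(1) pc' by (intro continuous_imp_measurable_on_sets_lebesgue) auto
    show "pm \<le> p x \<and> p x \<le> P" if "x \<in> \<Omega>" for x
    proof
      show "pm \<le> p x" using AE_le_imp_le_on_open[OF \<Omega>(1) pc' _ that] pm(1) by (simp add: X_def)
      show "p x \<le> P" using P[of x] that closure_subset by fastforce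
    qed
    obtain x where "x \<in> \<Omega>" using \<Omega>(3) by blast
    then have "norm (D x) \<le> L" using L closure_subset by blast
    then show "L \<ge> 0" using norm_ge_zero[of "D x"] by linarith
  qed (use \<Omega> pm lip in auto)
  then show ?thesis by (rule that)
qed

theorem theorem1:
  fixes \<Omega> :: "'a::euclidean_space set"
    and p r q s \<alpha> \<gamma> :: "'a \<Rightarrow> real"
    and f g A :: "'a \<Rightarrow> real \<Rightarrow> real"
    and ul uu :: "'a \<Rightarrow> real"
  assumes dim: "DIM('a) > 1"
    and dom: "open \<Omega>" "connected \<Omega>" "bounded \<Omega>" "\<Omega> \<noteq> {}"
    and bdry: "C2_boundary \<Omega>"
    and H0: "H0 \<Omega> p r q s \<alpha> \<gamma>"
    and f_cont: "continuous_on (closure \<Omega> \<times> UNIV) (\<lambda>(x, t). f x t)"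
    and g_cont: "continuous_on (closure \<Omega> \<times> UNIV) (\<lambda>(x, t). g x t)"
    and A_cont: "continuous_on (closure \<Omega> \<times> {0<..}) (\<lambda>(x, t). A x t)"
    and pair: "sub_super_pair \<Omega> p r q s \<alpha> \<gamma> f g A ul uu"
    and ul_pos: "AE x in lebesgue_on \<Omega>. ul x > 0"
    and f_nonneg: "\<forall>x\<in>closure \<Omega>. \<forall>t\<in>{0..Linf_norm \<Omega> uu}. f x t \<ge> 0"
    and g_nonneg: "\<forall>x\<in>closure \<Omega>. \<forall>t\<in>{0..Linf_norm \<Omega> uu}. g x t \<ge> 0"
    and A_pos: "\<forall>x\<in>closure \<Omega>. \<forall>t\<in>{lux_norm \<Omega> r ul..lux_norm \<Omega> r uu}. A x t > 0"
  shows "\<exists>u. weak_solution \<Omega> p r q s \<alpha> \<gamma> f g A u \<and>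
             (AE x in lebesgue_on \<Omega>. 0 < u x \<and> ul x \<le> u x \<and> u x \<le> uu x)"
proof -
  have p: "C1_on_closure \<Omega> p" "1 < ess_inf \<Omega> p" and e: "r \<in> Linf_plus \<Omega>" "q \<in> Linf_plus \<Omega>" "s \<in> Linf_plus \<Omega>"
    and \<alpha>\<gamma>: "\<alpha> \<in> Linf \<Omega>" "\<gamma> \<in> Linf \<Omega>" "AE x in lebesgue_on \<Omega>. \<alpha> x \<ge> 0 \<and> \<gamma> x \<ge> 0"
    using H0 by (auto simp: H0_def)
  obtain pm pp L where "pde_domain \<Omega> p pm pp L" by (rule pde_domain_exists[OF dom(1,3,4) p])
  then interpret pde_domain \<Omega> p pm pp L .
  have ex: "\<exists>Q. linf_exponent \<Omega> p pm pp L m Q" if m: "m \<in> Linf_plus \<Omega>" for m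
  proof -
    obtain Q where "m \<in> borel_measurable (lebesgue_on \<Omega>)" "Q \<ge> 1" "AE x in lebesgue_on \<Omega>. 1 \<le> m x \<and> m x \<le> Q"
      by (rule AE_bounds_Linf_plus[OF m])
    then have "linf_exponent \<Omega> p pm pp L m Q"
      by (intro linf_exponent.intro linf_exponent_axioms.intro pde_domain_axioms)
    then show ?thesis ..
  qed
  obtain Qr Qq Qs where Q: "linf_exponent \<Omega> p pm pp L r Qr" "linf_exponent \<Omega> p pm pp L q Qq" "linf_exponent \<Omega> p pm pp L s Qs"
    using ex[OF e(1)] ex[OF e(2)] ex[OF e(3)] by blast
  have uL: "ul \<in> Linf \<Omega>" "uu \<in> Linf \<Omega>" "AE x in lebesgue_on \<Omega>. ul x \<le> uu x"
    using pair unfolding sub_super_pair_def by blast+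
  define E where "E = max (Linf_norm \<Omega> \<alpha>) (Linf_norm \<Omega> \<gamma>)"
  \<comment> \<open>The constant \<open>C\<close> is the sup norm of \<open>uu\<close>, the value up
    to which f and g are known to be nonnegative.\<close>
  interpret pde_problem \<Omega> p pm pp L r q s \<alpha> \<gamma> f g A ul uu Qr Qq Qs E "Linf_norm \<Omega> uu"
  proof (intro pde_problem.intro pde_problem_axioms.intro pde_domain_axioms Q f_cont g_cont A_cont f_nonneg g_nonneg A_pos)
    show "\<alpha> \<in> borel_measurable (lebesgue_on \<Omega>)" "\<gamma> \<in> borel_measurable (lebesgue_on \<Omega>)"
      "ul \<in> borel_measurable (lebesgue_on \<Omega>)" "uu \<in> borel_measurable (lebesgue_on \<Omega>)"
      using \<alpha>\<gamma> uL by (auto simp: Linf_def)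
    show "AE x in lebesgue_on \<Omega>. 0 \<le> \<alpha> x \<and> \<alpha> x \<le> E" using \<alpha>\<gamma>(3) AE_le_Linf_norm[OF \<alpha>\<gamma>(1)] by eventually_elim (auto simp: E_def)
    show "AE x in lebesgue_on \<Omega>. 0 \<le> \<gamma> x \<and> \<gamma> x \<le> E" using \<alpha>\<gamma>(3) AE_le_Linf_norm[OF \<alpha>\<gamma>(2)] by eventually_elim (auto simp: E_def)
    show "AE x in lebesgue_on \<Omega>. 0 < ul x \<and> ul x \<le> uu x \<and> uu x \<le> Linf_norm \<Omega> uu"
      using ul_pos uL(3) AE_le_Linf_norm[OF uL(2)] by eventually_elim auto
  qed
  show ?thesis by (rule solution_exists[OF pair])
qed

end
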